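(* Let $\mathcal{A}$ be an additive $\Bbbk$-linear monoidal category and $\mathcal{M}$ an additive $(\mathcal{A},\mathcal{A})$ $\star$-bimodule category. Suppose $Z\in\mathcal{K}^b(\mathcal{M})$ is such that the complex $\underline{\mathrm{Hom}}(Z\star X,Y\star Z)$ has zero homology in negative cohomological degrees for all $X,Y\in\mathcal{A}$. Then any object $(Z,\tau)\in\mathcal{Z}(\mathcal{A},\mathcal{K}^b(\mathcal{M}))$ lifts to an object $(Z,\boldsymbol{\tau})\in\mathcal{Z}(\mathcal{K}^b(\mathcal{A}),\mathcal{K}^b(\mathcal{M}))$.
   Context: $\Bbbk$ is a fixed commutative ring. The monoidal product of $\mathcal{A}$ is $\star$. An $(\mathcal{A},\mathcal{A})$ $\star$-bimodule category $\mathcal{M}$ is a $\Bbbk$-linear category with $\Bbbk$-bilinear functors $\star\colon\mathcal{A}\otimes\mathcal{M}\to\mathcal{M}$ and $\star\colon\mathcal{M}\otimes\mathcal{A}\to\mathcal{M}$ satisfying the usual unit and associativity constraints up to coherent natural isomorphism. For bounded cochain complexes $X,Y$ over a $\Bbbk$-linear category, $\underline{\mathrm{Hom}}(X,Y)$ is the Hom complex with $\underline{\mathrm{Hom}}^k(X,Y)=\prod_i\mathrm{Hom}(X^i,Y^{i+k})$ and $d(f)=\delta_Y\circ f-(-1)^{|f|}f\circ\delta_X$. $\mathcal{K}^b$ denotes the homotopy category of bounded complexes, with morphisms $H^0(\underline{\mathrm{Hom}}(X,Y))$. $\mathcal{K}^b(\mathcal{M})$ is a $\star$-bimodule category over $\mathcal{K}^b(\mathcal{A})$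 by total tensor products of complexes with the Koszul sign rule $(f\star g)|_{X^i\star Y^j}=(-1)^{i|g|}f|_{X^i}\star g|_{Y^j}$, and over $\mathcal{A}$ by regarding objects of $\mathcal{A}$ as complexes in degree $0$. Drinfeld centralizer: for a $\star$-bimodule category $\mathcal{N}$ over a monoidal category $\mathcal{C}$, an object of $\mathcal{Z}(\mathcal{C},\mathcal{N})$ is a pair $(Z,\tau)$ with $Z\in\mathcal{N}$ and $\tau$ a natural isomorphism with components $\tau_X\colon Z\star X\to X\star Z$ ($X\in\mathcal{C}$) such that $\tau_{X\star Y}=(\mathrm{id}_X\star\tau_Y)\circ(\tau_X\star\mathrm{id}_Y)$ for all $X,Y\in\mathcal{C}$. An object $(Z,\boldsymbol{\tau})$ of $\mathcal{Z}(\mathcal{K}^b(\mathcal{A}),\mathcal{K}^b(\mathcal{M}))$ lifts $(Z,\tau)\in\mathcal{Z}(\mathcal{A},\mathcal{K}^b(\mathcal{M}))$ if $\boldsymbol{\tau}_X=\tau_X$ for all $X\in\mathcal{A}$. *)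

theory Defs
  imports Complex_Main
begin

section \<open>Categories, bifunctors, and associativity constraints\<close>

record ('o, 'm) cat =
  Obj :: "'o set"
  Hom :: "'o \<Rightarrow> 'o \<Rightarrow> 'm set"
  Comp :: "'m \<Rightarrow> 'm \<Rightarrow> 'm"  (infixr "\<cdot>\<index>" 70)
  Ident :: "'o \<Rightarrow> 'm"

locale category =
  fixes C :: "('o, 'm, 'x) cat_scheme"
  assumes comp_closed:
      "\<lbrakk>X \<in> Obj C; Y \<in> Obj C; Z \<in> Obj C; f \<in> Hom C X Y; g \<in> Hom C Y Z\<rbrakk>
        \<Longrightarrow> g \<cdot>\<^bsub>C\<^esub> f \<in> Hom C X Z"
    and ident_closed: "X \<in> Obj C \<Longrightarrow> Ident C X \<in> Hom C X X"
    and comp_ident_right: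
      "\<lbrakk>X \<in> Obj C; Y \<in> Obj C; f \<in> Hom C X Y\<rbrakk> \<Longrightarrow> f \<cdot>\<^bsub>C\<^esub> Ident C X = f"
    and comp_ident_left:
      "\<lbrakk>X \<in> Obj C; Y \<in> Obj C; f \<in> Hom C X Y\<rbrakk> \<Longrightarrow> Ident C Y \<cdot>\<^bsub>C\<^esub> f = f"
    and comp_assoc:
      "\<lbrakk>W \<in> Obj C; X \<in> Obj C; Y \<in> Obj C; Z \<in> Obj C;
        f \<in> Hom C W X; g \<in> Hom C X Y; h \<in> Hom C Y Z\<rbrakk>
        \<Longrightarrow> (h \<cdot>\<^bsub>C\<^esub> g) \<cdot>\<^bsub>C\<^esub> f = h \<cdot>\<^bsub>C\<^esub> (g \<cdot>\<^bsub>C\<^esub> f)"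

definition is_iso :: "('o, 'm, 'x) cat_scheme \<Rightarrow> 'o \<Rightarrow> 'o \<Rightarrow> 'm \<Rightarrow> bool" where
  "is_iso C X Y f \<longleftrightarrow>
    f \<in> Hom C X Y \<and> (\<exists>g \<in> Hom C Y X. g \<cdot>\<^bsub>C\<^esub> f = Ident C X \<and> f \<cdot>\<^bsub>C\<^esub> g = Ident C Y)"

record ('o, 'm) arr =
  src :: "'o"
  tgt :: "'o"
  mor :: "'m"

record ('o1, 'm1, 'o2, 'm2, 'o3, 'm3) bifun =
  ObT :: "'o1 \<Rightarrow> 'o2 \<Rightarrow> 'o3"  (infixl "\<star>\<index>" 75)
  MorT :: "'m1 \<Rightarrow> 'm2 \<Rightarrow> 'm3"  (infixl "\<otimes>\<index>" 75)

locale bifunctor =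
  fixes A :: "('o1, 'm1, 'x1) cat_scheme"
    and B :: "('o2, 'm2, 'x2) cat_scheme"
    and D :: "('o3, 'm3, 'x3) cat_scheme"
    and F :: "('o1, 'm1, 'o2, 'm2, 'o3, 'm3) bifun"
  assumes obj_closed: "\<lbrakk>X \<in> Obj A; Y \<in> Obj B\<rbrakk> \<Longrightarrow> X \<star>\<^bsub>F\<^esub> Y \<in> Obj D"
    and mor_closed:
      "\<lbrakk>X \<in> Obj A; X' \<in> Obj A; Y \<in> Obj B; Y' \<in> Obj B; f \<in> Hom A X X'; g \<in> Hom B Y Y'\<rbrakk>
        \<Longrightarrow> f \<otimes>\<^bsub>F\<^esub> g \<in> Hom D (X \<star>\<^bsub>F\<^esub> Y) (X' \<star>\<^bsub>F\<^esub> Y')"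
    and preserves_ident:
      "\<lbrakk>X \<in> Obj A; Y \<in> Obj B\<rbrakk> \<Longrightarrow> Ident A X \<otimes>\<^bsub>F\<^esub> Ident B Y = Ident D (X \<star>\<^bsub>F\<^esub> Y)"
    and preserves_comp:
      "\<lbrakk>X \<in> Obj A; X' \<in> Obj A; X'' \<in> Obj A; Y \<in> Obj B; Y' \<in> Obj B; Y'' \<in> Obj B;
        f \<in> Hom A X X'; f' \<in> Hom A X' X''; g \<in> Hom B Y Y'; g' \<in> Hom B Y' Y''\<rbrakk>
        \<Longrightarrow> (f' \<cdot>\<^bsub>A\<^esub> f) \<otimes>\<^bsub>F\<^esub> (g' \<cdot>\<^bsub>B\<^esub> g) = (f' \<otimes>\<^bsub>F\<^esub> g') \<cdot>\<^bsub>D\<^esub> (f \<otimes>\<^bsub>F\<^esub> g)"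

text \<open>
  A natural isomorphism from \<open>(X \<star> Y) \<star> Z\<close> to \<open>X \<star> (Y \<star> Z)\<close>, where the four occurrences of
  \<open>\<star>\<close> may be different bifunctors: \<open>F1\<close> for \<open>X \<star> Y\<close>, \<open>F2\<close> for the outer product on the left,
  \<open>F3\<close> for \<open>Y \<star> Z\<close> and \<open>F4\<close> for the outer product on the right.
\<close>

locale associativity_constraint =
  fixes P :: "('o1, 'm1, 'x1) cat_scheme"
    and Q :: "('o2, 'm2, 'x2) cat_scheme"
    and S :: "('o3, 'm3, 'x3) cat_scheme"
    and U :: "('o4, 'm4, 'x4) cat_scheme"
    and F1 :: "('o1, 'm1, 'o2, 'm2, 'o5, 'm5) bifun"
    and F2 :: "('o5, 'm5, 'o3, 'm3, 'o4, 'm4) bifun"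
    and F3 :: "('o2, 'm2, 'o3, 'm3, 'o6, 'm6) bifun"
    and F4 :: "('o1, 'm1, 'o6, 'm6, 'o4, 'm4) bifun"
    and \<alpha> :: "'o1 \<Rightarrow> 'o2 \<Rightarrow> 'o3 \<Rightarrow> 'm4"
  assumes assoc_iso:
      "\<lbrakk>X \<in> Obj P; Y \<in> Obj Q; Z \<in> Obj S\<rbrakk>
        \<Longrightarrow> is_iso U ((X \<star>\<^bsub>F1\<^esub> Y) \<star>\<^bsub>F2\<^esub> Z) (X \<star>\<^bsub>F4\<^esub> (Y \<star>\<^bsub>F3\<^esub> Z)) (\<alpha> X Y Z)"
    and assoc_natural:
      "\<lbrakk>X \<in> Obj P; X' \<in> Obj P; Y \<in> Obj Q; Y' \<in> Obj Q; Z \<in> Obj S; Z' \<in> Obj S;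
        f \<in> Hom P X X'; g \<in> Hom Q Y Y'; h \<in> Hom S Z Z'\<rbrakk>
        \<Longrightarrow> \<alpha> X' Y' Z' \<cdot>\<^bsub>U\<^esub> ((f \<otimes>\<^bsub>F1\<^esub> g) \<otimes>\<^bsub>F2\<^esub> h) = (f \<otimes>\<^bsub>F4\<^esub> (g \<otimes>\<^bsub>F3\<^esub> h)) \<cdot>\<^bsub>U\<^esub> \<alpha> X Y Z"


section \<open>Monoidal categories and bimodule categories\<close>

record ('o, 'm) moncat = "('o, 'm) cat" +
  Tensor :: "('o, 'm, 'o, 'm, 'o, 'm) bifun"
  Unit :: "'o"
  Assoc :: "'o \<Rightarrow> 'o \<Rightarrow> 'o \<Rightarrow> 'm"
  LUnit :: "'o \<Rightarrow> 'm"
  RUnit :: "'o \<Rightarrow> 'm"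

locale monoidal_category = category A +
  bifunctor A A A "Tensor A" +
  associativity_constraint A A A A "Tensor A" "Tensor A" "Tensor A" "Tensor A" "Assoc A"
  for A :: "('o, 'm) moncat" +
  assumes unit_closed: "Unit A \<in> Obj A"
    and lunit_iso: "X \<in> Obj A \<Longrightarrow> is_iso A (Unit A \<star>\<^bsub>Tensor A\<^esub> X) X (LUnit A X)"
    and lunit_natural:
      "\<lbrakk>X \<in> Obj A; Y \<in> Obj A; f \<in> Hom A X Y\<rbrakk>
        \<Longrightarrow> LUnit A Y \<cdot>\<^bsub>A\<^esub> (Ident A (Unit A) \<otimes>\<^bsub>Tensor A\<^esub> f) = f \<cdot>\<^bsub>A\<^esub> LUnit A X"
    and runit_iso: "X \<in> Obj A \<Longrightarrow> is_iso A (X \<star>\<^bsub>Tensor A\<^esub> Unit A) X (RUnit A X)"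
    and runit_natural:
      "\<lbrakk>X \<in> Obj A; Y \<in> Obj A; f \<in> Hom A X Y\<rbrakk>
        \<Longrightarrow> RUnit A Y \<cdot>\<^bsub>A\<^esub> (f \<otimes>\<^bsub>Tensor A\<^esub> Ident A (Unit A)) = f \<cdot>\<^bsub>A\<^esub> RUnit A X"
    and triangle:
      "\<lbrakk>X \<in> Obj A; Y \<in> Obj A\<rbrakk>
        \<Longrightarrow> (Ident A X \<otimes>\<^bsub>Tensor A\<^esub> LUnit A Y) \<cdot>\<^bsub>A\<^esub> Assoc A X (Unit A) Y
          = RUnit A X \<otimes>\<^bsub>Tensor A\<^esub> Ident A Y"
    and pentagon:
      "\<lbrakk>W \<in> Obj A; X \<in> Obj A; Y \<in> Obj A; Z \<in> Obj A\<rbrakk>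
        \<Longrightarrow> Assoc A W X (Y \<star>\<^bsub>Tensor A\<^esub> Z) \<cdot>\<^bsub>A\<^esub> Assoc A (W \<star>\<^bsub>Tensor A\<^esub> X) Y Z
          = (Ident A W \<otimes>\<^bsub>Tensor A\<^esub> Assoc A X Y Z) \<cdot>\<^bsub>A\<^esub> Assoc A W (X \<star>\<^bsub>Tensor A\<^esub> Y) Z
            \<cdot>\<^bsub>A\<^esub> (Assoc A W X Y \<otimes>\<^bsub>Tensor A\<^esub> Ident A Z)"

text \<open>
  The structure of a bimodule category with objects \<open>'p\<close> and morphisms \<open>'n\<close> over a monoidal
  category with objects \<open>'o\<close> and morphisms \<open>'m\<close>. The constraints are directed as follows:
  \<open>LAssoc X Y M : (X \<star> Y) \<star> M \<rightarrow> X \<star> (Y \<star> M)\<close>,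
  \<open>MAssoc X M Y : (X \<star> M) \<star> Y \<rightarrow> X \<star> (M \<star> Y)\<close>,
  \<open>RAssoc M X Y : (M \<star> X) \<star> Y \<rightarrow> M \<star> (X \<star> Y)\<close>,
  \<open>LAUnit M : 1 \<star> M \<rightarrow> M\<close>, \<open>RAUnit M : M \<star> 1 \<rightarrow> M\<close>.
\<close>

record ('p, 'n, 'o, 'm) bimod = "('p, 'n) cat" +
  LAct :: "('o, 'm, 'p, 'n, 'p, 'n) bifun"
  RAct :: "('p, 'n, 'o, 'm, 'p, 'n) bifun"
  LAssoc :: "'o \<Rightarrow> 'o \<Rightarrow> 'p \<Rightarrow> 'n"
  MAssoc :: "'o \<Rightarrow> 'p \<Rightarrow> 'o \<Rightarrow> 'n"
  RAssoc :: "'p \<Rightarrow> 'o \<Rightarrow> 'o \<Rightarrow> 'n"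
  LAUnit :: "'p \<Rightarrow> 'n"
  RAUnit :: "'p \<Rightarrow> 'n"

locale bimodule_category =
  A: monoidal_category A + M: category M +
  L: bifunctor A M M "LAct M" +
  R: bifunctor M A M "RAct M" +
  LA: associativity_constraint A A M M "Tensor A" "LAct M" "LAct M" "LAct M" "LAssoc M" +
  MA: associativity_constraint A M A M "LAct M" "RAct M" "RAct M" "LAct M" "MAssoc M" +
  RA: associativity_constraint M A A M "RAct M" "RAct M" "Tensor A" "RAct M" "RAssoc M"
  for A :: "('o, 'm) moncat" and M :: "('p, 'n, 'o, 'm) bimod" +
  assumes lact_unit_iso: "N \<in> Obj M \<Longrightarrow> is_iso M (Unit A \<star>\<^bsub>LAct M\<^esub> N) N (LAUnit M N)"
    and lact_unit_natural:
      "\<lbrakk>N \<in> Obj M; N' \<in> Obj M; f \<in> Hom M N N'\<rbrakk>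
        \<Longrightarrow> LAUnit M N' \<cdot>\<^bsub>M\<^esub> (Ident A (Unit A) \<otimes>\<^bsub>LAct M\<^esub> f) = f \<cdot>\<^bsub>M\<^esub> LAUnit M N"
    and ract_unit_iso: "N \<in> Obj M \<Longrightarrow> is_iso M (N \<star>\<^bsub>RAct M\<^esub> Unit A) N (RAUnit M N)"
    and ract_unit_natural:
      "\<lbrakk>N \<in> Obj M; N' \<in> Obj M; f \<in> Hom M N N'\<rbrakk>
        \<Longrightarrow> RAUnit M N' \<cdot>\<^bsub>M\<^esub> (f \<otimes>\<^bsub>RAct M\<^esub> Ident A (Unit A)) = f \<cdot>\<^bsub>M\<^esub> RAUnit M N"
    and lact_triangle:
      "\<lbrakk>X \<in> Obj A; N \<in> Obj M\<rbrakk>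
        \<Longrightarrow> (Ident A X \<otimes>\<^bsub>LAct M\<^esub> LAUnit M N) \<cdot>\<^bsub>M\<^esub> LAssoc M X (Unit A) N
          = RUnit A X \<otimes>\<^bsub>LAct M\<^esub> Ident M N"
    and ract_triangle:
      "\<lbrakk>N \<in> Obj M; X \<in> Obj A\<rbrakk>
        \<Longrightarrow> (Ident M N \<otimes>\<^bsub>RAct M\<^esub> LUnit A X) \<cdot>\<^bsub>M\<^esub> RAssoc M N (Unit A) X
          = RAUnit M N \<otimes>\<^bsub>RAct M\<^esub> Ident A X"
    and pentagon_AAAM:
      "\<lbrakk>W \<in> Obj A; X \<in> Obj A; Y \<in> Obj A; N \<in> Obj M\<rbrakk>
        \<Longrightarrow> LAssoc M W X (Y \<star>\<^bsub>LAct M\<^esub> N) \<cdot>\<^bsub>M\<^esub> LAssoc M (W \<star>\<^bsub>Tensor A\<^esub> X) Y N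
          = (Ident A W \<otimes>\<^bsub>LAct M\<^esub> LAssoc M X Y N) \<cdot>\<^bsub>M\<^esub> LAssoc M W (X \<star>\<^bsub>Tensor A\<^esub> Y) N
            \<cdot>\<^bsub>M\<^esub> (Assoc A W X Y \<otimes>\<^bsub>LAct M\<^esub> Ident M N)"
    and pentagon_AAMA:
      "\<lbrakk>W \<in> Obj A; X \<in> Obj A; N \<in> Obj M; Y \<in> Obj A\<rbrakk>
        \<Longrightarrow> LAssoc M W X (N \<star>\<^bsub>RAct M\<^esub> Y) \<cdot>\<^bsub>M\<^esub> MAssoc M (W \<star>\<^bsub>Tensor A\<^esub> X) N Y
          = (Ident A W \<otimes>\<^bsub>LAct M\<^esub> MAssoc M X N Y) \<cdot>\<^bsub>M\<^esub> MAssoc M W (X \<star>\<^bsub>LAct M\<^esub> N) Y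
            \<cdot>\<^bsub>M\<^esub> (LAssoc M W X N \<otimes>\<^bsub>RAct M\<^esub> Ident A Y)"
    and pentagon_AMAA:
      "\<lbrakk>W \<in> Obj A; N \<in> Obj M; X \<in> Obj A; Y \<in> Obj A\<rbrakk>
        \<Longrightarrow> MAssoc M W N (X \<star>\<^bsub>Tensor A\<^esub> Y) \<cdot>\<^bsub>M\<^esub> RAssoc M (W \<star>\<^bsub>LAct M\<^esub> N) X Y
          = (Ident A W \<otimes>\<^bsub>LAct M\<^esub> RAssoc M N X Y) \<cdot>\<^bsub>M\<^esub> MAssoc M W (N \<star>\<^bsub>RAct M\<^esub> X) Y
            \<cdot>\<^bsub>M\<^esub> (MAssoc M W N X \<otimes>\<^bsub>RAct M\<^esub> Ident A Y)"
    and pentagon_MAAA: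
      "\<lbrakk>N \<in> Obj M; W \<in> Obj A; X \<in> Obj A; Y \<in> Obj A\<rbrakk>
        \<Longrightarrow> RAssoc M N W (X \<star>\<^bsub>Tensor A\<^esub> Y) \<cdot>\<^bsub>M\<^esub> RAssoc M (N \<star>\<^bsub>RAct M\<^esub> W) X Y
          = (Ident M N \<otimes>\<^bsub>RAct M\<^esub> Assoc A W X Y) \<cdot>\<^bsub>M\<^esub> RAssoc M N (W \<star>\<^bsub>Tensor A\<^esub> X) Y
            \<cdot>\<^bsub>M\<^esub> (RAssoc M N W X \<otimes>\<^bsub>RAct M\<^esub> Ident A Y)"


section \<open>Linear and additive categories\<close>

text \<open>
  All Hom-modules of a linear category are submodules of one ambient module \<open>'m\<close>, and composition
  and bifunctors are given by a single operation on \<open>'m\<close>. This is no restriction: for \<open>'m\<close> one can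
  take the direct sum of all Hom-modules.
\<close>

locale linear_category = category C + module scale
  for C :: "('o, 'm::ab_group_add, 'x) cat_scheme"
    and scale :: "'k::comm_ring_1 \<Rightarrow> 'm \<Rightarrow> 'm" +
  assumes hom_submodule: "\<lbrakk>X \<in> Obj C; Y \<in> Obj C\<rbrakk> \<Longrightarrow> subspace (Hom C X Y)"
    and comp_add_left:
      "\<lbrakk>X \<in> Obj C; Y \<in> Obj C; Z \<in> Obj C; f \<in> Hom C X Y; g \<in> Hom C Y Z; g' \<in> Hom C Y Z\<rbrakk>
        \<Longrightarrow> (g + g') \<cdot>\<^bsub>C\<^esub> f = g \<cdot>\<^bsub>C\<^esub> f + g' \<cdot>\<^bsub>C\<^esub> f"
    and comp_add_right:
      "\<lbrakk>X \<in> Obj C; Y \<in> Obj C; Z \<in> Obj C; f \<in> Hom C X Y; f' \<in> Hom C X Y; g \<in> Hom C Y Z\<rbrakk>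
        \<Longrightarrow> g \<cdot>\<^bsub>C\<^esub> (f + f') = g \<cdot>\<^bsub>C\<^esub> f + g \<cdot>\<^bsub>C\<^esub> f'"
    and comp_scale_left:
      "\<lbrakk>X \<in> Obj C; Y \<in> Obj C; Z \<in> Obj C; f \<in> Hom C X Y; g \<in> Hom C Y Z\<rbrakk>
        \<Longrightarrow> scale c g \<cdot>\<^bsub>C\<^esub> f = scale c (g \<cdot>\<^bsub>C\<^esub> f)"
    and comp_scale_right:
      "\<lbrakk>X \<in> Obj C; Y \<in> Obj C; Z \<in> Obj C; f \<in> Hom C X Y; g \<in> Hom C Y Z\<rbrakk>
        \<Longrightarrow> g \<cdot>\<^bsub>C\<^esub> scale c f = scale c (g \<cdot>\<^bsub>C\<^esub> f)"

definition is_zero :: "('o, 'm::ab_group_add, 'x) cat_scheme \<Rightarrow> 'o \<Rightarrow> bool" where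
  "is_zero C X \<longleftrightarrow> X \<in> Obj C \<and> (\<forall>Y \<in> Obj C. Hom C X Y = {0} \<and> Hom C Y X = {0})"

locale additive_category = linear_category C scale
  for C :: "('o, 'm::ab_group_add, 'x) cat_scheme"
    and scale :: "'k::comm_ring_1 \<Rightarrow> 'm \<Rightarrow> 'm" +
  assumes zero_object: "\<exists>X. is_zero C X"
    and biproduct:
      "\<lbrakk>X \<in> Obj C; Y \<in> Obj C\<rbrakk>
        \<Longrightarrow> \<exists>S \<in> Obj C. \<exists>i1 \<in> Hom C X S. \<exists>i2 \<in> Hom C Y S. \<exists>p1 \<in> Hom C S X. \<exists>p2 \<in> Hom C S Y.
            p1 \<cdot>\<^bsub>C\<^esub> i1 = Ident C X \<and> p2 \<cdot>\<^bsub>C\<^esub> i2 = Ident C Y \<and>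
            p1 \<cdot>\<^bsub>C\<^esub> i2 = 0 \<and> p2 \<cdot>\<^bsub>C\<^esub> i1 = 0 \<and>
            i1 \<cdot>\<^bsub>C\<^esub> p1 + i2 \<cdot>\<^bsub>C\<^esub> p2 = Ident C S"

locale bilinear_bifunctor =
  bifunctor A B D F
  for A :: "('o1, 'm1::ab_group_add, 'x1) cat_scheme"
    and sA :: "'k::comm_ring_1 \<Rightarrow> 'm1 \<Rightarrow> 'm1"
    and B :: "('o2, 'm2::ab_group_add, 'x2) cat_scheme"
    and sB :: "'k \<Rightarrow> 'm2 \<Rightarrow> 'm2"
    and D :: "('o3, 'm3::ab_group_add, 'x3) cat_scheme"
    and sD :: "'k \<Rightarrow> 'm3 \<Rightarrow> 'm3"
    and F :: "('o1, 'm1, 'o2, 'm2, 'o3, 'm3) bifun" +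
  assumes mor_add_left:
      "\<lbrakk>X \<in> Obj A; X' \<in> Obj A; Y \<in> Obj B; Y' \<in> Obj B;
        f \<in> Hom A X X'; f' \<in> Hom A X X'; g \<in> Hom B Y Y'\<rbrakk>
        \<Longrightarrow> (f + f') \<otimes>\<^bsub>F\<^esub> g = f \<otimes>\<^bsub>F\<^esub> g + f' \<otimes>\<^bsub>F\<^esub> g"
    and mor_add_right:
      "\<lbrakk>X \<in> Obj A; X' \<in> Obj A; Y \<in> Obj B; Y' \<in> Obj B;
        f \<in> Hom A X X'; g \<in> Hom B Y Y'; g' \<in> Hom B Y Y'\<rbrakk>
        \<Longrightarrow> f \<otimes>\<^bsub>F\<^esub> (g + g') = f \<otimes>\<^bsub>F\<^esub> g + f \<otimes>\<^bsub>F\<^esub> g'"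
    and mor_scale_left:
      "\<lbrakk>X \<in> Obj A; X' \<in> Obj A; Y \<in> Obj B; Y' \<in> Obj B; f \<in> Hom A X X'; g \<in> Hom B Y Y'\<rbrakk>
        \<Longrightarrow> sA c f \<otimes>\<^bsub>F\<^esub> g = sD c (f \<otimes>\<^bsub>F\<^esub> g)"
    and mor_scale_right:
      "\<lbrakk>X \<in> Obj A; X' \<in> Obj A; Y \<in> Obj B; Y' \<in> Obj B; f \<in> Hom A X X'; g \<in> Hom B Y Y'\<rbrakk>
        \<Longrightarrow> f \<otimes>\<^bsub>F\<^esub> sB c g = sD c (f \<otimes>\<^bsub>F\<^esub> g)"

locale additive_monoidal_category =
  monoidal_category A + additive_category A scale +
  bilinear_bifunctor A scale A scale A scale "Tensor A"
  for A :: "('o, 'm::ab_group_add) moncat"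
    and scale :: "'k::comm_ring_1 \<Rightarrow> 'm \<Rightarrow> 'm"

locale additive_bimodule_category =
  bimodule_category A M +
  AA: additive_monoidal_category A sA + AM: additive_category M sM +
  LB: bilinear_bifunctor A sA M sM M sM "LAct M" +
  RB: bilinear_bifunctor M sM A sA M sM "RAct M"
  for A :: "('o, 'm::ab_group_add) moncat"
    and sA :: "'k::comm_ring_1 \<Rightarrow> 'm \<Rightarrow> 'm"
    and M :: "('p, 'n::ab_group_add, 'o, 'm) bimod"
    and sM :: "'k \<Rightarrow> 'n \<Rightarrow> 'n"

text \<open>
  A direct sum \<open>\<Oplus>\<^sub>i W i\<close> over all integers of a family with only finitely many nonzero terms. The
  summation in the last clause ranges over the nonzero terms, since \<open>\<Sum>\<close> over an infinite index
  set is \<open>0\<close> by convention; the omitted terms factor through zero objects.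
\<close>

record ('o, 'm) dsum =
  sum_ob :: "'o"
  inj :: "int \<Rightarrow> 'm"
  prj :: "int \<Rightarrow> 'm"

definition is_direct_sum ::
  "('o, 'm::ab_group_add, 'x) cat_scheme \<Rightarrow> (int \<Rightarrow> 'o) \<Rightarrow> ('o, 'm) dsum \<Rightarrow> bool" where
  "is_direct_sum C W S \<longleftrightarrow>
    finite {i. \<not> is_zero C (W i)} \<and> sum_ob S \<in> Obj C \<and>
    (\<forall>i. inj S i \<in> Hom C (W i) (sum_ob S) \<and> prj S i \<in> Hom C (sum_ob S) (W i)) \<and>
    (\<forall>i. prj S i \<cdot>\<^bsub>C\<^esub> inj S i = Ident C (W i)) \<and>
    (\<forall>i j. i \<noteq> j \<longrightarrow> prj S j \<cdot>\<^bsub>C\<^esub> inj S i = 0) \<and>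
    (\<Sum>i | \<not> is_zero C (W i). inj S i \<cdot>\<^bsub>C\<^esub> prj S i) = Ident C (sum_ob S)"

definition direct_sum ::
  "('o, 'm::ab_group_add, 'x) cat_scheme \<Rightarrow> (int \<Rightarrow> 'o) \<Rightarrow> ('o, 'm) dsum" where
  "direct_sum C W = (SOME S. is_direct_sum C W S)"


section \<open>Complexes and the homotopy category\<close>

record ('o, 'm) cochain =
  ob :: "int \<Rightarrow> 'o"
  diff :: "int \<Rightarrow> 'm"

definition bounded_complex ::
  "('o, 'm::ab_group_add, 'x) cat_scheme \<Rightarrow> ('o, 'm) cochain \<Rightarrow> bool" where
  "bounded_complex C X \<longleftrightarrow>
    (\<forall>i. ob X i \<in> Obj C \<and> diff X i \<in> Hom C (ob X i) (ob X (i + 1))) \<and>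
    (\<forall>i. diff X (i + 1) \<cdot>\<^bsub>C\<^esub> diff X i = 0) \<and>
    (\<exists>N. \<forall>i. \<bar>i\<bar> > N \<longrightarrow> is_zero C (ob X i))"

text \<open>Multiplication by \<open>(-1)\<^sup>n\<close>.\<close>

definition ksign :: "int \<Rightarrow> 'm::ab_group_add \<Rightarrow> 'm" where
  "ksign n x = (if even n then x else - x)"

definition hom_cx ::
  "('o, 'm::ab_group_add, 'x) cat_scheme \<Rightarrow> ('o, 'm) cochain \<Rightarrow> ('o, 'm) cochain
    \<Rightarrow> int \<Rightarrow> (int \<Rightarrow> 'm) set" where
  "hom_cx C X Y k = {f. \<forall>i. f i \<in> Hom C (ob X i) (ob Y (i + k))}"

definition hom_diff ::
  "('o, 'm::ab_group_add, 'x) cat_scheme \<Rightarrow> ('o, 'm) cochain \<Rightarrow> ('o, 'm) cochain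
    \<Rightarrow> int \<Rightarrow> (int \<Rightarrow> 'm) \<Rightarrow> (int \<Rightarrow> 'm)" where
  "hom_diff C X Y k f =
    (\<lambda>i. diff Y (i + k) \<cdot>\<^bsub>C\<^esub> f i - ksign k (f (i + 1) \<cdot>\<^bsub>C\<^esub> diff X i))"

definition hom_cocycles ::
  "('o, 'm::ab_group_add, 'x) cat_scheme \<Rightarrow> ('o, 'm) cochain \<Rightarrow> ('o, 'm) cochain
    \<Rightarrow> int \<Rightarrow> (int \<Rightarrow> 'm) set" where
  "hom_cocycles C X Y k = {f \<in> hom_cx C X Y k. hom_diff C X Y k f = (\<lambda>_. 0)}"

definition hom_coboundaries ::
  "('o, 'm::ab_group_add, 'x) cat_scheme \<Rightarrow> ('o, 'm) cochain \<Rightarrow> ('o, 'm) cochain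
    \<Rightarrow> int \<Rightarrow> (int \<Rightarrow> 'm) set" where
  "hom_coboundaries C X Y k = hom_diff C X Y (k - 1) ` hom_cx C X Y (k - 1)"

definition hom_class ::
  "('o, 'm::ab_group_add, 'x) cat_scheme \<Rightarrow> ('o, 'm) cochain \<Rightarrow> ('o, 'm) cochain
    \<Rightarrow> int \<Rightarrow> (int \<Rightarrow> 'm) \<Rightarrow> (int \<Rightarrow> 'm) set" where
  "hom_class C X Y k f = {(\<lambda>i. f i + b i) | b. b \<in> hom_coboundaries C X Y k}"

definition hom_cohomology ::
  "('o, 'm::ab_group_add, 'x) cat_scheme \<Rightarrow> ('o, 'm) cochain \<Rightarrow> ('o, 'm) cochain
    \<Rightarrow> int \<Rightarrow> (int \<Rightarrow> 'm) set set" where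
  "hom_cohomology C X Y k = hom_class C X Y k ` hom_cocycles C X Y k"

text \<open>
  A morphism of the homotopy category is a class in the zeroth cohomology of the Hom complex,
  that is, a coset of the coboundaries, tagged with its source and target.
\<close>

type_synonym ('o, 'm) kmor = "(('o, 'm) cochain, (int \<Rightarrow> 'm) set) arr"

definition kclass ::
  "('o, 'm::ab_group_add, 'x) cat_scheme \<Rightarrow> ('o, 'm) cochain \<Rightarrow> ('o, 'm) cochain
    \<Rightarrow> (int \<Rightarrow> 'm) \<Rightarrow> ('o, 'm) kmor" where
  "kclass C X Y f = \<lparr>src = X, tgt = Y, mor = hom_class C X Y 0 f\<rparr>"

definition krep :: "('o, 'm) kmor \<Rightarrow> int \<Rightarrow> 'm" where
  "krep u = (SOME f. f \<in> mor u)"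

definition Kb ::
  "('o, 'm::ab_group_add, 'x) cat_scheme \<Rightarrow> (('o, 'm) cochain, ('o, 'm) kmor) cat" where
  "Kb C =
    \<lparr>Obj = {X. bounded_complex C X},
     Hom = (\<lambda>X Y. {\<lparr>src = X, tgt = Y, mor = c\<rparr> | c. c \<in> hom_cohomology C X Y 0}),
     Comp = (\<lambda>v u. kclass C (src u) (tgt v) (\<lambda>i. krep v i \<cdot>\<^bsub>C\<^esub> krep u i)),
     Ident = (\<lambda>X. kclass C X X (\<lambda>i. Ident C (ob X i)))\<rparr>"


section \<open>Total tensor products\<close>

text \<open>
  \<open>(X \<star> Y)\<^sup>n = \<Oplus>\<^sub>i X\<^sup>i \<star> Y\<^sup>n\<^sup>-\<^sup>i\<close>. In \<open>tot_mor\<close>, the families \<open>f\<close> and \<open>g\<close> are homogeneous of degrees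
  \<open>k\<close> and \<open>l\<close>, and the sign is that of the Koszul rule.
\<close>

definition tot_sum ::
  "('o3, 'm3::ab_group_add, 'x3) cat_scheme \<Rightarrow> ('o1, 'm1, 'o2, 'm2, 'o3, 'm3) bifun
    \<Rightarrow> ('o1, 'm1) cochain \<Rightarrow> ('o2, 'm2) cochain \<Rightarrow> int \<Rightarrow> ('o3, 'm3) dsum" where
  "tot_sum D F X Y n = direct_sum D (\<lambda>i. ob X i \<star>\<^bsub>F\<^esub> ob Y (n - i))"

definition tot_mor ::
  "('o3, 'm3::ab_group_add, 'x3) cat_scheme \<Rightarrow> ('o1, 'm1, 'o2, 'm2, 'o3, 'm3) bifun
    \<Rightarrow> ('o1, 'm1) cochain \<Rightarrow> ('o2, 'm2) cochain \<Rightarrow> ('o1, 'm1) cochain \<Rightarrow> ('o2, 'm2) cochain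
    \<Rightarrow> int \<Rightarrow> int \<Rightarrow> (int \<Rightarrow> 'm1) \<Rightarrow> (int \<Rightarrow> 'm2) \<Rightarrow> (int \<Rightarrow> 'm3)" where
  "tot_mor D F X Y X' Y' k l f g =
    (\<lambda>n. \<Sum>i | \<not> is_zero D (ob X i \<star>\<^bsub>F\<^esub> ob Y (n - i)).
      inj (tot_sum D F X' Y' (n + k + l)) (i + k)
        \<cdot>\<^bsub>D\<^esub> ksign (i * l) (f i \<otimes>\<^bsub>F\<^esub> g (n - i))
        \<cdot>\<^bsub>D\<^esub> prj (tot_sum D F X Y n) i)"

definition tot ::
  "('o1, 'm1, 'x1) cat_scheme \<Rightarrow> ('o2, 'm2, 'x2) cat_scheme
    \<Rightarrow> ('o3, 'm3::ab_group_add, 'x3) cat_scheme \<Rightarrow> ('o1, 'm1, 'o2, 'm2, 'o3, 'm3) bifun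
    \<Rightarrow> ('o1, 'm1) cochain \<Rightarrow> ('o2, 'm2) cochain \<Rightarrow> ('o3, 'm3) cochain" where
  "tot A B D F X Y =
    \<lparr>ob = (\<lambda>n. sum_ob (tot_sum D F X Y n)),
     diff = (\<lambda>n. tot_mor D F X Y X Y 1 0 (diff X) (\<lambda>j. Ident B (ob Y j)) n
               + tot_mor D F X Y X Y 0 1 (\<lambda>i. Ident A (ob X i)) (diff Y) n)\<rparr>"

definition Kb_bifun ::
  "('o1, 'm1, 'x1) cat_scheme \<Rightarrow> ('o2, 'm2, 'x2) cat_scheme
    \<Rightarrow> ('o3, 'm3::ab_group_add, 'x3) cat_scheme \<Rightarrow> ('o1, 'm1, 'o2, 'm2, 'o3, 'm3) bifun
    \<Rightarrow> (('o1, 'm1) cochain, ('o1, 'm1) kmor, ('o2, 'm2) cochain, ('o2, 'm2) kmor,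
        ('o3, 'm3) cochain, ('o3, 'm3) kmor) bifun" where
  "Kb_bifun A B D F =
    \<lparr>ObT = tot A B D F,
     MorT = (\<lambda>u v. kclass D (tot A B D F (src u) (src v)) (tot A B D F (tgt u) (tgt v))
               (tot_mor D F (src u) (src v) (tgt u) (tgt v) 0 0 (krep u) (krep v)))\<rparr>"

text \<open>
  The associator of total tensor products, assembled from the \<open>\<alpha> (X\<^sup>i) (Y\<^sup>p\<^sup>-\<^sup>i) (Z\<^sup>n\<^sup>-\<^sup>p)\<close> without
  signs. The bifunctors are named as in \<open>associativity_constraint\<close>, with
  \<open>F1 : P \<times> Q \<rightarrow> R\<close>, \<open>F2 : R \<times> S \<rightarrow> U\<close>, \<open>F3 : Q \<times> S \<rightarrow> V\<close> and \<open>F4 : P \<times> V \<rightarrow> U\<close>.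
\<close>

definition Kb_assoc ::
  "('o1, 'm1, 'x1) cat_scheme \<Rightarrow> ('o2, 'm2, 'x2) cat_scheme \<Rightarrow> ('o3, 'm3, 'x3) cat_scheme
    \<Rightarrow> ('o5, 'm5::ab_group_add, 'x5) cat_scheme \<Rightarrow> ('o6, 'm6::ab_group_add, 'x6) cat_scheme
    \<Rightarrow> ('o4, 'm4::ab_group_add, 'x4) cat_scheme
    \<Rightarrow> ('o1, 'm1, 'o2, 'm2, 'o5, 'm5) bifun \<Rightarrow> ('o5, 'm5, 'o3, 'm3, 'o4, 'm4) bifun
    \<Rightarrow> ('o2, 'm2, 'o3, 'm3, 'o6, 'm6) bifun \<Rightarrow> ('o1, 'm1, 'o6, 'm6, 'o4, 'm4) bifun
    \<Rightarrow> ('o1 \<Rightarrow> 'o2 \<Rightarrow> 'o3 \<Rightarrow> 'm4)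
    \<Rightarrow> ('o1, 'm1) cochain \<Rightarrow> ('o2, 'm2) cochain \<Rightarrow> ('o3, 'm3) cochain \<Rightarrow> ('o4, 'm4) kmor" where
  "Kb_assoc P Q S R V U F1 F2 F3 F4 \<alpha> X Y Z =
    (let XY = tot P Q R F1 X Y; YZ = tot Q S V F3 Y Z in
     kclass U (tot R S U F2 XY Z) (tot P V U F4 X YZ)
       (\<lambda>n. \<Sum>p | \<not> is_zero U (ob XY p \<star>\<^bsub>F2\<^esub> ob Z (n - p)).
            \<Sum>i | \<not> is_zero R (ob X i \<star>\<^bsub>F1\<^esub> ob Y (p - i)).
              inj (tot_sum U F4 X YZ n) i
              \<cdot>\<^bsub>U\<^esub> (Ident P (ob X i) \<otimes>\<^bsub>F4\<^esub> inj (tot_sum V F3 Y Z (n - i)) (p - i))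
              \<cdot>\<^bsub>U\<^esub> \<alpha> (ob X i) (ob Y (p - i)) (ob Z (n - p))
              \<cdot>\<^bsub>U\<^esub> (prj (tot_sum R F1 X Y p) i \<otimes>\<^bsub>F2\<^esub> Ident S (ob Z (n - p)))
              \<cdot>\<^bsub>U\<^esub> prj (tot_sum U F2 XY Z n) p))"

definition stalk :: "('o, 'm::ab_group_add, 'x) cat_scheme \<Rightarrow> 'o \<Rightarrow> ('o, 'm) cochain" where
  "stalk C X =
    \<lparr>ob = (\<lambda>i. if i = 0 then X else (SOME N. is_zero C N)), diff = (\<lambda>_. 0)\<rparr>"

definition stalk_mor ::
  "('o, 'm::ab_group_add, 'x) cat_scheme \<Rightarrow> ('o, 'm) arr \<Rightarrow> ('o, 'm) kmor" where
  "stalk_mor C u =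
    kclass C (stalk C (src u)) (stalk C (tgt u)) (\<lambda>i. if i = 0 then mor u else 0)"

definition Kb_mon ::
  "('o, 'm::ab_group_add) moncat \<Rightarrow> (('o, 'm) cochain, ('o, 'm) kmor) moncat" where
  "Kb_mon A =
    \<lparr>Obj = Obj (Kb A), Hom = Hom (Kb A), Comp = Comp (Kb A), Ident = Ident (Kb A),
     Tensor = Kb_bifun A A A (Tensor A),
     Unit = stalk A (Unit A),
     Assoc = Kb_assoc A A A A A A (Tensor A) (Tensor A) (Tensor A) (Tensor A) (Assoc A),
     LUnit = (\<lambda>X. kclass A (tot A A A (Tensor A) (stalk A (Unit A)) X) X
       (\<lambda>n. LUnit A (ob X n) \<cdot>\<^bsub>A\<^esub> prj (tot_sum A (Tensor A) (stalk A (Unit A)) X n) 0)),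
     RUnit = (\<lambda>X. kclass A (tot A A A (Tensor A) X (stalk A (Unit A))) X
       (\<lambda>n. RUnit A (ob X n) \<cdot>\<^bsub>A\<^esub> prj (tot_sum A (Tensor A) X (stalk A (Unit A)) n) n))\<rparr>"

definition Kb_bimod ::
  "('o, 'm::ab_group_add) moncat \<Rightarrow> ('p, 'n::ab_group_add, 'o, 'm) bimod
    \<Rightarrow> (('p, 'n) cochain, ('p, 'n) kmor, ('o, 'm) cochain, ('o, 'm) kmor) bimod" where
  "Kb_bimod A M =
    \<lparr>Obj = Obj (Kb M), Hom = Hom (Kb M), Comp = Comp (Kb M), Ident = Ident (Kb M),
     LAct = Kb_bifun A M M (LAct M),
     RAct = Kb_bifun M A M (RAct M),
     LAssoc = Kb_assoc A A M A M M (Tensor A) (LAct M) (LAct M) (LAct M) (LAssoc M),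
     MAssoc = Kb_assoc A M A M M M (LAct M) (RAct M) (RAct M) (LAct M) (MAssoc M),
     RAssoc = Kb_assoc M A A M A M (RAct M) (RAct M) (Tensor A) (RAct M) (RAssoc M),
     LAUnit = (\<lambda>N. kclass M (tot A M M (LAct M) (stalk A (Unit A)) N) N
       (\<lambda>n. LAUnit M (ob N n) \<cdot>\<^bsub>M\<^esub> prj (tot_sum M (LAct M) (stalk A (Unit A)) N n) 0)),
     RAUnit = (\<lambda>N. kclass M (tot M A M (RAct M) N (stalk A (Unit A))) N
       (\<lambda>n. RAUnit M (ob N n) \<cdot>\<^bsub>M\<^esub> prj (tot_sum M (RAct M) N (stalk A (Unit A)) n) n))\<rparr>"

text \<open>
  The monoidality isomorphism \<open>X[0] \<star> Y[0] \<rightarrow> (X \<star> Y)[0]\<close> of the embedding of \<open>A\<close> in its homotopy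
  category, and its inverse.
\<close>

definition stalk_mu ::
  "('o, 'm::ab_group_add) moncat \<Rightarrow> 'o \<Rightarrow> 'o \<Rightarrow> ('o, 'm) kmor" where
  "stalk_mu A X Y =
    kclass A (tot A A A (Tensor A) (stalk A X) (stalk A Y)) (stalk A (X \<star>\<^bsub>Tensor A\<^esub> Y))
      (\<lambda>n. if n = 0 then prj (tot_sum A (Tensor A) (stalk A X) (stalk A Y) 0) 0 else 0)"

definition stalk_mu_inv ::
  "('o, 'm::ab_group_add) moncat \<Rightarrow> 'o \<Rightarrow> 'o \<Rightarrow> ('o, 'm) kmor" where
  "stalk_mu_inv A X Y =
    kclass A (stalk A (X \<star>\<^bsub>Tensor A\<^esub> Y)) (tot A A A (Tensor A) (stalk A X) (stalk A Y))
      (\<lambda>n. if n = 0 then inj (tot_sum A (Tensor A) (stalk A X) (stalk A Y) 0) 0 else 0)"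

text \<open>
  The Hom-sets of a linear category share their zero, so that a morphism does not determine its
  source and target. \<open>typed A\<close> is \<open>A\<close> with Hom-sets made disjoint by tagging. This is needed for
  the restriction of bimodule categories along the embedding \<open>X \<mapsto> X[0]\<close>, whose effect on a morphism
  depends on source and target.
\<close>

definition typed :: "('o, 'm) moncat \<Rightarrow> ('o, ('o, 'm) arr) moncat" where
  "typed A =
    \<lparr>Obj = Obj A,
     Hom = (\<lambda>X Y. {\<lparr>src = X, tgt = Y, mor = f\<rparr> | f. f \<in> Hom A X Y}),
     Comp = (\<lambda>v u. \<lparr>src = src u, tgt = tgt v, mor = mor v \<cdot>\<^bsub>A\<^esub> mor u\<rparr>),
     Ident = (\<lambda>X. \<lparr>src = X, tgt = X, mor = Ident A X\<rparr>),
     Tensor =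
       \<lparr>ObT = ObT (Tensor A),
        MorT = (\<lambda>u v. \<lparr>src = src u \<star>\<^bsub>Tensor A\<^esub> src v, tgt = tgt u \<star>\<^bsub>Tensor A\<^esub> tgt v,
                       mor = mor u \<otimes>\<^bsub>Tensor A\<^esub> mor v\<rparr>)\<rparr>,
     Unit = Unit A,
     Assoc = (\<lambda>X Y Z. \<lparr>src = (X \<star>\<^bsub>Tensor A\<^esub> Y) \<star>\<^bsub>Tensor A\<^esub> Z,
                       tgt = X \<star>\<^bsub>Tensor A\<^esub> (Y \<star>\<^bsub>Tensor A\<^esub> Z), mor = Assoc A X Y Z\<rparr>),
     LUnit = (\<lambda>X. \<lparr>src = Unit A \<star>\<^bsub>Tensor A\<^esub> X, tgt = X, mor = LUnit A X\<rparr>),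
     RUnit = (\<lambda>X. \<lparr>src = X \<star>\<^bsub>Tensor A\<^esub> Unit A, tgt = X, mor = RUnit A X\<rparr>)\<rparr>"

text \<open>The homotopy category of \<open>M\<close> as a bimodule category over \<open>A\<close>.\<close>

definition Kb_bimod_base ::
  "('o, 'm::ab_group_add) moncat \<Rightarrow> ('p, 'n::ab_group_add, 'o, 'm) bimod
    \<Rightarrow> (('p, 'n) cochain, ('p, 'n) kmor, 'o, ('o, 'm) arr) bimod" where
  "Kb_bimod_base A M =
    (let K = Kb_bimod A M; L = LAct K; R = RAct K; E = stalk A in
     \<lparr>Obj = Obj K, Hom = Hom K, Comp = Comp K, Ident = Ident K,
      LAct = \<lparr>ObT = (\<lambda>X N. E X \<star>\<^bsub>L\<^esub> N), MorT = (\<lambda>u w. stalk_mor A u \<otimes>\<^bsub>L\<^esub> w)\<rparr>,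
      RAct = \<lparr>ObT = (\<lambda>N X. N \<star>\<^bsub>R\<^esub> E X), MorT = (\<lambda>w u. w \<otimes>\<^bsub>R\<^esub> stalk_mor A u)\<rparr>,
      LAssoc = (\<lambda>X Y N. LAssoc K (E X) (E Y) N \<cdot>\<^bsub>K\<^esub> (stalk_mu_inv A X Y \<otimes>\<^bsub>L\<^esub> Ident K N)),
      MAssoc = (\<lambda>X N Y. MAssoc K (E X) N (E Y)),
      RAssoc = (\<lambda>N X Y. (Ident K N \<otimes>\<^bsub>R\<^esub> stalk_mu A X Y) \<cdot>\<^bsub>K\<^esub> RAssoc K N (E X) (E Y)),
      LAUnit = LAUnit K,
      RAUnit = RAUnit K\<rparr>)"


section \<open>Drinfeld centralizers\<close>

text \<open>
  With associativity constraints written out, the multiplicativity condition reads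
  \<open>\<alpha>\<^sub>X\<^sub>,\<^sub>Y\<^sub>,\<^sub>Z \<circ> \<tau>\<^sub>X\<^sub>\<star>\<^sub>Y \<circ> \<alpha>\<^sub>Z\<^sub>,\<^sub>X\<^sub>,\<^sub>Y = (id\<^sub>X \<star> \<tau>\<^sub>Y) \<circ> \<alpha>\<^sub>X\<^sub>,\<^sub>Z\<^sub>,\<^sub>Y \<circ> (\<tau>\<^sub>X \<star> id\<^sub>Y)\<close>.
\<close>

definition centralizer ::
  "('o, 'm) moncat \<Rightarrow> ('p, 'n, 'o, 'm) bimod \<Rightarrow> ('p \<times> ('o \<Rightarrow> 'n)) set" where
  "centralizer C N =
    {(Z, \<tau>). Z \<in> Obj N \<and>
      (\<forall>X \<in> Obj C. is_iso N (Z \<star>\<^bsub>RAct N\<^esub> X) (X \<star>\<^bsub>LAct N\<^esub> Z) (\<tau> X)) \<and>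
      (\<forall>X \<in> Obj C. \<forall>Y \<in> Obj C. \<forall>f \<in> Hom C X Y.
        \<tau> Y \<cdot>\<^bsub>N\<^esub> (Ident N Z \<otimes>\<^bsub>RAct N\<^esub> f) = (f \<otimes>\<^bsub>LAct N\<^esub> Ident N Z) \<cdot>\<^bsub>N\<^esub> \<tau> X) \<and>
      (\<forall>X \<in> Obj C. \<forall>Y \<in> Obj C.
        LAssoc N X Y Z \<cdot>\<^bsub>N\<^esub> \<tau> (X \<star>\<^bsub>Tensor C\<^esub> Y) \<cdot>\<^bsub>N\<^esub> RAssoc N Z X Y
        = (Ident C X \<otimes>\<^bsub>LAct N\<^esub> \<tau> Y) \<cdot>\<^bsub>N\<^esub> MAssoc N X Z Y \<cdot>\<^bsub>N\<^esub> (\<tau> X \<otimes>\<^bsub>RAct N\<^esub> Ident C Y))}"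

text \<open>Objects of \<open>A\<close> are identified with the complexes \<open>stalk A X\<close>.\<close>

definition lifts ::
  "('o, 'm::ab_group_add) moncat \<Rightarrow> (('o, 'm) cochain \<Rightarrow> 'k) \<Rightarrow> ('o \<Rightarrow> 'k) \<Rightarrow> bool" where
  "lifts A T \<tau> \<longleftrightarrow> (\<forall>X \<in> Obj A. T (stalk A X) = \<tau> X)"

end

theory Submission
  imports Defs
begin

text \<open>
  For a bounded complex \<open>X\<close>, both \<open>Z \<star> X\<close> and \<open>X \<star> Z\<close> are filtered by the degree in \<open>X\<close>, with columns
  \<open>Z \<star> X\<^sup>i\<close> and \<open>X\<^sup>i \<star> Z\<close>. Consider a morphism between two filtered complexes that respects the filtrations.
  A component that raises the filtration by \<open>r\<close> lives in the Hom complex between columns in degree lowered by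
  \<open>r\<close>; since that complex has no cohomology in negative degrees, a cochain whose coboundary raises the
  filtration can be corrected to a cocycle one filtration step after another, without changing its diagonal,
  and two cocycles with homotopic diagonals are homotopic. Existence of the lift uses the diagonal given by
  the half-braiding on the objects \<open>X\<^sup>i\<close>, whose naturality removes the first obstruction, which sits in
  degree 0. Uniqueness turns naturality and multiplicativity into statements about the diagonals, where they
  are given. As \<open>Z \<star> V \<cong> V \<star> Z\<close> for \<open>V\<close> in \<open>A\<close>, the vanishing hypothesis passes to the Hom complexes
  between all columns that occur, and so the same principle also yields a homotopy inverse.
\<close>

text \<open>All Hom-sets lie in one type and share its zero, so a morphism does not know its source
  and target. Calculations therefore use arrows tagged with both, for which typing, associativity
  and interchange become rewrite rules; results are read off with \<open>mor\<close>. Columns of Z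
  \<star> X carry the sign (-1)^(j (n - j)): the differential of X acts there to the right of Z and
  picks up a Koszul sign. With this choice adjacent columns are connected by the plain d_X, and
  naturality of the half-braiding applies without signs. Multiplicativity meets an obstacle. A
  column (i, j) of (Z \<star> X) \<star> Y has filtration degree i + j, so pairs with i + j = k + l
  but i \<noteq> k also belong to the diagonal, and there the lift for X \<star> Y is known only on
  the whole object (X \<star> Y)^(i+j), not on its summands. Naturality for the inclusions of the
  summands makes these entries null-homotopic. A lift must have the restricted half-braiding as its
  diagonal exactly. The given cocycle on a complex in degree 0 is itself such a lift, so uniqueness
  yields agreement with \<open>\<tau>\<close>.\<close>

definition valid :: "('o, 'm, 'x) cat_scheme \<Rightarrow> ('o, 'm) arr \<Rightarrow> bool" where
  "valid C u \<longleftrightarrow> src u \<in> Obj C \<and> tgt u \<in> Obj C \<and> mor u \<in> Hom C (src u) (tgt u)"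

definition tcomp :: "('o, 'm, 'x) cat_scheme \<Rightarrow> ('o, 'm) arr \<Rightarrow> ('o, 'm) arr \<Rightarrow> ('o, 'm) arr"
    (infixr "\<odot>\<index>" 70) where
  "v \<odot>\<^bsub>C\<^esub> u = \<lparr>src = src u, tgt = tgt v, mor = mor v \<cdot>\<^bsub>C\<^esub> mor u\<rparr>"

definition tid :: "('o, 'm, 'x) cat_scheme \<Rightarrow> 'o \<Rightarrow> ('o, 'm) arr" where
  "tid C X = \<lparr>src = X, tgt = X, mor = Ident C X\<rparr>"

definition tten :: "('o1, 'm1, 'o2, 'm2, 'o3, 'm3) bifun \<Rightarrow> ('o1, 'm1) arr \<Rightarrow> ('o2, 'm2) arr
    \<Rightarrow> ('o3, 'm3) arr" (infixl "\<Otimes>\<index>" 75) where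
  "u \<Otimes>\<^bsub>F\<^esub> v =
    \<lparr>src = src u \<star>\<^bsub>F\<^esub> src v, tgt = tgt u \<star>\<^bsub>F\<^esub> tgt v, mor = mor u \<otimes>\<^bsub>F\<^esub> mor v\<rparr>"

definition tsgn :: "int \<Rightarrow> ('o, 'm::ab_group_add) arr \<Rightarrow> ('o, 'm) arr" where
  "tsgn n u = \<lparr>src = src u, tgt = tgt u, mor = ksign n (mor u)\<rparr>"

definition tzero :: "'o \<Rightarrow> 'o \<Rightarrow> ('o, 'm::ab_group_add) arr" where
  "tzero X Y = \<lparr>src = X, tgt = Y, mor = 0\<rparr>"

definition tadd :: "('o, 'm::ab_group_add) arr \<Rightarrow> ('o, 'm) arr \<Rightarrow> ('o, 'm) arr"
    (infixl "\<oplus>" 65) where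
  "u \<oplus> v = \<lparr>src = src u, tgt = tgt u, mor = mor u + mor v\<rparr>"

text \<open>A bare family of morphisms records neither its complexes nor its degree; the tags put
  both back, so that composability of components is a matter of integer arithmetic.\<close>

definition tmap :: "('o, 'm) cochain \<Rightarrow> ('o, 'm) cochain \<Rightarrow> int \<Rightarrow> (int \<Rightarrow> 'm) \<Rightarrow> int \<Rightarrow> ('o, 'm) arr" where
  "tmap X Y k f n = \<lparr>src = ob X n, tgt = ob Y (n + k), mor = f n\<rparr>"

lemma arr_fields [simp]:
  "src (v \<odot>\<^bsub>C\<^esub> u) = src u" "tgt (v \<odot>\<^bsub>C\<^esub> u) = tgt v" "mor (v \<odot>\<^bsub>C\<^esub> u) = mor v \<cdot>\<^bsub>C\<^esub> mor u"
  "src (tid C X) = X" "tgt (tid C X) = X" "mor (tid C X) = Ident C X"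
  "src (p \<Otimes>\<^bsub>F\<^esub> q) = src p \<star>\<^bsub>F\<^esub> src q" "tgt (p \<Otimes>\<^bsub>F\<^esub> q) = tgt p \<star>\<^bsub>F\<^esub> tgt q"
  "mor (p \<Otimes>\<^bsub>F\<^esub> q) = mor p \<otimes>\<^bsub>F\<^esub> mor q"
  "src (tsgn n a) = src a" "tgt (tsgn n a) = tgt a" "mor (tsgn n a) = ksign n (mor a)"
  "src (tzero X Y) = X" "tgt (tzero X Y) = Y" "mor (tzero X Y :: ('o, 'b::ab_group_add) arr) = 0"
  "src (a \<oplus> b) = src a" "tgt (a \<oplus> b) = tgt a" "mor (a \<oplus> b) = mor a + mor b"
  "src (tmap K L k f n) = ob K n" "tgt (tmap K L k f n) = ob L (n + k)" "mor (tmap K L k f n) = f n"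
  by (simp_all add: tcomp_def tid_def tten_def tsgn_def tzero_def tadd_def tmap_def)

lemma arr_eqI: "src u = src v \<Longrightarrow> tgt u = tgt v \<Longrightarrow> mor u = mor v \<Longrightarrow> u = (v :: ('o, 'm) arr)"
  by (cases u; cases v) simp

lemma ksign_simps [simp]:
  "ksign n (0 :: 'm::ab_group_add) = 0" "ksign 0 x = (x :: 'm)"
  "ksign n (ksign n x) = x"
  by (simp_all add: ksign_def)

lemma ksign_ksign: "ksign m (ksign n x) = ksign (m + n) x"
  by (simp add: ksign_def)

lemma ksign_cong: "even m = even n \<Longrightarrow> ksign m x = ksign n x"
  by (simp add: ksign_def)

lemma ksign_add: "ksign n (x + y) = ksign n x + ksign n y"
  by (simp add: ksign_def)

lemma ksign_diff: "ksign n (x - y) = ksign n x - ksign n y"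
  by (simp add: ksign_def)

lemma ksign_eq_0 [simp]: "ksign n x = 0 \<longleftrightarrow> x = 0"
  by (simp add: ksign_def)

lemma tsgn_tsgn [simp]: "tsgn m (tsgn n u) = tsgn (m + n) u"
  by (rule arr_eqI) (simp_all add: ksign_ksign)

lemma tsgn_0 [simp]: "tsgn 0 u = u"
  by (rule arr_eqI) simp_all

lemma tsgn_cong: "even m = even n \<Longrightarrow> tsgn m u = tsgn n u"
  by (rule arr_eqI) (simp_all add: ksign_def)

lemma tsgn_even: "even m \<Longrightarrow> tsgn m u = u"
  by (rule arr_eqI) (simp_all add: ksign_def)

lemma tsgn_tzero [simp]: "tsgn m (tzero X Y) = tzero X Y"
  by (rule arr_eqI) simp_all

lemma tsgn_tadd [simp]: "tsgn m (u \<oplus> v) = tsgn m u \<oplus> tsgn m v"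
  by (rule arr_eqI) (simp_all add: ksign_add)

lemma sum_eq_single:
  assumes "finite S" "a \<in> S" "\<And>b. b \<in> S \<Longrightarrow> b \<noteq> a \<Longrightarrow> f b = 0"
  shows "sum f S = f a"
proof -
  have "sum f S = sum f {a}"
    by (rule sum.mono_neutral_right) (use assms in auto)
  then show ?thesis by simp
qed

section \<open>Calculus of tagged arrows\<close>

context category
begin

lemma valid_tcomp [simp]: "valid C u \<Longrightarrow> valid C v \<Longrightarrow> tgt u = src v \<Longrightarrow> valid C (v \<odot>\<^bsub>C\<^esub> u)"
  by (auto simp: valid_def intro: comp_closed)

lemma valid_tid [simp]: "X \<in> Obj C \<Longrightarrow> valid C (tid C X)"
  by (simp add: valid_def ident_closed)

lemma tcomp_assoc [simp]:
  "valid C u \<Longrightarrow> valid C v \<Longrightarrow> valid C w \<Longrightarrow> tgt u = src v \<Longrightarrow> tgt v = src w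
    \<Longrightarrow> (w \<odot>\<^bsub>C\<^esub> v) \<odot>\<^bsub>C\<^esub> u = w \<odot>\<^bsub>C\<^esub> (v \<odot>\<^bsub>C\<^esub> u)"
  by (rule arr_eqI) (auto simp: valid_def intro: comp_assoc)

lemma tid_left [simp]: "valid C u \<Longrightarrow> tgt u = X \<Longrightarrow> tid C X \<odot>\<^bsub>C\<^esub> u = u"
  by (rule arr_eqI) (auto simp: valid_def intro: comp_ident_left)

lemma tid_right [simp]: "valid C u \<Longrightarrow> src u = X \<Longrightarrow> u \<odot>\<^bsub>C\<^esub> tid C X = u"
  by (rule arr_eqI) (auto simp: valid_def intro: comp_ident_right)

text \<open>\<open>tcomp_assoc\<close> brackets composites to the right, which hides a redex of v
  after u inside v after (u after w). This rule carries an equation for the redex over to that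
  position.\<close>

lemma tcomp_reduce:
  "v \<odot>\<^bsub>C\<^esub> u = r \<Longrightarrow> valid C u \<Longrightarrow> valid C v \<Longrightarrow> valid C w \<Longrightarrow> tgt w = src u \<Longrightarrow> tgt u = src v
    \<Longrightarrow> v \<odot>\<^bsub>C\<^esub> (u \<odot>\<^bsub>C\<^esub> w) = r \<odot>\<^bsub>C\<^esub> w"
  using tcomp_assoc by metis

end

context linear_category
begin

lemma hom_zero [simp]: "X \<in> Obj C \<Longrightarrow> Y \<in> Obj C \<Longrightarrow> 0 \<in> Hom C X Y"
  using hom_submodule subspace_0 by blast

lemma hom_add: "\<lbrakk>X \<in> Obj C; Y \<in> Obj C; f \<in> Hom C X Y; g \<in> Hom C X Y\<rbrakk> \<Longrightarrow> f + g \<in> Hom C X Y"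
  using hom_submodule subspace_add by blast

lemma hom_minus: "\<lbrakk>X \<in> Obj C; Y \<in> Obj C; f \<in> Hom C X Y\<rbrakk> \<Longrightarrow> - f \<in> Hom C X Y"
  using hom_submodule subspace_neg by blast

lemma hom_sub: "\<lbrakk>X \<in> Obj C; Y \<in> Obj C; f \<in> Hom C X Y; g \<in> Hom C X Y\<rbrakk> \<Longrightarrow> f - g \<in> Hom C X Y"
  using hom_submodule subspace_diff by blast

lemma hom_ksign: "\<lbrakk>X \<in> Obj C; Y \<in> Obj C; f \<in> Hom C X Y\<rbrakk> \<Longrightarrow> ksign n f \<in> Hom C X Y"
  by (simp add: ksign_def hom_minus)

lemma hom_sum:
  "\<lbrakk>X \<in> Obj C; Y \<in> Obj C; \<And>i. i \<in> S \<Longrightarrow> f i \<in> Hom C X Y\<rbrakk> \<Longrightarrow> sum f S \<in> Hom C X Y"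
  using hom_submodule subspace_sum by blast

lemma comp_zero_left:
  "\<lbrakk>X \<in> Obj C; Y \<in> Obj C; Z \<in> Obj C; f \<in> Hom C X Y\<rbrakk> \<Longrightarrow> 0 \<cdot>\<^bsub>C\<^esub> f = 0"
  using comp_add_left[of X Y Z f 0 0] by simp

lemma comp_zero_right:
  "\<lbrakk>X \<in> Obj C; Y \<in> Obj C; Z \<in> Obj C; g \<in> Hom C Y Z\<rbrakk> \<Longrightarrow> g \<cdot>\<^bsub>C\<^esub> 0 = 0"
  using comp_add_right[of X Y Z 0 0 g] by simp

lemma comp_minus_left:
  "\<lbrakk>X \<in> Obj C; Y \<in> Obj C; Z \<in> Obj C; f \<in> Hom C X Y; g \<in> Hom C Y Z\<rbrakk> \<Longrightarrow> (- g) \<cdot>\<^bsub>C\<^esub> f = - (g \<cdot>\<^bsub>C\<^esub> f)"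
  using comp_add_left[of X Y Z f g "- g"]
  by (metis add.right_inverse comp_zero_left hom_minus minus_unique)

lemma comp_minus_right:
  "\<lbrakk>X \<in> Obj C; Y \<in> Obj C; Z \<in> Obj C; f \<in> Hom C X Y; g \<in> Hom C Y Z\<rbrakk> \<Longrightarrow> g \<cdot>\<^bsub>C\<^esub> (- f) = - (g \<cdot>\<^bsub>C\<^esub> f)"
  using comp_add_right[of X Y Z f "- f" g]
  by (metis add.right_inverse comp_zero_right hom_minus minus_unique)

lemma comp_diff_left:
  "\<lbrakk>X \<in> Obj C; Y \<in> Obj C; Z \<in> Obj C; f \<in> Hom C X Y; g \<in> Hom C Y Z; g' \<in> Hom C Y Z\<rbrakk>
    \<Longrightarrow> (g - g') \<cdot>\<^bsub>C\<^esub> f = g \<cdot>\<^bsub>C\<^esub> f - g' \<cdot>\<^bsub>C\<^esub> f"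
  using comp_add_left[of X Y Z f g "- g'"] by (simp add: comp_minus_left hom_minus)

lemma comp_diff_right:
  "\<lbrakk>X \<in> Obj C; Y \<in> Obj C; Z \<in> Obj C; f \<in> Hom C X Y; f' \<in> Hom C X Y; g \<in> Hom C Y Z\<rbrakk>
    \<Longrightarrow> g \<cdot>\<^bsub>C\<^esub> (f - f') = g \<cdot>\<^bsub>C\<^esub> f - g \<cdot>\<^bsub>C\<^esub> f'"
  using comp_add_right[of X Y Z f "- f'" g] by (simp add: comp_minus_right hom_minus)

lemma comp_ksign_left:
  "\<lbrakk>X \<in> Obj C; Y \<in> Obj C; Z \<in> Obj C; f \<in> Hom C X Y; g \<in> Hom C Y Z\<rbrakk>
    \<Longrightarrow> ksign n g \<cdot>\<^bsub>C\<^esub> f = ksign n (g \<cdot>\<^bsub>C\<^esub> f)"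
  by (simp add: ksign_def comp_minus_left)

lemma comp_ksign_right:
  "\<lbrakk>X \<in> Obj C; Y \<in> Obj C; Z \<in> Obj C; f \<in> Hom C X Y; g \<in> Hom C Y Z\<rbrakk>
    \<Longrightarrow> g \<cdot>\<^bsub>C\<^esub> ksign n f = ksign n (g \<cdot>\<^bsub>C\<^esub> f)"
  by (simp add: ksign_def comp_minus_right)

lemma comp_sum_left:
  "\<lbrakk>X \<in> Obj C; Y \<in> Obj C; Z \<in> Obj C; f \<in> Hom C X Y; \<And>i. i \<in> S \<Longrightarrow> g i \<in> Hom C Y Z\<rbrakk>
    \<Longrightarrow> sum g S \<cdot>\<^bsub>C\<^esub> f = (\<Sum>i\<in>S. g i \<cdot>\<^bsub>C\<^esub> f)"
  by (induction S rule: infinite_finite_induct) (simp_all add: comp_zero_left comp_add_left hom_sum)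

lemma comp_sum_right:
  "\<lbrakk>X \<in> Obj C; Y \<in> Obj C; Z \<in> Obj C; \<And>i. i \<in> S \<Longrightarrow> f i \<in> Hom C X Y; g \<in> Hom C Y Z\<rbrakk>
    \<Longrightarrow> g \<cdot>\<^bsub>C\<^esub> sum f S = (\<Sum>i\<in>S. g \<cdot>\<^bsub>C\<^esub> f i)"
  by (induction S rule: infinite_finite_induct) (simp_all add: comp_zero_right comp_add_right hom_sum)

lemma valid_tsgn [simp]: "valid C u \<Longrightarrow> valid C (tsgn n u)"
  by (simp add: valid_def hom_ksign)

lemma valid_tzero [simp]: "X \<in> Obj C \<Longrightarrow> Y \<in> Obj C \<Longrightarrow> valid C (tzero X Y)"
  by (simp add: valid_def)

lemma valid_tadd [simp]:
  "valid C u \<Longrightarrow> valid C v \<Longrightarrow> src u = src v \<Longrightarrow> tgt u = tgt v \<Longrightarrow> valid C (u \<oplus> v)"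
  by (simp add: valid_def hom_add)

text \<open>Rewriting moves signs outwards, where \<open>tsgn_tsgn\<close> adds their exponents; a
  sign computation then ends in a comparison of parities.\<close>

lemma tcomp_tsgn_left [simp]:
  "valid C u \<Longrightarrow> valid C v \<Longrightarrow> tgt u = src v \<Longrightarrow> tsgn n v \<odot>\<^bsub>C\<^esub> u = tsgn n (v \<odot>\<^bsub>C\<^esub> u)"
  by (rule arr_eqI) (auto simp: valid_def intro: comp_ksign_left)

lemma tcomp_tsgn_right [simp]:
  "valid C u \<Longrightarrow> valid C v \<Longrightarrow> tgt u = src v \<Longrightarrow> v \<odot>\<^bsub>C\<^esub> tsgn n u = tsgn n (v \<odot>\<^bsub>C\<^esub> u)"
  by (rule arr_eqI) (auto simp: valid_def intro: comp_ksign_right)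

lemma tcomp_tzero_left [simp]:
  "valid C u \<Longrightarrow> Y \<in> Obj C \<Longrightarrow> tgt u = X \<Longrightarrow> tzero X Y \<odot>\<^bsub>C\<^esub> u = tzero (src u) Y"
  by (rule arr_eqI) (auto simp: valid_def intro: comp_zero_left)

lemma tcomp_tzero_right [simp]:
  "valid C v \<Longrightarrow> X \<in> Obj C \<Longrightarrow> src v = Y \<Longrightarrow> v \<odot>\<^bsub>C\<^esub> tzero X Y = tzero X (tgt v)"
  by (rule arr_eqI) (auto simp: valid_def intro: comp_zero_right)

lemma tcomp_tadd_left [simp]:
  "\<lbrakk>valid C u; valid C v; valid C v'; tgt u = src v; src v = src v'; tgt v = tgt v'\<rbrakk>
    \<Longrightarrow> (v \<oplus> v') \<odot>\<^bsub>C\<^esub> u = (v \<odot>\<^bsub>C\<^esub> u) \<oplus> (v' \<odot>\<^bsub>C\<^esub> u)"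
  by (rule arr_eqI) (auto simp: valid_def intro: comp_add_left)

lemma tcomp_tadd_right [simp]:
  "\<lbrakk>valid C u; valid C v; valid C u'; tgt u = src v; src u = src u'; tgt u = tgt u'\<rbrakk>
    \<Longrightarrow> v \<odot>\<^bsub>C\<^esub> (u \<oplus> u') = (v \<odot>\<^bsub>C\<^esub> u) \<oplus> (v \<odot>\<^bsub>C\<^esub> u')"
  by (rule arr_eqI) (auto simp: valid_def intro: comp_add_right)

lemma is_zero_src: "is_zero C (src u) \<Longrightarrow> valid C u \<Longrightarrow> mor u = 0"
  by (auto simp: is_zero_def valid_def)

lemma is_zero_tgt: "is_zero C (tgt u) \<Longrightarrow> valid C u \<Longrightarrow> mor u = 0"
  by (auto simp: is_zero_def valid_def)

text \<open>Every morphism factors through an identity, so a vanishing identity kills all morphisms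
  from and to the object.\<close>

lemma is_zero_iff_ident: "X \<in> Obj C \<Longrightarrow> is_zero C X \<longleftrightarrow> Ident C X = 0"
proof
  assume X: "X \<in> Obj C" and 0: "Ident C X = 0"
  have "f = 0" if "Y \<in> Obj C" "f \<in> Hom C X Y" for Y f
    using comp_ident_right[OF X that] comp_zero_right[OF X X that(1) that(2)] 0 by simp
  moreover have "f = 0" if "Y \<in> Obj C" "f \<in> Hom C Y X" for Y f
    using comp_ident_left[OF that(1) X that(2)] comp_zero_left[OF that(1) X X that(2)] 0 by simp
  ultimately show "is_zero C X"
    using X hom_zero by (fastforce simp: is_zero_def)
qed (auto simp: is_zero_def dest: ident_closed)

end

section \<open>Direct sums\<close>

context additive_category
begin

text \<open>Induction on the index set: the zero object is the empty sum, and a binary biproduct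
  adds one summand.\<close>

lemma direct_sum_over_finite:
  assumes "finite S" "\<And>i. W i \<in> Obj C"
  shows "\<exists>D \<in> Obj C. \<exists>\<iota> \<pi>. (\<forall>i\<in>S. \<iota> i \<in> Hom C (W i) D \<and> \<pi> i \<in> Hom C D (W i)
      \<and> \<pi> i \<cdot>\<^bsub>C\<^esub> \<iota> i = Ident C (W i)) \<and> (\<forall>i\<in>S. \<forall>j\<in>S. i \<noteq> j \<longrightarrow> \<pi> j \<cdot>\<^bsub>C\<^esub> \<iota> i = 0)
      \<and> (\<Sum>i\<in>S. \<iota> i \<cdot>\<^bsub>C\<^esub> \<pi> i) = Ident C D"
  using assms(1)
proof (induction S)
  case empty
  obtain N where N: "is_zero C N" using zero_object by blast
  then have "Ident C N = 0" "N \<in> Obj C" using is_zero_iff_ident by (auto simp: is_zero_def)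
  then show ?case by auto
next
  case (insert a S)
  then obtain D \<iota> \<pi> where D: "D \<in> Obj C"
    and m: "\<And>i. i\<in>S \<Longrightarrow> \<iota> i \<in> Hom C (W i) D" "\<And>i. i\<in>S \<Longrightarrow> \<pi> i \<in> Hom C D (W i)"
    and one: "\<And>i. i \<in> S \<Longrightarrow> \<pi> i \<cdot>\<^bsub>C\<^esub> \<iota> i = Ident C (W i)"
    and orth: "\<And>i j. i \<in> S \<Longrightarrow> j \<in> S \<Longrightarrow> i \<noteq> j \<Longrightarrow> \<pi> j \<cdot>\<^bsub>C\<^esub> \<iota> i = 0"
    and tot: "(\<Sum>i\<in>S. \<iota> i \<cdot>\<^bsub>C\<^esub> \<pi> i) = Ident C D"
    by blast
  obtain E i1 i2 p1 p2 where E: "E \<in> Obj C" "i1 \<in> Hom C D E" "i2 \<in> Hom C (W a) E"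
      "p1 \<in> Hom C E D" "p2 \<in> Hom C E (W a)"
      and e: "p1 \<cdot>\<^bsub>C\<^esub> i1 = Ident C D" "p2 \<cdot>\<^bsub>C\<^esub> i2 = Ident C (W a)" "p1 \<cdot>\<^bsub>C\<^esub> i2 = 0" "p2 \<cdot>\<^bsub>C\<^esub> i1 = 0"
      "i1 \<cdot>\<^bsub>C\<^esub> p1 + i2 \<cdot>\<^bsub>C\<^esub> p2 = Ident C E"
    using biproduct[OF D assms(2)[of a]] by blast
  define \<iota>' where "\<iota>' i = (if i = a then i2 else i1 \<cdot>\<^bsub>C\<^esub> \<iota> i)" for i
  define \<pi>' where "\<pi>' i = (if i = a then p2 else \<pi> i \<cdot>\<^bsub>C\<^esub> p1)" for i
  note W = assms(2)
  \<comment> \<open>\<open>p1\<close> after \<open>i1\<close> is the identity of the old sum, so the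
    old summands keep their relations inside the new one.\<close>
  have cancel: "(\<pi> j \<cdot>\<^bsub>C\<^esub> p1) \<cdot>\<^bsub>C\<^esub> (i1 \<cdot>\<^bsub>C\<^esub> \<iota> i) = \<pi> j \<cdot>\<^bsub>C\<^esub> \<iota> i" if "i \<in> S" "j \<in> S" for i j
  proof -
    have "p1 \<cdot>\<^bsub>C\<^esub> (i1 \<cdot>\<^bsub>C\<^esub> \<iota> i) = \<iota> i"
      using comp_assoc[OF W D E(1) D m(1)[OF that(1)] E(2,4)] comp_ident_left[OF W D m(1)[OF that(1)]] e(1)
      by simp
    then show ?thesis
      using comp_assoc[OF W E(1) D W comp_closed[OF W D E(1) m(1)[OF that(1)] E(2)] E(4) m(2)[OF that(2)]]
      by simp
  qed
  have c2: "p2 \<cdot>\<^bsub>C\<^esub> (i1 \<cdot>\<^bsub>C\<^esub> \<iota> i) = 0" if "i \<in> S" for i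
    using comp_assoc[OF W D E(1) W m(1)[OF that] E(2,5)] comp_zero_left[OF W D W m(1)[OF that]] e(4) by simp
  have c3: "(\<pi> i \<cdot>\<^bsub>C\<^esub> p1) \<cdot>\<^bsub>C\<^esub> i2 = 0" if "i \<in> S" for i
    using comp_assoc[OF W E(1) D W E(3,4) m(2)[OF that]] comp_zero_right[OF W D W m(2)[OF that]] e(3) by simp
  have c4: "(i1 \<cdot>\<^bsub>C\<^esub> \<iota> i) \<cdot>\<^bsub>C\<^esub> (\<pi> i \<cdot>\<^bsub>C\<^esub> p1) = i1 \<cdot>\<^bsub>C\<^esub> (\<iota> i \<cdot>\<^bsub>C\<^esub> \<pi> i) \<cdot>\<^bsub>C\<^esub> p1" if "i \<in> S" for i
  proof -
    have "(i1 \<cdot>\<^bsub>C\<^esub> \<iota> i) \<cdot>\<^bsub>C\<^esub> (\<pi> i \<cdot>\<^bsub>C\<^esub> p1) = i1 \<cdot>\<^bsub>C\<^esub> (\<iota> i \<cdot>\<^bsub>C\<^esub> (\<pi> i \<cdot>\<^bsub>C\<^esub> p1))"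
      using comp_assoc[OF E(1) W D E(1) comp_closed[OF E(1) D W E(4) m(2)[OF that]] m(1)[OF that] E(2)] .
    then show ?thesis using comp_assoc[OF E(1) D W D E(4) m(2)[OF that] m(1)[OF that]] by simp
  qed
  have "(\<Sum>i\<in>S. i1 \<cdot>\<^bsub>C\<^esub> (\<iota> i \<cdot>\<^bsub>C\<^esub> \<pi> i) \<cdot>\<^bsub>C\<^esub> p1) = i1 \<cdot>\<^bsub>C\<^esub> p1"
  proof -
    have h: "\<iota> i \<cdot>\<^bsub>C\<^esub> \<pi> i \<in> Hom C D D" if "i \<in> S" for i
      using comp_closed[OF D W D m(2)[OF that] m(1)[OF that]] .
    have "(\<Sum>i\<in>S. i1 \<cdot>\<^bsub>C\<^esub> (\<iota> i \<cdot>\<^bsub>C\<^esub> \<pi> i) \<cdot>\<^bsub>C\<^esub> p1) = i1 \<cdot>\<^bsub>C\<^esub> (\<Sum>i\<in>S. (\<iota> i \<cdot>\<^bsub>C\<^esub> \<pi> i) \<cdot>\<^bsub>C\<^esub> p1)"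
      by (rule comp_sum_right[OF E(1) D E(1) comp_closed[OF E(1) D D E(4) h] E(2), symmetric])
    also have "(\<Sum>i\<in>S. (\<iota> i \<cdot>\<^bsub>C\<^esub> \<pi> i) \<cdot>\<^bsub>C\<^esub> p1) = (\<Sum>i\<in>S. \<iota> i \<cdot>\<^bsub>C\<^esub> \<pi> i) \<cdot>\<^bsub>C\<^esub> p1"
      by (rule comp_sum_left[OF E(1) D D E(4) h, symmetric])
    finally show ?thesis using tot comp_ident_left[OF E(1) D E(4)] by simp
  qed
  then have "(\<Sum>i\<in>insert a S. \<iota>' i \<cdot>\<^bsub>C\<^esub> \<pi>' i) = Ident C E"
  proof -
    have "(\<Sum>i\<in>S. \<iota>' i \<cdot>\<^bsub>C\<^esub> \<pi>' i) = (\<Sum>i\<in>S. i1 \<cdot>\<^bsub>C\<^esub> (\<iota> i \<cdot>\<^bsub>C\<^esub> \<pi> i) \<cdot>\<^bsub>C\<^esub> p1)"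
      using insert.hyps by (intro sum.cong) (auto simp: \<iota>'_def \<pi>'_def c4)
    then show ?thesis
      using insert.hyps e(5) \<open>(\<Sum>i\<in>S. i1 \<cdot>\<^bsub>C\<^esub> (\<iota> i \<cdot>\<^bsub>C\<^esub> \<pi> i) \<cdot>\<^bsub>C\<^esub> p1) = _\<close>
      by (simp add: \<iota>'_def \<pi>'_def add.commute)
  qed
  moreover have "\<forall>i\<in>insert a S. \<iota>' i \<in> Hom C (W i) E \<and> \<pi>' i \<in> Hom C E (W i)"
    using insert.hyps E m comp_closed[OF W D E(1) _ E(2)] comp_closed[OF E(1) D W E(4)]
    by (auto simp: \<iota>'_def \<pi>'_def)
  moreover have "\<forall>i\<in>insert a S. \<pi>' i \<cdot>\<^bsub>C\<^esub> \<iota>' i = Ident C (W i)"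
    using cancel one e(2) by (auto simp: \<iota>'_def \<pi>'_def)
  moreover have "\<forall>i\<in>insert a S. \<forall>j\<in>insert a S. i \<noteq> j \<longrightarrow> \<pi>' j \<cdot>\<^bsub>C\<^esub> \<iota>' i = 0"
    using cancel orth c2 c3 by (auto simp: \<iota>'_def \<pi>'_def)
  ultimately show ?case using E(1) by blast
qed

text \<open>A direct sum has an inclusion and a projection at every integer. At the zero summands
  both are taken to be 0, which is consistent because the identity of a zero object is 0.\<close>

lemma is_direct_sum_direct_sum:
  assumes W: "\<And>i. W i \<in> Obj C" and fin: "finite {i. \<not> is_zero C (W i)}"
  shows "is_direct_sum C W (direct_sum C W)"
proof -
  let ?S = "{i. \<not> is_zero C (W i)}"
  obtain D \<iota> \<pi> where D: "D \<in> Obj C"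
    and m: "\<And>i. i\<in>?S \<Longrightarrow> \<iota> i \<in> Hom C (W i) D \<and> \<pi> i \<in> Hom C D (W i) \<and> \<pi> i \<cdot>\<^bsub>C\<^esub> \<iota> i = Ident C (W i)"
    and orth: "\<And>i j. i \<in> ?S \<Longrightarrow> j \<in> ?S \<Longrightarrow> i \<noteq> j \<Longrightarrow> \<pi> j \<cdot>\<^bsub>C\<^esub> \<iota> i = 0"
    and tot: "(\<Sum>i\<in>?S. \<iota> i \<cdot>\<^bsub>C\<^esub> \<pi> i) = Ident C D"
    using direct_sum_over_finite[where W = W, OF fin W] by blast
  define T where "T = \<lparr>sum_ob = D, inj = (\<lambda>i. if i \<in> ?S then \<iota> i else 0), prj = (\<lambda>i. if i \<in> ?S then \<pi> i else 0)\<rparr>"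
  have fields: "sum_ob T = D" "inj T i = (if i \<in> ?S then \<iota> i else 0)" "prj T i = (if i \<in> ?S then \<pi> i else 0)" for i
    by (simp_all add: T_def)
  have z: "Ident C (W i) = 0" if "i \<notin> ?S" for i
    using that is_zero_iff_ident W by auto
  have zz: "(0 :: 'm) \<cdot>\<^bsub>C\<^esub> 0 = 0"
    using comp_zero_left[OF D D D, of 0] D by simp
  have "prj T i \<cdot>\<^bsub>C\<^esub> inj T i = Ident C (W i)" for i
    using m[of i] z[of i] zz by (auto simp: fields)
  moreover have "prj T j \<cdot>\<^bsub>C\<^esub> inj T i = 0" if "i \<noteq> j" for i j
    using m[of i] m[of j] orth[of i j] that zz
      comp_zero_left[OF W[of i] D W[of j], of "\<iota> i"] comp_zero_right[OF W[of i] D W[of j], of "\<pi> j"]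
    by (auto simp: fields)
  moreover have "(\<Sum>i | \<not> is_zero C (W i). inj T i \<cdot>\<^bsub>C\<^esub> prj T i) = Ident C D"
    using tot by (simp add: fields)
  moreover have "inj T i \<in> Hom C (W i) D \<and> prj T i \<in> Hom C D (W i)" for i
    using m[of i] W D by (auto simp: fields)
  ultimately have "is_direct_sum C W T"
    unfolding is_direct_sum_def using fin D by (simp add: fields(1))
  then show ?thesis
    unfolding direct_sum_def by (rule someI)
qed

end

section \<open>Hom complexes and the homotopy category\<close>

text \<open>Filtered complexes and their columns are treated without a bound on the degrees;
  finiteness enters through the index set of the filtration.\<close>

definition cplx :: "('o, 'm::ab_group_add, 'x) cat_scheme \<Rightarrow> ('o, 'm) cochain \<Rightarrow> bool" where
  "cplx C X \<longleftrightarrow> (\<forall>i. ob X i \<in> Obj C \<and> diff X i \<in> Hom C (ob X i) (ob X (i + 1))) \<and>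
    (\<forall>i. diff X (i + 1) \<cdot>\<^bsub>C\<^esub> diff X i = 0)"

lemma bounded_complex_cplx [simp]: "bounded_complex C X \<Longrightarrow> cplx C X"
  by (simp add: bounded_complex_def cplx_def)

lemma cplx_ob [simp]: "cplx C X \<Longrightarrow> ob X i \<in> Obj C"
  by (simp add: cplx_def)

lemma cplx_diff: "cplx C X \<Longrightarrow> diff X i \<in> Hom C (ob X i) (ob X (i + 1))"
  by (simp add: cplx_def)

lemma cplx_diff_diff: "cplx C X \<Longrightarrow> diff X (i + 1) \<cdot>\<^bsub>C\<^esub> diff X i = 0"
  by (simp add: cplx_def)

lemma hom_cxD: "f \<in> hom_cx C X Y k \<Longrightarrow> f i \<in> Hom C (ob X i) (ob Y (i + k))"
  by (simp add: hom_cx_def)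

lemma hom_cocyclesD: "f \<in> hom_cocycles C X Y k \<Longrightarrow> f \<in> hom_cx C X Y k"
  by (simp add: hom_cocycles_def)

definition homotopic :: "('o, 'm::ab_group_add, 'x) cat_scheme \<Rightarrow> ('o, 'm) cochain \<Rightarrow> ('o, 'm) cochain
    \<Rightarrow> (int \<Rightarrow> 'm) \<Rightarrow> (int \<Rightarrow> 'm) \<Rightarrow> bool" where
  "homotopic C X Y f g \<longleftrightarrow> (\<lambda>i. f i - g i) \<in> hom_coboundaries C X Y 0"

context linear_category
begin

lemma valid_tmap [simp]:
  "f \<in> hom_cx C X Y k \<Longrightarrow> cplx C X \<Longrightarrow> cplx C Y \<Longrightarrow> valid C (tmap X Y k f i)"
  by (simp add: valid_def hom_cxD)

lemma diff_hom_cx [simp]: "cplx C X \<Longrightarrow> diff X \<in> hom_cx C X X 1"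
  by (simp add: hom_cx_def cplx_diff)

lemma ident_hom_cx [simp]: "cplx C X \<Longrightarrow> (\<lambda>i. Ident C (ob X i)) \<in> hom_cx C X X 0"
  by (simp add: hom_cx_def ident_closed)

context
  fixes X Y assumes X: "cplx C X" and Y: "cplx C Y"
begin

lemma hom_cx_zero [simp]: "(\<lambda>_. 0) \<in> hom_cx C X Y k"
  using X Y by (simp add: hom_cx_def)

lemma hom_cx_add: "f \<in> hom_cx C X Y k \<Longrightarrow> g \<in> hom_cx C X Y k \<Longrightarrow> (\<lambda>i. f i + g i) \<in> hom_cx C X Y k"
  using X Y by (simp add: hom_cx_def hom_add)

lemma hom_cx_sub: "f \<in> hom_cx C X Y k \<Longrightarrow> g \<in> hom_cx C X Y k \<Longrightarrow> (\<lambda>i. f i - g i) \<in> hom_cx C X Y k"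
  using X Y by (simp add: hom_cx_def hom_sub)

lemma hom_cx_ksign: "f \<in> hom_cx C X Y k \<Longrightarrow> (\<lambda>i. ksign n (f i)) \<in> hom_cx C X Y k"
  using X Y by (simp add: hom_cx_def hom_ksign)

lemma comp_diff_hom_cx:
  assumes f: "f \<in> hom_cx C X Y k"
  shows "diff Y (i + k) \<cdot>\<^bsub>C\<^esub> f i \<in> Hom C (ob X i) (ob Y (i + k + 1))"
    "f (i + 1) \<cdot>\<^bsub>C\<^esub> diff X i \<in> Hom C (ob X i) (ob Y (i + k + 1))"
proof -
  show "diff Y (i + k) \<cdot>\<^bsub>C\<^esub> f i \<in> Hom C (ob X i) (ob Y (i + k + 1))"
    by (rule comp_closed[OF _ _ _ hom_cxD[OF f] cplx_diff[OF Y]]) (simp_all add: X Y)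
  have "f (i + 1) \<in> Hom C (ob X (i + 1)) (ob Y (i + k + 1))"
    using hom_cxD[OF f, of "i + 1"] by (simp add: ac_simps)
  from comp_closed[OF _ _ _ cplx_diff[OF X] this]
  show "f (i + 1) \<cdot>\<^bsub>C\<^esub> diff X i \<in> Hom C (ob X i) (ob Y (i + k + 1))"
    by (simp_all add: X Y)
qed

lemma hom_diff_closed:
  assumes f: "f \<in> hom_cx C X Y k"
  shows "hom_diff C X Y k f \<in> hom_cx C X Y (k + 1)"
  unfolding hom_cx_def hom_diff_def
  using comp_diff_hom_cx[OF f] X Y
  by (auto intro!: hom_sub hom_ksign simp: add.assoc)

lemma hom_diff_sub:
  assumes "f \<in> hom_cx C X Y k" "g \<in> hom_cx C X Y k"
  shows "hom_diff C X Y k (\<lambda>i. f i - g i) = (\<lambda>i. hom_diff C X Y k f i - hom_diff C X Y k g i)"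
proof
  fix i
  have "diff Y (i + k) \<cdot>\<^bsub>C\<^esub> (f i - g i) = diff Y (i + k) \<cdot>\<^bsub>C\<^esub> f i - diff Y (i + k) \<cdot>\<^bsub>C\<^esub> g i"
    by (rule comp_diff_right[OF _ _ _ hom_cxD[OF assms(1)] hom_cxD[OF assms(2)] cplx_diff[OF Y]])
      (simp_all add: X Y)
  moreover have "(f (i + 1) - g (i + 1)) \<cdot>\<^bsub>C\<^esub> diff X i = f (i + 1) \<cdot>\<^bsub>C\<^esub> diff X i - g (i + 1) \<cdot>\<^bsub>C\<^esub> diff X i"
    by (rule comp_diff_left[OF _ _ _ cplx_diff[OF X] hom_cxD[OF assms(1)] hom_cxD[OF assms(2)]])
      (simp_all add: X Y)
  ultimately show "hom_diff C X Y k (\<lambda>i. f i - g i) i = hom_diff C X Y k f i - hom_diff C X Y k g i"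
    unfolding hom_diff_def by (simp add: ksign_diff)
qed

lemma hom_diff_zero [simp]: "hom_diff C X Y k (\<lambda>_. 0) = (\<lambda>_. 0)"
  using hom_diff_sub[OF hom_cx_zero hom_cx_zero, of k] by simp

lemma hom_diff_add:
  assumes "f \<in> hom_cx C X Y k" "g \<in> hom_cx C X Y k"
  shows "hom_diff C X Y k (\<lambda>i. f i + g i) = (\<lambda>i. hom_diff C X Y k f i + hom_diff C X Y k g i)"
  using hom_diff_sub[OF assms(1) hom_cx_sub[OF hom_cx_zero assms(2)]]
    hom_diff_sub[OF hom_cx_zero assms(2)] by simp

lemma hom_diff_ksign:
  assumes "f \<in> hom_cx C X Y k"
  shows "hom_diff C X Y k (\<lambda>i. ksign n (f i)) = (\<lambda>i. ksign n (hom_diff C X Y k f i))"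
  using hom_diff_sub[OF hom_cx_zero assms] by (cases "even n") (simp_all add: ksign_def)

text \<open>The squares of the two differentials vanish, and the two mixed terms cancel because the
  signs in degrees k and k + 1 are opposite.\<close>

lemma hom_diff_hom_diff:
  assumes f: "f \<in> hom_cx C X Y k"
  shows "hom_diff C X Y (k + 1) (hom_diff C X Y k f) = (\<lambda>_. 0)"
proof
  fix i
  let ?a = "diff Y (i + k)" and ?b = "diff Y (i + k + 1)" and ?c = "diff X i" and ?d = "diff X (i + 1)"
  have f1: "f (i + 1) \<in> Hom C (ob X (i + 1)) (ob Y (i + k + 1))"
    using hom_cxD[OF f, of "i + 1"] by (simp add: ac_simps)
  have f2: "f (i + 1 + 1) \<in> Hom C (ob X (i + 1 + 1)) (ob Y (i + k + 1 + 1))"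
    using hom_cxD[OF f, of "i + 1 + 1"] by (simp add: ac_simps)
  note O = cplx_ob[OF X] cplx_ob[OF Y]
  note d1 = comp_diff_hom_cx[OF f, of i]
  have d2: "f (i + 1 + 1) \<cdot>\<^bsub>C\<^esub> ?d \<in> Hom C (ob X (i + 1)) (ob Y (i + k + 1 + 1))"
      "?b \<cdot>\<^bsub>C\<^esub> f (i + 1) \<in> Hom C (ob X (i + 1)) (ob Y (i + k + 1 + 1))"
    using comp_closed[OF O(1) O(1) O(2) cplx_diff[OF X] f2]
      comp_closed[OF O(1) O(2) O(2) f1 cplx_diff[OF Y]] by simp_all
  have 1: "?b \<cdot>\<^bsub>C\<^esub> (?a \<cdot>\<^bsub>C\<^esub> f i - ksign k (f (i + 1) \<cdot>\<^bsub>C\<^esub> ?c))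
      = - ksign k (?b \<cdot>\<^bsub>C\<^esub> (f (i + 1) \<cdot>\<^bsub>C\<^esub> ?c))"
    using comp_diff_right[OF O(1) O(2) O(2) d1(1) hom_ksign[OF O(1) O(2) d1(2)] cplx_diff[OF Y], of k]
      comp_ksign_right[OF O(1) O(2) O(2) d1(2) cplx_diff[OF Y], of k]
      comp_assoc[OF O(1) O(2) O(2) O(2) hom_cxD[OF f] cplx_diff[OF Y] cplx_diff[OF Y], of i]
      comp_zero_left[OF O(1) O(2) O(2) hom_cxD[OF f, of i]]
    by (simp add: cplx_diff_diff[OF Y])
  have 2: "(?b \<cdot>\<^bsub>C\<^esub> f (i + 1) - ksign k (f (i + 1 + 1) \<cdot>\<^bsub>C\<^esub> ?d)) \<cdot>\<^bsub>C\<^esub> ?c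
      = ?b \<cdot>\<^bsub>C\<^esub> (f (i + 1) \<cdot>\<^bsub>C\<^esub> ?c)"
    using comp_diff_left[OF O(1) O(1) O(2) cplx_diff[OF X] d2(2) hom_ksign[OF O(1) O(2) d2(1)], of k]
      comp_ksign_left[OF O(1) O(1) O(2) cplx_diff[OF X] d2(1), of k]
      comp_assoc[OF O(1) O(1) O(1) O(2) cplx_diff[OF X] cplx_diff[OF X] f2]
      comp_assoc[OF O(1) O(1) O(2) O(2) cplx_diff[OF X] f1 cplx_diff[OF Y]]
      comp_zero_right[OF O(1) O(1) O(2) f2]
    by (simp add: cplx_diff_diff[OF X])
  have "hom_diff C X Y (k + 1) (hom_diff C X Y k f) i
      = ?b \<cdot>\<^bsub>C\<^esub> (?a \<cdot>\<^bsub>C\<^esub> f i - ksign k (f (i + 1) \<cdot>\<^bsub>C\<^esub> ?c))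
        - ksign (k + 1) ((?b \<cdot>\<^bsub>C\<^esub> f (i + 1) - ksign k (f (i + 1 + 1) \<cdot>\<^bsub>C\<^esub> ?d)) \<cdot>\<^bsub>C\<^esub> ?c)"
    by (simp add: hom_diff_def ac_simps)
  also have "\<dots> = 0"
    unfolding 1 2 by (simp add: ksign_def)
  finally show "hom_diff C X Y (k + 1) (hom_diff C X Y k f) i = 0" .
qed

lemma coboundaryI: "f \<in> hom_cx C X Y (k - 1) \<Longrightarrow> g = hom_diff C X Y (k - 1) f \<Longrightarrow> g \<in> hom_coboundaries C X Y k"
  by (simp add: hom_coboundaries_def)

lemma coboundary_cocycle: "f \<in> hom_coboundaries C X Y k \<Longrightarrow> f \<in> hom_cocycles C X Y k"
  using hom_diff_closed[of _ "k - 1"] hom_diff_hom_diff[of _ "k - 1"]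
  by (auto simp: hom_coboundaries_def hom_cocycles_def)

lemma coboundary_zero [simp]: "(\<lambda>_. 0) \<in> hom_coboundaries C X Y k"
  by (rule coboundaryI[OF hom_cx_zero]) simp

lemma coboundary_add:
  "f \<in> hom_coboundaries C X Y k \<Longrightarrow> g \<in> hom_coboundaries C X Y k \<Longrightarrow> (\<lambda>i. f i + g i) \<in> hom_coboundaries C X Y k"
  by (auto simp: hom_coboundaries_def hom_diff_add[symmetric] intro!: imageI hom_cx_add)

lemma coboundary_sub:
  "f \<in> hom_coboundaries C X Y k \<Longrightarrow> g \<in> hom_coboundaries C X Y k \<Longrightarrow> (\<lambda>i. f i - g i) \<in> hom_coboundaries C X Y k"
  by (auto simp: hom_coboundaries_def hom_diff_sub[symmetric] intro!: imageI hom_cx_sub)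

lemma coboundary_ksign:
  "f \<in> hom_coboundaries C X Y k \<Longrightarrow> (\<lambda>i. ksign n (f i)) \<in> hom_coboundaries C X Y k"
  by (auto simp: hom_coboundaries_def hom_diff_ksign[symmetric] intro!: imageI hom_cx_ksign)

lemma cocycle_zero [simp]: "(\<lambda>_. 0) \<in> hom_cocycles C X Y k"
  by (rule coboundary_cocycle[OF coboundary_zero])

lemma cocycle_sub:
  "f \<in> hom_cocycles C X Y k \<Longrightarrow> g \<in> hom_cocycles C X Y k \<Longrightarrow> (\<lambda>i. f i - g i) \<in> hom_cocycles C X Y k"
  by (simp add: hom_cocycles_def hom_cx_sub hom_diff_sub)

lemma homotopic_refl [simp]: "homotopic C X Y f f"
  by (simp add: homotopic_def)

lemma homotopic_sym: "homotopic C X Y f g \<Longrightarrow> homotopic C X Y g f"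
  using coboundary_sub[OF coboundary_zero, of "\<lambda>i. f i - g i"] by (simp add: homotopic_def)

lemma homotopic_trans: "homotopic C X Y f g \<Longrightarrow> homotopic C X Y g h \<Longrightarrow> homotopic C X Y f h"
  using coboundary_add[of "\<lambda>i. f i - g i" _ "\<lambda>i. g i - h i"] by (simp add: homotopic_def)

lemma homotopic_cocycle:
  assumes "homotopic C X Y f g" "f \<in> hom_cocycles C X Y 0" shows "g \<in> hom_cocycles C X Y 0"
  using cocycle_sub[OF assms(2) coboundary_cocycle[OF assms(1)[unfolded homotopic_def]]] by simp

end

context
  fixes X Y Z assumes X: "cplx C X" and Y: "cplx C Y" and Z: "cplx C Z"
begin

lemma hom_cx_comp:
  assumes f: "f \<in> hom_cx C X Y k" and g: "g \<in> hom_cx C Y Z l"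
  shows "(\<lambda>i. g (i + k) \<cdot>\<^bsub>C\<^esub> f i) \<in> hom_cx C X Z (k + l)"
  using comp_closed[OF cplx_ob[OF X] cplx_ob[OF Y] cplx_ob[OF Z] hom_cxD[OF f] hom_cxD[OF g]]
  by (simp add: hom_cx_def add.assoc)

text \<open>The Leibniz rule d(g f) = d(g) f + (-1)^l g d(f). From it follow all statements on
  composites of cocycles with cocycles or coboundaries.\<close>

lemma hom_diff_comp:
  assumes f: "f \<in> hom_cx C X Y k" and g: "g \<in> hom_cx C Y Z l"
  shows "hom_diff C X Z (k + l) (\<lambda>i. g (i + k) \<cdot>\<^bsub>C\<^esub> f i)
    = (\<lambda>i. hom_diff C Y Z l g (i + k) \<cdot>\<^bsub>C\<^esub> f i + ksign l (g (i + (k + 1)) \<cdot>\<^bsub>C\<^esub> hom_diff C X Y k f i))"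
proof
  fix i
  note O = cplx_ob[OF X] cplx_ob[OF Y] cplx_ob[OF Z]
  have f1: "f (i + 1) \<in> Hom C (ob X (i + 1)) (ob Y (i + k + 1))"
    using hom_cxD[OF f, of "i + 1"] by (simp add: ac_simps)
  have g1: "g (i + k + 1) \<in> Hom C (ob Y (i + k + 1)) (ob Z (i + k + l + 1))"
    using hom_cxD[OF g, of "i + k + 1"] by (simp add: ac_simps)
  note df = comp_diff_hom_cx[OF X Y f, of i]
  note dg = comp_diff_hom_cx[OF Y Z g, of "i + k"]
  have "(diff Z (i + k + l) \<cdot>\<^bsub>C\<^esub> g (i + k) - ksign l (g (i + k + 1) \<cdot>\<^bsub>C\<^esub> diff Y (i + k))) \<cdot>\<^bsub>C\<^esub> f i
      = diff Z (i + k + l) \<cdot>\<^bsub>C\<^esub> (g (i + k) \<cdot>\<^bsub>C\<^esub> f i)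
        - ksign l (g (i + k + 1) \<cdot>\<^bsub>C\<^esub> (diff Y (i + k) \<cdot>\<^bsub>C\<^esub> f i))"
    using comp_diff_left[OF O hom_cxD[OF f] dg(1) hom_ksign[OF O(2,3) dg(2)], of l]
      comp_ksign_left[OF O hom_cxD[OF f] dg(2), of l]
      comp_assoc[OF O O(3) hom_cxD[OF f] hom_cxD[OF g] cplx_diff[OF Z], of i]
      comp_assoc[OF O(1,2) O(2,3) hom_cxD[OF f] cplx_diff[OF Y] g1]
    by simp
  moreover have "g (i + k + 1) \<cdot>\<^bsub>C\<^esub> (diff Y (i + k) \<cdot>\<^bsub>C\<^esub> f i - ksign k (f (i + 1) \<cdot>\<^bsub>C\<^esub> diff X i))
      = g (i + k + 1) \<cdot>\<^bsub>C\<^esub> (diff Y (i + k) \<cdot>\<^bsub>C\<^esub> f i)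
        - ksign k ((g (i + k + 1) \<cdot>\<^bsub>C\<^esub> f (i + 1)) \<cdot>\<^bsub>C\<^esub> diff X i)"
    using comp_diff_right[OF O df(1) hom_ksign[OF O(1,2) df(2)] g1, of k]
      comp_ksign_right[OF O df(2) g1, of k] comp_assoc[OF O(1) O cplx_diff[OF X] f1 g1]
    by simp
  ultimately show "hom_diff C X Z (k + l) (\<lambda>i. g (i + k) \<cdot>\<^bsub>C\<^esub> f i) i
    = hom_diff C Y Z l g (i + k) \<cdot>\<^bsub>C\<^esub> f i + ksign l (g (i + (k + 1)) \<cdot>\<^bsub>C\<^esub> hom_diff C X Y k f i)"
    by (simp add: hom_diff_def ksign_diff ksign_ksign ac_simps)
qed

lemma cocycle_comp:
  assumes f: "f \<in> hom_cocycles C X Y k" and g: "g \<in> hom_cocycles C Y Z l"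
  shows "(\<lambda>i. g (i + k) \<cdot>\<^bsub>C\<^esub> f i) \<in> hom_cocycles C X Z (k + l)"
proof -
  note f' = hom_cocyclesD[OF f] and g' = hom_cocyclesD[OF g]
  \<comment> \<open>The zero is common to all Hom-sets, so an arbitrary object such as
    \<open>ob Z 0\<close> may serve as its target.\<close>
  have "0 \<cdot>\<^bsub>C\<^esub> f i = 0" for i
    by (rule comp_zero_left[where Z = "ob Z 0", OF _ _ _ hom_cxD[OF f']]) (simp_all add: X Y Z)
  moreover have "g i \<cdot>\<^bsub>C\<^esub> 0 = 0" for i
    by (rule comp_zero_right[where X = "ob X 0", OF _ _ _ hom_cxD[OF g']]) (simp_all add: X Y Z)
  ultimately show ?thesis
    using hom_cx_comp[OF f' g'] hom_diff_comp[OF f' g'] f g by (simp add: hom_cocycles_def)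
qed

lemma coboundary_comp_left:
  assumes f: "f \<in> hom_cocycles C X Y k" and g: "g \<in> hom_coboundaries C Y Z l"
  shows "(\<lambda>i. g (i + k) \<cdot>\<^bsub>C\<^esub> f i) \<in> hom_coboundaries C X Z (k + l)"
proof -
  note f' = hom_cocyclesD[OF f]
  obtain h where h: "h \<in> hom_cx C Y Z (l - 1)" "g = hom_diff C Y Z (l - 1) h"
    using g by (auto simp: hom_coboundaries_def)
  have "h i \<cdot>\<^bsub>C\<^esub> 0 = 0" for i
    by (rule comp_zero_right[where X = "ob X 0", OF _ _ _ hom_cxD[OF h(1)]]) (simp_all add: X Y Z)
  then show ?thesis
    using hom_cx_comp[OF f' h(1)] hom_diff_comp[OF f' h(1)] f h
    by (intro coboundaryI[OF X Z]) (auto simp: hom_cocycles_def add_diff_eq)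
qed

lemma coboundary_comp_right:
  assumes f: "f \<in> hom_coboundaries C X Y k" and g: "g \<in> hom_cocycles C Y Z l"
  shows "(\<lambda>i. g (i + k) \<cdot>\<^bsub>C\<^esub> f i) \<in> hom_coboundaries C X Z (k + l)"
proof -
  note g' = hom_cocyclesD[OF g]
  obtain h where h: "h \<in> hom_cx C X Y (k - 1)" "f = hom_diff C X Y (k - 1) h"
    using f by (auto simp: hom_coboundaries_def)
  have z: "0 \<cdot>\<^bsub>C\<^esub> h i = 0" for i
    by (rule comp_zero_left[where Z = "ob Z 0", OF _ _ _ hom_cxD[OF h(1)]]) (simp_all add: X Y Z)
  \<comment> \<open>If f = d(h), the Leibniz rule for g h gives g f with the sign (-1)^l, which is
    removed afterwards.\<close>
  have "(\<lambda>i. ksign l (g (i + k) \<cdot>\<^bsub>C\<^esub> f i)) \<in> hom_coboundaries C X Z (k + l)"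
    using hom_cx_comp[OF h(1) g'] hom_diff_comp[OF h(1) g'] g h z
    by (intro coboundaryI[OF X Z]) (auto simp: hom_cocycles_def algebra_simps)
  from coboundary_ksign[OF X Z this, of l] show ?thesis by simp
qed

text \<open>The difference telescopes as (g - g') f + g' (f - f').\<close>

lemma homotopic_comp:
  assumes f: "f \<in> hom_cocycles C X Y 0" and f': "homotopic C X Y f f'"
    and g: "g \<in> hom_cocycles C Y Z 0" and g': "homotopic C Y Z g g'"
  shows "homotopic C X Z (\<lambda>i. g i \<cdot>\<^bsub>C\<^esub> f i) (\<lambda>i. g' i \<cdot>\<^bsub>C\<^esub> f' i)"
proof -
  note O = cplx_ob[OF X] cplx_ob[OF Y] cplx_ob[OF Z]
  have c': "f' \<in> hom_cocycles C X Y 0" "g' \<in> hom_cocycles C Y Z 0"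
    using homotopic_cocycle f f' g g' X Y Z by blast+
  have m: "f i \<in> Hom C (ob X i) (ob Y i)" "f' i \<in> Hom C (ob X i) (ob Y i)"
     "g i \<in> Hom C (ob Y i) (ob Z i)" "g' i \<in> Hom C (ob Y i) (ob Z i)" for i
    using hom_cxD[OF hom_cocyclesD[OF f]] hom_cxD[OF hom_cocyclesD[OF g]]
      hom_cxD[OF hom_cocyclesD[OF c'(1)]] hom_cxD[OF hom_cocyclesD[OF c'(2)]] by (metis add.right_neutral)+
  have "(\<lambda>i. (g i - g' i) \<cdot>\<^bsub>C\<^esub> f i) \<in> hom_coboundaries C X Z 0"
    using coboundary_comp_left[OF f g'[unfolded homotopic_def]] by simp
  moreover have "(\<lambda>i. g' i \<cdot>\<^bsub>C\<^esub> (f i - f' i)) \<in> hom_coboundaries C X Z 0"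
    using coboundary_comp_right[OF f'[unfolded homotopic_def] c'(2)] by simp
  ultimately have "(\<lambda>i. (g i - g' i) \<cdot>\<^bsub>C\<^esub> f i + g' i \<cdot>\<^bsub>C\<^esub> (f i - f' i)) \<in> hom_coboundaries C X Z 0"
    by (rule coboundary_add[OF X Z])
  moreover have "(g i - g' i) \<cdot>\<^bsub>C\<^esub> f i + g' i \<cdot>\<^bsub>C\<^esub> (f i - f' i) = g i \<cdot>\<^bsub>C\<^esub> f i - g' i \<cdot>\<^bsub>C\<^esub> f' i" for i
    using comp_diff_left[OF O m(1) m(3,4)] comp_diff_right[OF O m(1,2) m(4)] by simp
  ultimately show ?thesis by (simp add: homotopic_def)
qed

end

lemma ident_cocycle [simp]:
  assumes X: "cplx C X" shows "(\<lambda>i. Ident C (ob X i)) \<in> hom_cocycles C X X 0"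
  using X comp_ident_right[OF _ _ cplx_diff[OF X]] comp_ident_left[OF _ _ cplx_diff[OF X]]
  by (auto simp: hom_cocycles_def hom_diff_def)

lemma cocycle_comp0:
  assumes "cplx C X" "cplx C Y" "cplx C Z" "f \<in> hom_cocycles C X Y 0" "g \<in> hom_cocycles C Y Z 0"
  shows "(\<lambda>i. g i \<cdot>\<^bsub>C\<^esub> f i) \<in> hom_cocycles C X Z 0"
  using cocycle_comp[OF assms] by simp

lemma hom_cx_0D: "f \<in> hom_cx C X Y 0 \<Longrightarrow> f i \<in> Hom C (ob X i) (ob Y i)"
  by (metis add.right_neutral hom_cxD)

lemma cocycle0_iff:
  "f \<in> hom_cocycles C X Y 0 \<longleftrightarrow> (\<forall>i. f i \<in> Hom C (ob X i) (ob Y i)) \<and>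
    (\<forall>i. diff Y i \<cdot>\<^bsub>C\<^esub> f i = f (i + 1) \<cdot>\<^bsub>C\<^esub> diff X i)"
  by (auto simp: hom_cocycles_def hom_cx_def hom_diff_def fun_eq_iff)

lemma comp0_ident:
  assumes "cplx C X" "cplx C Y" "f \<in> hom_cx C X Y 0"
  shows "(\<lambda>i. f i \<cdot>\<^bsub>C\<^esub> Ident C (ob X i)) = f" "(\<lambda>i. Ident C (ob Y i) \<cdot>\<^bsub>C\<^esub> f i) = f"
  using comp_ident_right[OF cplx_ob[OF assms(1)] cplx_ob[OF assms(2)] hom_cx_0D[OF assms(3)]]
    comp_ident_left[OF cplx_ob[OF assms(1)] cplx_ob[OF assms(2)] hom_cx_0D[OF assms(3)]] by auto

section \<open>Hom complexes without cohomology in negative degrees\<close>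

definition acyclic_below :: "('o, 'm) cochain \<Rightarrow> ('o, 'm) cochain \<Rightarrow> bool" where
  "acyclic_below X Y \<longleftrightarrow> (\<forall>k<0. hom_cocycles C X Y k \<subseteq> hom_coboundaries C X Y k)"

text \<open>It suffices that \<open>X'\<close> is a homotopy retract of \<open>X\<close>: f b is a
  coboundary, hence so is f b a, and this differs from f by f (b a - 1), again a coboundary.\<close>

lemma acyclic_below_source:
  assumes X: "cplx C X" and X': "cplx C X'" and Y: "cplx C Y"
    and b: "b \<in> hom_cocycles C X X' 0" and a: "a \<in> hom_cocycles C X' X 0"
    and ba: "homotopic C X' X' (\<lambda>i. b i \<cdot>\<^bsub>C\<^esub> a i) (\<lambda>i. Ident C (ob X' i))"
    and ac: "acyclic_below X Y"
  shows "acyclic_below X' Y"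
  unfolding acyclic_below_def
proof (intro allI impI subsetI)
  fix k :: int and f assume k: "k < 0" and f: "f \<in> hom_cocycles C X' Y k"
  note O = cplx_ob[OF X] cplx_ob[OF X'] cplx_ob[OF Y]
  have fb: "(\<lambda>i. f i \<cdot>\<^bsub>C\<^esub> b i) \<in> hom_coboundaries C X Y k"
    using cocycle_comp[OF X X' Y b f] ac k by (auto simp: acyclic_below_def)
  have "(\<lambda>i. (f i \<cdot>\<^bsub>C\<^esub> b i) \<cdot>\<^bsub>C\<^esub> a i) \<in> hom_coboundaries C X' Y k"
    using coboundary_comp_left[OF X' X Y a fb] by simp
  moreover have "(f i \<cdot>\<^bsub>C\<^esub> b i) \<cdot>\<^bsub>C\<^esub> a i = f i \<cdot>\<^bsub>C\<^esub> (b i \<cdot>\<^bsub>C\<^esub> a i)" for i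
    by (rule comp_assoc[OF O(2) O(1) O(2) O(3)])
      (use a b f in \<open>auto dest!: hom_cocyclesD intro: hom_cx_0D hom_cxD\<close>)
  ultimately have 1: "(\<lambda>i. f i \<cdot>\<^bsub>C\<^esub> (b i \<cdot>\<^bsub>C\<^esub> a i)) \<in> hom_coboundaries C X' Y k" by simp
  have 2: "(\<lambda>i. f i \<cdot>\<^bsub>C\<^esub> (b i \<cdot>\<^bsub>C\<^esub> a i - Ident C (ob X' i))) \<in> hom_coboundaries C X' Y k"
    using coboundary_comp_right[OF X' X' Y ba[unfolded homotopic_def] f] by simp
  have m: "b i \<cdot>\<^bsub>C\<^esub> a i \<in> Hom C (ob X' i) (ob X' i)" "f i \<in> Hom C (ob X' i) (ob Y (i + k))" for i
    using hom_cx_0D[OF hom_cocyclesD[OF cocycle_comp0[OF X' X X' a b]]] hom_cxD[OF hom_cocyclesD[OF f]] by auto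
  have "f i \<cdot>\<^bsub>C\<^esub> (b i \<cdot>\<^bsub>C\<^esub> a i) - f i \<cdot>\<^bsub>C\<^esub> (b i \<cdot>\<^bsub>C\<^esub> a i - Ident C (ob X' i)) = f i" for i
    using comp_diff_right[OF O(2) O(2) O(3) m(1) ident_closed[OF O(2)] m(2)] comp_ident_right[OF O(2) O(3) m(2)]
    by simp
  then show "f \<in> hom_coboundaries C X' Y k"
    using coboundary_sub[OF X' Y 1 2] by simp
qed

text \<open>Dual to \<open>acyclic_below_source\<close>: f equals (b a) f - (b a - 1) f, where a f
  is a coboundary by assumption.\<close>

lemma acyclic_below_target:
  assumes X: "cplx C X" and Y: "cplx C Y" and Y': "cplx C Y'"
    and b: "b \<in> hom_cocycles C Y Y' 0" and a: "a \<in> hom_cocycles C Y' Y 0"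
    and ba: "homotopic C Y' Y' (\<lambda>i. b i \<cdot>\<^bsub>C\<^esub> a i) (\<lambda>i. Ident C (ob Y' i))"
    and ac: "acyclic_below X Y"
  shows "acyclic_below X Y'"
  unfolding acyclic_below_def
proof (intro allI impI subsetI)
  fix k :: int and f assume k: "k < 0" and f: "f \<in> hom_cocycles C X Y' k"
  note O = cplx_ob[OF X] cplx_ob[OF Y] cplx_ob[OF Y']
  have m: "a i \<in> Hom C (ob Y' i) (ob Y i)" "b i \<in> Hom C (ob Y i) (ob Y' i)"
     "f i \<in> Hom C (ob X i) (ob Y' (i + k))" for i
    using a b f by (auto dest!: hom_cocyclesD intro: hom_cx_0D hom_cxD)
  have af: "(\<lambda>i. a (i + k) \<cdot>\<^bsub>C\<^esub> f i) \<in> hom_coboundaries C X Y k"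
    using cocycle_comp[OF X Y' Y f a] ac k by (auto simp: acyclic_below_def)
  have "(\<lambda>i. b (i + k) \<cdot>\<^bsub>C\<^esub> (a (i + k) \<cdot>\<^bsub>C\<^esub> f i)) \<in> hom_coboundaries C X Y' k"
    using coboundary_comp_right[OF X Y Y' af b] by simp
  moreover have "b (i + k) \<cdot>\<^bsub>C\<^esub> (a (i + k) \<cdot>\<^bsub>C\<^esub> f i) = (b (i + k) \<cdot>\<^bsub>C\<^esub> a (i + k)) \<cdot>\<^bsub>C\<^esub> f i" for i
    by (rule comp_assoc[OF O(1) O(3) O(2) O(3) m(3,1,2), symmetric])
  ultimately have 1: "(\<lambda>i. (b (i + k) \<cdot>\<^bsub>C\<^esub> a (i + k)) \<cdot>\<^bsub>C\<^esub> f i) \<in> hom_coboundaries C X Y' k" by simp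
  have 2: "(\<lambda>i. (b (i + k) \<cdot>\<^bsub>C\<^esub> a (i + k) - Ident C (ob Y' (i + k))) \<cdot>\<^bsub>C\<^esub> f i) \<in> hom_coboundaries C X Y' k"
    using coboundary_comp_left[OF X Y' Y' f ba[unfolded homotopic_def]] by simp
  have "(b (i + k) \<cdot>\<^bsub>C\<^esub> a (i + k)) \<cdot>\<^bsub>C\<^esub> f i - (b (i + k) \<cdot>\<^bsub>C\<^esub> a (i + k) - Ident C (ob Y' (i + k))) \<cdot>\<^bsub>C\<^esub> f i = f i" for i
    using comp_diff_left[OF O(1) O(3) O(3) m(3) comp_closed[OF O(3) O(2) O(3) m(1,2)] ident_closed[OF O(3)]]
      comp_ident_left[OF O(1) O(3) m(3)] by simp
  then show "f \<in> hom_coboundaries C X Y' k"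
    using coboundary_sub[OF X Y' 1 2] by simp
qed

text \<open>The hypothesis of the theorem speaks of sets of cohomology classes. A cocycle lies in
  its own class, and the zero class consists of the coboundaries.\<close>

lemma acyclic_belowI:
  assumes X: "cplx C X" and Y: "cplx C Y"
    and coh: "\<And>k. k < 0 \<Longrightarrow> hom_cohomology C X Y k = {hom_class C X Y k (\<lambda>_. 0)}"
  shows "acyclic_below X Y"
  unfolding acyclic_below_def
proof (intro allI impI subsetI)
  fix k :: int and f assume k: "k < 0" and f: "f \<in> hom_cocycles C X Y k"
  have "hom_class C X Y k f = hom_class C X Y k (\<lambda>_. 0)"
    using coh[OF k] f by (auto simp: hom_cohomology_def)
  moreover have "f \<in> hom_class C X Y k f"
    unfolding hom_class_def by (intro CollectI exI[of _ "\<lambda>_. 0"]) (simp add: X Y)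
  ultimately show "f \<in> hom_coboundaries C X Y k"
    by (auto simp: hom_class_def)
qed

section \<open>Morphisms of the homotopy category as homotopy classes\<close>

lemma Kb_Obj [simp]: "X \<in> Obj (Kb C) \<longleftrightarrow> bounded_complex C X"
  by (simp add: Kb_def)

lemma kclass_fields [simp]: "src (kclass C X Y f) = X" "tgt (kclass C X Y f) = Y"
  "mor (kclass C X Y f) = hom_class C X Y 0 f"
  by (simp_all add: kclass_def)

lemma kclass_in_Kb [simp]: "f \<in> hom_cocycles C X Y 0 \<Longrightarrow> kclass C X Y f \<in> Hom (Kb C) X Y"
  by (auto simp: Kb_def kclass_def hom_cohomology_def)

lemma Kb_HomE:
  assumes "u \<in> Hom (Kb C) X Y"
  obtains f where "f \<in> hom_cocycles C X Y 0" "u = kclass C X Y f"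
  using assms by (auto simp: Kb_def kclass_def hom_cohomology_def)

context
  fixes X Y assumes X: "cplx C X" and Y: "cplx C Y"
begin

lemma kclass_eq_iff: "kclass C X Y f = kclass C X Y g \<longleftrightarrow> homotopic C X Y f g"
proof
  assume "kclass C X Y f = kclass C X Y g"
  then have "hom_class C X Y 0 f = hom_class C X Y 0 g" by (simp add: kclass_def)
  moreover have "f \<in> hom_class C X Y 0 f"
    unfolding hom_class_def by (intro CollectI exI[of _ "\<lambda>_. 0"]) (simp add: X Y)
  ultimately have "f \<in> hom_class C X Y 0 g" by simp
  then show "homotopic C X Y f g" by (auto simp: hom_class_def homotopic_def)
next
  have *: "hom_class C X Y 0 f \<subseteq> hom_class C X Y 0 g" if "homotopic C X Y f g" for f g
  proof
    fix h assume "h \<in> hom_class C X Y 0 f"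
    then obtain b where b: "b \<in> hom_coboundaries C X Y 0" "h = (\<lambda>i. f i + b i)" by (auto simp: hom_class_def)
    have "(\<lambda>i. (f i - g i) + b i) \<in> hom_coboundaries C X Y 0"
      using that b(1) coboundary_add[OF X Y] by (simp add: homotopic_def)
    then show "h \<in> hom_class C X Y 0 g"
      unfolding hom_class_def by (intro CollectI exI[of _ "\<lambda>i. (f i - g i) + b i"]) (simp add: b(2))
  qed
  assume "homotopic C X Y f g"
  then show "kclass C X Y f = kclass C X Y g"
    using *[of f g] *[of g f] homotopic_sym[OF X Y] by (auto simp: kclass_def)
qed

text \<open>The choice made by \<open>krep\<close> matters only up to homotopy, so calculations in
  the homotopy category may use whatever cocycle is at hand.\<close>

lemma krep_kclass: "homotopic C X Y f (krep (kclass C X Y f))"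
proof -
  have "f \<in> mor (kclass C X Y f)"
    unfolding kclass_def hom_class_def arr.simps
    by (intro CollectI exI[of _ "\<lambda>_. 0"]) (simp add: X Y)
  then have "krep (kclass C X Y f) \<in> mor (kclass C X Y f)"
    unfolding krep_def by (rule someI[where P = "\<lambda>g. g \<in> mor (kclass C X Y f)"])
  then have "homotopic C X Y (krep (kclass C X Y f)) f"
    by (auto simp: kclass_def hom_class_def homotopic_def)
  then show ?thesis by (rule homotopic_sym[OF X Y])
qed

lemma krep_cocycle: "f \<in> hom_cocycles C X Y 0 \<Longrightarrow> krep (kclass C X Y f) \<in> hom_cocycles C X Y 0"
  by (rule homotopic_cocycle[OF X Y krep_kclass])

lemma kclass_krep: "u \<in> Hom (Kb C) X Y \<Longrightarrow> kclass C X Y (krep u) = u"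
  by (metis Kb_HomE kclass_eq_iff krep_kclass)

end

text \<open>Composition is defined through chosen representatives; compatibility of homotopies with
  composition frees it from the choice.\<close>

lemma Kb_comp:
  assumes "cplx C X" "cplx C Y" "cplx C Z" "f \<in> hom_cocycles C X Y 0" "g \<in> hom_cocycles C Y Z 0"
  shows "kclass C Y Z g \<cdot>\<^bsub>Kb C\<^esub> kclass C X Y f = kclass C X Z (\<lambda>i. g i \<cdot>\<^bsub>C\<^esub> f i)"
proof -
  have "homotopic C X Z (\<lambda>i. g i \<cdot>\<^bsub>C\<^esub> f i)
      (\<lambda>i. krep (kclass C Y Z g) i \<cdot>\<^bsub>C\<^esub> krep (kclass C X Y f) i)"
    using assms by (intro homotopic_comp[of X Y Z] krep_kclass)
  then show ?thesis
    using assms by (simp add: Kb_def kclass_eq_iff[symmetric])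
qed

lemma Kb_ident [simp]: "Ident (Kb C) X = kclass C X X (\<lambda>i. Ident C (ob X i))"
  by (simp add: Kb_def)

lemma Kb_is_isoI:
  assumes "cplx C X" "cplx C Y" "f \<in> hom_cocycles C X Y 0" "g \<in> hom_cocycles C Y X 0"
    "homotopic C X X (\<lambda>i. g i \<cdot>\<^bsub>C\<^esub> f i) (\<lambda>i. Ident C (ob X i))"
    "homotopic C Y Y (\<lambda>i. f i \<cdot>\<^bsub>C\<^esub> g i) (\<lambda>i. Ident C (ob Y i))"
  shows "is_iso (Kb C) X Y (kclass C X Y f)"
  unfolding is_iso_def using assms
  by (intro conjI bexI[of _ "kclass C Y X g"]) (simp_all add: Kb_comp kclass_eq_iff)

text \<open>The representative is pinned to \<open>krep u\<close>, so that the cocycle of a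
  half-braiding can be named once and for all, while its inverse is obtained when needed.\<close>

lemma Kb_is_isoE:
  assumes X: "cplx C X" and Y: "cplx C Y" and u: "is_iso (Kb C) X Y u"
  obtains f g where "f = krep u" "u = kclass C X Y f" "f \<in> hom_cocycles C X Y 0" "g \<in> hom_cocycles C Y X 0"
    "homotopic C X X (\<lambda>i. g i \<cdot>\<^bsub>C\<^esub> f i) (\<lambda>i. Ident C (ob X i))"
    "homotopic C Y Y (\<lambda>i. f i \<cdot>\<^bsub>C\<^esub> g i) (\<lambda>i. Ident C (ob Y i))"
proof -
  obtain v where uv: "u \<in> Hom (Kb C) X Y" "v \<in> Hom (Kb C) Y X"
      "v \<cdot>\<^bsub>Kb C\<^esub> u = Ident (Kb C) X" "u \<cdot>\<^bsub>Kb C\<^esub> v = Ident (Kb C) Y"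
    using u by (auto simp: is_iso_def)
  define f where "f = krep u"
  have f: "u = kclass C X Y f" "f \<in> hom_cocycles C X Y 0"
    using uv(1) kclass_krep[OF X Y] krep_cocycle[OF X Y] by (auto simp: f_def elim: Kb_HomE)
  from uv(2) obtain g where g: "g \<in> hom_cocycles C Y X 0" "v = kclass C Y X g" by (rule Kb_HomE)
  show ?thesis
    by (rule that[OF f_def f g(1)])
      (use uv(3,4) f g X Y in \<open>simp_all add: Kb_comp kclass_eq_iff\<close>)
qed

end

section \<open>Total tensor products\<close>

definition tinj ::
  "('o3, 'm3::ab_group_add, 'x3) cat_scheme \<Rightarrow> ('o1, 'm1, 'o2, 'm2, 'o3, 'm3) bifun
    \<Rightarrow> ('o1, 'm1) cochain \<Rightarrow> ('o2, 'm2) cochain \<Rightarrow> int \<Rightarrow> int \<Rightarrow> ('o3, 'm3) arr" where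
  "tinj D F X Y n i =
    \<lparr>src = ob X i \<star>\<^bsub>F\<^esub> ob Y (n - i), tgt = sum_ob (tot_sum D F X Y n), mor = inj (tot_sum D F X Y n) i\<rparr>"

definition tprj ::
  "('o3, 'm3::ab_group_add, 'x3) cat_scheme \<Rightarrow> ('o1, 'm1, 'o2, 'm2, 'o3, 'm3) bifun
    \<Rightarrow> ('o1, 'm1) cochain \<Rightarrow> ('o2, 'm2) cochain \<Rightarrow> int \<Rightarrow> int \<Rightarrow> ('o3, 'm3) arr" where
  "tprj D F X Y n i =
    \<lparr>src = sum_ob (tot_sum D F X Y n), tgt = ob X i \<star>\<^bsub>F\<^esub> ob Y (n - i), mor = prj (tot_sum D F X Y n) i\<rparr>"

lemma tinj_fields [simp]:
  "src (tinj D F X Y n i) = ob X i \<star>\<^bsub>F\<^esub> ob Y (n - i)"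
  "tgt (tinj D F X Y n i) = sum_ob (tot_sum D F X Y n)"
  "mor (tinj D F X Y n i) = inj (tot_sum D F X Y n) i"
  "src (tprj D F X Y n i) = sum_ob (tot_sum D F X Y n)"
  "tgt (tprj D F X Y n i) = ob X i \<star>\<^bsub>F\<^esub> ob Y (n - i)"
  "mor (tprj D F X Y n i) = prj (tot_sum D F X Y n) i"
  by (simp_all add: tinj_def tprj_def)

lemma ob_tot [simp]: "ob (tot A B D F X Y) n = sum_ob (tot_sum D F X Y n)"
  by (simp add: tot_def)

text \<open>The setting in which total tensor products are formed. It is instantiated by the product
  of \<open>A\<close> and by the two actions on \<open>M\<close>.\<close>

locale tensor_functor =
  A: additive_category A sA + B: additive_category B sB + D: additive_category D sD +
  bilinear_bifunctor A sA B sB D sD F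
  for A :: "('o1, 'm1::ab_group_add, 'x1) cat_scheme"
    and sA :: "'k::comm_ring_1 \<Rightarrow> 'm1 \<Rightarrow> 'm1"
    and B :: "('o2, 'm2::ab_group_add, 'x2) cat_scheme"
    and sB :: "'k \<Rightarrow> 'm2 \<Rightarrow> 'm2"
    and D :: "('o3, 'm3::ab_group_add, 'x3) cat_scheme"
    and sD :: "'k \<Rightarrow> 'm3 \<Rightarrow> 'm3"
    and F :: "('o1, 'm1, 'o2, 'm2, 'o3, 'm3) bifun"
begin

lemma obj_closed' [simp]: "X \<in> Obj A \<Longrightarrow> Y \<in> Obj B \<Longrightarrow> X \<star>\<^bsub>F\<^esub> Y \<in> Obj D"
  by (rule obj_closed)

lemma mor_zero_left:
  "\<lbrakk>X \<in> Obj A; X' \<in> Obj A; Y \<in> Obj B; Y' \<in> Obj B; g \<in> Hom B Y Y'\<rbrakk> \<Longrightarrow> 0 \<otimes>\<^bsub>F\<^esub> g = 0"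
  using mor_add_left[of X X' Y Y' 0 0 g] by simp

lemma mor_zero_right:
  "\<lbrakk>X \<in> Obj A; X' \<in> Obj A; Y \<in> Obj B; Y' \<in> Obj B; f \<in> Hom A X X'\<rbrakk> \<Longrightarrow> f \<otimes>\<^bsub>F\<^esub> 0 = 0"
  using mor_add_right[of X X' Y Y' f 0 0] by simp

lemma mor_minus_left:
  "\<lbrakk>X \<in> Obj A; X' \<in> Obj A; Y \<in> Obj B; Y' \<in> Obj B; f \<in> Hom A X X'; g \<in> Hom B Y Y'\<rbrakk>
    \<Longrightarrow> (- f) \<otimes>\<^bsub>F\<^esub> g = - (f \<otimes>\<^bsub>F\<^esub> g)"
  using mor_add_left[of X X' Y Y' f "- f" g]
  by (metis A.hom_minus add.right_inverse minus_unique mor_zero_left)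

lemma mor_minus_right:
  "\<lbrakk>X \<in> Obj A; X' \<in> Obj A; Y \<in> Obj B; Y' \<in> Obj B; f \<in> Hom A X X'; g \<in> Hom B Y Y'\<rbrakk>
    \<Longrightarrow> f \<otimes>\<^bsub>F\<^esub> (- g) = - (f \<otimes>\<^bsub>F\<^esub> g)"
  using mor_add_right[of X X' Y Y' f g "- g"]
  by (metis B.hom_minus add.right_inverse minus_unique mor_zero_right)

lemma valid_tten [simp]: "valid A u \<Longrightarrow> valid B v \<Longrightarrow> valid D (u \<Otimes>\<^bsub>F\<^esub> v)"
  by (simp add: valid_def mor_closed)

lemma tten_comp [simp]:
  "\<lbrakk>valid A u; valid A u'; valid B v; valid B v'; tgt u = src u'; tgt v = src v'\<rbrakk>
    \<Longrightarrow> (u' \<Otimes>\<^bsub>F\<^esub> v') \<odot>\<^bsub>D\<^esub> (u \<Otimes>\<^bsub>F\<^esub> v) = (u' \<odot>\<^bsub>A\<^esub> u) \<Otimes>\<^bsub>F\<^esub> (v' \<odot>\<^bsub>B\<^esub> v)"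
  using preserves_comp[of "src u" "tgt u" "tgt u'" "src v" "tgt v" "tgt v'" "mor u" "mor u'" "mor v" "mor v'"]
  by (intro arr_eqI) (auto simp: valid_def)

text \<open>The interchange law in right-bracketed position, as in
  \<open>tcomp_reduce\<close>.\<close>

lemma tten_comp_tail [simp]:
  "\<lbrakk>valid A u; valid A u'; valid B v; valid B v'; tgt u = src u'; tgt v = src v';
    valid D w; tgt w = src u \<star>\<^bsub>F\<^esub> src v\<rbrakk>
    \<Longrightarrow> (u' \<Otimes>\<^bsub>F\<^esub> v') \<odot>\<^bsub>D\<^esub> ((u \<Otimes>\<^bsub>F\<^esub> v) \<odot>\<^bsub>D\<^esub> w) = ((u' \<odot>\<^bsub>A\<^esub> u) \<Otimes>\<^bsub>F\<^esub> (v' \<odot>\<^bsub>B\<^esub> v)) \<odot>\<^bsub>D\<^esub> w"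
  by (rule D.tcomp_reduce) simp_all

lemma tten_tid [simp]: "X \<in> Obj A \<Longrightarrow> Y \<in> Obj B \<Longrightarrow> tid A X \<Otimes>\<^bsub>F\<^esub> tid B Y = tid D (X \<star>\<^bsub>F\<^esub> Y)"
  by (rule arr_eqI) (simp_all add: preserves_ident)

lemma tten_tsgn_left [simp]: "valid A u \<Longrightarrow> valid B v \<Longrightarrow> tsgn n u \<Otimes>\<^bsub>F\<^esub> v = tsgn n (u \<Otimes>\<^bsub>F\<^esub> v)"
  by (rule arr_eqI) (auto simp: valid_def ksign_def intro: mor_minus_left)

lemma tten_tsgn_right [simp]: "valid A u \<Longrightarrow> valid B v \<Longrightarrow> u \<Otimes>\<^bsub>F\<^esub> tsgn n v = tsgn n (u \<Otimes>\<^bsub>F\<^esub> v)"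
  by (rule arr_eqI) (auto simp: valid_def ksign_def intro: mor_minus_right)

lemma tten_tzero_left [simp]:
  "X \<in> Obj A \<Longrightarrow> X' \<in> Obj A \<Longrightarrow> valid B v \<Longrightarrow> tzero X X' \<Otimes>\<^bsub>F\<^esub> v = tzero (X \<star>\<^bsub>F\<^esub> src v) (X' \<star>\<^bsub>F\<^esub> tgt v)"
  by (rule arr_eqI) (auto simp: valid_def intro: mor_zero_left)

lemma tten_tzero_right [simp]:
  "Y \<in> Obj B \<Longrightarrow> Y' \<in> Obj B \<Longrightarrow> valid A u \<Longrightarrow> u \<Otimes>\<^bsub>F\<^esub> tzero Y Y' = tzero (src u \<star>\<^bsub>F\<^esub> Y) (tgt u \<star>\<^bsub>F\<^esub> Y')"
  by (rule arr_eqI) (auto simp: valid_def intro: mor_zero_right)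

lemma tten_tadd_left [simp]:
  "\<lbrakk>valid A u; valid A u'; valid B v; src u = src u'; tgt u = tgt u'\<rbrakk>
    \<Longrightarrow> (u \<oplus> u') \<Otimes>\<^bsub>F\<^esub> v = (u \<Otimes>\<^bsub>F\<^esub> v) \<oplus> (u' \<Otimes>\<^bsub>F\<^esub> v)"
  by (rule arr_eqI) (auto simp: valid_def intro: mor_add_left)

lemma tten_tadd_right [simp]:
  "\<lbrakk>valid A u; valid B v'; valid B v; src v = src v'; tgt v = tgt v'\<rbrakk>
    \<Longrightarrow> u \<Otimes>\<^bsub>F\<^esub> (v \<oplus> v') = (u \<Otimes>\<^bsub>F\<^esub> v) \<oplus> (u \<Otimes>\<^bsub>F\<^esub> v')"
  by (rule arr_eqI) (auto simp: valid_def intro: mor_add_right)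

text \<open>The identity of the product is a tensor product with the zero morphism.\<close>

lemma is_zero_tensor_left: "is_zero A X \<Longrightarrow> Y \<in> Obj B \<Longrightarrow> is_zero D (X \<star>\<^bsub>F\<^esub> Y)"
  using A.is_zero_iff_ident[of X] D.is_zero_iff_ident[of "X \<star>\<^bsub>F\<^esub> Y"] preserves_ident[of X Y]
    mor_zero_left[of X X Y Y] B.ident_closed[of Y]
  by (auto simp: is_zero_def)

lemma is_zero_tensor_right: "X \<in> Obj A \<Longrightarrow> is_zero B Y \<Longrightarrow> is_zero D (X \<star>\<^bsub>F\<^esub> Y)"
  using B.is_zero_iff_ident[of Y] D.is_zero_iff_ident[of "X \<star>\<^bsub>F\<^esub> Y"] preserves_ident[of X Y]
    mor_zero_right[of X X Y Y] A.ident_closed[of X]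
  by (auto simp: is_zero_def)

context
  fixes X Y assumes X [simp]: "bounded_complex A X" and Y [simp]: "bounded_complex B Y"
begin

lemma tot_finite: "finite {i. \<not> is_zero D (ob X i \<star>\<^bsub>F\<^esub> ob Y (n - i))}"
proof -
  obtain N where N: "\<And>i. \<bar>i\<bar> > N \<Longrightarrow> is_zero A (ob X i)"
    using X by (auto simp: bounded_complex_def)
  have "i \<in> {-N..N}" if "\<not> is_zero D (ob X i \<star>\<^bsub>F\<^esub> ob Y (n - i))" for i
    using that is_zero_tensor_left[OF N, of i "ob Y (n - i)"] by force
  then show ?thesis
    by (intro finite_subset[OF _ finite_atLeastAtMost_int[of "-N" N]]) auto
qed

lemma tot_direct_sum: "is_direct_sum D (\<lambda>i. ob X i \<star>\<^bsub>F\<^esub> ob Y (n - i)) (tot_sum D F X Y n)"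
  unfolding tot_sum_def by (rule D.is_direct_sum_direct_sum[OF _ tot_finite]) simp

lemma tot_ob_closed [simp]: "sum_ob (tot_sum D F X Y n) \<in> Obj D"
  using tot_direct_sum by (simp add: is_direct_sum_def)

lemma valid_tinj [simp]: "valid D (tinj D F X Y n i)"
  using tot_direct_sum by (simp add: is_direct_sum_def valid_def)

lemma valid_tprj [simp]: "valid D (tprj D F X Y n i)"
  using tot_direct_sum by (simp add: is_direct_sum_def valid_def)

lemma tprj_tinj [simp]: "tprj D F X Y n i \<odot>\<^bsub>D\<^esub> tinj D F X Y n i = tid D (ob X i \<star>\<^bsub>F\<^esub> ob Y (n - i))"
  using tot_direct_sum by (intro arr_eqI) (simp_all add: is_direct_sum_def)

lemma tprj_tinj_neq [simp]:
  "i \<noteq> j \<Longrightarrow> tprj D F X Y n j \<odot>\<^bsub>D\<^esub> tinj D F X Y n i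
    = tzero (ob X i \<star>\<^bsub>F\<^esub> ob Y (n - i)) (ob X j \<star>\<^bsub>F\<^esub> ob Y (n - j))"
  using tot_direct_sum by (intro arr_eqI) (simp_all add: is_direct_sum_def)

text \<open>Zero summands contribute 0, so any finite set that contains the nonzero ones serves.
  With the empty set the total object is seen to be zero, with a singleton it is seen to be a single
  summand.\<close>

lemma tot_sum_ident:
  assumes "finite S" "\<And>i. i \<notin> S \<Longrightarrow> is_zero D (ob X i \<star>\<^bsub>F\<^esub> ob Y (n - i))"
  shows "(\<Sum>i\<in>S. inj (tot_sum D F X Y n) i \<cdot>\<^bsub>D\<^esub> prj (tot_sum D F X Y n) i)
    = Ident D (sum_ob (tot_sum D F X Y n))"
proof -
  have "(\<Sum>i\<in>S. inj (tot_sum D F X Y n) i \<cdot>\<^bsub>D\<^esub> prj (tot_sum D F X Y n) i)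
    = (\<Sum>i | \<not> is_zero D (ob X i \<star>\<^bsub>F\<^esub> ob Y (n - i)). inj (tot_sum D F X Y n) i \<cdot>\<^bsub>D\<^esub> prj (tot_sum D F X Y n) i)"
  proof (rule sum.mono_neutral_right[OF assms(1)])
    show "{i. \<not> is_zero D (ob X i \<star>\<^bsub>F\<^esub> ob Y (n - i))} \<subseteq> S" using assms(2) by auto
    show "\<forall>i\<in>S - {i. \<not> is_zero D (ob X i \<star>\<^bsub>F\<^esub> ob Y (n - i))}.
       inj (tot_sum D F X Y n) i \<cdot>\<^bsub>D\<^esub> prj (tot_sum D F X Y n) i = 0"
    proof
      fix i assume "i \<in> S - {i. \<not> is_zero D (ob X i \<star>\<^bsub>F\<^esub> ob Y (n - i))}"
      then have "mor (tinj D F X Y n i) = 0" by (intro D.is_zero_src) auto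
      then have "tinj D F X Y n i = tzero (ob X i \<star>\<^bsub>F\<^esub> ob Y (n - i)) (sum_ob (tot_sum D F X Y n))"
        by (intro arr_eqI) simp_all
      then have "mor (tinj D F X Y n i \<odot>\<^bsub>D\<^esub> tprj D F X Y n i) = 0" by simp
      then show "inj (tot_sum D F X Y n) i \<cdot>\<^bsub>D\<^esub> prj (tot_sum D F X Y n) i = 0" by simp
    qed
  qed
  then show ?thesis using tot_direct_sum by (simp add: is_direct_sum_def)
qed

text \<open>Inclusions after projections add up to the identity, so an arrow is the sum of its
  restrictions to the summands, each composed with the projection.\<close>

lemma tot_ext:
  assumes u: "valid D u" "src u = sum_ob (tot_sum D F X Y n)" and v: "valid D v" "src v = src u" "tgt v = tgt u"
    and eq: "\<And>i. u \<odot>\<^bsub>D\<^esub> tinj D F X Y n i = v \<odot>\<^bsub>D\<^esub> tinj D F X Y n i"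
  shows "u = v"
proof -
  let ?S = "{i. \<not> is_zero D (ob X i \<star>\<^bsub>F\<^esub> ob Y (n - i))}"
  have vv: "valid D (tinj D F X Y n i \<odot>\<^bsub>D\<^esub> tprj D F X Y n i)" for i
    by simp
  have *: "mor w = (\<Sum>i\<in>?S. mor ((w \<odot>\<^bsub>D\<^esub> tinj D F X Y n i) \<odot>\<^bsub>D\<^esub> tprj D F X Y n i))"
    if w: "valid D w" "src w = sum_ob (tot_sum D F X Y n)" for w
  proof -
    have "mor w = mor w \<cdot>\<^bsub>D\<^esub> (\<Sum>i\<in>?S. inj (tot_sum D F X Y n) i \<cdot>\<^bsub>D\<^esub> prj (tot_sum D F X Y n) i)"
      using w D.comp_ident_right[of "src w" "tgt w" "mor w"] tot_finite by (subst tot_sum_ident) (auto simp: valid_def)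
    also have "\<dots> = (\<Sum>i\<in>?S. mor w \<cdot>\<^bsub>D\<^esub> (inj (tot_sum D F X Y n) i \<cdot>\<^bsub>D\<^esub> prj (tot_sum D F X Y n) i))"
      by (rule D.comp_sum_right[of "sum_ob (tot_sum D F X Y n)" "sum_ob (tot_sum D F X Y n)" "tgt w"])
        (use w vv in \<open>auto simp: valid_def\<close>)
    also have "\<dots> = (\<Sum>i\<in>?S. mor (w \<odot>\<^bsub>D\<^esub> tinj D F X Y n i \<odot>\<^bsub>D\<^esub> tprj D F X Y n i))"
      by simp
    finally show ?thesis using w by simp
  qed
  have "src v = sum_ob (tot_sum D F X Y n)" using u v by simp
  from trans[OF *[OF u, unfolded eq] *[OF v(1) this, symmetric]] have "mor u = mor v" .
  then show ?thesis using v by (intro arr_eqI) simp_all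
qed

end

context
  fixes X Y X' Y'
  assumes X [simp]: "bounded_complex A X" and Y [simp]: "bounded_complex B Y"
    and X' [simp]: "bounded_complex A X'" and Y' [simp]: "bounded_complex B Y'"
begin

lemma tot_mor_summand_closed:
  assumes f: "f \<in> hom_cx A X X' k" and g: "g \<in> hom_cx B Y Y' l"
  shows "valid D (tinj D F X' Y' (n + k + l) (i + k)
        \<odot>\<^bsub>D\<^esub> tsgn (i * l) (tmap X X' k f i \<Otimes>\<^bsub>F\<^esub> tmap Y Y' l g (n - i)) \<odot>\<^bsub>D\<^esub> tprj D F X Y n i)"
  using f g by (simp add: algebra_simps)

lemma tot_mor_closed:
  assumes f: "f \<in> hom_cx A X X' k" and g: "g \<in> hom_cx B Y Y' l"
  shows "tot_mor D F X Y X' Y' k l f g \<in> hom_cx D (tot A B D F X Y) (tot A B D F X' Y') (k + l)"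
  unfolding hom_cx_def tot_mor_def
proof (intro CollectI allI)
  fix n
  show "(\<Sum>i | \<not> is_zero D (ob X i \<star>\<^bsub>F\<^esub> ob Y (n - i)). inj (tot_sum D F X' Y' (n + k + l)) (i + k)
        \<cdot>\<^bsub>D\<^esub> ksign (i * l) (f i \<otimes>\<^bsub>F\<^esub> g (n - i)) \<cdot>\<^bsub>D\<^esub> prj (tot_sum D F X Y n) i)
     \<in> Hom D (ob (tot A B D F X Y) n) (ob (tot A B D F X' Y') (n + (k + l)))"
    by (rule D.hom_sum) (use tot_mor_summand_closed[OF f g, of n] in \<open>auto simp: valid_def add.assoc\<close>)
qed

text \<open>Orthogonality of the summands leaves only the term with index i. This rule replaces the
  defining sum in what follows.\<close>

lemma tot_mor_tinj:
  assumes f: "f \<in> hom_cx A X X' k" and g: "g \<in> hom_cx B Y Y' l"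
  shows "tmap (tot A B D F X Y) (tot A B D F X' Y') (k + l) (tot_mor D F X Y X' Y' k l f g) n \<odot>\<^bsub>D\<^esub> tinj D F X Y n i
    = tsgn (i * l) (tinj D F X' Y' (n + k + l) (i + k) \<odot>\<^bsub>D\<^esub> (tmap X X' k f i \<Otimes>\<^bsub>F\<^esub> tmap Y Y' l g (n - i)))"
    (is "?L = ?R")
proof (rule arr_eqI)
  show "src ?L = src ?R" by simp
  show "tgt ?L = tgt ?R" by (simp add: add.assoc)
  let ?S = "{i. \<not> is_zero D (ob X i \<star>\<^bsub>F\<^esub> ob Y (n - i))}"
  let ?t = "\<lambda>j. tinj D F X' Y' (n + k + l) (j + k)
        \<odot>\<^bsub>D\<^esub> tsgn (j * l) (tmap X X' k f j \<Otimes>\<^bsub>F\<^esub> tmap Y Y' l g (n - j)) \<odot>\<^bsub>D\<^esub> tprj D F X Y n j"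
  have tj: "?t j \<odot>\<^bsub>D\<^esub> tinj D F X Y n i = (if i = j then ?R else tzero (src ?R) (tgt ?R))" for j
    using f g by (auto simp: algebra_simps)
  have vR: "valid D ?R" using f g by (simp add: algebra_simps)
  have "mor ?L = (\<Sum>j\<in>?S. mor (?t j)) \<cdot>\<^bsub>D\<^esub> mor (tinj D F X Y n i)"
    by (simp add: tot_mor_def)
  also have "\<dots> = (\<Sum>j\<in>?S. mor (?t j) \<cdot>\<^bsub>D\<^esub> mor (tinj D F X Y n i))"
    by (rule D.comp_sum_left[of "ob X i \<star>\<^bsub>F\<^esub> ob Y (n - i)" "sum_ob (tot_sum D F X Y n)" "sum_ob (tot_sum D F X' Y' (n + k + l))"])
      (use tot_mor_summand_closed[OF f g, of n] valid_tinj[OF X Y, of n i] in \<open>auto simp: valid_def\<close>)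
  also have "\<dots> = (\<Sum>j\<in>?S. if i = j then mor ?R else 0)"
  proof (rule sum.cong[OF refl])
    fix j
    have "mor (?t j \<odot>\<^bsub>D\<^esub> tinj D F X Y n i) = (if i = j then mor ?R else 0)"
      unfolding tj by simp
    then show "mor (?t j) \<cdot>\<^bsub>D\<^esub> mor (tinj D F X Y n i) = (if i = j then mor ?R else 0)"
      by simp
  qed
  also have "\<dots> = mor ?R"
  proof (cases "i \<in> ?S")
    case True then show ?thesis using tot_finite[OF X Y, of n] by simp
  next
    case False
    \<comment> \<open>The defining sum skips the indices of zero summands; there the right-hand side
      starts at a zero object.\<close>
    then have "mor ?R = 0" using vR by (intro D.is_zero_src) simp_all
    then show ?thesis using False by (auto intro: sum.neutral)
  qed
  finally show "mor ?L = mor ?R" .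
qed

text \<open>Dual to \<open>tot_mor_tinj\<close>, tested on the summands of the source; f and g shift
  the index j of the source to j + k in the target.\<close>

lemma tot_mor_tprj:
  assumes f: "f \<in> hom_cx A X X' k" and g: "g \<in> hom_cx B Y Y' l"
  shows "tprj D F X' Y' (n + k + l) (j + k) \<odot>\<^bsub>D\<^esub>
      tmap (tot A B D F X Y) (tot A B D F X' Y') (k + l) (tot_mor D F X Y X' Y' k l f g) n
    = tsgn (j * l) ((tmap X X' k f j \<Otimes>\<^bsub>F\<^esub> tmap Y Y' l g (n - j)) \<odot>\<^bsub>D\<^esub> tprj D F X Y n j)"
    (is "?L = ?R")
proof (rule tot_ext[OF X Y])
  have c: "valid D (tmap (tot A B D F X Y) (tot A B D F X' Y') (k + l) (tot_mor D F X Y X' Y' k l f g) n)"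
    using tot_mor_closed[OF f g] by (auto simp: valid_def hom_cx_def)
  show "valid D ?L" using c by (simp add: add.assoc)
  show "valid D ?R" using f g by (simp add: algebra_simps)
  show "src ?L = sum_ob (tot_sum D F X Y n)" "src ?R = src ?L" "tgt ?R = tgt ?L"
    by (simp_all add: algebra_simps)
  fix i
  have "?L \<odot>\<^bsub>D\<^esub> tinj D F X Y n i = tprj D F X' Y' (n + k + l) (j + k) \<odot>\<^bsub>D\<^esub>
      (tmap (tot A B D F X Y) (tot A B D F X' Y') (k + l) (tot_mor D F X Y X' Y' k l f g) n \<odot>\<^bsub>D\<^esub> tinj D F X Y n i)"
    using c by (simp add: add.assoc)
  also have "\<dots> = ?R \<odot>\<^bsub>D\<^esub> tinj D F X Y n i"
    unfolding tot_mor_tinj[OF f g]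
    using f g D.tcomp_reduce[OF tprj_tinj[OF X' Y']] D.tcomp_reduce[OF tprj_tinj_neq[OF X' Y']]
    by (cases "i = j") (simp_all add: algebra_simps)
  finally show "?L \<odot>\<^bsub>D\<^esub> tinj D F X Y n i = ?R \<odot>\<^bsub>D\<^esub> tinj D F X Y n i" .
qed

end

end

lemma tmap_ident [simp]: "tmap X X 0 (\<lambda>i. Ident C (ob X i)) n = tid C (ob X n)"
  by (rule arr_eqI) simp_all

lemma tsgn_twice [simp]: "tsgn (2 * n) u = u" "tsgn (2 * n + m) u = tsgn m u" "tsgn (m + 2 * n) u = tsgn m u"
  by (auto intro: tsgn_even tsgn_cong)

context linear_category
begin

lemma tmap_diff_diff [simp]:
  "cplx C X \<Longrightarrow> j = i + 1 \<Longrightarrow> tmap X X 1 (diff X) j \<odot>\<^bsub>C\<^esub> tmap X X 1 (diff X) i = tzero (ob X i) (ob X (j + 1))"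
  by (rule arr_eqI) (simp_all add: cplx_diff_diff)

text \<open>Tagged arrows have a sum but no difference, so the sign -(-1)^k of the Hom complex is
  written as (-1)^(k + 1).\<close>

lemma tmap_hom_diff:
  "m = k + 1 \<Longrightarrow> tmap X Y m (hom_diff C X Y k f) i
    = (tmap Y Y 1 (diff Y) (i + k) \<odot>\<^bsub>C\<^esub> tmap X Y k f i)
      \<oplus> tsgn (k + 1) (tmap X Y k f (i + 1) \<odot>\<^bsub>C\<^esub> tmap X X 1 (diff X) i)"
  by (rule arr_eqI) (simp_all add: hom_diff_def ksign_def ac_simps)

lemma tadd_tzero_left [simp]: "src v = X \<Longrightarrow> tgt v = Y \<Longrightarrow> tzero X Y \<oplus> v = v"
  by (rule arr_eqI) simp_all

lemma tadd_tzero_right [simp]: "v \<oplus> tzero X Y = v"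
  by (rule arr_eqI) simp_all

end

section \<open>The total tensor product as a complex, and as a bifunctor up to homotopy\<close>

context tensor_functor
begin

context
  fixes X Y assumes X [simp]: "bounded_complex A X" and Y [simp]: "bounded_complex B Y"
begin

text \<open>The degrees stay in the forms \<open>1 + 0\<close> and \<open>0 + 1\<close> so that the
  rules for \<open>tot_mor\<close> match.\<close>

lemma tot_diff_split:
  "tmap (tot A B D F X Y) (tot A B D F X Y) 1 (diff (tot A B D F X Y)) n
    = tmap (tot A B D F X Y) (tot A B D F X Y) (1 + 0)
        (tot_mor D F X Y X Y 1 0 (diff X) (\<lambda>j. Ident B (ob Y j))) n
      \<oplus> tmap (tot A B D F X Y) (tot A B D F X Y) (0 + 1)
        (tot_mor D F X Y X Y 0 1 (\<lambda>i. Ident A (ob X i)) (diff Y)) n"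
  by (rule arr_eqI) (simp_all add: tot_def)

lemma valid_tot_mor:
  assumes "bounded_complex A X'" "bounded_complex B Y'" "f \<in> hom_cx A X X' k" "g \<in> hom_cx B Y Y' l"
  shows "valid D (tmap (tot A B D F X Y) (tot A B D F X' Y') (k + l) (tot_mor D F X Y X' Y' k l f g) n)"
  using tot_mor_closed[OF X Y assms] X Y assms(1,2) by (auto simp: valid_def hom_cx_def)

lemma valid_tot_diff [simp]:
  "valid D (tmap (tot A B D F X Y) (tot A B D F X Y) 1 (diff (tot A B D F X Y)) n)"
  unfolding tot_diff_split
  using valid_tot_mor[OF X Y A.diff_hom_cx B.ident_hom_cx]
    valid_tot_mor[OF X Y A.ident_hom_cx B.diff_hom_cx] by simp

lemma tot_diff_tinj:
  "tmap (tot A B D F X Y) (tot A B D F X Y) 1 (diff (tot A B D F X Y)) n \<odot>\<^bsub>D\<^esub> tinj D F X Y n i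
    = (tinj D F X Y (n + 1) (i + 1) \<odot>\<^bsub>D\<^esub> (tmap X X 1 (diff X) i \<Otimes>\<^bsub>F\<^esub> tid B (ob Y (n - i))))
      \<oplus> tsgn i (tinj D F X Y (n + 1) i \<odot>\<^bsub>D\<^esub> (tid A (ob X i) \<Otimes>\<^bsub>F\<^esub> tmap Y Y 1 (diff Y) (n - i)))"
proof -
  have c: "diff X \<in> hom_cx A X X 1" "(\<lambda>j. Ident B (ob Y j)) \<in> hom_cx B Y Y 0"
    "(\<lambda>i. Ident A (ob X i)) \<in> hom_cx A X X 0" "diff Y \<in> hom_cx B Y Y 1" by simp_all
  show ?thesis
    unfolding tot_diff_split
    using tot_mor_tinj[OF X Y X Y c(1,2), of n i] tot_mor_tinj[OF X Y X Y c(3,4), of n i]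
      valid_tot_mor[OF X Y c(1,2), of n] valid_tot_mor[OF X Y c(3,4), of n]
    by simp
qed

lemma tot_diff_tinj_tail:
  assumes "valid D w" "tgt w = ob X i \<star>\<^bsub>F\<^esub> ob Y (n - i)"
  shows "tmap (tot A B D F X Y) (tot A B D F X Y) 1 (diff (tot A B D F X Y)) n \<odot>\<^bsub>D\<^esub> (tinj D F X Y n i \<odot>\<^bsub>D\<^esub> w)
    = (tinj D F X Y (n + 1) (i + 1) \<odot>\<^bsub>D\<^esub> ((tmap X X 1 (diff X) i \<Otimes>\<^bsub>F\<^esub> tid B (ob Y (n - i))) \<odot>\<^bsub>D\<^esub> w))
      \<oplus> tsgn i (tinj D F X Y (n + 1) i \<odot>\<^bsub>D\<^esub> ((tid A (ob X i) \<Otimes>\<^bsub>F\<^esub> tmap Y Y 1 (diff Y) (n - i)) \<odot>\<^bsub>D\<^esub> w))"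
  using assms
  by (subst D.tcomp_reduce[OF tot_diff_tinj]) (simp_all add: algebra_simps)

lemma tot_diff_diff:
  "tmap (tot A B D F X Y) (tot A B D F X Y) 1 (diff (tot A B D F X Y)) (n + 1)
    \<odot>\<^bsub>D\<^esub> tmap (tot A B D F X Y) (tot A B D F X Y) 1 (diff (tot A B D F X Y)) n
    = tzero (sum_ob (tot_sum D F X Y n)) (sum_ob (tot_sum D F X Y (n + 1 + 1)))"
    (is "?d' \<odot>\<^bsub>D\<^esub> ?d = _")
proof (rule tot_ext[OF X Y])
  show "valid D (?d' \<odot>\<^bsub>D\<^esub> ?d)" by simp
  fix i
  let ?w = "tinj D F X Y (n + 1 + 1) (i + 1) \<odot>\<^bsub>D\<^esub> (tmap X X 1 (diff X) i \<Otimes>\<^bsub>F\<^esub> tmap Y Y 1 (diff Y) (n - i))"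
  have "(?d' \<odot>\<^bsub>D\<^esub> ?d) \<odot>\<^bsub>D\<^esub> tinj D F X Y n i = ?d' \<odot>\<^bsub>D\<^esub> (?d \<odot>\<^bsub>D\<^esub> tinj D F X Y n i)" by simp
  \<comment> \<open>The squares of the differentials vanish. The mixed term arises twice: the
    differential of \<open>Y\<close> acts in X-degree i + 1 or i, according to whether that of
    \<open>X\<close> has acted before.\<close>
  also have "\<dots> = tsgn (i + 1) ?w \<oplus> tsgn i ?w"
    unfolding tot_diff_tinj by (simp add: tot_diff_tinj_tail algebra_simps)
  also have "\<dots> = tzero (sum_ob (tot_sum D F X Y n)) (sum_ob (tot_sum D F X Y (n + 1 + 1))) \<odot>\<^bsub>D\<^esub> tinj D F X Y n i"
    by (rule arr_eqI) (simp_all add: ksign_def)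
  finally show "(?d' \<odot>\<^bsub>D\<^esub> ?d) \<odot>\<^bsub>D\<^esub> tinj D F X Y n i = \<dots>" .
qed simp_all

lemma tot_bounded [simp]: "bounded_complex D (tot A B D F X Y)"
  unfolding bounded_complex_def
proof (intro conjI allI)
  let ?T = "tot A B D F X Y"
  fix n
  show "ob ?T n \<in> Obj D" by simp
  show "diff ?T n \<in> Hom D (ob ?T n) (ob ?T (n + 1))"
    using valid_tot_diff[of n] by (simp add: valid_def)
  show "diff ?T (n + 1) \<cdot>\<^bsub>D\<^esub> diff ?T n = 0"
    using arg_cong[where f = mor, OF tot_diff_diff[of n]] by simp
  obtain N N' where N: "\<And>i. \<bar>i\<bar> > N \<Longrightarrow> is_zero A (ob X i)" and N': "\<And>i. \<bar>i\<bar> > N' \<Longrightarrow> is_zero B (ob Y i)"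
    using X Y unfolding bounded_complex_def by blast
  \<comment> \<open>When n exceeds the sum of the two bounds in absolute value, i or n - i leaves
    its own bound, so every summand is zero.\<close>
  have "is_zero D (ob ?T n)" if n: "\<bar>n\<bar> > \<bar>N\<bar> + \<bar>N'\<bar>" for n
  proof -
    have "is_zero D (ob X i \<star>\<^bsub>F\<^esub> ob Y (n - i))" for i
    proof (cases "\<bar>i\<bar> > N")
      case True
      then show ?thesis using is_zero_tensor_left[OF N] by simp
    next
      case False
      then have "\<bar>n - i\<bar> > N'" using n by linarith
      then show ?thesis using is_zero_tensor_right[OF _ N'] by simp
    qed
    then have "Ident D (sum_ob (tot_sum D F X Y n)) = 0"
      using tot_sum_ident[OF X Y, of "{}" n] by simp
    then show ?thesis using D.is_zero_iff_ident by simp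
  qed
  then show "\<exists>N. \<forall>i. N < \<bar>i\<bar> \<longrightarrow> is_zero D (ob ?T i)" by blast
qed

end

lemma tot_hom_cx_eqI:
  assumes "bounded_complex A X" "bounded_complex B Y" "cplx D W"
    and h: "h \<in> hom_cx D (tot A B D F X Y) W m" and h': "h' \<in> hom_cx D (tot A B D F X Y) W m"
    and eq: "\<And>n i. tmap (tot A B D F X Y) W m h n \<odot>\<^bsub>D\<^esub> tinj D F X Y n i
      = tmap (tot A B D F X Y) W m h' n \<odot>\<^bsub>D\<^esub> tinj D F X Y n i"
  shows "h = h'"
proof
  fix n
  have "tmap (tot A B D F X Y) W m h n = tmap (tot A B D F X Y) W m h' n"
    using assms by (intro tot_ext[OF assms(1,2) _ _ _ _ _ eq]) simp_all
  from arg_cong[where f = mor, OF this] show "h n = h' n" by simp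
qed

context
  fixes X Y X' Y'
  assumes X [simp]: "bounded_complex A X" and Y [simp]: "bounded_complex B Y"
    and X' [simp]: "bounded_complex A X'" and Y' [simp]: "bounded_complex B Y'"
begin

lemma tot_mor_closed' [simp]:
  "\<lbrakk>f \<in> hom_cx A X X' k; g \<in> hom_cx B Y Y' l; m = k + l\<rbrakk>
    \<Longrightarrow> tot_mor D F X Y X' Y' k l f g \<in> hom_cx D (tot A B D F X Y) (tot A B D F X' Y') m"
  using tot_mor_closed[OF X Y X' Y'] by simp

lemma tot_mor_tinj' [simp]:
  assumes f: "f \<in> hom_cx A X X' k" and g: "g \<in> hom_cx B Y Y' l" and m: "m = k + l"
  shows "tmap (tot A B D F X Y) (tot A B D F X' Y') m (tot_mor D F X Y X' Y' k l f g) n \<odot>\<^bsub>D\<^esub> tinj D F X Y n i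
    = tsgn (i * l) (tinj D F X' Y' (n + k + l) (i + k) \<odot>\<^bsub>D\<^esub> (tmap X X' k f i \<Otimes>\<^bsub>F\<^esub> tmap Y Y' l g (n - i)))"
  unfolding m by (rule tot_mor_tinj[OF X Y X' Y' f g])

lemma tot_mor_tinj_tail [simp]:
  assumes f: "f \<in> hom_cx A X X' k" and g: "g \<in> hom_cx B Y Y' l" and m: "m = k + l"
    and w: "valid D w" "tgt w = ob X i \<star>\<^bsub>F\<^esub> ob Y (n - i)"
  shows "tmap (tot A B D F X Y) (tot A B D F X' Y') m (tot_mor D F X Y X' Y' k l f g) n \<odot>\<^bsub>D\<^esub> (tinj D F X Y n i \<odot>\<^bsub>D\<^esub> w)
    = tsgn (i * l) (tinj D F X' Y' (n + k + l) (i + k) \<odot>\<^bsub>D\<^esub> ((tmap X X' k f i \<Otimes>\<^bsub>F\<^esub> tmap Y Y' l g (n - i)) \<odot>\<^bsub>D\<^esub> w))"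
  using assms by (subst D.tcomp_reduce[OF tot_mor_tinj'[OF f g m]]) (simp_all add: algebra_simps)

lemma tot_mor_add_left:
  assumes f: "f \<in> hom_cx A X X' k" and f': "f' \<in> hom_cx A X X' k" and g: "g \<in> hom_cx B Y Y' l"
  shows "tot_mor D F X Y X' Y' k l (\<lambda>i. f i + f' i) g
    = (\<lambda>i. tot_mor D F X Y X' Y' k l f g i + tot_mor D F X Y X' Y' k l f' g i)"
proof (rule tot_hom_cx_eqI[OF X Y, where m = "k + l" and W = "tot A B D F X' Y'"])
  fix n i
  have t: "tmap X X' k (\<lambda>i. f i + f' i) i = tmap X X' k f i \<oplus> tmap X X' k f' i" for i
    by (rule arr_eqI) simp_all
  have t': "tmap (tot A B D F X Y) (tot A B D F X' Y') m (\<lambda>i. u i + v i) n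
    = tmap (tot A B D F X Y) (tot A B D F X' Y') m u n \<oplus> tmap (tot A B D F X Y) (tot A B D F X' Y') m v n" for u v m n
    by (rule arr_eqI) simp_all
  show "tmap (tot A B D F X Y) (tot A B D F X' Y') (k + l) (tot_mor D F X Y X' Y' k l (\<lambda>i. f i + f' i) g) n \<odot>\<^bsub>D\<^esub> tinj D F X Y n i
    = tmap (tot A B D F X Y) (tot A B D F X' Y') (k + l)
      (\<lambda>i. tot_mor D F X Y X' Y' k l f g i + tot_mor D F X Y X' Y' k l f' g i) n \<odot>\<^bsub>D\<^esub> tinj D F X Y n i"
    using f f' g A.hom_cx_add[OF _ _ f f'] by (simp add: t t' algebra_simps)
qed (use f f' g A.hom_cx_add[OF _ _ f f'] in \<open>auto intro!: D.hom_cx_add\<close>)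

lemma tot_mor_add_right:
  assumes f: "f \<in> hom_cx A X X' k" and g: "g \<in> hom_cx B Y Y' l" and g': "g' \<in> hom_cx B Y Y' l"
  shows "tot_mor D F X Y X' Y' k l f (\<lambda>i. g i + g' i)
    = (\<lambda>i. tot_mor D F X Y X' Y' k l f g i + tot_mor D F X Y X' Y' k l f g' i)"
proof (rule tot_hom_cx_eqI[OF X Y, where m = "k + l" and W = "tot A B D F X' Y'"])
  fix n i
  have t: "tmap Y Y' l (\<lambda>i. g i + g' i) i = tmap Y Y' l g i \<oplus> tmap Y Y' l g' i" for i
    by (rule arr_eqI) simp_all
  have t': "tmap (tot A B D F X Y) (tot A B D F X' Y') m (\<lambda>i. u i + v i) n
    = tmap (tot A B D F X Y) (tot A B D F X' Y') m u n \<oplus> tmap (tot A B D F X Y) (tot A B D F X' Y') m v n" for u v m n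
    by (rule arr_eqI) simp_all
  show "tmap (tot A B D F X Y) (tot A B D F X' Y') (k + l) (tot_mor D F X Y X' Y' k l f (\<lambda>i. g i + g' i)) n \<odot>\<^bsub>D\<^esub> tinj D F X Y n i
    = tmap (tot A B D F X Y) (tot A B D F X' Y') (k + l)
      (\<lambda>i. tot_mor D F X Y X' Y' k l f g i + tot_mor D F X Y X' Y' k l f g' i) n \<odot>\<^bsub>D\<^esub> tinj D F X Y n i"
    using f g g' B.hom_cx_add[OF _ _ g g'] by (simp add: t t' algebra_simps)
qed (use f g g' B.hom_cx_add[OF _ _ g g'] in \<open>auto intro!: D.hom_cx_add\<close>)

lemma tot_mor_zero_left:
  assumes g: "g \<in> hom_cx B Y Y' l" shows "tot_mor D F X Y X' Y' k l (\<lambda>_. 0) g = (\<lambda>_. 0)"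
proof
  fix n
  show "tot_mor D F X Y X' Y' k l (\<lambda>_. 0) g n = 0"
    using fun_cong[OF tot_mor_add_left[OF A.hom_cx_zero A.hom_cx_zero g, of k], of n] by simp
qed

lemma tot_mor_zero_right:
  assumes f: "f \<in> hom_cx A X X' k" shows "tot_mor D F X Y X' Y' k l f (\<lambda>_. 0) = (\<lambda>_. 0)"
proof
  fix n
  show "tot_mor D F X Y X' Y' k l f (\<lambda>_. 0) n = 0"
    using fun_cong[OF tot_mor_add_right[OF f B.hom_cx_zero B.hom_cx_zero, of l], of n] by simp
qed

text \<open>The Leibniz rule d(f \<star> g) = d(f) \<star> g + (-1)^k f \<star> d(g) for homogeneous
  families combined with the Koszul sign.\<close>

lemma hom_diff_tot_mor:
  assumes f: "f \<in> hom_cx A X X' k" and g: "g \<in> hom_cx B Y Y' l"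
  shows "hom_diff D (tot A B D F X Y) (tot A B D F X' Y') (k + l) (tot_mor D F X Y X' Y' k l f g)
    = (\<lambda>i. tot_mor D F X Y X' Y' (k + 1) l (hom_diff A X X' k f) g i
        + ksign k (tot_mor D F X Y X' Y' k (l + 1) f (hom_diff B Y Y' l g) i))"
    (is "?L = ?R")
proof (rule tot_hom_cx_eqI[OF X Y, where m = "k + l + 1" and W = "tot A B D F X' Y'"])
  let ?T = "tot A B D F X Y" and ?T' = "tot A B D F X' Y'"
  have df: "hom_diff A X X' k f \<in> hom_cx A X X' (k + 1)" using f by (intro A.hom_diff_closed) simp_all
  have dg: "hom_diff B Y Y' l g \<in> hom_cx B Y Y' (l + 1)" using g by (intro B.hom_diff_closed) simp_all
  have c: "tot_mor D F X Y X' Y' k l f g \<in> hom_cx D ?T ?T' (k + l)" using f g by simp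
  show "?L \<in> hom_cx D ?T ?T' (k + l + 1)"
    using c by (intro D.hom_diff_closed) simp_all
  show "?R \<in> hom_cx D ?T ?T' (k + l + 1)"
    using f g df dg by (intro D.hom_cx_add D.hom_cx_ksign) (auto simp: ac_simps)
  show "cplx D ?T'" by simp
  fix n i
  have tR: "tmap ?T ?T' m ?R n = tmap ?T ?T' m (tot_mor D F X Y X' Y' (k + 1) l (hom_diff A X X' k f) g) n
      \<oplus> tsgn k (tmap ?T ?T' m (tot_mor D F X Y X' Y' k (l + 1) f (hom_diff B Y Y' l g)) n)" for m
    by (rule arr_eqI) simp_all
  let ?j = "tinj D F X' Y' (n + k + l + 1)"
  let ?a = "?j (i + k + 1) \<odot>\<^bsub>D\<^esub> ((tmap X' X' 1 (diff X') (i + k) \<odot>\<^bsub>A\<^esub> tmap X X' k f i) \<Otimes>\<^bsub>F\<^esub> tmap Y Y' l g (n - i))"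
  let ?b = "?j (i + k + 1) \<odot>\<^bsub>D\<^esub> ((tmap X X' k f (i + 1) \<odot>\<^bsub>A\<^esub> tmap X X 1 (diff X) i) \<Otimes>\<^bsub>F\<^esub> tmap Y Y' l g (n - i))"
  let ?c = "?j (i + k) \<odot>\<^bsub>D\<^esub> (tmap X X' k f i \<Otimes>\<^bsub>F\<^esub> (tmap Y' Y' 1 (diff Y') (n - i + l) \<odot>\<^bsub>B\<^esub> tmap Y Y' l g (n - i)))"
  let ?e = "?j (i + k) \<odot>\<^bsub>D\<^esub> (tmap X X' k f i \<Otimes>\<^bsub>F\<^esub> (tmap Y Y' l g (n - i + 1) \<odot>\<^bsub>B\<^esub> tmap Y Y 1 (diff Y) (n - i)))"
  have L: "tmap ?T ?T' (k + l + 1) ?L n \<odot>\<^bsub>D\<^esub> tinj D F X Y n i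
    = tsgn (i * l) (?a \<oplus> tsgn (i + k) ?c)
      \<oplus> tsgn (k + l + 1) (tsgn ((i + 1) * l) ?b \<oplus> tsgn (i + i * l) ?e)"
    unfolding D.tmap_hom_diff[OF refl]
    using f g c by (simp add: tot_diff_tinj tot_diff_tinj_tail algebra_simps)
  have R: "tmap ?T ?T' (k + l + 1) ?R n \<odot>\<^bsub>D\<^esub> tinj D F X Y n i
    = tsgn (i * l) (?a \<oplus> tsgn (k + 1) ?b) \<oplus> tsgn (k + i * (l + 1)) (?c \<oplus> tsgn (l + 1) ?e)"
    unfolding tR
    using f g df dg by (simp add: A.tmap_hom_diff B.tmap_hom_diff algebra_simps)
  \<comment> \<open>Both sides consist of the same four terms on each summand; only the parities of
    exponents in i, k and l remain to be compared.\<close>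
  show "tmap ?T ?T' (k + l + 1) ?L n \<odot>\<^bsub>D\<^esub> tinj D F X Y n i = tmap ?T ?T' (k + l + 1) ?R n \<odot>\<^bsub>D\<^esub> tinj D F X Y n i"
    unfolding L R
    by (rule arr_eqI) (cases "even i"; cases "even k"; cases "even l"; simp add: ksign_def add.commute)+
qed

lemma tot_mor_cocycle:
  assumes f: "f \<in> hom_cocycles A X X' 0" and g: "g \<in> hom_cocycles B Y Y' 0"
  shows "tot_mor D F X Y X' Y' 0 0 f g \<in> hom_cocycles D (tot A B D F X Y) (tot A B D F X' Y') 0"
proof -
  note f' = hom_cocyclesD[OF f] and g' = hom_cocyclesD[OF g]
  show ?thesis
    using hom_diff_tot_mor[OF f' g'] tot_mor_closed'[OF f' g'] f g tot_mor_zero_left[OF g'] tot_mor_zero_right[OF f'] by (simp add: hom_cocycles_def)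
qed

text \<open>If f' - f = d(h) and g' - g = d(h'), then f' \<star> g' - f \<star> g is the coboundary
  of h \<star> g' + f \<star> h', by the Leibniz rule.\<close>

lemma tot_mor_homotopic:
  assumes f: "f \<in> hom_cocycles A X X' 0" and g: "g \<in> hom_cocycles B Y Y' 0"
    and ff': "homotopic A X X' f' f" and gg': "homotopic B Y Y' g' g"
  shows "homotopic D (tot A B D F X Y) (tot A B D F X' Y')
    (tot_mor D F X Y X' Y' 0 0 f' g') (tot_mor D F X Y X' Y' 0 0 f g)"
proof -
  let ?T = "tot A B D F X Y" and ?T' = "tot A B D F X' Y'"
  obtain h where h: "h \<in> hom_cx A X X' (-1)" "(\<lambda>i. f' i - f i) = hom_diff A X X' (-1) h"
    using ff' by (auto simp: homotopic_def hom_coboundaries_def)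
  obtain h' where h': "h' \<in> hom_cx B Y Y' (-1)" "(\<lambda>i. g' i - g i) = hom_diff B Y Y' (-1) h'"
    using gg' by (auto simp: homotopic_def hom_coboundaries_def)
  have f': "f' \<in> hom_cocycles A X X' 0" and g': "g' \<in> hom_cocycles B Y Y' 0"
    using A.homotopic_cocycle[OF _ _ A.homotopic_sym[OF _ _ ff'] f] B.homotopic_cocycle[OF _ _ B.homotopic_sym[OF _ _ gg'] g]
    by simp_all
  note fc = hom_cocyclesD[OF f] and gc = hom_cocyclesD[OF g] and gc' = hom_cocyclesD[OF g']
  have dh: "hom_diff A X X' (-1) h \<in> hom_cx A X X' 0" using A.hom_diff_closed[OF _ _ h(1)] by simp
  have dh': "hom_diff B Y Y' (-1) h' \<in> hom_cx B Y Y' 0" using B.hom_diff_closed[OF _ _ h'(1)] by simp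
  have ff: "(\<lambda>i. f i + hom_diff A X X' (-1) h i) = f'" and gg: "(\<lambda>i. g i + hom_diff B Y Y' (-1) h' i) = g'"
    unfolding h(2)[symmetric] h'(2)[symmetric] by simp_all
  have 1: "tot_mor D F X Y X' Y' 0 0 f' g' i = tot_mor D F X Y X' Y' 0 0 f g' i
      + tot_mor D F X Y X' Y' 0 0 (hom_diff A X X' (-1) h) g' i" for i
    using fun_cong[OF tot_mor_add_left[OF fc dh gc'], of i] unfolding ff .
  have 2: "tot_mor D F X Y X' Y' 0 0 f g' i = tot_mor D F X Y X' Y' 0 0 f g i
      + tot_mor D F X Y X' Y' 0 0 f (hom_diff B Y Y' (-1) h') i" for i
    using fun_cong[OF tot_mor_add_right[OF fc gc dh'], of i] unfolding gg .
  have zg: "hom_diff B Y Y' 0 g' = (\<lambda>_. 0)" and zf: "hom_diff A X X' 0 f = (\<lambda>_. 0)"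
    using g' f by (simp_all add: hom_cocycles_def)
  have "hom_diff D ?T ?T' (0 - 1) (tot_mor D F X Y X' Y' (-1) 0 h g') = tot_mor D F X Y X' Y' 0 0 (hom_diff A X X' (-1) h) g'"
    using hom_diff_tot_mor[OF h(1) gc'] unfolding zg tot_mor_zero_right[OF h(1)] by simp
  then have 3: "tot_mor D F X Y X' Y' 0 0 (hom_diff A X X' (-1) h) g' \<in> hom_coboundaries D ?T ?T' 0"
    using tot_mor_closed'[OF h(1) gc', of "0 - 1"] by (intro D.coboundaryI[OF _ _ _ sym]) simp_all
  have "hom_diff D ?T ?T' (0 - 1) (tot_mor D F X Y X' Y' 0 (-1) f h') = tot_mor D F X Y X' Y' 0 0 f (hom_diff B Y Y' (-1) h')"
    using hom_diff_tot_mor[OF fc h'(1)] unfolding zf tot_mor_zero_left[OF h'(1)] by simp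
  then have 4: "tot_mor D F X Y X' Y' 0 0 f (hom_diff B Y Y' (-1) h') \<in> hom_coboundaries D ?T ?T' 0"
    using tot_mor_closed'[OF fc h'(1), of "0 - 1"] by (intro D.coboundaryI[OF _ _ _ sym]) simp_all
  have "(\<lambda>i. tot_mor D F X Y X' Y' 0 0 f' g' i - tot_mor D F X Y X' Y' 0 0 f g i)
    = (\<lambda>i. tot_mor D F X Y X' Y' 0 0 f (hom_diff B Y Y' (-1) h') i
        + tot_mor D F X Y X' Y' 0 0 (hom_diff A X X' (-1) h) g' i)"
    by (rule ext) (simp only: 1 2, simp)
  with D.coboundary_add[OF _ _ 4 3] show ?thesis
    by (simp add: homotopic_def)
qed

lemma Kb_bifun_MorT [simp]:
  assumes f: "f \<in> hom_cocycles A X X' 0" and g: "g \<in> hom_cocycles B Y Y' 0"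
  shows "MorT (Kb_bifun A B D F) (kclass A X X' f) (kclass B Y Y' g)
    = kclass D (tot A B D F X Y) (tot A B D F X' Y') (tot_mor D F X Y X' Y' 0 0 f g)"
proof -
  have "homotopic D (tot A B D F X Y) (tot A B D F X' Y')
    (tot_mor D F X Y X' Y' 0 0 (krep (kclass A X X' f)) (krep (kclass B Y Y' g))) (tot_mor D F X Y X' Y' 0 0 f g)"
    by (rule tot_mor_homotopic[OF f g A.homotopic_sym[OF _ _ A.krep_kclass] B.homotopic_sym[OF _ _ B.krep_kclass]])
      simp_all
  then show ?thesis by (simp add: Kb_bifun_def D.kclass_eq_iff)
qed

end

lemma Kb_bifun_ObT [simp]: "ObT (Kb_bifun A B D F) = tot A B D F"
  by (simp add: Kb_bifun_def)

end

section \<open>Filtered complexes\<close>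

text \<open>
  The columns \<open>c a\<close> are complexes placed in degree \<open>g a\<close>. With the sign \<open>(-1)\<^sup>g\<^sup>a\<close> on the diagonal,
  a component \<open>c a \<rightarrow> c b\<close> of a cocycle of degree \<open>m\<close> that raises the filtration as little as possible
  is a cocycle of degree \<open>m + g a - g b\<close> without further signs.
\<close>

definition filtered ::
  "('o, 'm::ab_group_add, 'x) cat_scheme \<Rightarrow> ('o, 'm) cochain \<Rightarrow> 'a set \<Rightarrow> ('a \<Rightarrow> int)
    \<Rightarrow> ('a \<Rightarrow> ('o, 'm) cochain) \<Rightarrow> ('a \<Rightarrow> int \<Rightarrow> ('o, 'm) arr) \<Rightarrow> ('a \<Rightarrow> int \<Rightarrow> ('o, 'm) arr) \<Rightarrow> bool" where
  "filtered C P I g c \<iota> \<pi> \<longleftrightarrow>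
    cplx C P \<and> finite I \<and>
    (\<forall>a\<in>I. cplx C (c a)) \<and>
    (\<forall>a\<in>I. \<forall>n. valid C (\<iota> a n) \<and> src (\<iota> a n) = ob (c a) (n - g a) \<and> tgt (\<iota> a n) = ob P n) \<and>
    (\<forall>a\<in>I. \<forall>n. valid C (\<pi> a n) \<and> src (\<pi> a n) = ob P n \<and> tgt (\<pi> a n) = ob (c a) (n - g a)) \<and>
    (\<forall>a\<in>I. \<forall>b\<in>I. \<forall>n. mor (\<pi> b n \<odot>\<^bsub>C\<^esub> \<iota> a n) = (if a = b then Ident C (ob (c a) (n - g a)) else 0)) \<and>
    (\<forall>n. (\<Sum>a\<in>I. mor (\<iota> a n \<odot>\<^bsub>C\<^esub> \<pi> a n)) = Ident C (ob P n)) \<and>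
    (\<forall>a\<in>I. \<forall>n. mor (\<pi> a (n + 1) \<odot>\<^bsub>C\<^esub> tmap P P 1 (diff P) n \<odot>\<^bsub>C\<^esub> \<iota> a n) = ksign (g a) (diff (c a) (n - g a))) \<and>
    (\<forall>a\<in>I. \<forall>b\<in>I. \<forall>n. a \<noteq> b \<longrightarrow> g b \<le> g a \<longrightarrow>
      mor (\<pi> b (n + 1) \<odot>\<^bsub>C\<^esub> tmap P P 1 (diff P) n \<odot>\<^bsub>C\<^esub> \<iota> a n) = 0)"

context linear_category
begin

lemma valid_comp_zero: "valid C v \<Longrightarrow> mor v \<cdot>\<^bsub>C\<^esub> 0 = 0" "valid C v \<Longrightarrow> 0 \<cdot>\<^bsub>C\<^esub> mor v = 0"
  by (auto simp: valid_def intro: comp_zero_right comp_zero_left)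

context
  fixes P I g c \<iota> \<pi> assumes F: "filtered C P I g c \<iota> \<pi>"
begin

lemma filtered_cplx: "cplx C P" "a \<in> I \<Longrightarrow> cplx C (c a)"
  and filtered_finite: "finite I"
  and filtered_inj: "a \<in> I \<Longrightarrow> valid C (\<iota> a n)" "a \<in> I \<Longrightarrow> src (\<iota> a n) = ob (c a) (n - g a)"
    "a \<in> I \<Longrightarrow> tgt (\<iota> a n) = ob P n"
  and filtered_prj: "a \<in> I \<Longrightarrow> valid C (\<pi> a n)" "a \<in> I \<Longrightarrow> src (\<pi> a n) = ob P n"
    "a \<in> I \<Longrightarrow> tgt (\<pi> a n) = ob (c a) (n - g a)"
  and filtered_sum: "(\<Sum>a\<in>I. mor (\<iota> a n \<odot>\<^bsub>C\<^esub> \<pi> a n)) = Ident C (ob P n)"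
  and filtered_diag: "a \<in> I \<Longrightarrow>
    mor (\<pi> a (n + 1) \<odot>\<^bsub>C\<^esub> tmap P P 1 (diff P) n \<odot>\<^bsub>C\<^esub> \<iota> a n) = ksign (g a) (diff (c a) (n - g a))"
  and filtered_off: "\<lbrakk>a \<in> I; b \<in> I; a \<noteq> b; g b \<le> g a\<rbrakk> \<Longrightarrow>
    mor (\<pi> b (n + 1) \<odot>\<^bsub>C\<^esub> tmap P P 1 (diff P) n \<odot>\<^bsub>C\<^esub> \<iota> a n) = 0"
  using F by (simp_all add: filtered_def)

lemma filtered_prj_inj:
  "a \<in> I \<Longrightarrow> \<pi> a n \<odot>\<^bsub>C\<^esub> \<iota> a n = tid C (ob (c a) (n - g a))"
  "\<lbrakk>a \<in> I; b \<in> I; a \<noteq> b\<rbrakk> \<Longrightarrow> \<pi> b n \<odot>\<^bsub>C\<^esub> \<iota> a n = tzero (ob (c a) (n - g a)) (ob (c b) (n - g b))"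
  using F by (auto simp: filtered_def intro!: arr_eqI)

text \<open>The identity of \<open>P\<close> in degree n, as the sum of inclusion after projection
  over all columns, is inserted between u and v.\<close>

lemma filtered_insert:
  assumes u: "valid C u" "tgt u = ob P n" and v: "valid C v" "src v = ob P n"
  shows "mor (v \<odot>\<^bsub>C\<^esub> u) = (\<Sum>a\<in>I. mor ((v \<odot>\<^bsub>C\<^esub> \<iota> a n) \<odot>\<^bsub>C\<^esub> (\<pi> a n \<odot>\<^bsub>C\<^esub> u)))"
proof -
  have v1: "valid C (\<iota> a n \<odot>\<^bsub>C\<^esub> \<pi> a n)" "src (\<iota> a n \<odot>\<^bsub>C\<^esub> \<pi> a n) = ob P n" "tgt (\<iota> a n \<odot>\<^bsub>C\<^esub> \<pi> a n) = ob P n"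
    if "a \<in> I" for a
    using that by (simp_all add: filtered_inj filtered_prj)
  have O: "src u \<in> Obj C" "tgt v \<in> Obj C" "ob P n \<in> Obj C"
    using u v filtered_cplx by (auto simp: valid_def)
  have h: "mor (\<iota> a n \<odot>\<^bsub>C\<^esub> \<pi> a n) \<in> Hom C (ob P n) (ob P n)" if "a \<in> I" for a
    using v1[OF that] by (simp only: valid_def)
  have hu: "mor u \<in> Hom C (src u) (ob P n)" and hv: "mor v \<in> Hom C (ob P n) (tgt v)"
    using u v by (auto simp: valid_def)
  have "mor (v \<odot>\<^bsub>C\<^esub> u) = mor v \<cdot>\<^bsub>C\<^esub> ((\<Sum>a\<in>I. mor (\<iota> a n \<odot>\<^bsub>C\<^esub> \<pi> a n)) \<cdot>\<^bsub>C\<^esub> mor u)"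
    unfolding filtered_sum using comp_ident_left[OF O(1) O(3) hu] by simp
  also have "\<dots> = mor v \<cdot>\<^bsub>C\<^esub> (\<Sum>a\<in>I. mor (\<iota> a n \<odot>\<^bsub>C\<^esub> \<pi> a n) \<cdot>\<^bsub>C\<^esub> mor u)"
    by (subst comp_sum_left[OF O(1) O(3) O(3) hu h]) (assumption, rule refl)
  also have "\<dots> = (\<Sum>a\<in>I. mor v \<cdot>\<^bsub>C\<^esub> (mor (\<iota> a n \<odot>\<^bsub>C\<^esub> \<pi> a n) \<cdot>\<^bsub>C\<^esub> mor u))"
    by (rule comp_sum_right[OF O(1) O(3) O(2) comp_closed[OF O(1) O(3) O(3) hu h] hv])
  also have "\<dots> = (\<Sum>a\<in>I. mor (v \<odot>\<^bsub>C\<^esub> (\<iota> a n \<odot>\<^bsub>C\<^esub> \<pi> a n) \<odot>\<^bsub>C\<^esub> u))"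
    by simp
  also have "\<dots> = (\<Sum>a\<in>I. mor ((v \<odot>\<^bsub>C\<^esub> \<iota> a n) \<odot>\<^bsub>C\<^esub> (\<pi> a n \<odot>\<^bsub>C\<^esub> u)))"
  proof (rule sum.cong[OF refl])
    fix a assume "a \<in> I"
    then have "v \<odot>\<^bsub>C\<^esub> (\<iota> a n \<odot>\<^bsub>C\<^esub> \<pi> a n) \<odot>\<^bsub>C\<^esub> u = (v \<odot>\<^bsub>C\<^esub> \<iota> a n) \<odot>\<^bsub>C\<^esub> (\<pi> a n \<odot>\<^bsub>C\<^esub> u)"
      using u v by (simp add: filtered_inj filtered_prj)
    then show "mor (v \<odot>\<^bsub>C\<^esub> (\<iota> a n \<odot>\<^bsub>C\<^esub> \<pi> a n) \<odot>\<^bsub>C\<^esub> u) = mor ((v \<odot>\<^bsub>C\<^esub> \<iota> a n) \<odot>\<^bsub>C\<^esub> (\<pi> a n \<odot>\<^bsub>C\<^esub> u))"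
      by (simp only:)
  qed
  finally show ?thesis .
qed

end

section \<open>Matrices of morphisms between filtered complexes\<close>

context
  fixes P I g c \<iota> \<pi> Q J h c' \<iota>' \<pi>'
  assumes FP: "filtered C P I g c \<iota> \<pi>" and FQ: "filtered C Q J h c' \<iota>' \<pi>'"
begin

lemmas source_simps [simp] = filtered_cplx[OF FP] filtered_inj[OF FP] filtered_prj[OF FP]
lemmas target_simps [simp] = filtered_cplx[OF FQ] filtered_inj[OF FQ] filtered_prj[OF FQ]

text \<open>The entry is indexed by the degree n in the filtered complex \<open>P\<close>;
  \<open>leading\<close> shifts it to the degree inside the column.\<close>

definition mat :: "int \<Rightarrow> (int \<Rightarrow> 'm) \<Rightarrow> 'a \<Rightarrow> 'b \<Rightarrow> int \<Rightarrow> 'm" where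
  "mat m \<phi> a b n = mor (\<pi>' b (n + m) \<odot>\<^bsub>C\<^esub> tmap P Q m \<phi> n \<odot>\<^bsub>C\<^esub> \<iota> a n)"

lemma mat_closed:
  assumes "\<phi> \<in> hom_cx C P Q m" "a \<in> I" "b \<in> J"
  shows "mat m \<phi> a b n \<in> Hom C (ob (c a) (n - g a)) (ob (c' b) (n + m - h b))"
proof -
  have "valid C (\<pi>' b (n + m) \<odot>\<^bsub>C\<^esub> tmap P Q m \<phi> n \<odot>\<^bsub>C\<^esub> \<iota> a n)" using assms by simp
  then show ?thesis using assms unfolding valid_def mat_def by simp
qed

lemma mat_sub:
  assumes "\<phi> \<in> hom_cx C P Q m" "\<psi> \<in> hom_cx C P Q m" "a \<in> I" "b \<in> J"
  shows "mat m (\<lambda>i. \<phi> i - \<psi> i) a b n = mat m \<phi> a b n - mat m \<psi> a b n"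
proof -
  have "tmap P Q m (\<lambda>i. \<phi> i - \<psi> i) n = tmap P Q m \<phi> n \<oplus> tsgn 1 (tmap P Q m \<psi> n)"
    by (rule arr_eqI) (simp_all add: ksign_def)
  then have "\<pi>' b (n + m) \<odot>\<^bsub>C\<^esub> tmap P Q m (\<lambda>i. \<phi> i - \<psi> i) n \<odot>\<^bsub>C\<^esub> \<iota> a n
    = (\<pi>' b (n + m) \<odot>\<^bsub>C\<^esub> tmap P Q m \<phi> n \<odot>\<^bsub>C\<^esub> \<iota> a n) \<oplus> tsgn 1 (\<pi>' b (n + m) \<odot>\<^bsub>C\<^esub> tmap P Q m \<psi> n \<odot>\<^bsub>C\<^esub> \<iota> a n)"
    using assms by simp
  from arg_cong[where f = mor, OF this] show ?thesis by (simp add: mat_def ksign_def)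
qed

text \<open>Inserting the identities of \<open>P\<close> and of \<open>Q\<close> recovers a family
  from its entries.\<close>

lemma mat_eq_0:
  assumes \<phi>: "\<phi> \<in> hom_cx C P Q m" and 0: "\<And>a b n. a \<in> I \<Longrightarrow> b \<in> J \<Longrightarrow> mat m \<phi> a b n = 0"
  shows "\<phi> = (\<lambda>_. 0)"
proof
  fix n
  have 1: "\<pi>' b (n + m) \<odot>\<^bsub>C\<^esub> tmap P Q m \<phi> n = tzero (ob P n) (ob (c' b) (n + m - h b))" if b: "b \<in> J" for b
  proof (rule arr_eqI)
    have "mor (\<pi>' b (n + m) \<odot>\<^bsub>C\<^esub> tmap P Q m \<phi> n)
      = mor ((\<pi>' b (n + m) \<odot>\<^bsub>C\<^esub> tmap P Q m \<phi> n) \<odot>\<^bsub>C\<^esub> tid C (ob P n))"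
      using b \<phi> by (simp del: arr_fields(3))
    also have "\<dots> = (\<Sum>a\<in>I. mor (((\<pi>' b (n + m) \<odot>\<^bsub>C\<^esub> tmap P Q m \<phi> n) \<odot>\<^bsub>C\<^esub> \<iota> a n) \<odot>\<^bsub>C\<^esub> (\<pi> a n \<odot>\<^bsub>C\<^esub> tid C (ob P n))))"
      by (rule filtered_insert[OF FP]) (use b \<phi> in simp_all)
    also have "\<dots> = 0"
    proof (rule sum.neutral, rule ballI)
      fix a assume a: "a \<in> I"
      have "(\<pi>' b (n + m) \<odot>\<^bsub>C\<^esub> tmap P Q m \<phi> n) \<odot>\<^bsub>C\<^esub> \<iota> a n = tzero (ob (c a) (n - g a)) (ob (c' b) (n + m - h b))"
        using 0[OF a b, of n] a b \<phi> by (intro arr_eqI) (simp_all add: mat_def comp_assoc[symmetric] del: arr_fields(3))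
      then show "mor (((\<pi>' b (n + m) \<odot>\<^bsub>C\<^esub> tmap P Q m \<phi> n) \<odot>\<^bsub>C\<^esub> \<iota> a n) \<odot>\<^bsub>C\<^esub> (\<pi> a n \<odot>\<^bsub>C\<^esub> tid C (ob P n))) = 0"
        using a b by (simp del: arr_fields(3))
    qed
    finally show "mor (\<pi>' b (n + m) \<odot>\<^bsub>C\<^esub> tmap P Q m \<phi> n) = mor (tzero (ob P n) (ob (c' b) (n + m - h b)) :: ('o, 'm) arr)"
      by simp
  qed (use b in simp_all)
  have "mor (tmap P Q m \<phi> n) = mor (tid C (ob Q (n + m)) \<odot>\<^bsub>C\<^esub> tmap P Q m \<phi> n)"
    using \<phi> by (simp del: arr_fields(3))
  also have "\<dots> = (\<Sum>b\<in>J. mor ((tid C (ob Q (n + m)) \<odot>\<^bsub>C\<^esub> \<iota>' b (n + m)) \<odot>\<^bsub>C\<^esub> (\<pi>' b (n + m) \<odot>\<^bsub>C\<^esub> tmap P Q m \<phi> n)))"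
    by (rule filtered_insert[OF FQ]) (use \<phi> in simp_all)
  also have "\<dots> = 0"
    by (rule sum.neutral) (use 1 in \<open>simp del: arr_fields(3)\<close>)
  finally show "\<phi> n = 0" by simp
qed

text \<open>Inverse to \<open>mat\<close>: the family with prescribed entries, from which diagonal
  families and corrections are built.\<close>

definition assemble :: "int \<Rightarrow> ('a \<Rightarrow> 'b \<Rightarrow> int \<Rightarrow> 'm) \<Rightarrow> int \<Rightarrow> 'm" where
  "assemble m W n = (\<Sum>a\<in>I. \<Sum>b\<in>J. mor (\<iota>' b (n + m) \<odot>\<^bsub>C\<^esub>
    \<lparr>src = ob (c a) (n - g a), tgt = ob (c' b) (n + m - h b), mor = W a b n\<rparr> \<odot>\<^bsub>C\<^esub> \<pi> a n))"

context
  fixes m W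
  assumes W: "\<And>a b n. a \<in> I \<Longrightarrow> b \<in> J \<Longrightarrow> W a b n \<in> Hom C (ob (c a) (n - g a)) (ob (c' b) (n + m - h b))"
begin

lemma valid_entry:
  "a \<in> I \<Longrightarrow> b \<in> J \<Longrightarrow>
    valid C \<lparr>src = ob (c a) (n - g a), tgt = ob (c' b) (n + m - h b), mor = W a b n\<rparr>"
  using W by (simp add: valid_def)

lemma assemble_closed: "assemble m W \<in> hom_cx C P Q m"
proof -
  have "mor (\<iota>' b (n + m) \<odot>\<^bsub>C\<^esub> \<lparr>src = ob (c a) (n - g a), tgt = ob (c' b) (n + m - h b), mor = W a b n\<rparr> \<odot>\<^bsub>C\<^esub> \<pi> a n)
    \<in> Hom C (ob P n) (ob Q (n + m))" if "a \<in> I" "b \<in> J" for a b n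
  proof -
    have "valid C (\<iota>' b (n + m) \<odot>\<^bsub>C\<^esub> \<lparr>src = ob (c a) (n - g a), tgt = ob (c' b) (n + m - h b), mor = W a b n\<rparr> \<odot>\<^bsub>C\<^esub> \<pi> a n)"
      using that valid_entry by simp
    then show ?thesis using that unfolding valid_def by simp
  qed
  then show ?thesis unfolding hom_cx_def assemble_def by (auto intro!: hom_sum)
qed

text \<open>Orthogonality of inclusions and projections picks the entry (a, b) out of the double
  sum.\<close>

lemma mat_assemble:
  assumes a: "a \<in> I" and b: "b \<in> J"
  shows "mat m (assemble m W) a b n = W a b n"
proof -
  let ?w = "\<lambda>a b. \<lparr>src = ob (c a) (n - g a), tgt = ob (c' b) (n + m - h b), mor = W a b n\<rparr>"
  let ?s = "\<lambda>x y. \<iota>' y (n + m) \<odot>\<^bsub>C\<^esub> ?w x y \<odot>\<^bsub>C\<^esub> \<pi> x n"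
  have vs: "valid C (?s x y)" if "x \<in> I" "y \<in> J" for x y
    using that valid_entry by simp
  have hs: "mor (?s x y) \<in> Hom C (ob P n) (ob Q (n + m))" if "x \<in> I" "y \<in> J" for x y
    using vs[OF that] that unfolding valid_def by simp
  have O: "ob (c a) (n - g a) \<in> Obj C" "ob P n \<in> Obj C" "ob Q (n + m) \<in> Obj C" "ob (c' b) (n + m - h b) \<in> Obj C"
    using a b by simp_all
  have i: "mor (\<iota> a n) \<in> Hom C (ob (c a) (n - g a)) (ob P n)"
    and p: "mor (\<pi>' b (n + m)) \<in> Hom C (ob Q (n + m)) (ob (c' b) (n + m - h b))"
    using filtered_inj(1)[OF FP a, of n] filtered_prj(1)[OF FQ b, of "n + m"] a b unfolding valid_def by simp_all
  have "mat m (assemble m W) a b n = mor (\<pi>' b (n + m)) \<cdot>\<^bsub>C\<^esub> ((\<Sum>x\<in>I. \<Sum>y\<in>J. mor (?s x y)) \<cdot>\<^bsub>C\<^esub> mor (\<iota> a n))"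
    by (simp add: mat_def assemble_def)
  also have "(\<Sum>x\<in>I. \<Sum>y\<in>J. mor (?s x y)) \<cdot>\<^bsub>C\<^esub> mor (\<iota> a n) = (\<Sum>x\<in>I. (\<Sum>y\<in>J. mor (?s x y)) \<cdot>\<^bsub>C\<^esub> mor (\<iota> a n))"
    by (rule comp_sum_left[OF O(1,2,3) i hom_sum[OF O(2,3) hs]])
  also have "\<dots> = (\<Sum>x\<in>I. \<Sum>y\<in>J. mor (?s x y) \<cdot>\<^bsub>C\<^esub> mor (\<iota> a n))"
    by (intro sum.cong refl comp_sum_left[OF O(1,2,3) i hs])
  also have "mor (\<pi>' b (n + m)) \<cdot>\<^bsub>C\<^esub> \<dots> = (\<Sum>x\<in>I. mor (\<pi>' b (n + m)) \<cdot>\<^bsub>C\<^esub> (\<Sum>y\<in>J. mor (?s x y) \<cdot>\<^bsub>C\<^esub> mor (\<iota> a n)))"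
    by (rule comp_sum_right[OF O(1,3,4) hom_sum[OF O(1,3) comp_closed[OF O(1,2,3) i hs]] p])
  also have "\<dots> = (\<Sum>x\<in>I. \<Sum>y\<in>J. mor (\<pi>' b (n + m)) \<cdot>\<^bsub>C\<^esub> (mor (?s x y) \<cdot>\<^bsub>C\<^esub> mor (\<iota> a n)))"
    by (intro sum.cong refl comp_sum_right[OF O(1,3,4) comp_closed[OF O(1,2,3) i hs] p])
  also have "\<dots> = (\<Sum>x\<in>I. \<Sum>y\<in>J. if x = a \<and> y = b then W a b n else 0)"
  proof (intro sum.cong refl)
    fix x y assume x: "x \<in> I" and y: "y \<in> J"
    have "\<pi>' b (n + m) \<odot>\<^bsub>C\<^esub> ?s x y \<odot>\<^bsub>C\<^esub> \<iota> a n = (\<pi>' b (n + m) \<odot>\<^bsub>C\<^esub> \<iota>' y (n + m)) \<odot>\<^bsub>C\<^esub> ?w x y \<odot>\<^bsub>C\<^esub> (\<pi> x n \<odot>\<^bsub>C\<^esub> \<iota> a n)"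
      using x y a b valid_entry by simp
    also have "mor \<dots> = (if x = a \<and> y = b then W a b n else 0)"
      using x y a b valid_entry[OF x y] valid_entry[OF a b]
      by (cases "x = a"; cases "y = b") (simp_all add: filtered_prj_inj[OF FP] filtered_prj_inj[OF FQ])
    finally show "mor (\<pi>' b (n + m)) \<cdot>\<^bsub>C\<^esub> (mor (?s x y) \<cdot>\<^bsub>C\<^esub> mor (\<iota> a n)) = (if x = a \<and> y = b then W a b n else 0)"
      by simp
  qed
  also have "\<dots> = (\<Sum>x\<in>I. if x = a then W a b n else 0)"
    using b filtered_finite[OF FQ] by (intro sum.cong refl) (auto simp: sum.delta)
  also have "\<dots> = W a b n"
    using a filtered_finite[OF FP] by simp
  finally show ?thesis .
qed

end

text \<open>The matrix of a coboundary is the signed difference of two matrix products, with the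
  matrices of the differentials of \<open>Q\<close> and of \<open>P\<close>.\<close>

lemma mat_hom_diff:
  assumes \<phi>: "\<phi> \<in> hom_cx C P Q m" and a: "a \<in> I" and b: "b \<in> J"
  shows "mat (m + 1) (hom_diff C P Q m \<phi>) a b n
    = (\<Sum>y\<in>J. mor (\<pi>' b (n + m + 1) \<odot>\<^bsub>C\<^esub> tmap Q Q 1 (diff Q) (n + m) \<odot>\<^bsub>C\<^esub> \<iota>' y (n + m)) \<cdot>\<^bsub>C\<^esub> mat m \<phi> a y n)
      - ksign m (\<Sum>x\<in>I. mat m \<phi> x b (n + 1) \<cdot>\<^bsub>C\<^esub> mor (\<pi> x (n + 1) \<odot>\<^bsub>C\<^esub> tmap P P 1 (diff P) n \<odot>\<^bsub>C\<^esub> \<iota> a n))"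
proof -
  let ?dQ = "tmap Q Q 1 (diff Q) (n + m)" and ?dP = "tmap P P 1 (diff P) n"
  let ?p = "\<pi>' b (n + m + 1)" and ?i = "\<iota> a n" and ?f = "tmap P Q m \<phi>"
  have \<pi>: "\<pi>' b (n + (m + 1)) = ?p" by (simp add: add.assoc)
  have eq: "\<pi>' b (n + (m + 1)) \<odot>\<^bsub>C\<^esub> tmap P Q (m + 1) (hom_diff C P Q m \<phi>) n \<odot>\<^bsub>C\<^esub> ?i
    = ((?p \<odot>\<^bsub>C\<^esub> ?dQ) \<odot>\<^bsub>C\<^esub> (?f n \<odot>\<^bsub>C\<^esub> ?i)) \<oplus> tsgn (m + 1) ((?p \<odot>\<^bsub>C\<^esub> ?f (n + 1)) \<odot>\<^bsub>C\<^esub> (?dP \<odot>\<^bsub>C\<^esub> ?i))"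
    unfolding tmap_hom_diff[OF refl] \<pi> using \<phi> a b by (simp add: algebra_simps)
  have 1: "mor ((?p \<odot>\<^bsub>C\<^esub> ?dQ) \<odot>\<^bsub>C\<^esub> (?f n \<odot>\<^bsub>C\<^esub> ?i))
    = (\<Sum>y\<in>J. mor (((?p \<odot>\<^bsub>C\<^esub> ?dQ) \<odot>\<^bsub>C\<^esub> \<iota>' y (n + m)) \<odot>\<^bsub>C\<^esub> (\<pi>' y (n + m) \<odot>\<^bsub>C\<^esub> (?f n \<odot>\<^bsub>C\<^esub> ?i))))"
    by (rule filtered_insert[OF FQ]) (use \<phi> a b in simp_all)
  have 2: "mor ((?p \<odot>\<^bsub>C\<^esub> ?f (n + 1)) \<odot>\<^bsub>C\<^esub> (?dP \<odot>\<^bsub>C\<^esub> ?i))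
    = (\<Sum>x\<in>I. mor (((?p \<odot>\<^bsub>C\<^esub> ?f (n + 1)) \<odot>\<^bsub>C\<^esub> \<iota> x (n + 1)) \<odot>\<^bsub>C\<^esub> (\<pi> x (n + 1) \<odot>\<^bsub>C\<^esub> (?dP \<odot>\<^bsub>C\<^esub> ?i))))"
    by (rule filtered_insert[OF FP]) (use \<phi> a b in \<open>simp_all add: algebra_simps\<close>)
  have 3: "mor (((?p \<odot>\<^bsub>C\<^esub> ?dQ) \<odot>\<^bsub>C\<^esub> \<iota>' y (n + m)) \<odot>\<^bsub>C\<^esub> (\<pi>' y (n + m) \<odot>\<^bsub>C\<^esub> (?f n \<odot>\<^bsub>C\<^esub> ?i)))
    = mor (?p \<odot>\<^bsub>C\<^esub> ?dQ \<odot>\<^bsub>C\<^esub> \<iota>' y (n + m)) \<cdot>\<^bsub>C\<^esub> mat m \<phi> a y n" if "y \<in> J" for y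
  proof -
    have "(?p \<odot>\<^bsub>C\<^esub> ?dQ) \<odot>\<^bsub>C\<^esub> \<iota>' y (n + m) = ?p \<odot>\<^bsub>C\<^esub> ?dQ \<odot>\<^bsub>C\<^esub> \<iota>' y (n + m)" using that b by simp
    then show ?thesis by (subst arr_fields(3)) (simp only: mat_def)
  qed
  have 4: "mor (((?p \<odot>\<^bsub>C\<^esub> ?f (n + 1)) \<odot>\<^bsub>C\<^esub> \<iota> x (n + 1)) \<odot>\<^bsub>C\<^esub> (\<pi> x (n + 1) \<odot>\<^bsub>C\<^esub> (?dP \<odot>\<^bsub>C\<^esub> ?i)))
    = mat m \<phi> x b (n + 1) \<cdot>\<^bsub>C\<^esub> mor (\<pi> x (n + 1) \<odot>\<^bsub>C\<^esub> ?dP \<odot>\<^bsub>C\<^esub> ?i)" if "x \<in> I" for x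
  proof -
    have "(?p \<odot>\<^bsub>C\<^esub> ?f (n + 1)) \<odot>\<^bsub>C\<^esub> \<iota> x (n + 1) = \<pi>' b (n + 1 + m) \<odot>\<^bsub>C\<^esub> ?f (n + 1) \<odot>\<^bsub>C\<^esub> \<iota> x (n + 1)"
      using that b \<phi> by (simp add: algebra_simps)
    then show ?thesis by (subst arr_fields(3)) (simp only: mat_def)
  qed
  have "mat (m + 1) (hom_diff C P Q m \<phi>) a b n
    = mor ((?p \<odot>\<^bsub>C\<^esub> ?dQ) \<odot>\<^bsub>C\<^esub> (?f n \<odot>\<^bsub>C\<^esub> ?i)) + ksign (m + 1) (mor ((?p \<odot>\<^bsub>C\<^esub> ?f (n + 1)) \<odot>\<^bsub>C\<^esub> (?dP \<odot>\<^bsub>C\<^esub> ?i)))"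
    unfolding mat_def eq by simp
  then show ?thesis
    unfolding 1 2 using 3 4 by (simp add: ksign_def del: arr_fields(3))
qed

section \<open>Solving equations one filtration step at a time\<close>

definition raises :: "int \<Rightarrow> int \<Rightarrow> (int \<Rightarrow> 'm) \<Rightarrow> bool" where
  "raises k m \<phi> \<longleftrightarrow> \<phi> \<in> hom_cx C P Q m \<and>
    (\<forall>a\<in>I. \<forall>b\<in>J. \<forall>n. h b < g a + k \<longrightarrow> mat m \<phi> a b n = 0)"

text \<open>Reindexing by the degree p = n - g a inside the column. For h b = g a + k this is a
  cochain of degree m - k between the columns: each step up the filtration lowers the degree by one,
  which is how vanishing in negative degrees comes into play.\<close>

definition leading :: "int \<Rightarrow> (int \<Rightarrow> 'm) \<Rightarrow> 'a \<Rightarrow> 'b \<Rightarrow> int \<Rightarrow> 'm" where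
  "leading m \<phi> a b p = mat m \<phi> a b (p + g a)"

lemma mat_leading: "mat m \<phi> a b n = leading m \<phi> a b (n - g a)"
  by (simp add: leading_def)

lemma leading_closed:
  assumes "\<phi> \<in> hom_cx C P Q m" "a \<in> I" "b \<in> J" "h b = g a + k"
  shows "leading m \<phi> a b \<in> hom_cx C (c a) (c' b) (m - k)"
  unfolding hom_cx_def leading_def
proof (intro CollectI allI)
  fix p
  show "mat m \<phi> a b (p + g a) \<in> Hom C (ob (c a) p) (ob (c' b) (p + (m - k)))"
    using mat_closed[OF assms(1-3), of "p + g a"] assms(4) by (simp add: algebra_simps)
qed

lemma mat_zero: "a \<in> I \<Longrightarrow> b \<in> J \<Longrightarrow> mat m (\<lambda>_. 0) a b n = 0"
  using mat_sub[OF hom_cx_zero hom_cx_zero, of a b m n] by simp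

lemma raises_zero: "raises k m (\<lambda>_. 0)"
  by (simp add: raises_def mat_zero)

lemma raises_sub:
  "raises k m \<phi> \<Longrightarrow> raises k m \<psi> \<Longrightarrow> raises k m (\<lambda>i. \<phi> i - \<psi> i)"
  using hom_cx_sub[OF filtered_cplx(1)[OF FP] filtered_cplx(1)[OF FQ]]
  by (auto simp: raises_def mat_sub)

text \<open>For entries with h b \<le> g a + k only the diagonal blocks of the differentials survive
  in the matrix products. An intermediate column y of \<open>Q\<close> either lies too low to be
  reached by the family, or has h b \<le> h y, and then the differential has no entry from y to b.
  The argument for a column x of \<open>P\<close> is dual.\<close>

lemma mat_comp_diff_eq_0:
  assumes \<phi>: "raises k m \<phi>" and a: "a \<in> I" and b: "b \<in> J" and hb: "h b \<le> g a + k"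
  shows "y \<in> J \<Longrightarrow> y \<noteq> b \<Longrightarrow>
      mor (\<pi>' b (n + m + 1) \<odot>\<^bsub>C\<^esub> tmap Q Q 1 (diff Q) (n + m) \<odot>\<^bsub>C\<^esub> \<iota>' y (n + m)) \<cdot>\<^bsub>C\<^esub> mat m \<phi> a y n = 0"
    and "x \<in> I \<Longrightarrow> x \<noteq> a \<Longrightarrow>
      mat m \<phi> x b (n + 1) \<cdot>\<^bsub>C\<^esub> mor (\<pi> x (n + 1) \<odot>\<^bsub>C\<^esub> tmap P P 1 (diff P) n \<odot>\<^bsub>C\<^esub> \<iota> a n) = 0"
proof -
  have \<phi>c: "\<phi> \<in> hom_cx C P Q m" using \<phi> by (simp add: raises_def)
  show "mor (\<pi>' b (n + m + 1) \<odot>\<^bsub>C\<^esub> tmap Q Q 1 (diff Q) (n + m) \<odot>\<^bsub>C\<^esub> \<iota>' y (n + m)) \<cdot>\<^bsub>C\<^esub> mat m \<phi> a y n = 0"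
    if y: "y \<in> J" "y \<noteq> b"
  proof (cases "h y < g a + k")
    case True
    then have 0: "mat m \<phi> a y n = 0" using \<phi> a y by (simp add: raises_def)
    have "valid C (\<pi>' b (n + m + 1) \<odot>\<^bsub>C\<^esub> tmap Q Q 1 (diff Q) (n + m) \<odot>\<^bsub>C\<^esub> \<iota>' y (n + m))"
      using b y by simp
    then show ?thesis unfolding 0 by (rule valid_comp_zero)
  next
    case False
    then have 0: "mor (\<pi>' b (n + m + 1) \<odot>\<^bsub>C\<^esub> tmap Q Q 1 (diff Q) (n + m) \<odot>\<^bsub>C\<^esub> \<iota>' y (n + m)) = 0"
      using filtered_off[OF FQ y(1) b y(2)] hb by simp
    show ?thesis unfolding 0
      by (rule comp_zero_left[OF _ _ _ mat_closed[OF \<phi>c a y(1)], where Z = "ob P 0"]) (use a b y in simp_all)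
  qed
  show "mat m \<phi> x b (n + 1) \<cdot>\<^bsub>C\<^esub> mor (\<pi> x (n + 1) \<odot>\<^bsub>C\<^esub> tmap P P 1 (diff P) n \<odot>\<^bsub>C\<^esub> \<iota> a n) = 0"
    if x: "x \<in> I" "x \<noteq> a"
  proof (cases "g x \<le> g a")
    case True
    then have 0: "mor (\<pi> x (n + 1) \<odot>\<^bsub>C\<^esub> tmap P P 1 (diff P) n \<odot>\<^bsub>C\<^esub> \<iota> a n) = 0"
      using filtered_off[OF FP a x(1)] x(2) by simp
    show ?thesis unfolding 0
      by (rule comp_zero_right[OF _ _ _ mat_closed[OF \<phi>c x(1) b], where X = "ob P 0"]) (use a b x in simp_all)
  next
    case False
    then have 0: "mat m \<phi> x b (n + 1) = 0" using \<phi> b x hb by (simp add: raises_def)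
    have "valid C (\<pi> x (n + 1) \<odot>\<^bsub>C\<^esub> tmap P P 1 (diff P) n \<odot>\<^bsub>C\<^esub> \<iota> a n)"
      using a x by simp
    then show ?thesis unfolding 0 by (rule valid_comp_zero)
  qed
qed

text \<open>Differentials do not lower the filtration, so a coboundary raises the filtration at
  least as far as the family itself.\<close>

lemma mat_hom_diff_low:
  assumes \<phi>: "raises k m \<phi>" and a: "a \<in> I" and b: "b \<in> J" and hb: "h b < g a + k"
  shows "mat (m + 1) (hom_diff C P Q m \<phi>) a b n = 0"
proof -
  have \<phi>c: "\<phi> \<in> hom_cx C P Q m" using \<phi> by (simp add: raises_def)
  have 0: "mat m \<phi> a b n = 0" "mat m \<phi> a b (n + 1) = 0" using \<phi> a b hb by (simp_all add: raises_def)
  have v: "valid C (\<pi>' b (n + m + 1) \<odot>\<^bsub>C\<^esub> tmap Q Q 1 (diff Q) (n + m) \<odot>\<^bsub>C\<^esub> \<iota>' b (n + m))"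
    "valid C (\<pi> a (n + 1) \<odot>\<^bsub>C\<^esub> tmap P P 1 (diff P) n \<odot>\<^bsub>C\<^esub> \<iota> a n)" using a b by simp_all
  have "mor (\<pi>' b (n + m + 1) \<odot>\<^bsub>C\<^esub> tmap Q Q 1 (diff Q) (n + m) \<odot>\<^bsub>C\<^esub> \<iota>' b (n + m)) \<cdot>\<^bsub>C\<^esub> mat m \<phi> a b n = 0"
    unfolding 0 by (rule valid_comp_zero[OF v(1)])
  moreover have "mat m \<phi> a b (n + 1) \<cdot>\<^bsub>C\<^esub> mor (\<pi> a (n + 1) \<odot>\<^bsub>C\<^esub> tmap P P 1 (diff P) n \<odot>\<^bsub>C\<^esub> \<iota> a n) = 0"
    unfolding 0 by (rule valid_comp_zero[OF v(2)])
  ultimately have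
    "\<And>y. y \<in> J \<Longrightarrow> mor (\<pi>' b (n + m + 1) \<odot>\<^bsub>C\<^esub> tmap Q Q 1 (diff Q) (n + m) \<odot>\<^bsub>C\<^esub> \<iota>' y (n + m)) \<cdot>\<^bsub>C\<^esub> mat m \<phi> a y n = 0"
    "\<And>x. x \<in> I \<Longrightarrow> mat m \<phi> x b (n + 1) \<cdot>\<^bsub>C\<^esub> mor (\<pi> x (n + 1) \<odot>\<^bsub>C\<^esub> tmap P P 1 (diff P) n \<odot>\<^bsub>C\<^esub> \<iota> a n) = 0"
    using mat_comp_diff_eq_0[OF \<phi> a b less_imp_le[OF hb]] by metis+
  then show ?thesis
    unfolding mat_hom_diff[OF \<phi>c a b] by (simp del: arr_fields(3))
qed

text \<open>The diagonal blocks carry the signs (-1)^(h b) and (-1)^(g a). Once (-1)^(h b) is taken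
  out, the second term keeps (-1)^(m + g a - h b) = (-1)^(m - k), exactly the sign of the Hom
  complex in degree m - k.\<close>

lemma mat_hom_diff_leading:
  assumes \<phi>: "raises k m \<phi>" and a: "a \<in> I" and b: "b \<in> J" and hb: "h b = g a + k"
  shows "mat (m + 1) (hom_diff C P Q m \<phi>) a b n
    = ksign (h b) (hom_diff C (c a) (c' b) (m - k) (leading m \<phi> a b) (n - g a))"
proof -
  have \<phi>c: "\<phi> \<in> hom_cx C P Q m" using \<phi> by (simp add: raises_def)
  have dQ: "diff (c' b) (n + m - h b) \<in> Hom C (ob (c' b) (n + m - h b)) (ob (c' b) (n + m - h b + 1))"
    and dP: "diff (c a) (n - g a) \<in> Hom C (ob (c a) (n - g a)) (ob (c a) (n - g a + 1))"
    using a b by (auto intro!: cplx_diff)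
  have m1: "mat m \<phi> a b (n + 1) \<in> Hom C (ob (c a) (n - g a + 1)) (ob (c' b) (n + m - h b + 1))"
    using mat_closed[OF \<phi>c a b, of "n + 1"] by (simp add: algebra_simps)
  have "mat (m + 1) (hom_diff C P Q m \<phi>) a b n
    = mor (\<pi>' b (n + m + 1) \<odot>\<^bsub>C\<^esub> tmap Q Q 1 (diff Q) (n + m) \<odot>\<^bsub>C\<^esub> \<iota>' b (n + m)) \<cdot>\<^bsub>C\<^esub> mat m \<phi> a b n
      - ksign m (mat m \<phi> a b (n + 1) \<cdot>\<^bsub>C\<^esub> mor (\<pi> a (n + 1) \<odot>\<^bsub>C\<^esub> tmap P P 1 (diff P) n \<odot>\<^bsub>C\<^esub> \<iota> a n))"
    unfolding mat_hom_diff[OF \<phi>c a b]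
    using sum_eq_single[OF filtered_finite[OF FQ] b mat_comp_diff_eq_0(1)[OF \<phi> a b eq_refl[OF hb]]]
      sum_eq_single[OF filtered_finite[OF FP] a mat_comp_diff_eq_0(2)[OF \<phi> a b eq_refl[OF hb]]]
    by (simp del: arr_fields(3))
  also have "\<dots> = ksign (h b) (diff (c' b) (n + m - h b) \<cdot>\<^bsub>C\<^esub> mat m \<phi> a b n)
      - ksign m (ksign (g a) (mat m \<phi> a b (n + 1) \<cdot>\<^bsub>C\<^esub> diff (c a) (n - g a)))"
    unfolding filtered_diag[OF FP a] filtered_diag[OF FQ b]
    using comp_ksign_left[OF _ _ _ mat_closed[OF \<phi>c a b] dQ] comp_ksign_right[OF _ _ _ dP m1] a b by simp
  also have "\<dots> = ksign (h b) (hom_diff C (c a) (c' b) (m - k) (leading m \<phi> a b) (n - g a))"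
    using hb by (simp add: hom_diff_def leading_def algebra_simps) (simp add: ksign_def)
  finally show ?thesis .
qed

text \<open>The lowest entries have primitives. A family concentrated on h b = g a + k with these
  primitives as entries has a coboundary that cancels the lowest entries and adds nothing below
  them.\<close>

lemma filtration_step:
  assumes \<phi>: "raises k m \<phi>" "\<phi> \<in> hom_cocycles C P Q m"
    and lead: "\<And>a b. \<lbrakk>a \<in> I; b \<in> J; h b = g a + k\<rbrakk> \<Longrightarrow> leading m \<phi> a b \<in> hom_coboundaries C (c a) (c' b) (m - k)"
  shows "\<exists>\<psi>. raises k (m - 1) \<psi> \<and> raises (k + 1) m (\<lambda>i. \<phi> i - hom_diff C P Q (m - 1) \<psi> i)"
proof -
  have \<phi>c: "\<phi> \<in> hom_cx C P Q m" using \<phi> by (simp add: raises_def)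
  have "\<forall>a b. \<exists>w. a \<in> I \<and> b \<in> J \<and> h b = g a + k \<longrightarrow> w \<in> hom_cx C (c a) (c' b) (m - 1 - k) \<and>
      leading m \<phi> a b = hom_diff C (c a) (c' b) (m - 1 - k) w"
    using lead by (fastforce simp: hom_coboundaries_def algebra_simps)
  then obtain w where w: "\<And>a b. \<lbrakk>a \<in> I; b \<in> J; h b = g a + k\<rbrakk> \<Longrightarrow> w a b \<in> hom_cx C (c a) (c' b) (m - 1 - k) \<and>
      leading m \<phi> a b = hom_diff C (c a) (c' b) (m - 1 - k) (w a b)" by metis
  \<comment> \<open>The factor (-1)^(h b) compensates the one in
    \<open>mat_hom_diff_leading\<close>.\<close>
  define W where "W a b n = (if h b = g a + k then ksign (h b) (w a b (n - g a)) else 0)" for a b n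
  have W: "W a b n \<in> Hom C (ob (c a) (n - g a)) (ob (c' b) (n + (m - 1) - h b))" if "a \<in> I" "b \<in> J" for a b n
  proof (cases "h b = g a + k")
    case True
    have "w a b (n - g a) \<in> Hom C (ob (c a) (n - g a)) (ob (c' b) (n - g a + (m - 1 - k)))"
      using w[OF that True] by (auto intro: hom_cxD)
    then show ?thesis using that True by (simp add: W_def hom_ksign algebra_simps)
  qed (use that in \<open>simp add: W_def\<close>)
  define \<psi> where "\<psi> = assemble (m - 1) W"
  have \<psi>c: "\<psi> \<in> hom_cx C P Q (m - 1)" unfolding \<psi>_def by (rule assemble_closed[OF W])
  have mat\<psi>: "mat (m - 1) \<psi> a b n = W a b n" if "a \<in> I" "b \<in> J" for a b n
    unfolding \<psi>_def by (rule mat_assemble[OF W that])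
  have \<psi>r: "raises k (m - 1) \<psi>" using \<psi>c mat\<psi> by (auto simp: raises_def W_def)
  have D\<psi>: "hom_diff C P Q (m - 1) \<psi> \<in> hom_cx C P Q m"
    using hom_diff_closed[OF _ _ \<psi>c] by simp
  have "mat m (\<lambda>i. \<phi> i - hom_diff C P Q (m - 1) \<psi> i) a b n = 0"
    if ab: "a \<in> I" "b \<in> J" "h b < g a + (k + 1)" for a b n
  proof (cases "h b = g a + k")
    case True
    have "leading (m - 1) \<psi> a b = (\<lambda>p. ksign (h b) (w a b p))"
      using mat\<psi>[OF ab(1,2)] True by (auto simp: leading_def W_def)
    then have "hom_diff C (c a) (c' b) (m - 1 - k) (leading (m - 1) \<psi> a b) = (\<lambda>p. ksign (h b) (leading m \<phi> a b p))"
      using w[OF ab(1,2) True] ab by (simp add: hom_diff_ksign)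
    then have "mat m (hom_diff C P Q (m - 1) \<psi>) a b n = mat m \<phi> a b n"
      using mat_hom_diff_leading[OF \<psi>r ab(1,2) True, of n] by (simp add: mat_leading)
    then show ?thesis using mat_sub[OF \<phi>c D\<psi> ab(1,2)] by simp
  next
    case False
    then have lt: "h b < g a + k" using ab by simp
    show ?thesis
      using mat_sub[OF \<phi>c D\<psi> ab(1,2), of n] mat_hom_diff_low[OF \<psi>r ab(1,2) lt, of n] \<phi>(1) ab lt
      by (simp add: raises_def)
  qed
  then have "raises (k + 1) m (\<lambda>i. \<phi> i - hom_diff C P Q (m - 1) \<psi> i)"
    using hom_cx_sub[OF _ _ \<phi>c D\<psi>] by (auto simp: raises_def)
  with \<psi>r show ?thesis by blast
qed

context
  assumes acyclic: "\<And>a b. a \<in> I \<Longrightarrow> b \<in> J \<Longrightarrow> acyclic_below (c a) (c' b)"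
begin

text \<open>Iteration of \<open>filtration_step\<close>. At height k > m the lowest entries are
  cocycles of the negative degree m - k, hence coboundaries; at k = m they have degree 0, where
  acyclicity says nothing and \<open>lead\<close> steps in.\<close>

lemma filtration_exact:
  assumes \<phi>: "raises k m \<phi>" "\<phi> \<in> hom_cocycles C P Q m" and km: "m \<le> k"
    and lead: "\<And>a b. \<lbrakk>a \<in> I; b \<in> J; h b = g a + k; k = m\<rbrakk> \<Longrightarrow> leading m \<phi> a b \<in> hom_coboundaries C (c a) (c' b) 0"
  shows "\<exists>\<psi>. raises k (m - 1) \<psi> \<and> \<phi> = hom_diff C P Q (m - 1) \<psi>"
proof -
  \<comment> \<open>Finitely many columns leave finitely many differences h b - g a. A family that
    raises the filtration beyond all of them is 0, so the induction runs on the distance to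
    \<open>K\<close>.\<close>
  obtain K where K: "\<And>a b. a \<in> I \<Longrightarrow> b \<in> J \<Longrightarrow> h b < g a + K"
  proof -
    have f: "finite ((\<lambda>(a, b). h b - g a) ` (I \<times> J))"
      using filtered_finite[OF FP] filtered_finite[OF FQ] by simp
    show thesis
    proof (rule that[of "Max (insert 0 ((\<lambda>(a, b). h b - g a) ` (I \<times> J))) + 1"])
      fix a b assume "a \<in> I" "b \<in> J"
      then have "h b - g a \<le> Max (insert 0 ((\<lambda>(a, b). h b - g a) ` (I \<times> J)))"
        using f by (intro Max_ge) auto
      then show "h b < g a + (Max (insert 0 ((\<lambda>(a, b). h b - g a) ` (I \<times> J))) + 1)" by simp
    qed
  qed
  show ?thesis
    using \<phi> km lead
  proof (induction "nat (K - k)" arbitrary: k \<phi> rule: less_induct)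
    case less
    have \<phi>c: "\<phi> \<in> hom_cx C P Q m" using less.prems by (simp add: raises_def)
    show ?case
    proof (cases "K \<le> k")
      case True
      then have "\<phi> = (\<lambda>_. 0)"
        using less.prems(1) K by (intro mat_eq_0[OF \<phi>c]) (fastforce simp: raises_def)
      with raises_zero[of k "m - 1"] show ?thesis by (intro exI[of _ "\<lambda>_. 0"]) simp
    next
      case False
      have "leading m \<phi> a b \<in> hom_coboundaries C (c a) (c' b) (m - k)"
        if ab: "a \<in> I" "b \<in> J" "h b = g a + k" for a b
      proof (cases "k = m")
        case True then show ?thesis using less.prems(4)[OF ab] by simp
      next
        case False
        \<comment> \<open>Up to sign this entry is the coboundary of the leading entry, which is
          thereby seen to be a cocycle.\<close>
        have D0: "mat (m + 1) (hom_diff C P Q m \<phi>) a b n = 0" for n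
          using less.prems(2) ab by (simp add: hom_cocycles_def mat_zero)
        have "hom_diff C (c a) (c' b) (m - k) (leading m \<phi> a b) p = 0" for p
          using mat_hom_diff_leading[OF less.prems(1) ab, of "p + g a"] D0 by simp
        then have "leading m \<phi> a b \<in> hom_cocycles C (c a) (c' b) (m - k)"
          using leading_closed[OF \<phi>c ab] by (auto simp: hom_cocycles_def)
        moreover have "m - k < 0" using less.prems(3) False by simp
        ultimately show ?thesis
          using acyclic[OF ab(1,2)] unfolding acyclic_below_def by blast
      qed
      from filtration_step[OF less.prems(1,2) this] obtain \<psi>
        where \<psi>: "raises k (m - 1) \<psi>" "raises (k + 1) m (\<lambda>i. \<phi> i - hom_diff C P Q (m - 1) \<psi> i)"
        by blast
      have \<psi>c: "\<psi> \<in> hom_cx C P Q (m - 1)" using \<psi> by (simp add: raises_def)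
      have "hom_diff C P Q (m - 1) \<psi> \<in> hom_cocycles C P Q m"
        by (rule coboundary_cocycle[OF _ _ coboundaryI[OF _ _ \<psi>c refl]]) simp_all
      then have "(\<lambda>i. \<phi> i - hom_diff C P Q (m - 1) \<psi> i) \<in> hom_cocycles C P Q m"
        using less.prems(2) by (intro cocycle_sub) simp_all
      then obtain \<psi>' where \<psi>': "raises (k + 1) (m - 1) \<psi>'"
          "(\<lambda>i. \<phi> i - hom_diff C P Q (m - 1) \<psi> i) = hom_diff C P Q (m - 1) \<psi>'"
        using less.hyps[OF _ \<psi>(2)] less.prems(3) False by force
      have \<psi>'c: "\<psi>' \<in> hom_cx C P Q (m - 1)" using \<psi>' by (simp add: raises_def)
      have r': "raises k (m - 1) \<psi>'" using \<psi>'(1) by (auto simp: raises_def)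
      \<comment> \<open>The sum of the two primitives is written as a difference to fit
        \<open>raises_sub\<close>.\<close>
      have "raises k (m - 1) (\<lambda>i. \<psi> i - (0 - \<psi>' i))" by (intro raises_sub raises_zero r' \<psi>(1))
      moreover have "\<phi> = hom_diff C P Q (m - 1) (\<lambda>i. \<psi> i + \<psi>' i)"
        using \<psi>'(2) hom_diff_add[OF _ _ \<psi>c \<psi>'c] by (simp add: fun_eq_iff diff_eq_eq add.commute)
      ultimately show ?thesis by (intro exI[of _ "\<lambda>i. \<psi> i + \<psi>' i"]) simp
    qed
  qed
qed

text \<open>This is \<open>filtration_exact\<close> for the difference of the two cocycles, in
  degree m = 0 at height k = 0; its lowest entries are the differences of the diagonals.\<close>

lemma filtered_homotopic:
  assumes U: "U \<in> hom_cocycles C P Q 0" "raises 0 0 U" and V: "V \<in> hom_cocycles C P Q 0" "raises 0 0 V"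
    and lead: "\<And>a b. \<lbrakk>a \<in> I; b \<in> J; h b = g a\<rbrakk> \<Longrightarrow> homotopic C (c a) (c' b) (leading 0 U a b) (leading 0 V a b)"
  shows "homotopic C P Q U V"
proof -
  have c: "U \<in> hom_cx C P Q 0" "V \<in> hom_cx C P Q 0" using U V by (auto dest: hom_cocyclesD)
  have "leading 0 (\<lambda>i. U i - V i) a b = (\<lambda>p. leading 0 U a b p - leading 0 V a b p)"
    if "a \<in> I" "b \<in> J" for a b
    using mat_sub[OF c that] by (auto simp: leading_def)
  then obtain \<psi> where "raises 0 (0 - 1) \<psi>" "(\<lambda>i. U i - V i) = hom_diff C P Q (0 - 1) \<psi>"
    using filtration_exact[OF raises_sub[OF U(2) V(2)] cocycle_sub[OF _ _ U(1) V(1)]] lead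
    by (auto simp: homotopic_def)
  then show ?thesis
    unfolding homotopic_def by (intro coboundaryI) (auto simp: raises_def)
qed

text \<open>The diagonal of \<open>U\<close> consists of cocycles, so the coboundary of
  \<open>U\<close> raises the filtration by 1. As it has degree 1, its entries at height 1 have
  degree 0 and form the first obstruction. The correction also raises the filtration by 1 and
  therefore leaves the diagonal alone.\<close>

lemma filtered_cocycle_extend:
  assumes U: "raises 0 0 U"
    and lead: "\<And>a b. \<lbrakk>a \<in> I; b \<in> J; h b = g a\<rbrakk> \<Longrightarrow> leading 0 U a b \<in> hom_cocycles C (c a) (c' b) 0"
    and first: "\<And>a b. \<lbrakk>a \<in> I; b \<in> J; h b = g a + 1\<rbrakk> \<Longrightarrow>
      leading 1 (hom_diff C P Q 0 U) a b \<in> hom_coboundaries C (c a) (c' b) 0"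
  shows "\<exists>T \<in> hom_cocycles C P Q 0. raises 0 0 T \<and> (\<forall>a\<in>I. \<forall>b\<in>J. h b = g a \<longrightarrow> leading 0 T a b = leading 0 U a b)"
proof -
  have Uc: "U \<in> hom_cx C P Q 0" using U by (simp add: raises_def)
  have DU: "hom_diff C P Q 0 U \<in> hom_cocycles C P Q 1"
    by (rule coboundary_cocycle[OF _ _ coboundaryI[of _ _ U]]) (simp_all add: Uc)
  have "mat 1 (hom_diff C P Q 0 U) a b n = 0" if ab: "a \<in> I" "b \<in> J" "h b < g a + 1" for a b n
  proof (cases "h b = g a")
    case True
    have "hom_diff C (c a) (c' b) 0 (leading 0 U a b) = (\<lambda>_. 0)"
      using lead[OF ab(1,2) True] by (simp add: hom_cocycles_def)
    then show ?thesis
      using mat_hom_diff_leading[OF U ab(1,2), of n] True by simp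
  next
    case False
    then show ?thesis using mat_hom_diff_low[OF U ab(1,2), of n] ab by simp
  qed
  then have "raises 1 1 (hom_diff C P Q 0 U)"
    using DU by (auto simp: raises_def dest: hom_cocyclesD)
  from filtration_exact[OF this DU] first obtain \<psi>
    where \<psi>: "raises 1 0 \<psi>" "hom_diff C P Q 0 U = hom_diff C P Q 0 \<psi>" by auto
  have \<psi>c: "\<psi> \<in> hom_cx C P Q 0" using \<psi> by (simp add: raises_def)
  have "raises 0 0 \<psi>" using \<psi>(1) by (auto simp: raises_def)
  then have "raises 0 0 (\<lambda>i. U i - \<psi> i)" by (intro raises_sub U)
  moreover have "(\<lambda>i. U i - \<psi> i) \<in> hom_cocycles C P Q 0"
    using hom_cx_sub[OF _ _ Uc \<psi>c] hom_diff_sub[OF _ _ Uc \<psi>c] \<psi>(2) by (simp add: hom_cocycles_def)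
  moreover have "leading 0 (\<lambda>i. U i - \<psi> i) a b = leading 0 U a b" if "a \<in> I" "b \<in> J" "h b = g a" for a b
    using mat_sub[OF Uc \<psi>c that(1,2)] \<psi>(1) that by (auto simp: leading_def raises_def)
  ultimately show ?thesis by blast
qed

end

end

declare source_simps [simp del] target_simps [simp del]

text \<open>The start is the family with \<open>t a\<close> on the diagonal and 0 elsewhere. The
  entries of its coboundary at height 1 measure the failure of the \<open>t a\<close> to commute
  with the connecting maps of the two filtrations, which \<open>nat\<close> makes
  null-homotopic.\<close>

lemma filtered_cocycle_exists:
  fixes I :: "'a set"
  assumes FP: "filtered C P I g c \<iota> \<pi>" and FQ: "filtered C Q I g c' \<iota>' \<pi>'"
    and acyclic: "\<And>a b. a \<in> I \<Longrightarrow> b \<in> I \<Longrightarrow> acyclic_below (c a) (c' b)"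
    and t: "\<And>a. a \<in> I \<Longrightarrow> t a \<in> hom_cocycles C (c a) (c' a) 0"
    and nat: "\<And>a b. \<lbrakk>a \<in> I; b \<in> I; g b = g a + 1\<rbrakk> \<Longrightarrow>
      (\<lambda>p. mor (\<pi>' b (p + g a + 1) \<odot>\<^bsub>C\<^esub> tmap Q Q 1 (diff Q) (p + g a) \<odot>\<^bsub>C\<^esub> \<iota>' a (p + g a)) \<cdot>\<^bsub>C\<^esub> t a p
         - t b p \<cdot>\<^bsub>C\<^esub> mor (\<pi> b (p + g a + 1) \<odot>\<^bsub>C\<^esub> tmap P P 1 (diff P) (p + g a) \<odot>\<^bsub>C\<^esub> \<iota> a (p + g a)))
      \<in> hom_coboundaries C (c a) (c' b) 0"
  shows "\<exists>T \<in> hom_cocycles C P Q 0.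
    (\<forall>a\<in>I. \<forall>b\<in>I. \<forall>n. g b < g a \<or> g b = g a \<and> a \<noteq> b \<longrightarrow> mor (\<pi>' b n \<odot>\<^bsub>C\<^esub> tmap P Q 0 T n \<odot>\<^bsub>C\<^esub> \<iota> a n) = 0) \<and>
    (\<forall>a\<in>I. \<forall>n. mor (\<pi>' a n \<odot>\<^bsub>C\<^esub> tmap P Q 0 T n \<odot>\<^bsub>C\<^esub> \<iota> a n) = t a (n - g a))"
proof -
  note source = filtered_cplx[OF FP] filtered_inj[OF FP] filtered_prj[OF FP]
  note target = filtered_cplx[OF FQ] filtered_inj[OF FQ] filtered_prj[OF FQ]
  define W where "W a b n = (if a = b then t a (n - g a) else 0)" for a b n
  have th: "t a p \<in> Hom C (ob (c a) p) (ob (c' a) p)" if "a \<in> I" for a p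
    using hom_cx_0D[OF hom_cocyclesD[OF t[OF that]]] .
  have W: "W a b n \<in> Hom C (ob (c a) (n - g a)) (ob (c' b) (n + 0 - g b))" if "a \<in> I" "b \<in> I" for a b n
    using th[of a "n - g a"] that source target by (auto simp: W_def)
  define U where "U = assemble I g c \<pi> I g c' \<iota>' 0 W"
  have Uc: "U \<in> hom_cx C P Q 0" unfolding U_def by (rule assemble_closed[OF FP FQ W])
  have matU: "mat P \<iota> Q \<pi>' 0 U a b n = W a b n" if "a \<in> I" "b \<in> I" for a b n
    unfolding U_def by (rule mat_assemble[OF FP FQ W that])
  have r: "raises TYPE('a) TYPE('a) P I g \<iota> Q I g \<pi>' 0 0 U"
    using Uc matU by (auto simp: raises_def[OF FP FQ] W_def)
  note leading = leading_def[OF FP FQ] and mat = mat_def[OF FP FQ] and raises = raises_def[OF FP FQ]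
  have dia: "leading P g \<iota> Q \<pi>' 0 U a b = (if a = b then t a else (\<lambda>_. 0))" if "a \<in> I" "b \<in> I" for a b
    using matU[OF that] by (auto simp: leading W_def)
  have "leading P g \<iota> Q \<pi>' 0 U a b \<in> hom_cocycles C (c a) (c' b) 0" if "a \<in> I" "b \<in> I" for a b
    using t that source target by (simp add: dia)
  moreover have "leading P g \<iota> Q \<pi>' 1 (hom_diff C P Q 0 U) a b \<in> hom_coboundaries C (c a) (c' b) 0"
    if a: "a \<in> I" and b: "b \<in> I" and gb: "g b = g a + 1" for a b
  proof -
    have "leading P g \<iota> Q \<pi>' 1 (hom_diff C P Q 0 U) a b p
      = mor (\<pi>' b (p + g a + 1) \<odot>\<^bsub>C\<^esub> tmap Q Q 1 (diff Q) (p + g a) \<odot>\<^bsub>C\<^esub> \<iota>' a (p + g a)) \<cdot>\<^bsub>C\<^esub> t a p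
         - t b p \<cdot>\<^bsub>C\<^esub> mor (\<pi> b (p + g a + 1) \<odot>\<^bsub>C\<^esub> tmap P P 1 (diff P) (p + g a) \<odot>\<^bsub>C\<^esub> \<iota> a (p + g a))" for p
    proof -
      let ?n = "p + g a"
      let ?q = "\<lambda>y. \<pi>' b (?n + 0 + 1) \<odot>\<^bsub>C\<^esub> tmap Q Q 1 (diff Q) (?n + 0) \<odot>\<^bsub>C\<^esub> \<iota>' y (?n + 0)"
      let ?p = "\<lambda>x. \<pi> x (?n + 1) \<odot>\<^bsub>C\<^esub> tmap P P 1 (diff P) ?n \<odot>\<^bsub>C\<^esub> \<iota> a ?n"
      \<comment> \<open>As \<open>U\<close> is diagonal, a single term of each matrix product
        remains.\<close>
      have 1: "(\<Sum>y\<in>I. mor (?q y) \<cdot>\<^bsub>C\<^esub> mat P \<iota> Q \<pi>' 0 U a y ?n) = mor (?q a) \<cdot>\<^bsub>C\<^esub> mat P \<iota> Q \<pi>' 0 U a a ?n"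
      proof (rule sum_eq_single[OF filtered_finite[OF FQ] a])
        fix y assume y: "y \<in> I" "y \<noteq> a"
        have "valid C (?q y)" using y b by (simp add: target)
        then show "mor (?q y) \<cdot>\<^bsub>C\<^esub> mat P \<iota> Q \<pi>' 0 U a y ?n = 0"
          using y valid_comp_zero matU[OF a y(1)] by (simp add: W_def del: arr_fields(3))
      qed
      have 2: "(\<Sum>x\<in>I. mat P \<iota> Q \<pi>' 0 U x b (?n + 1) \<cdot>\<^bsub>C\<^esub> mor (?p x)) = mat P \<iota> Q \<pi>' 0 U b b (?n + 1) \<cdot>\<^bsub>C\<^esub> mor (?p b)"
      proof (rule sum_eq_single[OF filtered_finite[OF FP] b])
        fix x assume x: "x \<in> I" "x \<noteq> b"
        have "valid C (?p x)" using x a by (simp add: source)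
        then show "mat P \<iota> Q \<pi>' 0 U x b (?n + 1) \<cdot>\<^bsub>C\<^esub> mor (?p x) = 0"
          using x valid_comp_zero matU[OF x(1) b] by (simp add: W_def del: arr_fields(3))
      qed
      show ?thesis
        using mat_hom_diff[OF FP FQ Uc a b, of ?n] unfolding 1 2
        using matU[OF a a] matU[OF b b] gb by (simp add: leading W_def)
    qed
    then show ?thesis using nat[OF a b gb] by presburger
  qed
  ultimately obtain T where T: "T \<in> hom_cocycles C P Q 0" "raises TYPE('a) TYPE('a) P I g \<iota> Q I g \<pi>' 0 0 T"
    "\<And>a b. a \<in> I \<Longrightarrow> b \<in> I \<Longrightarrow> g b = g a \<Longrightarrow> leading P g \<iota> Q \<pi>' 0 T a b = leading P g \<iota> Q \<pi>' 0 U a b"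
    using filtered_cocycle_extend[OF FP FQ acyclic r] by blast
  \<comment> \<open>Distinct columns may share a filtration degree; \<open>T\<close> agrees with
    \<open>U\<close> on such pairs and hence vanishes there.\<close>
  have "mat P \<iota> Q \<pi>' 0 T a b n = (if a = b then t a (n - g a) else 0)" if "a \<in> I" "b \<in> I" "g b = g a" for a b n
    using fun_cong[OF T(3)[OF that], of "n - g a"] dia[OF that(1,2)] by (simp add: leading)
  moreover have "mat P \<iota> Q \<pi>' 0 T a b n = 0" if "a \<in> I" "b \<in> I" "g b < g a" for a b n
    using T(2) that by (simp add: raises)
  ultimately show ?thesis
    using T(1) by (intro bexI[of _ T]) (auto simp: mat)
qed

end

section \<open>Columns of total tensor products and the induced filtrations\<close>

definition rcol :: "('o2, 'm2, 'x2) cat_scheme \<Rightarrow> ('o1, 'm1, 'o2, 'm2, 'o3, 'm3) bifun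
    \<Rightarrow> ('o1, 'm1) cochain \<Rightarrow> 'o2 \<Rightarrow> ('o3, 'm3) cochain" where
  "rcol B F K W = \<lparr>ob = (\<lambda>n. ob K n \<star>\<^bsub>F\<^esub> W), diff = (\<lambda>n. diff K n \<otimes>\<^bsub>F\<^esub> Ident B W)\<rparr>"

text \<open>Columns are formed degree by degree, without the chosen direct sums of
  \<open>tot\<close>. Up to isomorphism they are the total tensor products with the object placed in
  degree 0.\<close>

definition lcol :: "('o1, 'm1, 'x1) cat_scheme \<Rightarrow> ('o1, 'm1, 'o2, 'm2, 'o3, 'm3) bifun
    \<Rightarrow> 'o1 \<Rightarrow> ('o2, 'm2) cochain \<Rightarrow> ('o3, 'm3) cochain" where
  "lcol A F W K = \<lparr>ob = (\<lambda>n. W \<star>\<^bsub>F\<^esub> ob K n), diff = (\<lambda>n. Ident A W \<otimes>\<^bsub>F\<^esub> diff K n)\<rparr>"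

lemma col_fields [simp]:
  "ob (rcol B F K W) n = ob K n \<star>\<^bsub>F\<^esub> W" "diff (rcol B F K W) n = diff K n \<otimes>\<^bsub>F\<^esub> Ident B W"
  "ob (lcol A F V L) n = V \<star>\<^bsub>F\<^esub> ob L n" "diff (lcol A F V L) n = Ident A V \<otimes>\<^bsub>F\<^esub> diff L n"
  by (simp_all add: rcol_def lcol_def)

text \<open>A complex as its own single column: the start from which the filtrations of double and
  triple products are built.\<close>

lemma (in linear_category) filtered_trivial:
  assumes "cplx C Z"
  shows "filtered C Z {()} (\<lambda>_. 0) (\<lambda>_. Z) (\<lambda>_ n. tid C (ob Z n)) (\<lambda>_ n. tid C (ob Z n))"
proof -
  have "tid C (ob Z (n + 1)) \<odot>\<^bsub>C\<^esub> tmap Z Z 1 (diff Z) n \<odot>\<^bsub>C\<^esub> tid C (ob Z n) = tmap Z Z 1 (diff Z) n" for n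
    using assms by simp
  from arg_cong[where f = mor, OF this] show ?thesis
    using assms comp_ident_left[OF _ _ ident_closed] by (auto simp: filtered_def)
qed

context tensor_functor
begin

lemma cplx_rcol [simp]:
  assumes K: "cplx A K" and W: "W \<in> Obj B" shows "cplx D (rcol B F K W)"
proof -
  have e: "(tmap K K 1 (diff K) (i + 1) \<Otimes>\<^bsub>F\<^esub> tid B W) \<odot>\<^bsub>D\<^esub> (tmap K K 1 (diff K) i \<Otimes>\<^bsub>F\<^esub> tid B W)
    = tzero (ob K i \<star>\<^bsub>F\<^esub> W) (ob K (i + 1 + 1) \<star>\<^bsub>F\<^esub> W)" for i
    using assms by simp
  have v: "valid D (tmap K K 1 (diff K) i \<Otimes>\<^bsub>F\<^esub> tid B W)" for i using assms by simp
  show ?thesis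
    using arg_cong[where f = mor, OF e] v assms by (auto simp: cplx_def valid_def)
qed

lemma cplx_lcol [simp]:
  assumes K: "cplx B K" and W: "W \<in> Obj A" shows "cplx D (lcol A F W K)"
proof -
  have e: "(tid A W \<Otimes>\<^bsub>F\<^esub> tmap K K 1 (diff K) (i + 1)) \<odot>\<^bsub>D\<^esub> (tid A W \<Otimes>\<^bsub>F\<^esub> tmap K K 1 (diff K) i)
    = tzero (W \<star>\<^bsub>F\<^esub> ob K i) (W \<star>\<^bsub>F\<^esub> ob K (i + 1 + 1))" for i
    using assms by simp
  have v: "valid D (tid A W \<Otimes>\<^bsub>F\<^esub> tmap K K 1 (diff K) i)" for i using assms by simp
  show ?thesis
    using arg_cong[where f = mor, OF e] v assms by (auto simp: cplx_def valid_def)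
qed

text \<open>Additivity of the tensor product in its first argument. The arrows p and r are carried
  along because the sum to be expanded stands inside a composite.\<close>

lemma sum_tten_left:
  assumes "finite S" "\<And>a. a \<in> S \<Longrightarrow> f a \<in> Hom A X X'" "X \<in> Obj A" "X' \<in> Obj A" "valid B q" "valid D p" "valid D r"
    "src p = X' \<star>\<^bsub>F\<^esub> tgt q" "tgt r = X \<star>\<^bsub>F\<^esub> src q"
  shows "mor (p \<odot>\<^bsub>D\<^esub> (\<lparr>src = X, tgt = X', mor = \<Sum>a\<in>S. f a\<rparr> \<Otimes>\<^bsub>F\<^esub> q) \<odot>\<^bsub>D\<^esub> r)
    = (\<Sum>a\<in>S. mor (p \<odot>\<^bsub>D\<^esub> (\<lparr>src = X, tgt = X', mor = f a\<rparr> \<Otimes>\<^bsub>F\<^esub> q) \<odot>\<^bsub>D\<^esub> r))"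
  using assms(1,2)
proof (induction S)
  case empty
  have 1: "\<lparr>src = X, tgt = X', mor = 0 :: 'm1\<rparr> = tzero X X'" by (simp add: tzero_def)
  have 2: "p \<odot>\<^bsub>D\<^esub> (tzero X X' \<Otimes>\<^bsub>F\<^esub> q) \<odot>\<^bsub>D\<^esub> r = tzero (src r) (tgt p)"
    using assms(3-) by (simp add: valid_def)
  show ?case unfolding sum.empty 1 2 by (rule arr_fields(15))
next
  case (insert a S)
  have h: "f a \<in> Hom A X X'" "(\<Sum>a\<in>S. f a) \<in> Hom A X X'"
    using insert.prems assms(3,4) by (auto intro: A.hom_sum)
  have v: "valid A \<lparr>src = X, tgt = X', mor = f a\<rparr>" "valid A \<lparr>src = X, tgt = X', mor = \<Sum>a\<in>S. f a\<rparr>"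
    using h assms(3,4) by (simp_all add: valid_def)
  have "\<lparr>src = X, tgt = X', mor = \<Sum>a\<in>insert a S. f a\<rparr>
    = \<lparr>src = X, tgt = X', mor = f a\<rparr> \<oplus> \<lparr>src = X, tgt = X', mor = \<Sum>a\<in>S. f a\<rparr>"
    using insert.hyps by (simp add: tadd_def)
  then have "p \<odot>\<^bsub>D\<^esub> (\<lparr>src = X, tgt = X', mor = \<Sum>a\<in>insert a S. f a\<rparr> \<Otimes>\<^bsub>F\<^esub> q) \<odot>\<^bsub>D\<^esub> r
    = (p \<odot>\<^bsub>D\<^esub> (\<lparr>src = X, tgt = X', mor = f a\<rparr> \<Otimes>\<^bsub>F\<^esub> q) \<odot>\<^bsub>D\<^esub> r)
      \<oplus> (p \<odot>\<^bsub>D\<^esub> (\<lparr>src = X, tgt = X', mor = \<Sum>a\<in>S. f a\<rparr> \<Otimes>\<^bsub>F\<^esub> q) \<odot>\<^bsub>D\<^esub> r)"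
    using v assms(3-) by simp
  from arg_cong[where f = mor, OF this] show ?case
    using insert.hyps insert.IH insert.prems by simp
qed

lemma sum_tten_right:
  assumes "finite S" "\<And>a. a \<in> S \<Longrightarrow> f a \<in> Hom B X X'" "X \<in> Obj B" "X' \<in> Obj B" "valid A q" "valid D p" "valid D r"
    "src p = tgt q \<star>\<^bsub>F\<^esub> X'" "tgt r = src q \<star>\<^bsub>F\<^esub> X"
  shows "mor (p \<odot>\<^bsub>D\<^esub> (q \<Otimes>\<^bsub>F\<^esub> \<lparr>src = X, tgt = X', mor = \<Sum>a\<in>S. f a\<rparr>) \<odot>\<^bsub>D\<^esub> r)
    = (\<Sum>a\<in>S. mor (p \<odot>\<^bsub>D\<^esub> (q \<Otimes>\<^bsub>F\<^esub> \<lparr>src = X, tgt = X', mor = f a\<rparr>) \<odot>\<^bsub>D\<^esub> r))"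
  using assms(1,2)
proof (induction S)
  case empty
  have 1: "\<lparr>src = X, tgt = X', mor = 0 :: 'm2\<rparr> = tzero X X'" by (simp add: tzero_def)
  have 2: "p \<odot>\<^bsub>D\<^esub> (q \<Otimes>\<^bsub>F\<^esub> tzero X X') \<odot>\<^bsub>D\<^esub> r = tzero (src r) (tgt p)"
    using assms(3-) by (simp add: valid_def)
  show ?case unfolding sum.empty 1 2 by (rule arr_fields(15))
next
  case (insert a S)
  have h: "f a \<in> Hom B X X'" "(\<Sum>a\<in>S. f a) \<in> Hom B X X'"
    using insert.prems assms(3,4) by (auto intro: B.hom_sum)
  have v: "valid B \<lparr>src = X, tgt = X', mor = f a\<rparr>" "valid B \<lparr>src = X, tgt = X', mor = \<Sum>a\<in>S. f a\<rparr>"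
    using h assms(3,4) by (simp_all add: valid_def)
  have "\<lparr>src = X, tgt = X', mor = \<Sum>a\<in>insert a S. f a\<rparr>
    = \<lparr>src = X, tgt = X', mor = f a\<rparr> \<oplus> \<lparr>src = X, tgt = X', mor = \<Sum>a\<in>S. f a\<rparr>"
    using insert.hyps by (simp add: tadd_def)
  then have "p \<odot>\<^bsub>D\<^esub> (q \<Otimes>\<^bsub>F\<^esub> \<lparr>src = X, tgt = X', mor = \<Sum>a\<in>insert a S. f a\<rparr>) \<odot>\<^bsub>D\<^esub> r
    = (p \<odot>\<^bsub>D\<^esub> (q \<Otimes>\<^bsub>F\<^esub> \<lparr>src = X, tgt = X', mor = f a\<rparr>) \<odot>\<^bsub>D\<^esub> r)
      \<oplus> (p \<odot>\<^bsub>D\<^esub> (q \<Otimes>\<^bsub>F\<^esub> \<lparr>src = X, tgt = X', mor = \<Sum>a\<in>S. f a\<rparr>) \<odot>\<^bsub>D\<^esub> r)"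
    using v assms(3-) by simp
  from arg_cong[where f = mor, OF this] show ?case
    using insert.hyps insert.IH insert.prems by simp
qed

end

text \<open>The column a of \<open>K\<close> is met here in inner degree p = n - j - g a.
  Conjugation with (-1)^(j p) turns the diagonal sign (-1)^(g a) into (-1)^(g a + j), as
  \<open>filtered\<close> demands, and turns the Koszul sign (-1)^(n - j) of the differential of
  \<open>Y\<close> into (-1)^(g a).\<close>

definition rinj ::
  "('o2, 'm2, 'x2) cat_scheme \<Rightarrow> ('o3, 'm3::ab_group_add, 'x3) cat_scheme \<Rightarrow> ('o1, 'm1, 'o2, 'm2, 'o3, 'm3) bifun
    \<Rightarrow> ('a \<Rightarrow> int) \<Rightarrow> ('a \<Rightarrow> int \<Rightarrow> ('o1, 'm1) arr) \<Rightarrow> ('o1, 'm1) cochain \<Rightarrow> ('o2, 'm2) cochain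
    \<Rightarrow> 'a \<times> int \<Rightarrow> int \<Rightarrow> ('o3, 'm3) arr" where
  "rinj B D F g \<iota> K Y = (\<lambda>(a, j) n. tsgn (j * (n - j - g a))
    (tinj D F K Y n (n - j) \<odot>\<^bsub>D\<^esub> (\<iota> a (n - j) \<Otimes>\<^bsub>F\<^esub> tid B (ob Y j))))"

definition rprj ::
  "('o2, 'm2, 'x2) cat_scheme \<Rightarrow> ('o3, 'm3::ab_group_add, 'x3) cat_scheme \<Rightarrow> ('o1, 'm1, 'o2, 'm2, 'o3, 'm3) bifun
    \<Rightarrow> ('a \<Rightarrow> int) \<Rightarrow> ('a \<Rightarrow> int \<Rightarrow> ('o1, 'm1) arr) \<Rightarrow> ('o1, 'm1) cochain \<Rightarrow> ('o2, 'm2) cochain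
    \<Rightarrow> 'a \<times> int \<Rightarrow> int \<Rightarrow> ('o3, 'm3) arr" where
  "rprj B D F g \<pi> K Y = (\<lambda>(a, j) n. tsgn (j * (n - j - g a))
    ((\<pi> a (n - j) \<Otimes>\<^bsub>F\<^esub> tid B (ob Y j)) \<odot>\<^bsub>D\<^esub> tprj D F K Y n (n - j)))"

text \<open>On this side the Koszul sign (-1)^i in front of the differential of \<open>K\<close>
  already turns (-1)^(g a) into (-1)^(i + g a), so the inclusions carry no sign.\<close>

definition linj ::
  "('o1, 'm1, 'x1) cat_scheme \<Rightarrow> ('o3, 'm3::ab_group_add, 'x3) cat_scheme \<Rightarrow> ('o1, 'm1, 'o2, 'm2, 'o3, 'm3) bifun
    \<Rightarrow> ('a \<Rightarrow> int \<Rightarrow> ('o2, 'm2) arr) \<Rightarrow> ('o1, 'm1) cochain \<Rightarrow> ('o2, 'm2) cochain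
    \<Rightarrow> int \<times> 'a \<Rightarrow> int \<Rightarrow> ('o3, 'm3) arr" where
  "linj A D F \<iota> X K = (\<lambda>(i, a) n. tinj D F X K n i \<odot>\<^bsub>D\<^esub> (tid A (ob X i) \<Otimes>\<^bsub>F\<^esub> \<iota> a (n - i)))"

definition lprj ::
  "('o1, 'm1, 'x1) cat_scheme \<Rightarrow> ('o3, 'm3::ab_group_add, 'x3) cat_scheme \<Rightarrow> ('o1, 'm1, 'o2, 'm2, 'o3, 'm3) bifun
    \<Rightarrow> ('a \<Rightarrow> int \<Rightarrow> ('o2, 'm2) arr) \<Rightarrow> ('o1, 'm1) cochain \<Rightarrow> ('o2, 'm2) cochain
    \<Rightarrow> int \<times> 'a \<Rightarrow> int \<Rightarrow> ('o3, 'm3) arr" where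
  "lprj A D F \<pi> X K = (\<lambda>(i, a) n. (tid A (ob X i) \<Otimes>\<^bsub>F\<^esub> \<pi> a (n - i)) \<odot>\<^bsub>D\<^esub> tprj D F X K n i)"

context tensor_functor
begin

context
  fixes K Y I g c \<iota> \<pi> JJ
  assumes K [simp]: "bounded_complex A K" and Y [simp]: "bounded_complex B Y"
    and FK: "filtered A K I g c \<iota> \<pi>"
    and JJ: "finite JJ" "\<And>j. j \<notin> JJ \<Longrightarrow> is_zero B (ob Y j)"
begin

lemma rinj_typing:
  assumes a: "a \<in> I"
  shows "valid D (rinj B D F g \<iota> K Y (a, j) n)"
    "src (rinj B D F g \<iota> K Y (a, j) n) = ob (c a) (n - (g a + j)) \<star>\<^bsub>F\<^esub> ob Y j"
    "tgt (rinj B D F g \<iota> K Y (a, j) n) = ob (tot A B D F K Y) n"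
    "valid D (rprj B D F g \<pi> K Y (a, j) n)"
    "tgt (rprj B D F g \<pi> K Y (a, j) n) = ob (c a) (n - (g a + j)) \<star>\<^bsub>F\<^esub> ob Y j"
    "src (rprj B D F g \<pi> K Y (a, j) n) = ob (tot A B D F K Y) n"
  using a by (simp_all add: rinj_def rprj_def A.filtered_inj[OF FK] A.filtered_prj[OF FK] algebra_simps)

lemma rprj_rinj:
  assumes a: "a \<in> I" and b: "b \<in> I"
  shows "mor (rprj B D F g \<pi> K Y (b, k) n \<odot>\<^bsub>D\<^esub> rinj B D F g \<iota> K Y (a, j) n)
    = (if (a, j) = (b, k) then Ident D (ob (c a) (n - (g a + j)) \<star>\<^bsub>F\<^esub> ob Y j) else 0)"
proof -
  note f = A.filtered_inj[OF FK] A.filtered_prj[OF FK] A.filtered_prj_inj[OF FK] A.filtered_cplx[OF FK]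
  have "rprj B D F g \<pi> K Y (b, k) n \<odot>\<^bsub>D\<^esub> rinj B D F g \<iota> K Y (a, j) n
    = (if (a, j) = (b, k) then tid D (ob (c a) (n - (g a + j)) \<star>\<^bsub>F\<^esub> ob Y j)
       else tzero (ob (c a) (n - (g a + j)) \<star>\<^bsub>F\<^esub> ob Y j) (ob (c b) (n - (g b + k)) \<star>\<^bsub>F\<^esub> ob Y k))"
    using a b D.tcomp_reduce[OF tprj_tinj[OF K Y]] D.tcomp_reduce[OF tprj_tinj_neq[OF K Y]]
    by (cases "j = k"; cases "a = b") (simp_all add: rinj_def rprj_def f diff_diff_eq ac_simps tsgn_even)
  then show ?thesis by (simp del: arr_fields(3))
qed

text \<open>From index j the total differential leads only to j, through \<open>K\<close>, and to j
  + 1, through \<open>Y\<close>. The exponents collect the signs of projection, Koszul rule and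
  inclusion.\<close>

lemma rprj_diff_rinj:
  assumes a: "a \<in> I" and b: "b \<in> I"
  shows "k = j \<Longrightarrow> rprj B D F g \<pi> K Y (b, k) (n + 1) \<odot>\<^bsub>D\<^esub>
      tmap (tot A B D F K Y) (tot A B D F K Y) 1 (diff (tot A B D F K Y)) n \<odot>\<^bsub>D\<^esub> rinj B D F g \<iota> K Y (a, j) n
    = tsgn (j * (n + 1 - j - g b) + j * (n - j - g a))
        ((\<pi> b (n - j + 1) \<odot>\<^bsub>A\<^esub> tmap K K 1 (diff K) (n - j) \<odot>\<^bsub>A\<^esub> \<iota> a (n - j)) \<Otimes>\<^bsub>F\<^esub> tid B (ob Y j))"
    and "k = j + 1 \<Longrightarrow> rprj B D F g \<pi> K Y (b, k) (n + 1) \<odot>\<^bsub>D\<^esub>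
      tmap (tot A B D F K Y) (tot A B D F K Y) 1 (diff (tot A B D F K Y)) n \<odot>\<^bsub>D\<^esub> rinj B D F g \<iota> K Y (a, j) n
    = tsgn ((j + 1) * (n - j - g b) + (n - j) + j * (n - j - g a))
        ((\<pi> b (n - j) \<odot>\<^bsub>A\<^esub> \<iota> a (n - j)) \<Otimes>\<^bsub>F\<^esub> tmap Y Y 1 (diff Y) j)"
    and "k \<noteq> j \<Longrightarrow> k \<noteq> j + 1 \<Longrightarrow> mor (rprj B D F g \<pi> K Y (b, k) (n + 1) \<odot>\<^bsub>D\<^esub>
      tmap (tot A B D F K Y) (tot A B D F K Y) 1 (diff (tot A B D F K Y)) n \<odot>\<^bsub>D\<^esub> rinj B D F g \<iota> K Y (a, j) n) = 0"
proof -
  note f = A.filtered_inj[OF FK] A.filtered_prj[OF FK] A.filtered_cplx[OF FK]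
  note red = D.tcomp_reduce[OF tprj_tinj[OF K Y]] D.tcomp_reduce[OF tprj_tinj_neq[OF K Y]]
  let ?d = "tmap (tot A B D F K Y) (tot A B D F K Y) 1 (diff (tot A B D F K Y)) n"
  have d: "?d \<odot>\<^bsub>D\<^esub> rinj B D F g \<iota> K Y (a, j) n = tsgn (j * (n - j - g a))
     ((tinj D F K Y (n + 1) (n - j + 1) \<odot>\<^bsub>D\<^esub> ((tmap K K 1 (diff K) (n - j) \<odot>\<^bsub>A\<^esub> \<iota> a (n - j)) \<Otimes>\<^bsub>F\<^esub> tid B (ob Y j)))
      \<oplus> tsgn (n - j) (tinj D F K Y (n + 1) (n - j) \<odot>\<^bsub>D\<^esub> (\<iota> a (n - j) \<Otimes>\<^bsub>F\<^esub> tmap Y Y 1 (diff Y) j)))"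
    using a by (simp add: rinj_def f tot_diff_tinj_tail algebra_simps)
  show "rprj B D F g \<pi> K Y (b, k) (n + 1) \<odot>\<^bsub>D\<^esub> ?d \<odot>\<^bsub>D\<^esub> rinj B D F g \<iota> K Y (a, j) n
    = tsgn (j * (n + 1 - j - g b) + j * (n - j - g a))
        ((\<pi> b (n - j + 1) \<odot>\<^bsub>A\<^esub> tmap K K 1 (diff K) (n - j) \<odot>\<^bsub>A\<^esub> \<iota> a (n - j)) \<Otimes>\<^bsub>F\<^esub> tid B (ob Y j))"
    if "k = j"
    unfolding d using a b that red by (simp add: rprj_def f algebra_simps)
  show "rprj B D F g \<pi> K Y (b, k) (n + 1) \<odot>\<^bsub>D\<^esub> ?d \<odot>\<^bsub>D\<^esub> rinj B D F g \<iota> K Y (a, j) n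
    = tsgn ((j + 1) * (n - j - g b) + (n - j) + j * (n - j - g a))
        ((\<pi> b (n - j) \<odot>\<^bsub>A\<^esub> \<iota> a (n - j)) \<Otimes>\<^bsub>F\<^esub> tmap Y Y 1 (diff Y) j)"
    if "k = j + 1"
    unfolding d using a b that red by (simp add: rprj_def f algebra_simps)
  have "rprj B D F g \<pi> K Y (b, k) (n + 1) \<odot>\<^bsub>D\<^esub> ?d \<odot>\<^bsub>D\<^esub> rinj B D F g \<iota> K Y (a, j) n
    = tzero (ob (c a) (n - (g a + j)) \<star>\<^bsub>F\<^esub> ob Y j) (ob (c b) (n + 1 - (g b + k)) \<star>\<^bsub>F\<^esub> ob Y k)"
    if "k \<noteq> j" "k \<noteq> j + 1"
    unfolding d using a b that red by (simp add: rprj_def f algebra_simps)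
  then show "mor (rprj B D F g \<pi> K Y (b, k) (n + 1) \<odot>\<^bsub>D\<^esub> ?d \<odot>\<^bsub>D\<^esub> rinj B D F g \<iota> K Y (a, j) n) = 0"
    if "k \<noteq> j" "k \<noteq> j + 1"
    using that by (simp del: arr_fields(3))
qed

text \<open>Summation over the columns of \<open>K\<close> gives the identity of each K^(n - j)
  \<star> Y^j; summation over j then gives the identity of the total object.\<close>

lemma rinj_rprj_sum:
  "(\<Sum>x\<in>I \<times> JJ. mor (rinj B D F g \<iota> K Y x n \<odot>\<^bsub>D\<^esub> rprj B D F g \<pi> K Y x n)) = Ident D (ob (tot A B D F K Y) n)"
proof -
  note f = A.filtered_inj[OF FK] A.filtered_prj[OF FK] A.filtered_cplx[OF FK]
  have 1: "rinj B D F g \<iota> K Y (a, j) n \<odot>\<^bsub>D\<^esub> rprj B D F g \<pi> K Y (a, j) n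
    = tinj D F K Y n (n - j) \<odot>\<^bsub>D\<^esub> (\<lparr>src = ob K (n - j), tgt = ob K (n - j), mor = mor (\<iota> a (n - j) \<odot>\<^bsub>A\<^esub> \<pi> a (n - j))\<rparr>
        \<Otimes>\<^bsub>F\<^esub> tid B (ob Y j)) \<odot>\<^bsub>D\<^esub> tprj D F K Y n (n - j)" if a: "a \<in> I" for a j
  proof -
    have e: "\<lparr>src = ob K (n - j), tgt = ob K (n - j), mor = mor (\<iota> a (n - j) \<odot>\<^bsub>A\<^esub> \<pi> a (n - j))\<rparr>
      = \<iota> a (n - j) \<odot>\<^bsub>A\<^esub> \<pi> a (n - j)"
      using a f by (intro arr_eqI) simp_all
    show ?thesis unfolding e using a by (simp add: rinj_def rprj_def f algebra_simps tsgn_even)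
  qed
  have 2: "(\<Sum>a\<in>I. mor (rinj B D F g \<iota> K Y (a, j) n \<odot>\<^bsub>D\<^esub> rprj B D F g \<pi> K Y (a, j) n))
    = inj (tot_sum D F K Y n) (n - j) \<cdot>\<^bsub>D\<^esub> prj (tot_sum D F K Y n) (n - j)" for j
  proof -
    have v: "valid A (\<iota> a (n - j) \<odot>\<^bsub>A\<^esub> \<pi> a (n - j))" if "a \<in> I" for a using that by (simp add: f)
    then have h: "mor (\<iota> a (n - j) \<odot>\<^bsub>A\<^esub> \<pi> a (n - j)) \<in> Hom A (ob K (n - j)) (ob K (n - j))" if "a \<in> I" for a
      using v[OF that] that f unfolding valid_def by simp
    have "(\<Sum>a\<in>I. mor (rinj B D F g \<iota> K Y (a, j) n \<odot>\<^bsub>D\<^esub> rprj B D F g \<pi> K Y (a, j) n))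
      = (\<Sum>a\<in>I. mor (tinj D F K Y n (n - j) \<odot>\<^bsub>D\<^esub> (\<lparr>src = ob K (n - j), tgt = ob K (n - j),
          mor = mor (\<iota> a (n - j) \<odot>\<^bsub>A\<^esub> \<pi> a (n - j))\<rparr> \<Otimes>\<^bsub>F\<^esub> tid B (ob Y j)) \<odot>\<^bsub>D\<^esub> tprj D F K Y n (n - j)))"
      by (intro sum.cong refl arg_cong[where f = mor] 1)
    also have "\<dots> = mor (tinj D F K Y n (n - j) \<odot>\<^bsub>D\<^esub> (\<lparr>src = ob K (n - j), tgt = ob K (n - j),
          mor = \<Sum>a\<in>I. mor (\<iota> a (n - j) \<odot>\<^bsub>A\<^esub> \<pi> a (n - j))\<rparr> \<Otimes>\<^bsub>F\<^esub> tid B (ob Y j)) \<odot>\<^bsub>D\<^esub> tprj D F K Y n (n - j))"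
      by (rule sum_tten_left[OF A.filtered_finite[OF FK] h, symmetric]) simp_all
    also have "\<lparr>src = ob K (n - j), tgt = ob K (n - j),
          mor = \<Sum>a\<in>I. mor (\<iota> a (n - j) \<odot>\<^bsub>A\<^esub> \<pi> a (n - j))\<rparr> = tid A (ob K (n - j))"
      unfolding A.filtered_sum[OF FK] by (simp add: tid_def)
    also have "tinj D F K Y n (n - j) \<odot>\<^bsub>D\<^esub> (tid A (ob K (n - j)) \<Otimes>\<^bsub>F\<^esub> tid B (ob Y j)) \<odot>\<^bsub>D\<^esub> tprj D F K Y n (n - j)
      = tinj D F K Y n (n - j) \<odot>\<^bsub>D\<^esub> tprj D F K Y n (n - j)" by simp
    finally show ?thesis by simp
  qed
  have "(\<Sum>x\<in>I \<times> JJ. mor (rinj B D F g \<iota> K Y x n \<odot>\<^bsub>D\<^esub> rprj B D F g \<pi> K Y x n))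
    = (\<Sum>j\<in>JJ. \<Sum>a\<in>I. mor (rinj B D F g \<iota> K Y (a, j) n \<odot>\<^bsub>D\<^esub> rprj B D F g \<pi> K Y (a, j) n))"
    by (subst sum.swap) (simp add: sum.cartesian_product case_prod_unfold del: arr_fields(3))
  also have "\<dots> = (\<Sum>j\<in>JJ. inj (tot_sum D F K Y n) (n - j) \<cdot>\<^bsub>D\<^esub> prj (tot_sum D F K Y n) (n - j))"
    unfolding 2 ..
  \<comment> \<open>The total object is indexed by the degree i = n - j of the first factor, the
    filtration by the degree j of the second.\<close>
  also have "\<dots> = (\<Sum>i\<in>(\<lambda>j. n - j) ` JJ. inj (tot_sum D F K Y n) i \<cdot>\<^bsub>D\<^esub> prj (tot_sum D F K Y n) i)"
    by (subst sum.reindex) (auto simp: inj_on_def)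
  also have "\<dots> = Ident D (sum_ob (tot_sum D F K Y n))"
  proof (rule tot_sum_ident[OF K Y])
    show "finite ((\<lambda>j. n - j) ` JJ)" using JJ by simp
    fix i assume "i \<notin> (\<lambda>j. n - j) ` JJ"
    then have "n - i \<notin> JJ" by force
    then show "is_zero D (ob K i \<star>\<^bsub>F\<^esub> ob Y (n - i))" using JJ(2) by (intro is_zero_tensor_right) simp_all
  qed
  finally show ?thesis by simp
qed

text \<open>A column of \<open>K\<close> tensored with one degree of \<open>Y\<close> is a column of
  the product, and filtration degrees add. The result is again \<open>filtered\<close>, so the
  construction can be repeated for triple products.\<close>

lemma filtered_tot_right:
  "filtered D (tot A B D F K Y) (I \<times> JJ) (\<lambda>(a, j). g a + j) (\<lambda>(a, j). rcol B F (c a) (ob Y j))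
    (rinj B D F g \<iota> K Y) (rprj B D F g \<pi> K Y)"
proof -
  let ?d = "\<lambda>n. tmap (tot A B D F K Y) (tot A B D F K Y) 1 (diff (tot A B D F K Y)) n"
  note f = A.filtered_inj[OF FK] A.filtered_prj[OF FK] A.filtered_cplx[OF FK]
  have diag: "mor (rprj B D F g \<pi> K Y (a, j) (n + 1) \<odot>\<^bsub>D\<^esub> ?d n \<odot>\<^bsub>D\<^esub> rinj B D F g \<iota> K Y (a, j) n)
    = ksign (g a + j) (diff (c a) (n - (g a + j)) \<otimes>\<^bsub>F\<^esub> Ident B (ob Y j))" if a: "a \<in> I" for a j n
  proof -
    have 1: "\<pi> a (n - j + 1) \<odot>\<^bsub>A\<^esub> tmap K K 1 (diff K) (n - j) \<odot>\<^bsub>A\<^esub> \<iota> a (n - j)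
      = tsgn (g a) (tmap (c a) (c a) 1 (diff (c a)) (n - j - g a))"
      using A.filtered_diag[OF FK a, of "n - j"] a by (intro arr_eqI) (simp_all add: f algebra_simps)
    \<comment> \<open>With p the inner degree, the exponents j (p + 1) and j p leave (-1)^j.\<close>
    have 2: "tsgn (j * (n + 1 - j - g a) + j * (n - j - g a) + g a) u = tsgn (g a + j) u" for u :: "('e, 'm3) arr"
      by (rule tsgn_cong) auto
    have "rprj B D F g \<pi> K Y (a, j) (n + 1) \<odot>\<^bsub>D\<^esub> ?d n \<odot>\<^bsub>D\<^esub> rinj B D F g \<iota> K Y (a, j) n
      = tsgn (j * (n + 1 - j - g a) + j * (n - j - g a) + g a)
        (tmap (c a) (c a) 1 (diff (c a)) (n - j - g a) \<Otimes>\<^bsub>F\<^esub> tid B (ob Y j))"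
      unfolding rprj_diff_rinj(1)[OF a a refl] 1 using a by (simp add: f)
    then show ?thesis unfolding 2 by (simp add: diff_diff_eq ac_simps)
  qed
  have off: "mor (rprj B D F g \<pi> K Y (b, k) (n + 1) \<odot>\<^bsub>D\<^esub> ?d n \<odot>\<^bsub>D\<^esub> rinj B D F g \<iota> K Y (a, j) n) = 0"
    if ab: "a \<in> I" "b \<in> I" "(a, j) \<noteq> (b, k)" "g b + k \<le> g a + j" for a b j k n
  proof -
    consider "k = j" | "k = j + 1" | "k \<noteq> j" "k \<noteq> j + 1" by blast
    then show ?thesis
    proof cases
      case 1
      then have "mor (\<pi> b (n - j + 1) \<odot>\<^bsub>A\<^esub> tmap K K 1 (diff K) (n - j) \<odot>\<^bsub>A\<^esub> \<iota> a (n - j)) = 0"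
        using A.filtered_off[OF FK ab(1,2)] ab by simp
      then have "\<pi> b (n - j + 1) \<odot>\<^bsub>A\<^esub> tmap K K 1 (diff K) (n - j) \<odot>\<^bsub>A\<^esub> \<iota> a (n - j)
        = tzero (ob (c a) (n - j - g a)) (ob (c b) (n - j + 1 - g b))"
        using ab by (intro arr_eqI) (simp_all add: f)
      then show ?thesis unfolding rprj_diff_rinj(1)[OF ab(1,2) 1] using ab by (simp add: f del: arr_fields(3))
    next
      case 2
      \<comment> \<open>With a = b this step would raise the filtration degree by one, contrary to
        the assumption on the degrees.\<close>
      then have "a \<noteq> b" using ab by auto
      then show ?thesis unfolding rprj_diff_rinj(2)[OF ab(1,2) 2]
        using ab by (simp add: f A.filtered_prj_inj[OF FK] del: arr_fields(3))
    next
      case 3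
      then show ?thesis using rprj_diff_rinj(3)[OF ab(1,2)] by (simp del: arr_fields(3))
    qed
  qed
  show ?thesis
    unfolding filtered_def
    using A.filtered_finite[OF FK] JJ(1) diag off rprj_rinj rinj_typing rinj_rprj_sum
    by (auto simp del: arr_fields(3) simp: f)
qed

text \<open>For a complex with a single column in filtration degree 0 the sign is trivial, and the
  connecting map is the differential of \<open>Y\<close> itself.\<close>

lemma rprj_diff_rinj_next:
  assumes a: "a \<in> I"
  shows "mor (rprj B D F g \<pi> K Y (a, j + 1) (n + 1) \<odot>\<^bsub>D\<^esub>
      tmap (tot A B D F K Y) (tot A B D F K Y) 1 (diff (tot A B D F K Y)) n \<odot>\<^bsub>D\<^esub> rinj B D F g \<iota> K Y (a, j) n)
    = ksign (g a) (Ident A (ob (c a) (n - j - g a)) \<otimes>\<^bsub>F\<^esub> diff Y j)"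
proof -
  have "ksign ((j + 1) * (n - j - g a) + (n - j) + j * (n - j - g a)) x = ksign (g a) x" for x :: 'm3
    by (rule ksign_cong) auto
  then show ?thesis
    unfolding rprj_diff_rinj(2)[OF a a refl] using a by (simp add: A.filtered_prj_inj[OF FK])
qed

end

context
  fixes X K I g c \<iota> \<pi> JJ
  assumes X [simp]: "bounded_complex A X" and K [simp]: "bounded_complex B K"
    and FK: "filtered B K I g c \<iota> \<pi>"
    and JJ: "finite JJ" "\<And>j. j \<notin> JJ \<Longrightarrow> is_zero A (ob X j)"
begin

lemma linj_typing:
  assumes a: "a \<in> I"
  shows "valid D (linj A D F \<iota> X K (i, a) n)"
    "src (linj A D F \<iota> X K (i, a) n) = ob X i \<star>\<^bsub>F\<^esub> ob (c a) (n - (i + g a))"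
    "tgt (linj A D F \<iota> X K (i, a) n) = ob (tot A B D F X K) n"
    "valid D (lprj A D F \<pi> X K (i, a) n)"
    "tgt (lprj A D F \<pi> X K (i, a) n) = ob X i \<star>\<^bsub>F\<^esub> ob (c a) (n - (i + g a))"
    "src (lprj A D F \<pi> X K (i, a) n) = ob (tot A B D F X K) n"
  using a by (simp_all add: linj_def lprj_def B.filtered_inj[OF FK] B.filtered_prj[OF FK] algebra_simps)

lemma lprj_linj:
  assumes a: "a \<in> I" and b: "b \<in> I"
  shows "mor (lprj A D F \<pi> X K (k, b) n \<odot>\<^bsub>D\<^esub> linj A D F \<iota> X K (i, a) n)
    = (if (i, a) = (k, b) then Ident D (ob X i \<star>\<^bsub>F\<^esub> ob (c a) (n - (i + g a))) else 0)"
proof -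
  note f = B.filtered_inj[OF FK] B.filtered_prj[OF FK] B.filtered_prj_inj[OF FK] B.filtered_cplx[OF FK]
  have "lprj A D F \<pi> X K (k, b) n \<odot>\<^bsub>D\<^esub> linj A D F \<iota> X K (i, a) n
    = (if (i, a) = (k, b) then tid D (ob X i \<star>\<^bsub>F\<^esub> ob (c a) (n - (i + g a)))
       else tzero (ob X i \<star>\<^bsub>F\<^esub> ob (c a) (n - (i + g a))) (ob X k \<star>\<^bsub>F\<^esub> ob (c b) (n - (k + g b))))"
    using a b D.tcomp_reduce[OF tprj_tinj[OF X K]] D.tcomp_reduce[OF tprj_tinj_neq[OF X K]]
    by (cases "i = k"; cases "a = b") (simp_all add: linj_def lprj_def f diff_diff_eq ac_simps)
  then show ?thesis by (simp del: arr_fields(3))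
qed

lemma lprj_diff_linj:
  assumes a: "a \<in> I" and b: "b \<in> I"
  shows "k = i \<Longrightarrow> lprj A D F \<pi> X K (k, b) (n + 1) \<odot>\<^bsub>D\<^esub>
      tmap (tot A B D F X K) (tot A B D F X K) 1 (diff (tot A B D F X K)) n \<odot>\<^bsub>D\<^esub> linj A D F \<iota> X K (i, a) n
    = tsgn i (tid A (ob X i) \<Otimes>\<^bsub>F\<^esub> (\<pi> b (n - i + 1) \<odot>\<^bsub>B\<^esub> tmap K K 1 (diff K) (n - i) \<odot>\<^bsub>B\<^esub> \<iota> a (n - i)))"
    and "k = i + 1 \<Longrightarrow> lprj A D F \<pi> X K (k, b) (n + 1) \<odot>\<^bsub>D\<^esub>
      tmap (tot A B D F X K) (tot A B D F X K) 1 (diff (tot A B D F X K)) n \<odot>\<^bsub>D\<^esub> linj A D F \<iota> X K (i, a) n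
    = tmap X X 1 (diff X) i \<Otimes>\<^bsub>F\<^esub> (\<pi> b (n - i) \<odot>\<^bsub>B\<^esub> \<iota> a (n - i))"
    and "k \<noteq> i \<Longrightarrow> k \<noteq> i + 1 \<Longrightarrow> mor (lprj A D F \<pi> X K (k, b) (n + 1) \<odot>\<^bsub>D\<^esub>
      tmap (tot A B D F X K) (tot A B D F X K) 1 (diff (tot A B D F X K)) n \<odot>\<^bsub>D\<^esub> linj A D F \<iota> X K (i, a) n) = 0"
proof -
  note f = B.filtered_inj[OF FK] B.filtered_prj[OF FK] B.filtered_cplx[OF FK]
  note red = D.tcomp_reduce[OF tprj_tinj[OF X K]] D.tcomp_reduce[OF tprj_tinj_neq[OF X K]]
  let ?d = "tmap (tot A B D F X K) (tot A B D F X K) 1 (diff (tot A B D F X K)) n"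
  have d: "?d \<odot>\<^bsub>D\<^esub> linj A D F \<iota> X K (i, a) n =
     (tinj D F X K (n + 1) (i + 1) \<odot>\<^bsub>D\<^esub> (tmap X X 1 (diff X) i \<Otimes>\<^bsub>F\<^esub> \<iota> a (n - i)))
      \<oplus> tsgn i (tinj D F X K (n + 1) i \<odot>\<^bsub>D\<^esub> (tid A (ob X i) \<Otimes>\<^bsub>F\<^esub> (tmap K K 1 (diff K) (n - i) \<odot>\<^bsub>B\<^esub> \<iota> a (n - i))))"
    using a by (simp add: linj_def f tot_diff_tinj_tail algebra_simps)
  show "lprj A D F \<pi> X K (k, b) (n + 1) \<odot>\<^bsub>D\<^esub> ?d \<odot>\<^bsub>D\<^esub> linj A D F \<iota> X K (i, a) n
    = tsgn i (tid A (ob X i) \<Otimes>\<^bsub>F\<^esub> (\<pi> b (n - i + 1) \<odot>\<^bsub>B\<^esub> tmap K K 1 (diff K) (n - i) \<odot>\<^bsub>B\<^esub> \<iota> a (n - i)))"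
    if "k = i"
    unfolding d using a b that red by (simp add: lprj_def f algebra_simps)
  show "lprj A D F \<pi> X K (k, b) (n + 1) \<odot>\<^bsub>D\<^esub> ?d \<odot>\<^bsub>D\<^esub> linj A D F \<iota> X K (i, a) n
    = tmap X X 1 (diff X) i \<Otimes>\<^bsub>F\<^esub> (\<pi> b (n - i) \<odot>\<^bsub>B\<^esub> \<iota> a (n - i))"
    if "k = i + 1"
    unfolding d using a b that red by (simp add: lprj_def f algebra_simps)
  have "lprj A D F \<pi> X K (k, b) (n + 1) \<odot>\<^bsub>D\<^esub> ?d \<odot>\<^bsub>D\<^esub> linj A D F \<iota> X K (i, a) n
    = tzero (ob X i \<star>\<^bsub>F\<^esub> ob (c a) (n - (i + g a))) (ob X k \<star>\<^bsub>F\<^esub> ob (c b) (n + 1 - (k + g b)))"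
    if "k \<noteq> i" "k \<noteq> i + 1"
    unfolding d using a b that red by (simp add: lprj_def f algebra_simps)
  then show "mor (lprj A D F \<pi> X K (k, b) (n + 1) \<odot>\<^bsub>D\<^esub> ?d \<odot>\<^bsub>D\<^esub> linj A D F \<iota> X K (i, a) n) = 0"
    if "k \<noteq> i" "k \<noteq> i + 1"
    using that by (simp del: arr_fields(3))
qed

lemma linj_lprj_sum:
  "(\<Sum>x\<in>JJ \<times> I. mor (linj A D F \<iota> X K x n \<odot>\<^bsub>D\<^esub> lprj A D F \<pi> X K x n)) = Ident D (ob (tot A B D F X K) n)"
proof -
  note f = B.filtered_inj[OF FK] B.filtered_prj[OF FK] B.filtered_cplx[OF FK]
  have 1: "linj A D F \<iota> X K (i, a) n \<odot>\<^bsub>D\<^esub> lprj A D F \<pi> X K (i, a) n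
    = tinj D F X K n i \<odot>\<^bsub>D\<^esub> (tid A (ob X i) \<Otimes>\<^bsub>F\<^esub> \<lparr>src = ob K (n - i), tgt = ob K (n - i), mor = mor (\<iota> a (n - i) \<odot>\<^bsub>B\<^esub> \<pi> a (n - i))\<rparr>)
        \<odot>\<^bsub>D\<^esub> tprj D F X K n i" if a: "a \<in> I" for a i
  proof -
    have e: "\<lparr>src = ob K (n - i), tgt = ob K (n - i), mor = mor (\<iota> a (n - i) \<odot>\<^bsub>B\<^esub> \<pi> a (n - i))\<rparr>
      = \<iota> a (n - i) \<odot>\<^bsub>B\<^esub> \<pi> a (n - i)"
      using a f by (intro arr_eqI) simp_all
    show ?thesis unfolding e using a by (simp add: linj_def lprj_def f algebra_simps tsgn_even)
  qed
  have 2: "(\<Sum>a\<in>I. mor (linj A D F \<iota> X K (i, a) n \<odot>\<^bsub>D\<^esub> lprj A D F \<pi> X K (i, a) n))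
    = inj (tot_sum D F X K n) i \<cdot>\<^bsub>D\<^esub> prj (tot_sum D F X K n) i" for i
  proof -
    have v: "valid B (\<iota> a (n - i) \<odot>\<^bsub>B\<^esub> \<pi> a (n - i))" if "a \<in> I" for a using that by (simp add: f)
    then have h: "mor (\<iota> a (n - i) \<odot>\<^bsub>B\<^esub> \<pi> a (n - i)) \<in> Hom B (ob K (n - i)) (ob K (n - i))" if "a \<in> I" for a
      using v[OF that] that f unfolding valid_def by simp
    have "(\<Sum>a\<in>I. mor (linj A D F \<iota> X K (i, a) n \<odot>\<^bsub>D\<^esub> lprj A D F \<pi> X K (i, a) n))
      = (\<Sum>a\<in>I. mor (tinj D F X K n i \<odot>\<^bsub>D\<^esub> (tid A (ob X i) \<Otimes>\<^bsub>F\<^esub> \<lparr>src = ob K (n - i), tgt = ob K (n - i),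
          mor = mor (\<iota> a (n - i) \<odot>\<^bsub>B\<^esub> \<pi> a (n - i))\<rparr>) \<odot>\<^bsub>D\<^esub> tprj D F X K n i))"
      by (intro sum.cong refl arg_cong[where f = mor] 1)
    also have "\<dots> = mor (tinj D F X K n i \<odot>\<^bsub>D\<^esub> (tid A (ob X i) \<Otimes>\<^bsub>F\<^esub> \<lparr>src = ob K (n - i), tgt = ob K (n - i),
          mor = \<Sum>a\<in>I. mor (\<iota> a (n - i) \<odot>\<^bsub>B\<^esub> \<pi> a (n - i))\<rparr>) \<odot>\<^bsub>D\<^esub> tprj D F X K n i)"
      by (rule sum_tten_right[OF B.filtered_finite[OF FK] h, symmetric]) simp_all
    also have "\<lparr>src = ob K (n - i), tgt = ob K (n - i),
          mor = \<Sum>a\<in>I. mor (\<iota> a (n - i) \<odot>\<^bsub>B\<^esub> \<pi> a (n - i))\<rparr> = tid B (ob K (n - i))"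
      unfolding B.filtered_sum[OF FK] by (simp add: tid_def)
    also have "tinj D F X K n i \<odot>\<^bsub>D\<^esub> (tid A (ob X i) \<Otimes>\<^bsub>F\<^esub> tid B (ob K (n - i))) \<odot>\<^bsub>D\<^esub> tprj D F X K n i
      = tinj D F X K n i \<odot>\<^bsub>D\<^esub> tprj D F X K n i" by simp
    finally show ?thesis by simp
  qed
  have "(\<Sum>x\<in>JJ \<times> I. mor (linj A D F \<iota> X K x n \<odot>\<^bsub>D\<^esub> lprj A D F \<pi> X K x n))
    = (\<Sum>i\<in>JJ. \<Sum>a\<in>I. mor (linj A D F \<iota> X K (i, a) n \<odot>\<^bsub>D\<^esub> lprj A D F \<pi> X K (i, a) n))"
    by (simp add: sum.cartesian_product case_prod_unfold del: arr_fields(3))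
  also have "\<dots> = (\<Sum>i\<in>JJ. inj (tot_sum D F X K n) i \<cdot>\<^bsub>D\<^esub> prj (tot_sum D F X K n) i)"
    unfolding 2 ..
  also have "\<dots> = Ident D (sum_ob (tot_sum D F X K n))"
  proof (rule tot_sum_ident[OF X K JJ(1)])
    fix i assume "i \<notin> JJ"
    then show "is_zero D (ob X i \<star>\<^bsub>F\<^esub> ob K (n - i))" using JJ(2) by (intro is_zero_tensor_left) simp_all
  qed
  finally show ?thesis by simp
qed

lemma filtered_tot_left:
  "filtered D (tot A B D F X K) (JJ \<times> I) (\<lambda>(i, a). i + g a) (\<lambda>(i, a). lcol A F (ob X i) (c a))
    (linj A D F \<iota> X K) (lprj A D F \<pi> X K)"
proof -
  let ?d = "\<lambda>n. tmap (tot A B D F X K) (tot A B D F X K) 1 (diff (tot A B D F X K)) n"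
  note f = B.filtered_inj[OF FK] B.filtered_prj[OF FK] B.filtered_cplx[OF FK]
  have diag: "mor (lprj A D F \<pi> X K (i, a) (n + 1) \<odot>\<^bsub>D\<^esub> ?d n \<odot>\<^bsub>D\<^esub> linj A D F \<iota> X K (i, a) n)
    = ksign (i + g a) (Ident A (ob X i) \<otimes>\<^bsub>F\<^esub> diff (c a) (n - (i + g a)))" if a: "a \<in> I" for a i n
  proof -
    have 1: "\<pi> a (n - i + 1) \<odot>\<^bsub>B\<^esub> tmap K K 1 (diff K) (n - i) \<odot>\<^bsub>B\<^esub> \<iota> a (n - i)
      = tsgn (g a) (tmap (c a) (c a) 1 (diff (c a)) (n - i - g a))"
      using B.filtered_diag[OF FK a, of "n - i"] a by (intro arr_eqI) (simp_all add: f algebra_simps)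
    show ?thesis
      unfolding lprj_diff_linj(1)[OF a a refl] 1 using a by (simp add: f diff_diff_eq ac_simps)
  qed
  have off: "mor (lprj A D F \<pi> X K (k, b) (n + 1) \<odot>\<^bsub>D\<^esub> ?d n \<odot>\<^bsub>D\<^esub> linj A D F \<iota> X K (i, a) n) = 0"
    if ab: "a \<in> I" "b \<in> I" "(i, a) \<noteq> (k, b)" "k + g b \<le> i + g a" for a b i k n
  proof -
    consider "k = i" | "k = i + 1" | "k \<noteq> i" "k \<noteq> i + 1" by blast
    then show ?thesis
    proof cases
      case 1
      then have "mor (\<pi> b (n - i + 1) \<odot>\<^bsub>B\<^esub> tmap K K 1 (diff K) (n - i) \<odot>\<^bsub>B\<^esub> \<iota> a (n - i)) = 0"
        using B.filtered_off[OF FK ab(1,2)] ab by simp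
      then have "\<pi> b (n - i + 1) \<odot>\<^bsub>B\<^esub> tmap K K 1 (diff K) (n - i) \<odot>\<^bsub>B\<^esub> \<iota> a (n - i)
        = tzero (ob (c a) (n - i - g a)) (ob (c b) (n - i + 1 - g b))"
        using ab by (intro arr_eqI) (simp_all add: f)
      then show ?thesis unfolding lprj_diff_linj(1)[OF ab(1,2) 1] using ab by (simp add: f del: arr_fields(3))
    next
      case 2
      then have "a \<noteq> b" using ab by auto
      then show ?thesis unfolding lprj_diff_linj(2)[OF ab(1,2) 2]
        using ab by (simp add: f B.filtered_prj_inj[OF FK] del: arr_fields(3))
    next
      case 3
      then show ?thesis using lprj_diff_linj(3)[OF ab(1,2)] by (simp del: arr_fields(3))
    qed
  qed
  show ?thesis
    unfolding filtered_def
    using B.filtered_finite[OF FK] JJ(1) diag off lprj_linj linj_typing linj_lprj_sum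
    by (auto simp del: arr_fields(3) simp: f)
qed

lemma lprj_diff_linj_next:
  assumes a: "a \<in> I"
  shows "mor (lprj A D F \<pi> X K (i + 1, a) (n + 1) \<odot>\<^bsub>D\<^esub>
      tmap (tot A B D F X K) (tot A B D F X K) 1 (diff (tot A B D F X K)) n \<odot>\<^bsub>D\<^esub> linj A D F \<iota> X K (i, a) n)
    = diff X i \<otimes>\<^bsub>F\<^esub> Ident B (ob (c a) (n - i - g a))"
  unfolding lprj_diff_linj(2)[OF a a refl] using a by (simp add: B.filtered_prj_inj[OF FK])

end

end

section \<open>The associator of total tensor products\<close>

text \<open>The family whose class is \<open>Kb_assoc\<close>, split off for calculations in
  components.\<close>

definition tot_assoc ::
  "('o1, 'm1, 'x1) cat_scheme \<Rightarrow> ('o2, 'm2, 'x2) cat_scheme \<Rightarrow> ('o3, 'm3, 'x3) cat_scheme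
    \<Rightarrow> ('o5, 'm5::ab_group_add, 'x5) cat_scheme \<Rightarrow> ('o6, 'm6::ab_group_add, 'x6) cat_scheme
    \<Rightarrow> ('o4, 'm4::ab_group_add, 'x4) cat_scheme
    \<Rightarrow> ('o1, 'm1, 'o2, 'm2, 'o5, 'm5) bifun \<Rightarrow> ('o5, 'm5, 'o3, 'm3, 'o4, 'm4) bifun
    \<Rightarrow> ('o2, 'm2, 'o3, 'm3, 'o6, 'm6) bifun \<Rightarrow> ('o1, 'm1, 'o6, 'm6, 'o4, 'm4) bifun
    \<Rightarrow> ('o1 \<Rightarrow> 'o2 \<Rightarrow> 'o3 \<Rightarrow> 'm4)
    \<Rightarrow> ('o1, 'm1) cochain \<Rightarrow> ('o2, 'm2) cochain \<Rightarrow> ('o3, 'm3) cochain \<Rightarrow> int \<Rightarrow> 'm4" where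
  "tot_assoc P Q S R V U F1 F2 F3 F4 \<alpha> X Y Z n =
    (let XY = tot P Q R F1 X Y; YZ = tot Q S V F3 Y Z in
       \<Sum>p | \<not> is_zero U (ob XY p \<star>\<^bsub>F2\<^esub> ob Z (n - p)).
            \<Sum>i | \<not> is_zero R (ob X i \<star>\<^bsub>F1\<^esub> ob Y (p - i)).
              inj (tot_sum U F4 X YZ n) i
              \<cdot>\<^bsub>U\<^esub> (Ident P (ob X i) \<otimes>\<^bsub>F4\<^esub> inj (tot_sum V F3 Y Z (n - i)) (p - i))
              \<cdot>\<^bsub>U\<^esub> \<alpha> (ob X i) (ob Y (p - i)) (ob Z (n - p))
              \<cdot>\<^bsub>U\<^esub> (prj (tot_sum R F1 X Y p) i \<otimes>\<^bsub>F2\<^esub> Ident S (ob Z (n - p)))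
              \<cdot>\<^bsub>U\<^esub> prj (tot_sum U F2 XY Z n) p)"

lemma Kb_assoc_eq: "Kb_assoc P Q S R V U F1 F2 F3 F4 \<alpha> X Y Z =
  kclass U (tot R S U F2 (tot P Q R F1 X Y) Z) (tot P V U F4 X (tot Q S V F3 Y Z))
    (tot_assoc P Q S R V U F1 F2 F3 F4 \<alpha> X Y Z)"
  by (simp add: Kb_assoc_def tot_assoc_def[abs_def] Let_def)

locale tensor_associator =
  T1: tensor_functor P sP Q sQ R sR F1 + T2: tensor_functor R sR S sS U sU F2 +
  T3: tensor_functor Q sQ S sS V sV F3 + T4: tensor_functor P sP V sV U sU F4 +
  associativity_constraint P Q S U F1 F2 F3 F4 \<alpha>
  for P :: "('o1, 'm1::ab_group_add, 'x1) cat_scheme" and sP :: "'k::comm_ring_1 \<Rightarrow> 'm1 \<Rightarrow> 'm1"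
    and Q :: "('o2, 'm2::ab_group_add, 'x2) cat_scheme" and sQ :: "'k \<Rightarrow> 'm2 \<Rightarrow> 'm2"
    and S :: "('o3, 'm3::ab_group_add, 'x3) cat_scheme" and sS :: "'k \<Rightarrow> 'm3 \<Rightarrow> 'm3"
    and R :: "('o5, 'm5::ab_group_add, 'x5) cat_scheme" and sR :: "'k \<Rightarrow> 'm5 \<Rightarrow> 'm5"
    and V :: "('o6, 'm6::ab_group_add, 'x6) cat_scheme" and sV :: "'k \<Rightarrow> 'm6 \<Rightarrow> 'm6"
    and U :: "('o4, 'm4::ab_group_add, 'x4) cat_scheme" and sU :: "'k \<Rightarrow> 'm4 \<Rightarrow> 'm4"
    and F1 :: "('o1, 'm1, 'o2, 'm2, 'o5, 'm5) bifun" and F2 :: "('o5, 'm5, 'o3, 'm3, 'o4, 'm4) bifun"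
    and F3 :: "('o2, 'm2, 'o3, 'm3, 'o6, 'm6) bifun" and F4 :: "('o1, 'm1, 'o6, 'm6, 'o4, 'm4) bifun"
    and \<alpha> :: "'o1 \<Rightarrow> 'o2 \<Rightarrow> 'o3 \<Rightarrow> 'm4"
begin

definition tas :: "'o1 \<Rightarrow> 'o2 \<Rightarrow> 'o3 \<Rightarrow> ('o4, 'm4) arr" where
  "tas X Y Z = \<lparr>src = (X \<star>\<^bsub>F1\<^esub> Y) \<star>\<^bsub>F2\<^esub> Z, tgt = X \<star>\<^bsub>F4\<^esub> (Y \<star>\<^bsub>F3\<^esub> Z), mor = \<alpha> X Y Z\<rparr>"

lemma tas_fields [simp]:
  "src (tas X Y Z) = (X \<star>\<^bsub>F1\<^esub> Y) \<star>\<^bsub>F2\<^esub> Z" "tgt (tas X Y Z) = X \<star>\<^bsub>F4\<^esub> (Y \<star>\<^bsub>F3\<^esub> Z)"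
  "mor (tas X Y Z) = \<alpha> X Y Z"
  by (simp_all add: tas_def)

lemma valid_tas [simp]: "X \<in> Obj P \<Longrightarrow> Y \<in> Obj Q \<Longrightarrow> Z \<in> Obj S \<Longrightarrow> valid U (tas X Y Z)"
  using assoc_iso by (simp add: valid_def is_iso_def)

lemma tas_natural:
  assumes "valid P f" "valid Q g" "valid S h" "X = tgt f" "Y = tgt g" "Z = tgt h"
  shows "tas X Y Z \<odot>\<^bsub>U\<^esub> ((f \<Otimes>\<^bsub>F1\<^esub> g) \<Otimes>\<^bsub>F2\<^esub> h)
    = (f \<Otimes>\<^bsub>F4\<^esub> (g \<Otimes>\<^bsub>F3\<^esub> h)) \<odot>\<^bsub>U\<^esub> tas (src f) (src g) (src h)"
  using assms by (intro arr_eqI) (auto simp: valid_def intro!: assoc_natural)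

text \<open>Tensoring with \<open>W\<close> is additive, so the decomposition of the identity of the
  total object survives it.\<close>

lemma T2_ext_left:
  assumes X: "bounded_complex P X" and Y: "bounded_complex Q Y" and W: "W \<in> Obj S"
    and u: "valid U u" "src u = sum_ob (tot_sum R F1 X Y p) \<star>\<^bsub>F2\<^esub> W"
    and v: "valid U v" "src v = src u" "tgt v = tgt u"
    and eq: "\<And>i. u \<odot>\<^bsub>U\<^esub> (tinj R F1 X Y p i \<Otimes>\<^bsub>F2\<^esub> tid S W) = v \<odot>\<^bsub>U\<^esub> (tinj R F1 X Y p i \<Otimes>\<^bsub>F2\<^esub> tid S W)"
  shows "u = v"
proof -
  let ?S = "{i. \<not> is_zero R (ob X i \<star>\<^bsub>F1\<^esub> ob Y (p - i))}"
  let ?O = "sum_ob (tot_sum R F1 X Y p)"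
  let ?e = "\<lambda>i. inj (tot_sum R F1 X Y p) i \<cdot>\<^bsub>R\<^esub> prj (tot_sum R F1 X Y p) i"
  have ve: "valid R (tinj R F1 X Y p i \<odot>\<^bsub>R\<^esub> tprj R F1 X Y p i)" for i using X Y by simp
  then have he: "?e i \<in> Hom R ?O ?O" for i by (simp add: valid_def)
  have e: "\<lparr>src = ?O, tgt = ?O, mor = ?e i\<rparr> = tinj R F1 X Y p i \<odot>\<^bsub>R\<^esub> tprj R F1 X Y p i" for i
    by (simp add: tcomp_def)
  have one: "\<lparr>src = ?O, tgt = ?O, mor = \<Sum>i\<in>?S. ?e i\<rparr> = tid R ?O"
    using T1.tot_sum_ident[OF X Y T1.tot_finite[OF X Y], of p] by (simp add: tid_def)
  have *: "mor w = (\<Sum>i\<in>?S. mor (w \<odot>\<^bsub>U\<^esub> (tinj R F1 X Y p i \<Otimes>\<^bsub>F2\<^esub> tid S W) \<odot>\<^bsub>U\<^esub> (tprj R F1 X Y p i \<Otimes>\<^bsub>F2\<^esub> tid S W)))"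
    if w: "valid U w" "src w = ?O \<star>\<^bsub>F2\<^esub> W" for w
  proof -
    have "w = w \<odot>\<^bsub>U\<^esub> (tid R ?O \<Otimes>\<^bsub>F2\<^esub> tid S W) \<odot>\<^bsub>U\<^esub> tid U (?O \<star>\<^bsub>F2\<^esub> W)" using w X Y W by simp
    then have "mor w = mor (w \<odot>\<^bsub>U\<^esub> (tid R ?O \<Otimes>\<^bsub>F2\<^esub> tid S W) \<odot>\<^bsub>U\<^esub> tid U (?O \<star>\<^bsub>F2\<^esub> W))" by (rule arg_cong)
    also have "\<dots> = (\<Sum>i\<in>?S. mor (w \<odot>\<^bsub>U\<^esub> (\<lparr>src = ?O, tgt = ?O, mor = ?e i\<rparr> \<Otimes>\<^bsub>F2\<^esub> tid S W) \<odot>\<^bsub>U\<^esub> tid U (?O \<star>\<^bsub>F2\<^esub> W)))"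
      unfolding one[symmetric] by (rule T2.sum_tten_left[OF T1.tot_finite[OF X Y] he]) (use w X Y W in simp_all)
    also have "\<dots> = (\<Sum>i\<in>?S. mor (w \<odot>\<^bsub>U\<^esub> (tinj R F1 X Y p i \<Otimes>\<^bsub>F2\<^esub> tid S W) \<odot>\<^bsub>U\<^esub> (tprj R F1 X Y p i \<Otimes>\<^bsub>F2\<^esub> tid S W)))"
      unfolding e using w X Y W by (intro sum.cong refl arg_cong[where f = mor]) simp
    finally show ?thesis .
  qed
  have **: "mor w = (\<Sum>i\<in>?S. mor ((w \<odot>\<^bsub>U\<^esub> (tinj R F1 X Y p i \<Otimes>\<^bsub>F2\<^esub> tid S W)) \<odot>\<^bsub>U\<^esub> (tprj R F1 X Y p i \<Otimes>\<^bsub>F2\<^esub> tid S W)))"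
    if w: "valid U w" "src w = ?O \<star>\<^bsub>F2\<^esub> W" for w
    by (rule trans[OF *[OF w]]) (use w X Y W in \<open>intro sum.cong refl arg_cong[where f = mor], simp\<close>)
  have "src v = ?O \<star>\<^bsub>F2\<^esub> W" using u v by simp
  from trans[OF **[OF u, unfolded eq] **[OF v(1) this, symmetric]] have "mor u = mor v" .
  then show ?thesis using v by (intro arr_eqI) simp_all
qed

context
  fixes X Y Z
  assumes X [simp]: "bounded_complex P X" and Y [simp]: "bounded_complex Q Y" and Z [simp]: "bounded_complex S Z"
begin

abbreviation "XY \<equiv> tot P Q R F1 X Y"
abbreviation "YZ \<equiv> tot Q S V F3 Y Z"
abbreviation "XYZ_l \<equiv> tot R S U F2 XY Z"
abbreviation "XYZ_r \<equiv> tot P V U F4 X YZ"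
abbreviation "ahat \<equiv> tot_assoc P Q S R V U F1 F2 F3 F4 \<alpha> X Y Z"

definition asum :: "int \<Rightarrow> int \<Rightarrow> int \<Rightarrow> ('o4, 'm4) arr" where
  "asum n p i = tinj U F4 X YZ n i \<odot>\<^bsub>U\<^esub> (tid P (ob X i) \<Otimes>\<^bsub>F4\<^esub> tinj V F3 Y Z (n - i) (p - i))
    \<odot>\<^bsub>U\<^esub> tas (ob X i) (ob Y (p - i)) (ob Z (n - p))
    \<odot>\<^bsub>U\<^esub> (tprj R F1 X Y p i \<Otimes>\<^bsub>F2\<^esub> tid S (ob Z (n - p))) \<odot>\<^bsub>U\<^esub> tprj U F2 XY Z n p"

lemma asum_typing [simp]:
  "valid U (asum n p i)" "src (asum n p i) = sum_ob (tot_sum U F2 XY Z n)"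
  "tgt (asum n p i) = sum_ob (tot_sum U F4 X YZ n)"
  by (simp_all add: asum_def)

lemma tot_assoc_asum:
  "ahat n = (\<Sum>p | \<not> is_zero U (ob XY p \<star>\<^bsub>F2\<^esub> ob Z (n - p)). \<Sum>i | \<not> is_zero R (ob X i \<star>\<^bsub>F1\<^esub> ob Y (p - i)). mor (asum n p i))"
  by (simp add: tot_assoc_def asum_def Let_def)

lemma asum_hom: "mor (asum n p i) \<in> Hom U (sum_ob (tot_sum U F2 XY Z n)) (sum_ob (tot_sum U F4 X YZ n))"
  using asum_typing(1)[of n p i] unfolding valid_def by simp

lemma tot_assoc_closed [simp]: "ahat \<in> hom_cx U XYZ_l XYZ_r 0"
  unfolding hom_cx_def tot_assoc_asum by (auto intro!: T2.D.hom_sum asum_hom)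

lemma tot_assoc_sandwich:
  assumes u: "valid U u" "src u = sum_ob (tot_sum U F4 X YZ n)" and w: "valid U w" "tgt w = sum_ob (tot_sum U F2 XY Z n)"
  shows "mor (u \<odot>\<^bsub>U\<^esub> tmap XYZ_l XYZ_r 0 ahat n \<odot>\<^bsub>U\<^esub> w)
    = (\<Sum>p | \<not> is_zero U (ob XY p \<star>\<^bsub>F2\<^esub> ob Z (n - p)). \<Sum>i | \<not> is_zero R (ob X i \<star>\<^bsub>F1\<^esub> ob Y (p - i)).
        mor (u \<odot>\<^bsub>U\<^esub> asum n p i \<odot>\<^bsub>U\<^esub> w))"
proof -
  let ?A = "sum_ob (tot_sum U F2 XY Z n)" and ?B = "sum_ob (tot_sum U F4 X YZ n)"
  have O: "src w \<in> Obj U" "?A \<in> Obj U" "?B \<in> Obj U" "tgt u \<in> Obj U"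
    and hu: "mor u \<in> Hom U ?B (tgt u)" and hw: "mor w \<in> Hom U (src w) ?A"
    using u w by (auto simp: valid_def)
  have hs: "(\<Sum>i | \<not> is_zero R (ob X i \<star>\<^bsub>F1\<^esub> ob Y (p - i)). mor (asum n p i)) \<in> Hom U ?A ?B" for p
    by (intro T2.D.hom_sum O asum_hom)
  note cw = T2.D.comp_closed[OF O(1,2,3) hw]
  have "mor (u \<odot>\<^bsub>U\<^esub> tmap XYZ_l XYZ_r 0 ahat n \<odot>\<^bsub>U\<^esub> w) = mor u \<cdot>\<^bsub>U\<^esub> (ahat n \<cdot>\<^bsub>U\<^esub> mor w)" by simp
  then show ?thesis
    unfolding tot_assoc_asum
    by (simp add: T2.D.comp_sum_left[OF O(1,2,3) hw hs] T2.D.comp_sum_left[OF O(1,2,3) hw asum_hom]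
        T2.D.comp_sum_right[OF O(1,3,4) _ hu] T2.D.hom_sum[OF O(1,3)] cw asum_hom hs)
qed

text \<open>The associator is determined by its restriction to the triple summands, where it is
  \<alpha>. Later statements about it rest on this rule instead of the double sum.\<close>

lemma tot_assoc_tinj:
  "tmap XYZ_l XYZ_r 0 ahat n \<odot>\<^bsub>U\<^esub> tinj U F2 XY Z n p \<odot>\<^bsub>U\<^esub> (tinj R F1 X Y p i \<Otimes>\<^bsub>F2\<^esub> tid S (ob Z (n - p)))
    = tinj U F4 X YZ n i \<odot>\<^bsub>U\<^esub> (tid P (ob X i) \<Otimes>\<^bsub>F4\<^esub> tinj V F3 Y Z (n - i) (p - i))
      \<odot>\<^bsub>U\<^esub> tas (ob X i) (ob Y (p - i)) (ob Z (n - p))" (is "_ \<odot>\<^bsub>U\<^esub> ?w = ?R")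
proof (rule arr_eqI)
  have vR: "valid U ?R" by simp
  have t: "asum n q j \<odot>\<^bsub>U\<^esub> ?w = (if q = p \<and> j = i then ?R else tzero (src ?R) (tgt ?R))" for q j
    using T2.D.tcomp_reduce[OF T2.tprj_tinj[OF T1.tot_bounded[OF X Y] Z]]
      T2.D.tcomp_reduce[OF T2.tprj_tinj_neq[OF T1.tot_bounded[OF X Y] Z]]
    by (cases "q = p"; cases "j = i") (simp_all add: asum_def)
  let ?S = "{p. \<not> is_zero U (ob XY p \<star>\<^bsub>F2\<^esub> ob Z (n - p))}"
  let ?S' = "\<lambda>p. {i. \<not> is_zero R (ob X i \<star>\<^bsub>F1\<^esub> ob Y (p - i))}"
  have fin: "finite ?S" "finite (?S' q)" for q
    using T2.tot_finite[OF T1.tot_bounded[OF X Y] Z, of n] T1.tot_finite[OF X Y, of q] by simp_all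
  have "tid U (sum_ob (tot_sum U F4 X YZ n)) \<odot>\<^bsub>U\<^esub> tmap XYZ_l XYZ_r 0 ahat n \<odot>\<^bsub>U\<^esub> ?w = tmap XYZ_l XYZ_r 0 ahat n \<odot>\<^bsub>U\<^esub> ?w"
    by simp
  moreover have "tid U (sum_ob (tot_sum U F4 X YZ n)) \<odot>\<^bsub>U\<^esub> asum n q j \<odot>\<^bsub>U\<^esub> ?w = asum n q j \<odot>\<^bsub>U\<^esub> ?w" for q j
    by simp
  ultimately have "mor (tmap XYZ_l XYZ_r 0 ahat n \<odot>\<^bsub>U\<^esub> ?w) = (\<Sum>q\<in>?S. \<Sum>j\<in>?S' q. mor (asum n q j \<odot>\<^bsub>U\<^esub> ?w))"
    using tot_assoc_sandwich[of "tid U (sum_ob (tot_sum U F4 X YZ n))" n ?w] by (simp del: arr_fields(3))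
  also have "\<dots> = (\<Sum>q\<in>?S. \<Sum>j\<in>?S' q. if q = p \<and> j = i then mor ?R else 0)"
    unfolding t by (intro sum.cong refl) simp
  also have "\<dots> = mor ?R"
  proof (cases "p \<in> ?S \<and> i \<in> ?S' p")
    case True
    have "(\<Sum>j\<in>?S' q. if q = p \<and> j = i then mor ?R else 0) = (if q = p then mor ?R else 0)" for q
      using True fin(2)[of q] by (cases "q = p") simp_all
    then show ?thesis using True fin(1) by (simp del: arr_fields(3))
  next
    case False
    have "mor ?R = 0"
    proof (cases "i \<in> ?S' p")
      case True
      \<comment> \<open>Here p is skipped in the outer sum although i occurs in the inner one. The
        triple summand is a retract of the zero object (X \<star> Y)^p \<star> Z^(n-p) and hence
        zero itself.\<close>
      then have z: "is_zero U (sum_ob (tot_sum R F1 X Y p) \<star>\<^bsub>F2\<^esub> ob Z (n - p))" using False by simp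
      let ?i = "tinj R F1 X Y p i \<Otimes>\<^bsub>F2\<^esub> tid S (ob Z (n - p))" and ?p = "tprj R F1 X Y p i \<Otimes>\<^bsub>F2\<^esub> tid S (ob Z (n - p))"
      have "mor ?i = 0" by (rule T2.D.is_zero_tgt) (use z in simp_all)
      then have i0: "?i = tzero (src ?R) (sum_ob (tot_sum R F1 X Y p) \<star>\<^bsub>F2\<^esub> ob Z (n - p))" by (intro arr_eqI) simp_all
      have "tid U (src ?R) = ?p \<odot>\<^bsub>U\<^esub> ?i" by simp
      also have "\<dots> = tzero (src ?R) (src ?R)" unfolding i0 by simp
      finally have "Ident U (src ?R) = 0" by (simp add: tid_def tzero_def)
      then have "is_zero U (src ?R)" by (subst T2.D.is_zero_iff_ident) simp_all
      then show ?thesis using vR by (rule T2.D.is_zero_src)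
    next
      case False
      then have "is_zero U (src ?R)" using T2.is_zero_tensor_left by simp
      then show ?thesis using vR by (rule T2.D.is_zero_src)
    qed
    then show ?thesis using False by (auto intro!: sum.neutral simp del: arr_fields(3))
  qed
  finally show "mor (tmap XYZ_l XYZ_r 0 ahat n \<odot>\<^bsub>U\<^esub> ?w) = mor ?R" .
qed simp_all

text \<open>Restriction to a triple summand, followed by naturality of \<alpha>. The differentials
  of \<open>X\<close>, \<open>Y\<close> and \<open>Z\<close> are to be inserted for f, g and
  h.\<close>

lemma tot_assoc_tinj_tten:
  assumes f: "valid P f" "tgt f = ob X j" and g: "valid Q g" "tgt g = ob Y (q - j)"
    and h: "valid S h" "tgt h = ob Z (m - q)"
  shows "tmap XYZ_l XYZ_r 0 ahat m \<odot>\<^bsub>U\<^esub> tinj U F2 XY Z m q \<odot>\<^bsub>U\<^esub> ((tinj R F1 X Y q j \<odot>\<^bsub>R\<^esub> (f \<Otimes>\<^bsub>F1\<^esub> g)) \<Otimes>\<^bsub>F2\<^esub> h)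
    = tinj U F4 X YZ m j \<odot>\<^bsub>U\<^esub> (f \<Otimes>\<^bsub>F4\<^esub> (tinj V F3 Y Z (m - j) (q - j) \<odot>\<^bsub>V\<^esub> (g \<Otimes>\<^bsub>F3\<^esub> h)))
      \<odot>\<^bsub>U\<^esub> tas (src f) (src g) (src h)"
proof -
  have src_closed: "src f \<in> Obj P" "src g \<in> Obj Q" "src h \<in> Obj S" using f g h by (simp_all add: valid_def)
  let ?k = "tinj R F1 X Y q j \<Otimes>\<^bsub>F2\<^esub> tid S (ob Z (m - q))" and ?l = "(f \<Otimes>\<^bsub>F1\<^esub> g) \<Otimes>\<^bsub>F2\<^esub> h"
  let ?j = "tinj U F4 X YZ m j" and ?a = "tas (ob X j) (ob Y (q - j)) (ob Z (m - q))"
  let ?m = "tid P (ob X j) \<Otimes>\<^bsub>F4\<^esub> tinj V F3 Y Z (m - j) (q - j)"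
  have 1: "(tinj R F1 X Y q j \<odot>\<^bsub>R\<^esub> (f \<Otimes>\<^bsub>F1\<^esub> g)) \<Otimes>\<^bsub>F2\<^esub> h = ?k \<odot>\<^bsub>U\<^esub> ?l" using f g h by simp
  have "tmap XYZ_l XYZ_r 0 ahat m \<odot>\<^bsub>U\<^esub> tinj U F2 XY Z m q \<odot>\<^bsub>U\<^esub> (?k \<odot>\<^bsub>U\<^esub> ?l)
    = (tmap XYZ_l XYZ_r 0 ahat m \<odot>\<^bsub>U\<^esub> tinj U F2 XY Z m q \<odot>\<^bsub>U\<^esub> ?k) \<odot>\<^bsub>U\<^esub> ?l"
    using f g h by simp
  also have "\<dots> = ?j \<odot>\<^bsub>U\<^esub> ?m \<odot>\<^bsub>U\<^esub> (?a \<odot>\<^bsub>U\<^esub> ?l)"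
    unfolding tot_assoc_tinj using f g h by simp
  also have "?a \<odot>\<^bsub>U\<^esub> ?l = (f \<Otimes>\<^bsub>F4\<^esub> (g \<Otimes>\<^bsub>F3\<^esub> h)) \<odot>\<^bsub>U\<^esub> tas (src f) (src g) (src h)"
    using f g h by (intro tas_natural) simp_all
  also have "?j \<odot>\<^bsub>U\<^esub> ?m \<odot>\<^bsub>U\<^esub> \<dots> = ?j \<odot>\<^bsub>U\<^esub> (f \<Otimes>\<^bsub>F4\<^esub> (tinj V F3 Y Z (m - j) (q - j) \<odot>\<^bsub>V\<^esub> (g \<Otimes>\<^bsub>F3\<^esub> h)))
      \<odot>\<^bsub>U\<^esub> tas (src f) (src g) (src h)"
    using f g h src_closed by simp
  finally show ?thesis unfolding 1 .
qed

text \<open>The component towards X^i, tested on all summands of (X \<star> Y)^p by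
  \<open>T2_ext_left\<close>; only the summand with first index i survives.\<close>

lemma tprj_tot_assoc:
  "tprj U F4 X YZ n i \<odot>\<^bsub>U\<^esub> tmap XYZ_l XYZ_r 0 ahat n \<odot>\<^bsub>U\<^esub> tinj U F2 XY Z n p
    = (tid P (ob X i) \<Otimes>\<^bsub>F4\<^esub> tinj V F3 Y Z (n - i) (p - i)) \<odot>\<^bsub>U\<^esub> tas (ob X i) (ob Y (p - i)) (ob Z (n - p))
      \<odot>\<^bsub>U\<^esub> (tprj R F1 X Y p i \<Otimes>\<^bsub>F2\<^esub> tid S (ob Z (n - p)))" (is "?L = ?R")
proof (rule T2_ext_left[OF X Y])
  fix k
  let ?w = "tinj R F1 X Y p k \<Otimes>\<^bsub>F2\<^esub> tid S (ob Z (n - p))"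
  have "?L \<odot>\<^bsub>U\<^esub> ?w = tprj U F4 X YZ n i \<odot>\<^bsub>U\<^esub> (tmap XYZ_l XYZ_r 0 ahat n \<odot>\<^bsub>U\<^esub> tinj U F2 XY Z n p \<odot>\<^bsub>U\<^esub> ?w)"
    by simp
  also have "\<dots> = ?R \<odot>\<^bsub>U\<^esub> ?w"
    unfolding tot_assoc_tinj
    using T2.D.tcomp_reduce[OF T4.tprj_tinj[OF X T3.tot_bounded[OF Y Z]]]
      T2.D.tcomp_reduce[OF T4.tprj_tinj_neq[OF X T3.tot_bounded[OF Y Z]]]
    by (cases "i = k") simp_all
  finally show "?L \<odot>\<^bsub>U\<^esub> ?w = ?R \<odot>\<^bsub>U\<^esub> ?w" .
qed simp_all

text \<open>On a triple summand both composites become d_X + (-1)^i d_Y + (-1)^p d_Z. The sign of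
  d_Z is (-1)^i (-1)^(p - i) for one bracketing and (-1)^p for the other, so an associator without
  signs commutes with the differentials.\<close>

lemma tot_assoc_cocycle: "ahat \<in> hom_cocycles U XYZ_l XYZ_r 0"
proof -
  have "tmap XYZ_r XYZ_r 1 (diff XYZ_r) n \<odot>\<^bsub>U\<^esub> tmap XYZ_l XYZ_r 0 ahat n
    = tmap XYZ_l XYZ_r 0 ahat (n + 1) \<odot>\<^bsub>U\<^esub> tmap XYZ_l XYZ_l 1 (diff XYZ_l) n" (is "?L = ?R") for n
  proof (rule T2.tot_ext[OF T1.tot_bounded[OF X Y] Z])
    fix p
    show "?L \<odot>\<^bsub>U\<^esub> tinj U F2 XY Z n p = ?R \<odot>\<^bsub>U\<^esub> tinj U F2 XY Z n p" (is "?L' = ?R'")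
    proof (rule T2_ext_left[OF X Y])
      fix i
      let ?w = "tinj R F1 X Y p i \<Otimes>\<^bsub>F2\<^esub> tid S (ob Z (n - p))"
      let ?a = "tas (ob X i) (ob Y (p - i)) (ob Z (n - p))"
      let ?dX = "tmap X X 1 (diff X) i" and ?dY = "tmap Y Y 1 (diff Y) (p - i)" and ?dZ = "tmap Z Z 1 (diff Z) (n - p)"
      let ?A = "tinj U F4 X YZ (n + 1) (i + 1) \<odot>\<^bsub>U\<^esub> (?dX \<Otimes>\<^bsub>F4\<^esub> tinj V F3 Y Z (n - i) (p - i)) \<odot>\<^bsub>U\<^esub> ?a"
      let ?B = "tinj U F4 X YZ (n + 1) i \<odot>\<^bsub>U\<^esub> (tid P (ob X i) \<Otimes>\<^bsub>F4\<^esub> (tinj V F3 Y Z (n - i + 1) (p - i + 1) \<odot>\<^bsub>V\<^esub> (?dY \<Otimes>\<^bsub>F3\<^esub> tid S (ob Z (n - p))))) \<odot>\<^bsub>U\<^esub> ?a"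
      let ?C = "tinj U F4 X YZ (n + 1) i \<odot>\<^bsub>U\<^esub> (tid P (ob X i) \<Otimes>\<^bsub>F4\<^esub> (tinj V F3 Y Z (n - i + 1) (p - i) \<odot>\<^bsub>V\<^esub> (tid Q (ob Y (p - i)) \<Otimes>\<^bsub>F3\<^esub> ?dZ))) \<odot>\<^bsub>U\<^esub> ?a"
      have "?L' \<odot>\<^bsub>U\<^esub> ?w = tmap XYZ_r XYZ_r 1 (diff XYZ_r) n \<odot>\<^bsub>U\<^esub> (tmap XYZ_l XYZ_r 0 ahat n \<odot>\<^bsub>U\<^esub> tinj U F2 XY Z n p \<odot>\<^bsub>U\<^esub> ?w)"
        by simp
      also have "\<dots> = ?A \<oplus> tsgn i (?B \<oplus> tsgn (p - i) ?C)"
        unfolding tot_assoc_tinj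
        by (simp add: T4.tot_diff_tinj_tail T3.tot_diff_tinj algebra_simps)
      also have "\<dots> = (?A \<oplus> tsgn i ?B) \<oplus> tsgn p ?C"
        by (rule arr_eqI) (simp_all add: ksign_add ksign_ksign add.assoc)
      finally have L: "?L' \<odot>\<^bsub>U\<^esub> ?w = (?A \<oplus> tsgn i ?B) \<oplus> tsgn p ?C" .
      let ?a1 = "tmap XYZ_l XYZ_r 0 ahat (n + 1)"
      have "?R' \<odot>\<^bsub>U\<^esub> ?w = ?a1 \<odot>\<^bsub>U\<^esub> (tmap XYZ_l XYZ_l 1 (diff XYZ_l) n \<odot>\<^bsub>U\<^esub> (tinj U F2 XY Z n p \<odot>\<^bsub>U\<^esub> ?w))"
        by simp
      also have "tmap XYZ_l XYZ_l 1 (diff XYZ_l) n \<odot>\<^bsub>U\<^esub> (tinj U F2 XY Z n p \<odot>\<^bsub>U\<^esub> ?w)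
        = (tinj U F2 XY Z (n + 1) (p + 1) \<odot>\<^bsub>U\<^esub> ((tinj R F1 X Y (p + 1) (i + 1) \<odot>\<^bsub>R\<^esub> (?dX \<Otimes>\<^bsub>F1\<^esub> tid Q (ob Y (p - i)))) \<Otimes>\<^bsub>F2\<^esub> tid S (ob Z (n - p)))
          \<oplus> tsgn i (tinj U F2 XY Z (n + 1) (p + 1) \<odot>\<^bsub>U\<^esub> ((tinj R F1 X Y (p + 1) i \<odot>\<^bsub>R\<^esub> (tid P (ob X i) \<Otimes>\<^bsub>F1\<^esub> ?dY)) \<Otimes>\<^bsub>F2\<^esub> tid S (ob Z (n - p)))))
          \<oplus> tsgn p (tinj U F2 XY Z (n + 1) p \<odot>\<^bsub>U\<^esub> ((tinj R F1 X Y p i \<odot>\<^bsub>R\<^esub> (tid P (ob X i) \<Otimes>\<^bsub>F1\<^esub> tid Q (ob Y (p - i)))) \<Otimes>\<^bsub>F2\<^esub> ?dZ))"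
        by (simp add: T2.tot_diff_tinj_tail T1.tot_diff_tinj algebra_simps)
      also have "?a1 \<odot>\<^bsub>U\<^esub> \<dots> = (?A \<oplus> tsgn i ?B) \<oplus> tsgn p ?C"
        using tot_assoc_tinj_tten[of ?dX "i + 1" "tid Q (ob Y (p - i))" "p + 1" "tid S (ob Z (n - p))" "n + 1"]
          tot_assoc_tinj_tten[of "tid P (ob X i)" i ?dY "p + 1" "tid S (ob Z (n - p))" "n + 1"]
          tot_assoc_tinj_tten[of "tid P (ob X i)" i "tid Q (ob Y (p - i))" p ?dZ "n + 1"]
        by (simp add: algebra_simps)
      finally show "?L' \<odot>\<^bsub>U\<^esub> ?w = ?R' \<odot>\<^bsub>U\<^esub> ?w" unfolding L ..
    qed simp_all
  qed simp_all
  from arg_cong[where f = mor, OF this] show ?thesis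
    using T2.D.hom_cx_0D[OF tot_assoc_closed] unfolding T2.D.cocycle0_iff by auto
qed

end

end

section \<open>Comparison and composition of filtered morphisms\<close>

context linear_category
begin

text \<open>Serves to drop the one-element index of \<open>filtered_trivial\<close> from the index
  set.\<close>

lemma filtered_reindex:
  assumes F: "filtered C P I g c \<iota> \<pi>" and f: "bij_betw f I' I"
  shows "filtered C P I' (\<lambda>x. g (f x)) (\<lambda>x. c (f x)) (\<lambda>x. \<iota> (f x)) (\<lambda>x. \<pi> (f x))"
proof -
  have fI: "f x \<in> I" if "x \<in> I'" for x using f that by (auto simp: bij_betw_def)
  have eq: "f x = f y \<longleftrightarrow> x = y" if "x \<in> I'" "y \<in> I'" for x y
    using f that by (auto simp: bij_betw_def inj_on_def)
  have sum: "(\<Sum>x\<in>I'. mor (\<iota> (f x) n \<odot>\<^bsub>C\<^esub> \<pi> (f x) n)) = Ident C (ob P n)" for n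
    using sum.reindex_bij_betw[OF f, of "\<lambda>a. mor (\<iota> a n \<odot>\<^bsub>C\<^esub> \<pi> a n)"] filtered_sum[OF F] by simp
  have fin: "finite I'" using filtered_finite[OF F] f by (simp add: bij_betw_finite)
  show ?thesis
    using F fin sum unfolding filtered_def by (auto simp: fI eq simp del: arr_fields(3))
qed

text \<open>\<open>filtered_homotopic\<close> with \<open>raises\<close>, \<open>leading\<close> and
  \<open>mat\<close> unfolded to explicit entries, ready for concrete filtrations.\<close>

lemma filtered_homotopicI:
  fixes I :: "'a set" and J :: "'b set"
  assumes FP: "filtered C P I g c \<iota> \<pi>" and FQ: "filtered C Q J h c' \<iota>' \<pi>'"
    and acyclic: "\<And>a b. a \<in> I \<Longrightarrow> b \<in> J \<Longrightarrow> acyclic_below (c a) (c' b)"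
    and U: "U \<in> hom_cocycles C P Q 0" and V: "V \<in> hom_cocycles C P Q 0"
    and low: "\<And>a b n. \<lbrakk>a \<in> I; b \<in> J; h b < g a\<rbrakk> \<Longrightarrow> mor (\<pi>' b n \<odot>\<^bsub>C\<^esub> tmap P Q 0 U n \<odot>\<^bsub>C\<^esub> \<iota> a n) = 0"
      "\<And>a b n. \<lbrakk>a \<in> I; b \<in> J; h b < g a\<rbrakk> \<Longrightarrow> mor (\<pi>' b n \<odot>\<^bsub>C\<^esub> tmap P Q 0 V n \<odot>\<^bsub>C\<^esub> \<iota> a n) = 0"
    and lead: "\<And>a b. \<lbrakk>a \<in> I; b \<in> J; h b = g a\<rbrakk> \<Longrightarrow> homotopic C (c a) (c' b)
      (\<lambda>p. mor (\<pi>' b (p + g a) \<odot>\<^bsub>C\<^esub> tmap P Q 0 U (p + g a) \<odot>\<^bsub>C\<^esub> \<iota> a (p + g a)))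
      (\<lambda>p. mor (\<pi>' b (p + g a) \<odot>\<^bsub>C\<^esub> tmap P Q 0 V (p + g a) \<odot>\<^bsub>C\<^esub> \<iota> a (p + g a)))"
  shows "homotopic C P Q U V"
proof (rule filtered_homotopic[OF FP FQ acyclic U _ V])
  note defs = raises_def[OF FP FQ] leading_def[OF FP FQ, abs_def] mat_def[OF FP FQ]
  show "raises TYPE('a) TYPE('b) P I g \<iota> Q J h \<pi>' 0 0 U" "raises TYPE('a) TYPE('b) P I g \<iota> Q J h \<pi>' 0 0 V"
    using U V low by (auto simp: defs dest: hom_cocyclesD simp del: arr_fields(3))
  show "homotopic C (c a) (c' b) (leading P g \<iota> Q \<pi>' 0 U a b) (leading P g \<iota> Q \<pi>' 0 V a b)"
    if "a \<in> I" "b \<in> J" "h b = g a" for a b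
    using lead[OF that] by (simp add: defs del: arr_fields(3))
qed

text \<open>A product of triangular matrices, with columns indexed by their filtration degree. A
  column y contributes only if i \<le> y \<le> k: none does for k < i, and only y = i for k =
  i.\<close>

lemma filtered_comp_int:
  assumes FQ: "filtered C Q J (\<lambda>j. j) c \<iota> \<pi>"
    and u: "valid C u" "tgt u = ob Q n" and v: "valid C v" "src v = ob Q n"
    and ui: "\<And>y. y \<in> J \<Longrightarrow> y < i \<Longrightarrow> mor (\<pi> y n \<odot>\<^bsub>C\<^esub> u) = 0"
    and vk: "\<And>y. y \<in> J \<Longrightarrow> k < y \<Longrightarrow> mor (v \<odot>\<^bsub>C\<^esub> \<iota> y n) = 0"
  shows "k < i \<Longrightarrow> mor (v \<odot>\<^bsub>C\<^esub> u) = 0"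
    and "k = i \<Longrightarrow> i \<in> J \<Longrightarrow> mor (v \<odot>\<^bsub>C\<^esub> u) = mor (v \<odot>\<^bsub>C\<^esub> \<iota> i n) \<cdot>\<^bsub>C\<^esub> mor (\<pi> i n \<odot>\<^bsub>C\<^esub> u)"
proof -
  note f = filtered_inj[OF FQ] filtered_prj[OF FQ]
  have z: "mor ((v \<odot>\<^bsub>C\<^esub> \<iota> y n) \<odot>\<^bsub>C\<^esub> (\<pi> y n \<odot>\<^bsub>C\<^esub> u)) = 0" if "y \<in> J" "y < i \<or> k < y" for y
  proof -
    have vv: "valid C (v \<odot>\<^bsub>C\<^esub> \<iota> y n)" "valid C (\<pi> y n \<odot>\<^bsub>C\<^esub> u)" using that u v by (simp_all add: f)
    have "mor (v \<odot>\<^bsub>C\<^esub> \<iota> y n) \<cdot>\<^bsub>C\<^esub> mor (\<pi> y n \<odot>\<^bsub>C\<^esub> u) = 0"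
      using that(2) ui[OF that(1)] vk[OF that(1)] valid_comp_zero[OF vv(1)] valid_comp_zero[OF vv(2)]
      by (auto simp del: arr_fields(3))
    then show ?thesis by (subst arr_fields(3))
  qed
  show "mor (v \<odot>\<^bsub>C\<^esub> u) = 0" if "k < i"
    unfolding filtered_insert[OF FQ u v] by (rule sum.neutral) (use z that in force)
  show "mor (v \<odot>\<^bsub>C\<^esub> u) = mor (v \<odot>\<^bsub>C\<^esub> \<iota> i n) \<cdot>\<^bsub>C\<^esub> mor (\<pi> i n \<odot>\<^bsub>C\<^esub> u)" if "k = i" "i \<in> J"
  proof -
    have "(\<Sum>y\<in>J. mor ((v \<odot>\<^bsub>C\<^esub> \<iota> y n) \<odot>\<^bsub>C\<^esub> (\<pi> y n \<odot>\<^bsub>C\<^esub> u))) = mor ((v \<odot>\<^bsub>C\<^esub> \<iota> i n) \<odot>\<^bsub>C\<^esub> (\<pi> i n \<odot>\<^bsub>C\<^esub> u))"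
      by (rule sum_eq_single[OF filtered_finite[OF FQ] that(2)]) (use z that in force)
    then show ?thesis unfolding filtered_insert[OF FQ u v] by (simp only: arr_fields(3))
  qed
qed

text \<open>A degreewise inverse q of a chain map j is a chain map: d q = q j d q = q d j q = q
  d.\<close>

lemma inverse_cocycle:
  assumes X: "cplx C X" and Y: "cplx C Y" and j: "j \<in> hom_cocycles C X Y 0"
    and q: "\<And>n. q n \<in> Hom C (ob Y n) (ob X n)"
    and qj: "\<And>n. q n \<cdot>\<^bsub>C\<^esub> j n = Ident C (ob X n)" and jq: "\<And>n. j n \<cdot>\<^bsub>C\<^esub> q n = Ident C (ob Y n)"
  shows "q \<in> hom_cocycles C Y X 0"
  unfolding cocycle0_iff
proof (intro conjI allI q)
  fix i
  have qc: "q \<in> hom_cx C Y X 0" and jc: "j \<in> hom_cx C X Y 0" using q hom_cocyclesD[OF j] by (simp_all add: hom_cx_def)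
  let ?dX = "tmap X X 1 (diff X) i" and ?dY = "tmap Y Y 1 (diff Y) i"
  let ?q = "tmap Y X 0 q" and ?j = "tmap X Y 0 j"
  have qj': "?q n \<odot>\<^bsub>C\<^esub> ?j n = tid C (ob X n)" and jq': "?j n \<odot>\<^bsub>C\<^esub> ?q n = tid C (ob Y n)" for n
    using qj jq by (auto intro!: arr_eqI)
  have dj: "?dY \<odot>\<^bsub>C\<^esub> ?j i = ?j (i + 1) \<odot>\<^bsub>C\<^esub> ?dX" using j by (intro arr_eqI) (auto simp: cocycle0_iff)
  have "?dX \<odot>\<^bsub>C\<^esub> ?q i = (?q (i + 1) \<odot>\<^bsub>C\<^esub> ?j (i + 1)) \<odot>\<^bsub>C\<^esub> ?dX \<odot>\<^bsub>C\<^esub> ?q i"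
    unfolding qj' using X Y qc by simp
  also have "\<dots> = ?q (i + 1) \<odot>\<^bsub>C\<^esub> ((?j (i + 1) \<odot>\<^bsub>C\<^esub> ?dX) \<odot>\<^bsub>C\<^esub> ?q i)" using X Y qc jc by simp
  also have "\<dots> = ?q (i + 1) \<odot>\<^bsub>C\<^esub> ?dY \<odot>\<^bsub>C\<^esub> (?j i \<odot>\<^bsub>C\<^esub> ?q i)"
    unfolding dj[symmetric] using X Y qc jc by simp
  also have "\<dots> = ?q (i + 1) \<odot>\<^bsub>C\<^esub> ?dY" unfolding jq' using X Y qc by simp
  finally show "diff X i \<cdot>\<^bsub>C\<^esub> q i = q (i + 1) \<cdot>\<^bsub>C\<^esub> diff Y i" by (auto dest: arg_cong[where f = mor])
qed

end

section \<open>Columns as functors of the complex and of the object\<close>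

context tensor_functor
begin

lemma rcol_cocycle:
  assumes "cplx A K" "cplx A K'" "W \<in> Obj B" "f \<in> hom_cocycles A K K' 0"
  shows "(\<lambda>n. f n \<otimes>\<^bsub>F\<^esub> Ident B W) \<in> hom_cocycles D (rcol B F K W) (rcol B F K' W) 0"
proof -
  have fc: "f \<in> hom_cx A K K' 0" using assms by (auto dest: hom_cocyclesD)
  have df: "tmap K' K' 1 (diff K') i \<odot>\<^bsub>A\<^esub> tmap K K' 0 f i = tmap K K' 0 f (i + 1) \<odot>\<^bsub>A\<^esub> tmap K K 1 (diff K) i" for i
    using assms(4) by (intro arr_eqI) (auto simp: A.cocycle0_iff)
  have v: "valid D (tmap K K' 0 f i \<Otimes>\<^bsub>F\<^esub> tid B W)" for i using assms fc by simp
  have "(tmap K' K' 1 (diff K') i \<Otimes>\<^bsub>F\<^esub> tid B W) \<odot>\<^bsub>D\<^esub> (tmap K K' 0 f i \<Otimes>\<^bsub>F\<^esub> tid B W)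
    = (tmap K K' 0 f (i + 1) \<Otimes>\<^bsub>F\<^esub> tid B W) \<odot>\<^bsub>D\<^esub> (tmap K K 1 (diff K) i \<Otimes>\<^bsub>F\<^esub> tid B W)" for i
    using assms fc df by simp
  from arg_cong[where f = mor, OF this] show ?thesis
    using v by (auto simp: D.cocycle0_iff valid_def)
qed

lemma lcol_cocycle:
  assumes "cplx B K" "cplx B K'" "W \<in> Obj A" "f \<in> hom_cocycles B K K' 0"
  shows "(\<lambda>n. Ident A W \<otimes>\<^bsub>F\<^esub> f n) \<in> hom_cocycles D (lcol A F W K) (lcol A F W K') 0"
proof -
  have fc: "f \<in> hom_cx B K K' 0" using assms by (auto dest: hom_cocyclesD)
  have df: "tmap K' K' 1 (diff K') i \<odot>\<^bsub>B\<^esub> tmap K K' 0 f i = tmap K K' 0 f (i + 1) \<odot>\<^bsub>B\<^esub> tmap K K 1 (diff K) i" for i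
    using assms(4) by (intro arr_eqI) (auto simp: B.cocycle0_iff)
  have v: "valid D (tid A W \<Otimes>\<^bsub>F\<^esub> tmap K K' 0 f i)" for i using assms fc by simp
  have "(tid A W \<Otimes>\<^bsub>F\<^esub> tmap K' K' 1 (diff K') i) \<odot>\<^bsub>D\<^esub> (tid A W \<Otimes>\<^bsub>F\<^esub> tmap K K' 0 f i)
    = (tid A W \<Otimes>\<^bsub>F\<^esub> tmap K K' 0 f (i + 1)) \<odot>\<^bsub>D\<^esub> (tid A W \<Otimes>\<^bsub>F\<^esub> tmap K K 1 (diff K) i)" for i
    using assms fc df by simp
  from arg_cong[where f = mor, OF this] show ?thesis
    using v by (auto simp: D.cocycle0_iff valid_def)
qed

lemma rcol_mor_cocycle:
  assumes "cplx A K" "W \<in> Obj B" "W' \<in> Obj B" "f \<in> Hom B W W'"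
  shows "(\<lambda>n. Ident A (ob K n) \<otimes>\<^bsub>F\<^esub> f) \<in> hom_cocycles D (rcol B F K W) (rcol B F K W') 0"
proof -
  let ?f = "\<lparr>src = W, tgt = W', mor = f\<rparr>"
  have vf: "valid B ?f" using assms by (simp add: valid_def)
  have v: "valid D (tid A (ob K i) \<Otimes>\<^bsub>F\<^esub> ?f)" for i using assms vf by simp
  have "(tmap K K 1 (diff K) i \<Otimes>\<^bsub>F\<^esub> tid B W') \<odot>\<^bsub>D\<^esub> (tid A (ob K i) \<Otimes>\<^bsub>F\<^esub> ?f)
    = (tid A (ob K (i + 1)) \<Otimes>\<^bsub>F\<^esub> ?f) \<odot>\<^bsub>D\<^esub> (tmap K K 1 (diff K) i \<Otimes>\<^bsub>F\<^esub> tid B W)" for i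
    using assms vf by simp
  from arg_cong[where f = mor, OF this] show ?thesis
    using v by (auto simp: D.cocycle0_iff valid_def)
qed

lemma lcol_mor_cocycle:
  assumes "cplx B K" "W \<in> Obj A" "W' \<in> Obj A" "f \<in> Hom A W W'"
  shows "(\<lambda>n. f \<otimes>\<^bsub>F\<^esub> Ident B (ob K n)) \<in> hom_cocycles D (lcol A F W K) (lcol A F W' K) 0"
proof -
  let ?f = "\<lparr>src = W, tgt = W', mor = f\<rparr>"
  have vf: "valid A ?f" using assms by (simp add: valid_def)
  have v: "valid D (?f \<Otimes>\<^bsub>F\<^esub> tid B (ob K i))" for i using assms vf by simp
  have "(tid A W' \<Otimes>\<^bsub>F\<^esub> tmap K K 1 (diff K) i) \<odot>\<^bsub>D\<^esub> (?f \<Otimes>\<^bsub>F\<^esub> tid B (ob K i))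
    = (?f \<Otimes>\<^bsub>F\<^esub> tid B (ob K (i + 1))) \<odot>\<^bsub>D\<^esub> (tid A W \<Otimes>\<^bsub>F\<^esub> tmap K K 1 (diff K) i)" for i
    using assms vf by simp
  from arg_cong[where f = mor, OF this] show ?thesis
    using v by (auto simp: D.cocycle0_iff valid_def)
qed

end

section \<open>Complexes concentrated in degree zero\<close>

context additive_category
begin

lemma some_zero: "is_zero C (SOME N. is_zero C N)"
  using zero_object by (rule someI_ex)

lemma stalk_ob_0 [simp]: "ob (stalk C X) 0 = X"
  by (simp add: stalk_def)

lemma stalk_ob_zero: "i \<noteq> 0 \<Longrightarrow> is_zero C (ob (stalk C X) i)"
  using some_zero by (simp add: stalk_def)

lemma stalk_diff [simp]: "diff (stalk C X) i = 0"
  by (simp add: stalk_def)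

lemma stalk_bounded [simp]:
  assumes X: "X \<in> Obj C" shows "bounded_complex C (stalk C X)"
proof -
  have O: "ob (stalk C X) i \<in> Obj C" for i
    using X stalk_ob_zero[of i X] by (cases "i = 0") (auto simp: is_zero_def)
  have "\<bar>i\<bar> > 0 \<longrightarrow> is_zero C (ob (stalk C X) i)" for i using stalk_ob_zero by simp
  then show ?thesis
    unfolding bounded_complex_def using O comp_zero_left[OF O O O hom_zero[OF O O]] by (auto intro!: exI[of _ 0])
qed

lemma stalk_mor_cocycle:
  assumes "X \<in> Obj C" "Y \<in> Obj C" "f \<in> Hom C X Y"
  shows "(\<lambda>i. if i = 0 then f else 0) \<in> hom_cocycles C (stalk C X) (stalk C Y) 0"
proof -
  have O: "ob (stalk C X) i \<in> Obj C" "ob (stalk C Y) i \<in> Obj C" for i using assms by (simp_all add: bounded_complex_cplx)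
  have h: "(if i = 0 then f else 0) \<in> Hom C (ob (stalk C X) i) (ob (stalk C Y) i)" for i
    using assms O by simp
  show ?thesis
    unfolding cocycle0_iff stalk_diff
    using h comp_zero_left[OF O(1) O(2) O(2) h] comp_zero_right[OF O(1) O(1) O(2) h] by presburger
qed

lemma stalk_mor_eq: "stalk_mor C \<lparr>src = X, tgt = Y, mor = f\<rparr>
    = kclass C (stalk C X) (stalk C Y) (\<lambda>i. if i = 0 then f else 0)"
  by (simp add: stalk_mor_def cong: if_cong)

text \<open>Away from degree 0 the stalk consists of zero objects, whose identities are 0.\<close>

lemma stalk_mor_ident:
  assumes "X \<in> Obj C"
  shows "stalk_mor C \<lparr>src = X, tgt = X, mor = Ident C X\<rparr> = Ident (Kb C) (stalk C X)"
proof -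
  have "(\<lambda>i. if i = 0 then Ident C X else 0) = (\<lambda>i. Ident C (ob (stalk C X) i))"
  proof
    fix i
    have "Ident C (ob (stalk C X) i) = 0" if "i \<noteq> 0"
      using stalk_ob_zero[OF that, of X] is_zero_iff_ident[of "ob (stalk C X) i"] assms by simp
    then show "(if i = 0 then Ident C X else 0) = Ident C (ob (stalk C X) i)" by (cases "i = 0") simp_all
  qed
  then show ?thesis by (simp add: stalk_mor_eq)
qed

end

context tensor_functor
begin

context
  fixes K W assumes K [simp]: "bounded_complex A K" and W [simp]: "W \<in> Obj B"
begin

text \<open>Only the summand with index n meets degree 0 of the stalk, so its inclusion is an
  isomorphism. It is a chain map because the stalk contributes the differential 0.\<close>

lemma stalk_right:
  shows tinj_stalk_right_cocycle:
      "(\<lambda>n. inj (tot_sum D F K (stalk B W) n) n) \<in> hom_cocycles D (rcol B F K W) (tot A B D F K (stalk B W)) 0"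
    and tprj_stalk_right_cocycle:
      "(\<lambda>n. prj (tot_sum D F K (stalk B W) n) n) \<in> hom_cocycles D (tot A B D F K (stalk B W)) (rcol B F K W) 0"
    and tprj_tinj_stalk_right:
      "prj (tot_sum D F K (stalk B W) n) n \<cdot>\<^bsub>D\<^esub> inj (tot_sum D F K (stalk B W) n) n = Ident D (ob K n \<star>\<^bsub>F\<^esub> W)"
    and tinj_tprj_stalk_right:
      "inj (tot_sum D F K (stalk B W) n) n \<cdot>\<^bsub>D\<^esub> prj (tot_sum D F K (stalk B W) n) n = Ident D (sum_ob (tot_sum D F K (stalk B W) n))"
proof -
  let ?S = "stalk B W" let ?T = "tot A B D F K ?S"
  note S = B.stalk_bounded[OF W]
  have z: "tmap ?S ?S 1 (diff ?S) i = tzero (ob ?S i) (ob ?S (i + 1))" for i by (intro arr_eqI) simp_all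
  have "tmap ?T ?T 1 (diff ?T) n \<odot>\<^bsub>D\<^esub> tinj D F K ?S n n
    = tinj D F K ?S (n + 1) (n + 1) \<odot>\<^bsub>D\<^esub> (tmap K K 1 (diff K) n \<Otimes>\<^bsub>F\<^esub> tid B W)" for n
  proof -
    have "tinj D F K ?S (n + 1) n \<odot>\<^bsub>D\<^esub> (tid A (ob K n) \<Otimes>\<^bsub>F\<^esub> tmap ?S ?S 1 (diff ?S) (n - n))
      = tzero (ob K n \<star>\<^bsub>F\<^esub> W) (sum_ob (tot_sum D F K ?S (n + 1)))"
      unfolding z using S by (simp add: algebra_simps)
    then show ?thesis unfolding tot_diff_tinj[OF K S] by (intro arr_eqI) (simp_all add: tzero_def tcomp_def tten_def tmap_def)
  qed
  from arg_cong[where f = mor, OF this] valid_tinj[OF K S, of n n for n]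
  show j: "(\<lambda>n. inj (tot_sum D F K ?S n) n) \<in> hom_cocycles D (rcol B F K W) ?T 0"
    by (auto simp: D.cocycle0_iff valid_def)
  show qj: "prj (tot_sum D F K ?S n) n \<cdot>\<^bsub>D\<^esub> inj (tot_sum D F K ?S n) n = Ident D (ob K n \<star>\<^bsub>F\<^esub> W)" for n
    using arg_cong[where f = mor, OF tprj_tinj[OF K S, of n n]] by (simp del: tprj_tinj)
  have "is_zero D (ob K i \<star>\<^bsub>F\<^esub> ob ?S (n - i))" if "i \<notin> {n}" for i n
    using that B.stalk_ob_zero[of "n - i" W] by (intro is_zero_tensor_right) simp_all
  then show jq: "inj (tot_sum D F K ?S n) n \<cdot>\<^bsub>D\<^esub> prj (tot_sum D F K ?S n) n = Ident D (sum_ob (tot_sum D F K ?S n))" for n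
    using tot_sum_ident[OF K S, of "{n}" n] by simp
  show "(\<lambda>n. prj (tot_sum D F K ?S n) n) \<in> hom_cocycles D ?T (rcol B F K W) 0"
    using valid_tprj[OF K S, of n n for n] qj jq S
    by (intro D.inverse_cocycle[OF _ _ j]) (auto simp: valid_def)
qed

end

context
  fixes K W assumes K [simp]: "bounded_complex B K" and W [simp]: "W \<in> Obj A"
begin

text \<open>As in \<open>stalk_right\<close>, now with the index 0, where the Koszul sign in front
  of the differential of \<open>K\<close> is trivial.\<close>

lemma stalk_left:
  shows tinj_stalk_left_cocycle:
      "(\<lambda>n. inj (tot_sum D F (stalk A W) K n) 0) \<in> hom_cocycles D (lcol A F W K) (tot A B D F (stalk A W) K) 0"
    and tprj_stalk_left_cocycle:
      "(\<lambda>n. prj (tot_sum D F (stalk A W) K n) 0) \<in> hom_cocycles D (tot A B D F (stalk A W) K) (lcol A F W K) 0"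
    and tprj_tinj_stalk_left:
      "prj (tot_sum D F (stalk A W) K n) 0 \<cdot>\<^bsub>D\<^esub> inj (tot_sum D F (stalk A W) K n) 0 = Ident D (W \<star>\<^bsub>F\<^esub> ob K n)"
    and tinj_tprj_stalk_left:
      "inj (tot_sum D F (stalk A W) K n) 0 \<cdot>\<^bsub>D\<^esub> prj (tot_sum D F (stalk A W) K n) 0 = Ident D (sum_ob (tot_sum D F (stalk A W) K n))"
proof -
  let ?S = "stalk A W" let ?T = "tot A B D F ?S K"
  note S = A.stalk_bounded[OF W]
  have z: "tmap ?S ?S 1 (diff ?S) i = tzero (ob ?S i) (ob ?S (i + 1))" for i by (intro arr_eqI) simp_all
  have "tmap ?T ?T 1 (diff ?T) n \<odot>\<^bsub>D\<^esub> tinj D F ?S K n 0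
    = tinj D F ?S K (n + 1) 0 \<odot>\<^bsub>D\<^esub> (tid A W \<Otimes>\<^bsub>F\<^esub> tmap K K 1 (diff K) n)" for n
  proof -
    have "tinj D F ?S K (n + 1) (0 + 1) \<odot>\<^bsub>D\<^esub> (tmap ?S ?S 1 (diff ?S) 0 \<Otimes>\<^bsub>F\<^esub> tid B (ob K (n - 0)))
      = tzero (W \<star>\<^bsub>F\<^esub> ob K n) (sum_ob (tot_sum D F ?S K (n + 1)))"
      unfolding z using S by simp
    then show ?thesis unfolding tot_diff_tinj[OF S K] by (intro arr_eqI) (simp_all add: tzero_def tcomp_def tten_def tmap_def)
  qed
  from arg_cong[where f = mor, OF this] valid_tinj[OF S K, of n 0 for n]
  show j: "(\<lambda>n. inj (tot_sum D F ?S K n) 0) \<in> hom_cocycles D (lcol A F W K) ?T 0"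
    by (auto simp: D.cocycle0_iff valid_def)
  show qj: "prj (tot_sum D F ?S K n) 0 \<cdot>\<^bsub>D\<^esub> inj (tot_sum D F ?S K n) 0 = Ident D (W \<star>\<^bsub>F\<^esub> ob K n)" for n
    using arg_cong[where f = mor, OF tprj_tinj[OF S K, of n 0]] by (simp del: tprj_tinj)
  have "is_zero D (ob ?S i \<star>\<^bsub>F\<^esub> ob K (n - i))" if "i \<notin> {0}" for i n
    using that A.stalk_ob_zero[of i W] by (intro is_zero_tensor_left) simp_all
  then show jq: "inj (tot_sum D F ?S K n) 0 \<cdot>\<^bsub>D\<^esub> prj (tot_sum D F ?S K n) 0 = Ident D (sum_ob (tot_sum D F ?S K n))" for n
    using tot_sum_ident[OF S K, of "{0}" n] by simp
  show "(\<lambda>n. prj (tot_sum D F ?S K n) 0) \<in> hom_cocycles D ?T (lcol A F W K) 0"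
    using valid_tprj[OF S K, of n 0 for n] qj jq S
    by (intro D.inverse_cocycle[OF _ _ j]) (auto simp: valid_def)
qed

end

end

section \<open>Components of morphisms between total tensor products\<close>

text \<open>The index set for filtrations by degree: finite for a bounded complex, and columns
  outside it are zero.\<close>

definition supp :: "('o, 'm::ab_group_add, 'x) cat_scheme \<Rightarrow> ('o, 'm) cochain \<Rightarrow> int set" where
  "supp C X = {i. \<not> is_zero C (ob X i)}"

lemma finite_supp [simp]: "bounded_complex C X \<Longrightarrow> finite (supp C X)"
proof -
  assume "bounded_complex C X"
  then obtain N where "\<And>i. \<bar>i\<bar> > N \<Longrightarrow> is_zero C (ob X i)" by (auto simp: bounded_complex_def)
  then have "supp C X \<subseteq> {-N..N}" unfolding supp_def by force
  then show ?thesis by (rule finite_subset) simp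
qed

context additive_bimodule_category
begin

sublocale tA: tensor_functor A sA A sA A sA "Tensor A" ..
sublocale tL: tensor_functor A sA M sM M sM "LAct M" ..
sublocale tR: tensor_functor M sM A sA M sM "RAct M" ..
sublocale aL: tensor_associator A sA A sA M sM A sA M sM M sM "Tensor A" "LAct M" "LAct M" "LAct M" "LAssoc M" ..
sublocale aM: tensor_associator A sA M sM A sA M sM M sM M sM "LAct M" "RAct M" "RAct M" "LAct M" "MAssoc M" ..
sublocale aR: tensor_associator M sM A sA A sA M sM A sA M sM "RAct M" "RAct M" "Tensor A" "RAct M" "RAssoc M" ..

abbreviation totA (infixl "\<diamond>\<^sub>A" 75) where "totA \<equiv> tot A A A (Tensor A)"
abbreviation totL (infixl "\<diamond>\<^sub>L" 75) where "totL \<equiv> tot A M M (LAct M)"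
abbreviation totR (infixl "\<diamond>\<^sub>R" 75) where "totR \<equiv> tot M A M (RAct M)"
abbreviation "jA \<equiv> tinj A (Tensor A)"
abbreviation "jL \<equiv> tinj M (LAct M)"
abbreviation "jR \<equiv> tinj M (RAct M)"
abbreviation "qA \<equiv> tprj A (Tensor A)"
abbreviation "qL \<equiv> tprj M (LAct M)"
abbreviation "qR \<equiv> tprj M (RAct M)"
abbreviation "hatL \<equiv> tot_assoc A A M A M M (Tensor A) (LAct M) (LAct M) (LAct M) (LAssoc M)"
abbreviation "hatM \<equiv> tot_assoc A M A M M M (LAct M) (RAct M) (RAct M) (LAct M) (MAssoc M)"
abbreviation "hatR \<equiv> tot_assoc M A A M A M (RAct M) (RAct M) (Tensor A) (RAct M) (RAssoc M)"

context
  fixes Z X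
  assumes Z [simp]: "bounded_complex M Z" and X [simp]: "bounded_complex A X"
begin

text \<open>The second statement records that adjacent columns are connected by 1 \<star> d_X
  without a sign, as needed for naturality of the half-braiding.\<close>

lemma filtered_R:
  "filtered M (Z \<diamond>\<^sub>R X) (supp A X) (\<lambda>j. j) (\<lambda>j. rcol A (RAct M) Z (ob X j))
    (\<lambda>j n. tsgn (j * (n - j)) (jR Z X n (n - j))) (\<lambda>j n. tsgn (j * (n - j)) (qR Z X n (n - j)))"
  "mor (tsgn ((j + 1) * (n + 1 - (j + 1))) (qR Z X (n + 1) (n + 1 - (j + 1))) \<odot>\<^bsub>M\<^esub> tmap (Z \<diamond>\<^sub>R X) (Z \<diamond>\<^sub>R X) 1 (diff (Z \<diamond>\<^sub>R X)) n
     \<odot>\<^bsub>M\<^esub> tsgn (j * (n - j)) (jR Z X n (n - j))) = Ident M (ob Z (n - j)) \<otimes>\<^bsub>RAct M\<^esub> diff X j"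
proof -
  have S: "finite (supp A X)" "\<And>j. j \<notin> supp A X \<Longrightarrow> is_zero A (ob X j)" by (simp, simp add: supp_def)
  note F = tR.filtered_tot_right[OF Z X AM.filtered_trivial[OF bounded_complex_cplx[OF Z]] S]
  have i: "rinj A M (RAct M) (\<lambda>_. 0) (\<lambda>_ n. tid M (ob Z n)) Z X (a, j) n = tsgn (j * (n - j)) (jR Z X n (n - j))" for a :: unit and j n
    by (simp add: rinj_def)
  have p: "rprj A M (RAct M) (\<lambda>_. 0) (\<lambda>_ n. tid M (ob Z n)) Z X (a, j) n = tsgn (j * (n - j)) (qR Z X n (n - j))" for a :: unit and j n
    by (simp add: rprj_def)
  have "bij_betw (\<lambda>j. ((), j)) (supp A X) ({()} \<times> supp A X)" by (auto simp: bij_betw_def inj_on_def)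
  from AM.filtered_reindex[OF F this]
  show "filtered M (Z \<diamond>\<^sub>R X) (supp A X) (\<lambda>j. j) (\<lambda>j. rcol A (RAct M) Z (ob X j))
    (\<lambda>j n. tsgn (j * (n - j)) (jR Z X n (n - j))) (\<lambda>j n. tsgn (j * (n - j)) (qR Z X n (n - j)))"
    by (simp add: i[abs_def] p[abs_def])
  show "mor (tsgn ((j + 1) * (n + 1 - (j + 1))) (qR Z X (n + 1) (n + 1 - (j + 1))) \<odot>\<^bsub>M\<^esub> tmap (Z \<diamond>\<^sub>R X) (Z \<diamond>\<^sub>R X) 1 (diff (Z \<diamond>\<^sub>R X)) n
     \<odot>\<^bsub>M\<^esub> tsgn (j * (n - j)) (jR Z X n (n - j))) = Ident M (ob Z (n - j)) \<otimes>\<^bsub>RAct M\<^esub> diff X j"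
    using tR.rprj_diff_rinj_next[OF Z X AM.filtered_trivial[OF bounded_complex_cplx[OF Z]] S, of "()" j n]
    unfolding i p by simp
qed

lemma filtered_L:
  "filtered M (X \<diamond>\<^sub>L Z) (supp A X) (\<lambda>j. j) (\<lambda>j. lcol A (LAct M) (ob X j) Z) (\<lambda>j n. jL X Z n j) (\<lambda>j n. qL X Z n j)"
  "mor (qL X Z (n + 1) (j + 1) \<odot>\<^bsub>M\<^esub> tmap (X \<diamond>\<^sub>L Z) (X \<diamond>\<^sub>L Z) 1 (diff (X \<diamond>\<^sub>L Z)) n \<odot>\<^bsub>M\<^esub> jL X Z n j)
    = diff X j \<otimes>\<^bsub>LAct M\<^esub> Ident M (ob Z (n - j))"
proof -
  have S: "finite (supp A X)" "\<And>j. j \<notin> supp A X \<Longrightarrow> is_zero A (ob X j)" by (simp, simp add: supp_def)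
  note F = tL.filtered_tot_left[OF X Z AM.filtered_trivial[OF bounded_complex_cplx[OF Z]] S]
  have i: "linj A M (LAct M) (\<lambda>_ n. tid M (ob Z n)) X Z (j, a) n = jL X Z n j" for a :: unit and j n
    by (simp add: linj_def)
  have p: "lprj A M (LAct M) (\<lambda>_ n. tid M (ob Z n)) X Z (j, a) n = qL X Z n j" for a :: unit and j n
    by (simp add: lprj_def)
  have "bij_betw (\<lambda>j. (j, ())) (supp A X) (supp A X \<times> {()})" by (auto simp: bij_betw_def inj_on_def)
  from AM.filtered_reindex[OF F this]
  show "filtered M (X \<diamond>\<^sub>L Z) (supp A X) (\<lambda>j. j) (\<lambda>j. lcol A (LAct M) (ob X j) Z) (\<lambda>j n. jL X Z n j) (\<lambda>j n. qL X Z n j)"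
    by (simp add: i[abs_def] p[abs_def])
  show "mor (qL X Z (n + 1) (j + 1) \<odot>\<^bsub>M\<^esub> tmap (X \<diamond>\<^sub>L Z) (X \<diamond>\<^sub>L Z) 1 (diff (X \<diamond>\<^sub>L Z)) n \<odot>\<^bsub>M\<^esub> jL X Z n j)
    = diff X j \<otimes>\<^bsub>LAct M\<^esub> Ident M (ob Z (n - j))"
    using tL.lprj_diff_linj_next[OF X Z AM.filtered_trivial[OF bounded_complex_cplx[OF Z]] S, of "()" j n]
    unfolding i p by simp
qed

end

section \<open>Components of morphisms between triple products\<close>

context
  fixes Z X Y
  assumes Z [simp]: "bounded_complex M Z" and X [simp]: "bounded_complex A X" and Y [simp]: "bounded_complex A Y"
begin

text \<open>The indices are the degrees i in \<open>X\<close> and j in \<open>Y\<close>, which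
  leaves degree n - (i + j) for \<open>Z\<close>. The sign of the filtration is kept apart and
  appears in \<open>filtered_RR\<close>.\<close>

definition jRR :: "int \<Rightarrow> int \<Rightarrow> int \<Rightarrow> ('p, 'n) arr" where
  "jRR n i j = jR (Z \<diamond>\<^sub>R X) Y n (n - j) \<odot>\<^bsub>M\<^esub> (jR Z X (n - j) (n - (i + j)) \<Otimes>\<^bsub>RAct M\<^esub> tid A (ob Y j))"

definition qRR :: "int \<Rightarrow> int \<Rightarrow> int \<Rightarrow> ('p, 'n) arr" where
  "qRR n i j = (qR Z X (n - j) (n - (i + j)) \<Otimes>\<^bsub>RAct M\<^esub> tid A (ob Y j)) \<odot>\<^bsub>M\<^esub> qR (Z \<diamond>\<^sub>R X) Y n (n - j)"

definition jLL :: "int \<Rightarrow> int \<Rightarrow> int \<Rightarrow> ('p, 'n) arr" where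
  "jLL n i j = jL X (Y \<diamond>\<^sub>L Z) n i \<odot>\<^bsub>M\<^esub> (tid A (ob X i) \<Otimes>\<^bsub>LAct M\<^esub> jL Y Z (n - i) j)"

definition qLL :: "int \<Rightarrow> int \<Rightarrow> int \<Rightarrow> ('p, 'n) arr" where
  "qLL n i j = (tid A (ob X i) \<Otimes>\<^bsub>LAct M\<^esub> qL Y Z (n - i) j) \<odot>\<^bsub>M\<^esub> qL X (Y \<diamond>\<^sub>L Z) n i"

lemma jRR_typing [simp]:
  "valid M (jRR n i j)" "src (jRR n i j) = (ob Z (n - (i + j)) \<star>\<^bsub>RAct M\<^esub> ob X i) \<star>\<^bsub>RAct M\<^esub> ob Y j"
  "tgt (jRR n i j) = sum_ob (tot_sum M (RAct M) (Z \<diamond>\<^sub>R X) Y n)"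
  by (simp_all add: jRR_def algebra_simps)

lemma qLL_typing [simp]:
  "valid M (qLL n i j)" "tgt (qLL n i j) = ob X i \<star>\<^bsub>LAct M\<^esub> (ob Y j \<star>\<^bsub>LAct M\<^esub> ob Z (n - (i + j)))"
  "src (qLL n i j) = sum_ob (tot_sum M (LAct M) X (Y \<diamond>\<^sub>L Z) n)"
  by (simp_all add: qLL_def algebra_simps)

text \<open>\<open>filtered_tot_right\<close> applied on top of \<open>filtered_R\<close>; the
  exponents i (n - j - i) and j (n - j - i) add up to (i + j) (n - (i + j)).\<close>

lemma filtered_RR:
  "filtered M ((Z \<diamond>\<^sub>R X) \<diamond>\<^sub>R Y) (supp A X \<times> supp A Y) (\<lambda>(i, j). i + j)
    (\<lambda>(i, j). rcol A (RAct M) (rcol A (RAct M) Z (ob X i)) (ob Y j))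
    (\<lambda>(i, j) n. tsgn ((i + j) * (n - (i + j))) (jRR n i j)) (\<lambda>(i, j) n. tsgn ((i + j) * (n - (i + j))) (qRR n i j))"
proof -
  have S: "finite (supp A Y)" "\<And>j. j \<notin> supp A Y \<Longrightarrow> is_zero A (ob Y j)" by (simp, simp add: supp_def)
  note F = tR.filtered_tot_right[OF tR.tot_bounded[OF Z X] Y filtered_R(1)[OF Z X] S]
  have i: "rinj A M (RAct M) (\<lambda>j. j) (\<lambda>j n. tsgn (j * (n - j)) (jR Z X n (n - j))) (Z \<diamond>\<^sub>R X) Y
      = (\<lambda>(i, j) n. tsgn ((i + j) * (n - (i + j))) (jRR n i j))"
    by (intro ext) (auto simp: rinj_def jRR_def algebra_simps)
  have p: "rprj A M (RAct M) (\<lambda>j. j) (\<lambda>j n. tsgn (j * (n - j)) (qR Z X n (n - j))) (Z \<diamond>\<^sub>R X) Y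
      = (\<lambda>(i, j) n. tsgn ((i + j) * (n - (i + j))) (qRR n i j))"
    by (intro ext) (auto simp: rprj_def qRR_def algebra_simps)
  show ?thesis using F unfolding i p .
qed

lemma filtered_LL:
  "filtered M (X \<diamond>\<^sub>L (Y \<diamond>\<^sub>L Z)) (supp A X \<times> supp A Y) (\<lambda>(i, j). i + j)
    (\<lambda>(i, j). lcol A (LAct M) (ob X i) (lcol A (LAct M) (ob Y j) Z))
    (\<lambda>(i, j) n. jLL n i j) (\<lambda>(i, j) n. qLL n i j)"
proof -
  have S: "finite (supp A X)" "\<And>j. j \<notin> supp A X \<Longrightarrow> is_zero A (ob X j)" by (simp, simp add: supp_def)
  note F = tL.filtered_tot_left[OF X tL.tot_bounded[OF Y Z] filtered_L(1)[OF Z Y] S]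
  have i: "linj A M (LAct M) (\<lambda>j n. jL Y Z n j) X (Y \<diamond>\<^sub>L Z) = (\<lambda>(i, j) n. jLL n i j)"
    by (intro ext) (auto simp: linj_def jLL_def)
  have p: "lprj A M (LAct M) (\<lambda>j n. qL Y Z n j) X (Y \<diamond>\<^sub>L Z) = (\<lambda>(i, j) n. qLL n i j)"
    by (intro ext) (auto simp: lprj_def qLL_def)
  show ?thesis using F unfolding i p .
qed

lemma hatR_jRR:
  "tmap ((Z \<diamond>\<^sub>R X) \<diamond>\<^sub>R Y) (Z \<diamond>\<^sub>R (X \<diamond>\<^sub>A Y)) 0 (hatR Z X Y) n \<odot>\<^bsub>M\<^esub> jRR n i j
    = jR Z (X \<diamond>\<^sub>A Y) n (n - (i + j)) \<odot>\<^bsub>M\<^esub> (tid M (ob Z (n - (i + j))) \<Otimes>\<^bsub>RAct M\<^esub> jA X Y (i + j) i)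
      \<odot>\<^bsub>M\<^esub> aR.tas (ob Z (n - (i + j))) (ob X i) (ob Y j)"
  using aR.tot_assoc_tinj[OF Z X Y, of n "n - j" "n - (i + j)"] by (simp add: jRR_def algebra_simps)

text \<open>The counterpart of \<open>hatR_jRR\<close> for projections, tested on the summands of
  the source; only the one with index k + l contributes.\<close>

lemma qLL_hatL:
  "qLL n k l \<odot>\<^bsub>M\<^esub> tmap ((X \<diamond>\<^sub>A Y) \<diamond>\<^sub>L Z) (X \<diamond>\<^sub>L (Y \<diamond>\<^sub>L Z)) 0 (hatL X Y Z) n
    = aL.tas (ob X k) (ob Y l) (ob Z (n - (k + l))) \<odot>\<^bsub>M\<^esub> (qA X Y (k + l) k \<Otimes>\<^bsub>LAct M\<^esub> tid M (ob Z (n - (k + l))))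
      \<odot>\<^bsub>M\<^esub> qL (X \<diamond>\<^sub>A Y) Z n (k + l)" (is "?L = ?R")
proof (rule tL.tot_ext[OF tA.tot_bounded[OF X Y] Z])
  fix p
  have "?L \<odot>\<^bsub>M\<^esub> jL (X \<diamond>\<^sub>A Y) Z n p = (tid A (ob X k) \<Otimes>\<^bsub>LAct M\<^esub> qL Y Z (n - k) l)
    \<odot>\<^bsub>M\<^esub> (qL X (Y \<diamond>\<^sub>L Z) n k \<odot>\<^bsub>M\<^esub> tmap ((X \<diamond>\<^sub>A Y) \<diamond>\<^sub>L Z) (X \<diamond>\<^sub>L (Y \<diamond>\<^sub>L Z)) 0 (hatL X Y Z) n \<odot>\<^bsub>M\<^esub> jL (X \<diamond>\<^sub>A Y) Z n p)"
    using aL.tot_assoc_closed[OF X Y Z] by (simp add: qLL_def)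
  also have "\<dots> = ?R \<odot>\<^bsub>M\<^esub> jL (X \<diamond>\<^sub>A Y) Z n p"
    unfolding aL.tprj_tot_assoc[OF X Y Z] by (cases "p = k + l") (simp_all add: algebra_simps)
  finally show "?L \<odot>\<^bsub>M\<^esub> jL (X \<diamond>\<^sub>A Y) Z n p = ?R \<odot>\<^bsub>M\<^esub> jL (X \<diamond>\<^sub>A Y) Z n p" .
qed (use aL.tot_assoc_closed[OF X Y Z] in \<open>simp_all add: algebra_simps\<close>)

text \<open>The entry from column (i, j) to column (k, l) sees only the entry of \<open>T\<close>
  from degree i + j to degree k + l of \<open>X \<diamond>\<^sub>A Y\<close>, placed between an
  inclusion and a projection of summands.\<close>

lemma components_assoc_left:
  assumes T: "T \<in> hom_cx M (Z \<diamond>\<^sub>R (X \<diamond>\<^sub>A Y)) ((X \<diamond>\<^sub>A Y) \<diamond>\<^sub>L Z) 0"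
  shows "qLL n k l \<odot>\<^bsub>M\<^esub> tmap ((Z \<diamond>\<^sub>R X) \<diamond>\<^sub>R Y) (X \<diamond>\<^sub>L (Y \<diamond>\<^sub>L Z)) 0
      (\<lambda>n. hatL X Y Z n \<cdot>\<^bsub>M\<^esub> (T n \<cdot>\<^bsub>M\<^esub> hatR Z X Y n)) n \<odot>\<^bsub>M\<^esub> jRR n i j
    = aL.tas (ob X k) (ob Y l) (ob Z (n - (k + l))) \<odot>\<^bsub>M\<^esub> (qA X Y (k + l) k \<Otimes>\<^bsub>LAct M\<^esub> tid M (ob Z (n - (k + l))))
      \<odot>\<^bsub>M\<^esub> (qL (X \<diamond>\<^sub>A Y) Z n (k + l) \<odot>\<^bsub>M\<^esub> tmap (Z \<diamond>\<^sub>R (X \<diamond>\<^sub>A Y)) ((X \<diamond>\<^sub>A Y) \<diamond>\<^sub>L Z) 0 T n \<odot>\<^bsub>M\<^esub> jR Z (X \<diamond>\<^sub>A Y) n (n - (i + j)))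
      \<odot>\<^bsub>M\<^esub> (tid M (ob Z (n - (i + j))) \<Otimes>\<^bsub>RAct M\<^esub> jA X Y (i + j) i) \<odot>\<^bsub>M\<^esub> aR.tas (ob Z (n - (i + j))) (ob X i) (ob Y j)"
proof -
  let ?L = "tmap ((X \<diamond>\<^sub>A Y) \<diamond>\<^sub>L Z) (X \<diamond>\<^sub>L (Y \<diamond>\<^sub>L Z)) 0 (hatL X Y Z) n"
  let ?R = "tmap ((Z \<diamond>\<^sub>R X) \<diamond>\<^sub>R Y) (Z \<diamond>\<^sub>R (X \<diamond>\<^sub>A Y)) 0 (hatR Z X Y) n"
  let ?T = "tmap (Z \<diamond>\<^sub>R (X \<diamond>\<^sub>A Y)) ((X \<diamond>\<^sub>A Y) \<diamond>\<^sub>L Z) 0 T n"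
  have c: "hatL X Y Z \<in> hom_cx M ((X \<diamond>\<^sub>A Y) \<diamond>\<^sub>L Z) (X \<diamond>\<^sub>L (Y \<diamond>\<^sub>L Z)) 0"
    "hatR Z X Y \<in> hom_cx M ((Z \<diamond>\<^sub>R X) \<diamond>\<^sub>R Y) (Z \<diamond>\<^sub>R (X \<diamond>\<^sub>A Y)) 0"
    using aL.tot_assoc_closed[OF X Y Z] aR.tot_assoc_closed[OF Z X Y] by simp_all
  have e: "tmap ((Z \<diamond>\<^sub>R X) \<diamond>\<^sub>R Y) (X \<diamond>\<^sub>L (Y \<diamond>\<^sub>L Z)) 0 (\<lambda>n. hatL X Y Z n \<cdot>\<^bsub>M\<^esub> (T n \<cdot>\<^bsub>M\<^esub> hatR Z X Y n)) n = ?L \<odot>\<^bsub>M\<^esub> ?T \<odot>\<^bsub>M\<^esub> ?R"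
    by (rule arr_eqI) simp_all
  have "qLL n k l \<odot>\<^bsub>M\<^esub> (?L \<odot>\<^bsub>M\<^esub> ?T \<odot>\<^bsub>M\<^esub> ?R) \<odot>\<^bsub>M\<^esub> jRR n i j = (qLL n k l \<odot>\<^bsub>M\<^esub> ?L) \<odot>\<^bsub>M\<^esub> ?T \<odot>\<^bsub>M\<^esub> (?R \<odot>\<^bsub>M\<^esub> jRR n i j)"
    using c T by simp
  then show ?thesis unfolding e qLL_hatL hatR_jRR using T by (simp add: algebra_simps)
qed

text \<open>\<open>TX\<close> acts from degree i to degree k of \<open>X\<close> while
  \<open>Y\<close> stays in degree j, then \<open>TY\<close> from j to l while \<open>X\<close>
  stays in degree k. Each factor changes one index only, so the entry is a single product.\<close>

lemma components_assoc_right: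
  assumes TX: "TX \<in> hom_cx M (Z \<diamond>\<^sub>R X) (X \<diamond>\<^sub>L Z) 0" and TY: "TY \<in> hom_cx M (Z \<diamond>\<^sub>R Y) (Y \<diamond>\<^sub>L Z) 0"
  shows "qLL n k l \<odot>\<^bsub>M\<^esub> tmap ((Z \<diamond>\<^sub>R X) \<diamond>\<^sub>R Y) (X \<diamond>\<^sub>L (Y \<diamond>\<^sub>L Z)) 0
      (\<lambda>n. tot_mor M (LAct M) X (Z \<diamond>\<^sub>R Y) X (Y \<diamond>\<^sub>L Z) 0 0 (\<lambda>i. Ident A (ob X i)) TY n
        \<cdot>\<^bsub>M\<^esub> (hatM X Z Y n \<cdot>\<^bsub>M\<^esub> tot_mor M (RAct M) (Z \<diamond>\<^sub>R X) Y (X \<diamond>\<^sub>L Z) Y 0 0 TX (\<lambda>i. Ident A (ob Y i)) n)) n \<odot>\<^bsub>M\<^esub> jRR n i j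
    = (tid A (ob X k) \<Otimes>\<^bsub>LAct M\<^esub> (qL Y Z (n - k) l \<odot>\<^bsub>M\<^esub> tmap (Z \<diamond>\<^sub>R Y) (Y \<diamond>\<^sub>L Z) 0 TY (n - k) \<odot>\<^bsub>M\<^esub> jR Z Y (n - k) (n - (k + j))))
      \<odot>\<^bsub>M\<^esub> aM.tas (ob X k) (ob Z (n - (k + j))) (ob Y j)
      \<odot>\<^bsub>M\<^esub> ((qL X Z (n - j) k \<odot>\<^bsub>M\<^esub> tmap (Z \<diamond>\<^sub>R X) (X \<diamond>\<^sub>L Z) 0 TX (n - j) \<odot>\<^bsub>M\<^esub> jR Z X (n - j) (n - (i + j))) \<Otimes>\<^bsub>RAct M\<^esub> tid A (ob Y j))"
proof -
  let ?l = "tot_mor M (LAct M) X (Z \<diamond>\<^sub>R Y) X (Y \<diamond>\<^sub>L Z) 0 0 (\<lambda>i. Ident A (ob X i)) TY"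
  let ?r = "tot_mor M (RAct M) (Z \<diamond>\<^sub>R X) Y (X \<diamond>\<^sub>L Z) Y 0 0 TX (\<lambda>i. Ident A (ob Y i))"
  let ?L = "tmap (X \<diamond>\<^sub>L (Z \<diamond>\<^sub>R Y)) (X \<diamond>\<^sub>L (Y \<diamond>\<^sub>L Z)) 0 ?l n"
  let ?R = "tmap ((Z \<diamond>\<^sub>R X) \<diamond>\<^sub>R Y) ((X \<diamond>\<^sub>L Z) \<diamond>\<^sub>R Y) 0 ?r n"
  let ?M = "tmap ((X \<diamond>\<^sub>L Z) \<diamond>\<^sub>R Y) (X \<diamond>\<^sub>L (Z \<diamond>\<^sub>R Y)) 0 (hatM X Z Y) n"
  have iX: "(\<lambda>i. Ident A (ob X i)) \<in> hom_cx A X X 0" and iY: "(\<lambda>i. Ident A (ob Y i)) \<in> hom_cx A Y Y 0" by simp_all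
  have c: "hatM X Z Y \<in> hom_cx M ((X \<diamond>\<^sub>L Z) \<diamond>\<^sub>R Y) (X \<diamond>\<^sub>L (Z \<diamond>\<^sub>R Y)) 0" "?l \<in> hom_cx M (X \<diamond>\<^sub>L (Z \<diamond>\<^sub>R Y)) (X \<diamond>\<^sub>L (Y \<diamond>\<^sub>L Z)) 0"
     "?r \<in> hom_cx M ((Z \<diamond>\<^sub>R X) \<diamond>\<^sub>R Y) ((X \<diamond>\<^sub>L Z) \<diamond>\<^sub>R Y) 0"
    using aM.tot_assoc_closed[OF X Z Y] TX TY by simp_all
  have e: "tmap ((Z \<diamond>\<^sub>R X) \<diamond>\<^sub>R Y) (X \<diamond>\<^sub>L (Y \<diamond>\<^sub>L Z)) 0 (\<lambda>n. ?l n \<cdot>\<^bsub>M\<^esub> (hatM X Z Y n \<cdot>\<^bsub>M\<^esub> ?r n)) n = ?L \<odot>\<^bsub>M\<^esub> ?M \<odot>\<^bsub>M\<^esub> ?R"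
    by (rule arr_eqI) simp_all
  have l: "qL X (Y \<diamond>\<^sub>L Z) n k \<odot>\<^bsub>M\<^esub> ?L = (tid A (ob X k) \<Otimes>\<^bsub>LAct M\<^esub> tmap (Z \<diamond>\<^sub>R Y) (Y \<diamond>\<^sub>L Z) 0 TY (n - k)) \<odot>\<^bsub>M\<^esub> qL X (Z \<diamond>\<^sub>R Y) n k"
    using tL.tot_mor_tprj[OF X _ X _ iX TY, of n k] by simp
  have m: "qL X (Z \<diamond>\<^sub>R Y) n k \<odot>\<^bsub>M\<^esub> ?M \<odot>\<^bsub>M\<^esub> jR (X \<diamond>\<^sub>L Z) Y n (n - j)
    = (tid A (ob X k) \<Otimes>\<^bsub>LAct M\<^esub> jR Z Y (n - k) (n - (k + j))) \<odot>\<^bsub>M\<^esub> aM.tas (ob X k) (ob Z (n - (k + j))) (ob Y j)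
      \<odot>\<^bsub>M\<^esub> (qL X Z (n - j) k \<Otimes>\<^bsub>RAct M\<^esub> tid A (ob Y j))"
    using aM.tprj_tot_assoc[OF X Z Y, of n k "n - j"] by (simp add: algebra_simps)
  have r: "?R \<odot>\<^bsub>M\<^esub> jRR n i j = jR (X \<diamond>\<^sub>L Z) Y n (n - j) \<odot>\<^bsub>M\<^esub> ((tmap (Z \<diamond>\<^sub>R X) (X \<diamond>\<^sub>L Z) 0 TX (n - j) \<odot>\<^bsub>M\<^esub> jR Z X (n - j) (n - (i + j))) \<Otimes>\<^bsub>RAct M\<^esub> tid A (ob Y j))"
    using TX by (simp add: jRR_def algebra_simps)
  have "qLL n k l \<odot>\<^bsub>M\<^esub> (?L \<odot>\<^bsub>M\<^esub> ?M \<odot>\<^bsub>M\<^esub> ?R) \<odot>\<^bsub>M\<^esub> jRR n i j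
    = (tid A (ob X k) \<Otimes>\<^bsub>LAct M\<^esub> qL Y Z (n - k) l) \<odot>\<^bsub>M\<^esub> (qL X (Y \<diamond>\<^sub>L Z) n k \<odot>\<^bsub>M\<^esub> ?L) \<odot>\<^bsub>M\<^esub> ?M \<odot>\<^bsub>M\<^esub> (?R \<odot>\<^bsub>M\<^esub> jRR n i j)"
    using c by (simp add: qLL_def)
  also have "\<dots> = (tid A (ob X k) \<Otimes>\<^bsub>LAct M\<^esub> (qL Y Z (n - k) l \<odot>\<^bsub>M\<^esub> tmap (Z \<diamond>\<^sub>R Y) (Y \<diamond>\<^sub>L Z) 0 TY (n - k)))
      \<odot>\<^bsub>M\<^esub> (qL X (Z \<diamond>\<^sub>R Y) n k \<odot>\<^bsub>M\<^esub> ?M \<odot>\<^bsub>M\<^esub> jR (X \<diamond>\<^sub>L Z) Y n (n - j))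
      \<odot>\<^bsub>M\<^esub> ((tmap (Z \<diamond>\<^sub>R X) (X \<diamond>\<^sub>L Z) 0 TX (n - j) \<odot>\<^bsub>M\<^esub> jR Z X (n - j) (n - (i + j))) \<Otimes>\<^bsub>RAct M\<^esub> tid A (ob Y j))"
    unfolding l r using c TX TY by (simp add: algebra_simps)
  also have "\<dots> = (tid A (ob X k) \<Otimes>\<^bsub>LAct M\<^esub> (qL Y Z (n - k) l \<odot>\<^bsub>M\<^esub> tmap (Z \<diamond>\<^sub>R Y) (Y \<diamond>\<^sub>L Z) 0 TY (n - k) \<odot>\<^bsub>M\<^esub> jR Z Y (n - k) (n - (k + j))))
      \<odot>\<^bsub>M\<^esub> aM.tas (ob X k) (ob Z (n - (k + j))) (ob Y j)
      \<odot>\<^bsub>M\<^esub> ((qL X Z (n - j) k \<odot>\<^bsub>M\<^esub> tmap (Z \<diamond>\<^sub>R X) (X \<diamond>\<^sub>L Z) 0 TX (n - j) \<odot>\<^bsub>M\<^esub> jR Z X (n - j) (n - (i + j))) \<Otimes>\<^bsub>RAct M\<^esub> tid A (ob Y j))"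
    unfolding m using c TX TY by (simp add: algebra_simps)
  finally show ?thesis unfolding e .
qed

end

end

section \<open>Restricting the half-braiding to columns\<close>

lemma Kb_bimod_simps [simp]:
  "Obj (Kb_bimod A M) = Obj (Kb M)" "Hom (Kb_bimod A M) = Hom (Kb M)" "Comp (Kb_bimod A M) = Comp (Kb M)"
  "Ident (Kb_bimod A M) = Ident (Kb M)"
  "LAct (Kb_bimod A M) = Kb_bifun A M M (LAct M)" "RAct (Kb_bimod A M) = Kb_bifun M A M (RAct M)"
  "LAssoc (Kb_bimod A M) = Kb_assoc A A M A M M (Tensor A) (LAct M) (LAct M) (LAct M) (LAssoc M)"
  "MAssoc (Kb_bimod A M) = Kb_assoc A M A M M M (LAct M) (RAct M) (RAct M) (LAct M) (MAssoc M)"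
  "RAssoc (Kb_bimod A M) = Kb_assoc M A A M A M (RAct M) (RAct M) (Tensor A) (RAct M) (RAssoc M)"
  by (simp_all add: Kb_bimod_def)

lemma Kb_bimod_base_simps [simp]:
  "Obj (Kb_bimod_base A M) = Obj (Kb M)" "Hom (Kb_bimod_base A M) = Hom (Kb M)" "Comp (Kb_bimod_base A M) = Comp (Kb M)"
  "Ident (Kb_bimod_base A M) = Ident (Kb M)"
  "X \<star>\<^bsub>LAct (Kb_bimod_base A M)\<^esub> N = tot A M M (LAct M) (stalk A X) N"
  "N \<star>\<^bsub>RAct (Kb_bimod_base A M)\<^esub> X = tot M A M (RAct M) N (stalk A X)"
  "u \<otimes>\<^bsub>LAct (Kb_bimod_base A M)\<^esub> w = MorT (Kb_bifun A M M (LAct M)) (stalk_mor A u) w"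
  "w \<otimes>\<^bsub>RAct (Kb_bimod_base A M)\<^esub> u = MorT (Kb_bifun M A M (RAct M)) w (stalk_mor A u)"
  "LAssoc (Kb_bimod_base A M) X Y N =
    LAssoc (Kb_bimod A M) (stalk A X) (stalk A Y) N \<cdot>\<^bsub>Kb M\<^esub> MorT (Kb_bifun A M M (LAct M)) (stalk_mu_inv A X Y) (Ident (Kb M) N)"
  "MAssoc (Kb_bimod_base A M) X N Y = MAssoc (Kb_bimod A M) (stalk A X) N (stalk A Y)"
  "RAssoc (Kb_bimod_base A M) N X Y =
    MorT (Kb_bifun M A M (RAct M)) (Ident (Kb M) N) (stalk_mu A X Y) \<cdot>\<^bsub>Kb M\<^esub> RAssoc (Kb_bimod A M) N (stalk A X) (stalk A Y)"
  by (simp_all add: Kb_bimod_base_def Let_def Kb_bifun_def)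

text \<open>The hypotheses of the theorem, with the actions of \<open>A\<close> spelled out as total
  tensor products with stalks.\<close>

locale centralizer_lift = additive_bimodule_category A sA M sM
  for A :: "('o, 'm::ab_group_add) moncat"
    and sA :: "'k::comm_ring_1 \<Rightarrow> 'm \<Rightarrow> 'm"
    and M :: "('p, 'n::ab_group_add, 'o, 'm) bimod"
    and sM :: "'k \<Rightarrow> 'n \<Rightarrow> 'n" +
  fixes Z :: "('p, 'n) cochain" and \<tau> :: "'o \<Rightarrow> ('p, 'n) kmor"
  assumes Z [simp]: "bounded_complex M Z"
    and hom_cohomology_negative: "\<And>X Y k. \<lbrakk>X \<in> Obj A; Y \<in> Obj A; k < 0\<rbrakk> \<Longrightarrow>
      hom_cohomology M (Z \<diamond>\<^sub>R stalk A X) (stalk A Y \<diamond>\<^sub>L Z) k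
      = {hom_class M (Z \<diamond>\<^sub>R stalk A X) (stalk A Y \<diamond>\<^sub>L Z) k (\<lambda>_. 0)}"
    and half_braiding: "(Z, \<tau>) \<in> centralizer (typed A) (Kb_bimod_base A M)"
begin

abbreviation colR where "colR X \<equiv> rcol A (RAct M) Z X"
abbreviation colL where "colL X \<equiv> lcol A (LAct M) X Z"
abbreviation colRR where "colRR X Y \<equiv> rcol A (RAct M) (colR X) Y"
abbreviation colLL where "colLL X Y \<equiv> lcol A (LAct M) X (colL Y)"

definition th :: "'o \<Rightarrow> int \<Rightarrow> 'n" where "th X = krep (\<tau> X)"

lemma th:
  assumes X: "X \<in> Obj A"
  shows th_cocycle: "th X \<in> hom_cocycles M (Z \<diamond>\<^sub>R stalk A X) (stalk A X \<diamond>\<^sub>L Z) 0"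
    and kclass_th: "kclass M (Z \<diamond>\<^sub>R stalk A X) (stalk A X \<diamond>\<^sub>L Z) (th X) = \<tau> X"
    and th_inverse: "\<exists>g \<in> hom_cocycles M (stalk A X \<diamond>\<^sub>L Z) (Z \<diamond>\<^sub>R stalk A X) 0.
      homotopic M (Z \<diamond>\<^sub>R stalk A X) (Z \<diamond>\<^sub>R stalk A X) (\<lambda>i. g i \<cdot>\<^bsub>M\<^esub> th X i) (\<lambda>i. Ident M (ob (Z \<diamond>\<^sub>R stalk A X) i)) \<and>
      homotopic M (stalk A X \<diamond>\<^sub>L Z) (stalk A X \<diamond>\<^sub>L Z) (\<lambda>i. th X i \<cdot>\<^bsub>M\<^esub> g i) (\<lambda>i. Ident M (ob (stalk A X \<diamond>\<^sub>L Z) i))"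
proof -
  have b: "cplx M (Z \<diamond>\<^sub>R stalk A X)" "cplx M (stalk A X \<diamond>\<^sub>L Z)" using X by simp_all
  have "is_iso (Kb_bimod_base A M) (Z \<diamond>\<^sub>R stalk A X) (stalk A X \<diamond>\<^sub>L Z) (\<tau> X)"
    using half_braiding X by (auto simp: centralizer_def typed_def)
  then have "is_iso (Kb M) (Z \<diamond>\<^sub>R stalk A X) (stalk A X \<diamond>\<^sub>L Z) (\<tau> X)" by (simp add: is_iso_def)
  from AM.Kb_is_isoE[OF b this] obtain f g where fg: "f = krep (\<tau> X)"
    "\<tau> X = kclass M (Z \<diamond>\<^sub>R stalk A X) (stalk A X \<diamond>\<^sub>L Z) f"
    "f \<in> hom_cocycles M (Z \<diamond>\<^sub>R stalk A X) (stalk A X \<diamond>\<^sub>L Z) 0"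
    "g \<in> hom_cocycles M (stalk A X \<diamond>\<^sub>L Z) (Z \<diamond>\<^sub>R stalk A X) 0"
    "homotopic M (Z \<diamond>\<^sub>R stalk A X) (Z \<diamond>\<^sub>R stalk A X) (\<lambda>i. g i \<cdot>\<^bsub>M\<^esub> f i) (\<lambda>i. Ident M (ob (Z \<diamond>\<^sub>R stalk A X) i))"
    "homotopic M (stalk A X \<diamond>\<^sub>L Z) (stalk A X \<diamond>\<^sub>L Z) (\<lambda>i. f i \<cdot>\<^bsub>M\<^esub> g i) (\<lambda>i. Ident M (ob (stalk A X \<diamond>\<^sub>L Z) i))" .
  have f: "th X = f" unfolding th_def fg(1) ..
  show "th X \<in> hom_cocycles M (Z \<diamond>\<^sub>R stalk A X) (stalk A X \<diamond>\<^sub>L Z) 0"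
    "kclass M (Z \<diamond>\<^sub>R stalk A X) (stalk A X \<diamond>\<^sub>L Z) (th X) = \<tau> X"
    unfolding f by (rule fg(3), rule fg(2)[symmetric])
  show "\<exists>g \<in> hom_cocycles M (stalk A X \<diamond>\<^sub>L Z) (Z \<diamond>\<^sub>R stalk A X) 0.
      homotopic M (Z \<diamond>\<^sub>R stalk A X) (Z \<diamond>\<^sub>R stalk A X) (\<lambda>i. g i \<cdot>\<^bsub>M\<^esub> th X i) (\<lambda>i. Ident M (ob (Z \<diamond>\<^sub>R stalk A X) i)) \<and>
      homotopic M (stalk A X \<diamond>\<^sub>L Z) (stalk A X \<diamond>\<^sub>L Z) (\<lambda>i. th X i \<cdot>\<^bsub>M\<^esub> g i) (\<lambda>i. Ident M (ob (stalk A X \<diamond>\<^sub>L Z) i))"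
    unfolding f using fg(4-6) by (intro bexI[OF _ fg(4)] conjI)
qed

text \<open>The naturality condition of the centralizer, read on representatives: equality of
  classes becomes a homotopy.\<close>

lemma th_natural:
  assumes X: "X \<in> Obj A" and Y: "Y \<in> Obj A" and f: "f \<in> Hom A X Y"
  defines "fh \<equiv> \<lambda>i::int. if i = 0 then f else 0"
  shows "homotopic M (Z \<diamond>\<^sub>R stalk A X) (stalk A Y \<diamond>\<^sub>L Z)
    (\<lambda>i. th Y i \<cdot>\<^bsub>M\<^esub> tot_mor M (RAct M) Z (stalk A X) Z (stalk A Y) 0 0 (\<lambda>i. Ident M (ob Z i)) fh i)
    (\<lambda>i. tot_mor M (LAct M) (stalk A X) Z (stalk A Y) Z 0 0 fh (\<lambda>i. Ident M (ob Z i)) i \<cdot>\<^bsub>M\<^esub> th X i)"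
proof -
  have fc: "fh \<in> hom_cocycles A (stalk A X) (stalk A Y) 0"
    unfolding fh_def by (rule AA.stalk_mor_cocycle[OF X Y f])
  let ?u = "\<lparr>src = X, tgt = Y, mor = f\<rparr>"
  have u: "stalk_mor A ?u = kclass A (stalk A X) (stalk A Y) fh"
    unfolding fh_def by (rule AA.stalk_mor_eq)
  have "\<tau> Y \<cdot>\<^bsub>Kb M\<^esub> MorT (Kb_bifun M A M (RAct M)) (Ident (Kb M) Z) (stalk_mor A ?u)
    = MorT (Kb_bifun A M M (LAct M)) (stalk_mor A ?u) (Ident (Kb M) Z) \<cdot>\<^bsub>Kb M\<^esub> \<tau> X"
    using half_braiding X Y f by (auto simp: centralizer_def typed_def)
  then show ?thesis
    unfolding u AM.Kb_ident kclass_th[OF X, symmetric] kclass_th[OF Y, symmetric]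
    using X Y fc th_cocycle[OF X] th_cocycle[OF Y]
    by (simp add: tR.tot_mor_cocycle tL.tot_mor_cocycle AM.Kb_comp AM.kclass_eq_iff)
qed

end

section \<open>The product of two complexes concentrated in degree zero\<close>

context additive_bimodule_category
begin

context
  fixes X Y assumes X [simp]: "X \<in> Obj A" and Y [simp]: "Y \<in> Obj A"
begin

lemma tot_stalk_zero: "n \<noteq> 0 \<Longrightarrow> is_zero A (ob (stalk A X \<diamond>\<^sub>A stalk A Y) n)"
proof -
  assume n: "n \<noteq> 0"
  have "is_zero A (ob (stalk A X) i \<star>\<^bsub>Tensor A\<^esub> ob (stalk A Y) (n - i))" for i
  proof (cases "i = 0")
    case True
    then show ?thesis using n AA.stalk_ob_zero[of n Y] tA.is_zero_tensor_right by simp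
  next
    case False
    then show ?thesis using AA.stalk_ob_zero[of i X] tA.is_zero_tensor_left by simp
  qed
  then have "Ident A (sum_ob (tot_sum A (Tensor A) (stalk A X) (stalk A Y) n)) = 0"
    using tA.tot_sum_ident[of "stalk A X" "stalk A Y" "{}" n] by simp
  then show ?thesis by (subst AA.is_zero_iff_ident) simp_all
qed

definition mu :: "int \<Rightarrow> 'm" where
  "mu n = (if n = 0 then prj (tot_sum A (Tensor A) (stalk A X) (stalk A Y) 0) 0 else 0)"

definition mu_inv :: "int \<Rightarrow> 'm" where
  "mu_inv n = (if n = 0 then inj (tot_sum A (Tensor A) (stalk A X) (stalk A Y) 0) 0 else 0)"

lemma stalk_mu_eq:
  "stalk_mu A X Y = kclass A (stalk A X \<diamond>\<^sub>A stalk A Y) (stalk A (X \<star>\<^bsub>Tensor A\<^esub> Y)) mu"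
  "stalk_mu_inv A X Y = kclass A (stalk A (X \<star>\<^bsub>Tensor A\<^esub> Y)) (stalk A X \<diamond>\<^sub>A stalk A Y) mu_inv"
  by (simp_all add: stalk_mu_def stalk_mu_inv_def mu_def[abs_def] mu_inv_def[abs_def])

lemma mu_hom: "mu n \<in> Hom A (ob (stalk A X \<diamond>\<^sub>A stalk A Y) n) (ob (stalk A (X \<star>\<^bsub>Tensor A\<^esub> Y)) n)"
    "mu_inv n \<in> Hom A (ob (stalk A (X \<star>\<^bsub>Tensor A\<^esub> Y)) n) (ob (stalk A X \<diamond>\<^sub>A stalk A Y) n)"
  using tA.valid_tprj[of "stalk A X" "stalk A Y" 0 0] tA.valid_tinj[of "stalk A X" "stalk A Y" 0 0]
  by (auto simp: mu_def mu_inv_def valid_def)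

text \<open>Both composites vanish: the stalk has differential 0, the total product is zero outside
  degree 0, and \<open>mu\<close> is 0 in degree 1.\<close>

lemma mu_cocycle: "mu \<in> hom_cocycles A (stalk A X \<diamond>\<^sub>A stalk A Y) (stalk A (X \<star>\<^bsub>Tensor A\<^esub> Y)) 0"
  unfolding AA.cocycle0_iff
proof (intro conjI allI mu_hom)
  fix i
  let ?T = "stalk A X \<diamond>\<^sub>A stalk A Y" and ?S = "stalk A (X \<star>\<^bsub>Tensor A\<^esub> Y)"
  have c: "mu \<in> hom_cx A ?T ?S 0" using mu_hom by (simp add: hom_cx_def)
  have S: "bounded_complex A ?S" by simp
  have v: "valid A (tmap ?T ?S 0 mu (i + 1) \<odot>\<^bsub>A\<^esub> tmap ?T ?T 1 (diff ?T) i)" using c S by simp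
  have "mu (i + 1) \<cdot>\<^bsub>A\<^esub> diff ?T i = 0"
  proof (cases "i = 0")
    case True
    then have "mu (i + 1) = 0" by (simp add: mu_def)
    then show ?thesis using AA.valid_comp_zero(2)[of "tmap ?T ?T 1 (diff ?T) i"] by simp
  next
    case False
    then show ?thesis using AA.is_zero_src[OF _ v] tot_stalk_zero[of i] by simp
  qed
  moreover have "diff ?S i \<cdot>\<^bsub>A\<^esub> mu i = 0"
    using AA.valid_comp_zero(2)[of "tmap ?T ?S 0 mu i"] c S by simp
  ultimately show "diff ?S i \<cdot>\<^bsub>A\<^esub> mu i = mu (i + 1) \<cdot>\<^bsub>A\<^esub> diff ?T i" by simp
qed

lemma mu_inv_cocycle: "mu_inv \<in> hom_cocycles A (stalk A (X \<star>\<^bsub>Tensor A\<^esub> Y)) (stalk A X \<diamond>\<^sub>A stalk A Y) 0"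
  unfolding AA.cocycle0_iff
proof (intro conjI allI mu_hom)
  fix i
  let ?T = "stalk A X \<diamond>\<^sub>A stalk A Y" and ?S = "stalk A (X \<star>\<^bsub>Tensor A\<^esub> Y)"
  have c: "mu_inv \<in> hom_cx A ?S ?T 0" using mu_hom by (simp add: hom_cx_def)
  have S: "bounded_complex A ?S" by simp
  have v: "valid A (tmap ?T ?T 1 (diff ?T) i \<odot>\<^bsub>A\<^esub> tmap ?S ?T 0 mu_inv i)" using c S by simp
  have "diff ?T i \<cdot>\<^bsub>A\<^esub> mu_inv i = 0"
  proof (cases "i = - 1")
    case True
    then have "mu_inv i = 0" by (simp add: mu_inv_def)
    then show ?thesis using AA.valid_comp_zero(1)[of "tmap ?T ?T 1 (diff ?T) i"] by simp
  next
    case False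
    then have "i + 1 \<noteq> 0" by simp
    then show ?thesis using AA.is_zero_tgt[OF _ v] tot_stalk_zero[of "i + 1"] by simp
  qed
  moreover have "mu_inv (i + 1) \<cdot>\<^bsub>A\<^esub> diff ?S i = 0"
    using AA.valid_comp_zero(1)[of "tmap ?S ?T 0 mu_inv (i + 1)"] c S by simp
  ultimately show "diff ?T i \<cdot>\<^bsub>A\<^esub> mu_inv i = mu_inv (i + 1) \<cdot>\<^bsub>A\<^esub> diff ?S i" by simp
qed

end

end

context centralizer_lift
begin

text \<open>The multiplicativity condition of the centralizer, read on representatives. The
  monoidality isomorphisms are grouped with the half-braiding of the product object, which gives the
  left side the shape of \<open>components_assoc_left\<close>.\<close>

lemma th_multiplicative:
  assumes X [simp]: "X \<in> Obj A" and Y [simp]: "Y \<in> Obj A"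
  defines "SX \<equiv> stalk A X" and "SY \<equiv> stalk A Y"
  shows "homotopic M ((Z \<diamond>\<^sub>R SX) \<diamond>\<^sub>R SY) (SX \<diamond>\<^sub>L (SY \<diamond>\<^sub>L Z))
    (\<lambda>n. hatL SX SY Z n \<cdot>\<^bsub>M\<^esub> ((tot_mor M (LAct M) (stalk A (X \<star>\<^bsub>Tensor A\<^esub> Y)) Z (SX \<diamond>\<^sub>A SY) Z 0 0 (mu_inv X Y) (\<lambda>i. Ident M (ob Z i)) n
      \<cdot>\<^bsub>M\<^esub> (th (X \<star>\<^bsub>Tensor A\<^esub> Y) n \<cdot>\<^bsub>M\<^esub> tot_mor M (RAct M) Z (SX \<diamond>\<^sub>A SY) Z (stalk A (X \<star>\<^bsub>Tensor A\<^esub> Y)) 0 0 (\<lambda>i. Ident M (ob Z i)) (mu X Y) n))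
      \<cdot>\<^bsub>M\<^esub> hatR Z SX SY n))
    (\<lambda>n. tot_mor M (LAct M) SX (Z \<diamond>\<^sub>R SY) SX (SY \<diamond>\<^sub>L Z) 0 0 (\<lambda>i. Ident A (ob SX i)) (th Y) n
        \<cdot>\<^bsub>M\<^esub> (hatM SX Z SY n \<cdot>\<^bsub>M\<^esub> tot_mor M (RAct M) (Z \<diamond>\<^sub>R SX) SY (SX \<diamond>\<^sub>L Z) SY 0 0 (th X) (\<lambda>i. Ident A (ob SY i)) n))"
proof -
  let ?XY = "X \<star>\<^bsub>Tensor A\<^esub> Y" let ?S = "stalk A ?XY"
  have XY: "?XY \<in> Obj A" by simp
  have B [simp]: "bounded_complex A SX" "bounded_complex A SY" "bounded_complex A ?S" unfolding SX_def SY_def by simp_all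
  let ?mi = "tot_mor M (LAct M) ?S Z (SX \<diamond>\<^sub>A SY) Z 0 0 (mu_inv X Y) (\<lambda>i. Ident M (ob Z i))"
  let ?m = "tot_mor M (RAct M) Z (SX \<diamond>\<^sub>A SY) Z ?S 0 0 (\<lambda>i. Ident M (ob Z i)) (mu X Y)"
  let ?t = "th ?XY"
  let ?l = "tot_mor M (LAct M) SX (Z \<diamond>\<^sub>R SY) SX (SY \<diamond>\<^sub>L Z) 0 0 (\<lambda>i. Ident A (ob SX i)) (th Y)"
  let ?r = "tot_mor M (RAct M) (Z \<diamond>\<^sub>R SX) SY (SX \<diamond>\<^sub>L Z) SY 0 0 (th X) (\<lambda>i. Ident A (ob SY i))"
  note muc = mu_cocycle[OF X Y, folded SX_def SY_def] mu_inv_cocycle[OF X Y, folded SX_def SY_def]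
  note thX = th_cocycle[OF X, folded SX_def] and thY = th_cocycle[OF Y, folded SY_def]
  have mi: "?mi \<in> hom_cocycles M (?S \<diamond>\<^sub>L Z) ((SX \<diamond>\<^sub>A SY) \<diamond>\<^sub>L Z) 0" using muc by (intro tL.tot_mor_cocycle) simp_all
  have m: "?m \<in> hom_cocycles M (Z \<diamond>\<^sub>R (SX \<diamond>\<^sub>A SY)) (Z \<diamond>\<^sub>R ?S) 0" using muc by (intro tR.tot_mor_cocycle) simp_all
  have l: "?l \<in> hom_cocycles M (SX \<diamond>\<^sub>L (Z \<diamond>\<^sub>R SY)) (SX \<diamond>\<^sub>L (SY \<diamond>\<^sub>L Z)) 0" using thY by (intro tL.tot_mor_cocycle) simp_all
  have r: "?r \<in> hom_cocycles M ((Z \<diamond>\<^sub>R SX) \<diamond>\<^sub>R SY) ((SX \<diamond>\<^sub>L Z) \<diamond>\<^sub>R SY) 0" using thX by (intro tR.tot_mor_cocycle) simp_all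
  have hL: "hatL SX SY Z \<in> hom_cocycles M ((SX \<diamond>\<^sub>A SY) \<diamond>\<^sub>L Z) (SX \<diamond>\<^sub>L (SY \<diamond>\<^sub>L Z)) 0"
    and hM: "hatM SX Z SY \<in> hom_cocycles M ((SX \<diamond>\<^sub>L Z) \<diamond>\<^sub>R SY) (SX \<diamond>\<^sub>L (Z \<diamond>\<^sub>R SY)) 0"
    and hR: "hatR Z SX SY \<in> hom_cocycles M ((Z \<diamond>\<^sub>R SX) \<diamond>\<^sub>R SY) (Z \<diamond>\<^sub>R (SX \<diamond>\<^sub>A SY)) 0"
    by (rule aL.tot_assoc_cocycle aM.tot_assoc_cocycle aR.tot_assoc_cocycle; simp)+
  have c: "(\<lambda>n. hatL SX SY Z n \<cdot>\<^bsub>M\<^esub> ?mi n) \<in> hom_cocycles M (?S \<diamond>\<^sub>L Z) (SX \<diamond>\<^sub>L (SY \<diamond>\<^sub>L Z)) 0"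
    "(\<lambda>n. ?m n \<cdot>\<^bsub>M\<^esub> hatR Z SX SY n) \<in> hom_cocycles M ((Z \<diamond>\<^sub>R SX) \<diamond>\<^sub>R SY) (Z \<diamond>\<^sub>R ?S) 0"
    "(\<lambda>n. hatM SX Z SY n \<cdot>\<^bsub>M\<^esub> ?r n) \<in> hom_cocycles M ((Z \<diamond>\<^sub>R SX) \<diamond>\<^sub>R SY) (SX \<diamond>\<^sub>L (Z \<diamond>\<^sub>R SY)) 0"
    by (rule AM.cocycle_comp0[OF _ _ _ mi hL] AM.cocycle_comp0[OF _ _ _ hR m] AM.cocycle_comp0[OF _ _ _ r hM]; simp)+
  have c': "(\<lambda>n. ?t n \<cdot>\<^bsub>M\<^esub> (?m n \<cdot>\<^bsub>M\<^esub> hatR Z SX SY n)) \<in> hom_cocycles M ((Z \<diamond>\<^sub>R SX) \<diamond>\<^sub>R SY) (?S \<diamond>\<^sub>L Z) 0"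
    by (rule AM.cocycle_comp0[OF _ _ _ c(2) th_cocycle[OF XY]]) simp_all
  have "LAssoc (Kb_bimod_base A M) X Y Z \<cdot>\<^bsub>Kb M\<^esub> \<tau> ?XY \<cdot>\<^bsub>Kb M\<^esub> RAssoc (Kb_bimod_base A M) Z X Y
    = MorT (Kb_bifun A M M (LAct M)) (stalk_mor A \<lparr>src = X, tgt = X, mor = Ident A X\<rparr>) (\<tau> Y)
      \<cdot>\<^bsub>Kb M\<^esub> MAssoc (Kb_bimod_base A M) X Z Y
      \<cdot>\<^bsub>Kb M\<^esub> MorT (Kb_bifun M A M (RAct M)) (\<tau> X) (stalk_mor A \<lparr>src = Y, tgt = Y, mor = Ident A Y\<rparr>)"
    using half_braiding by (simp add: centralizer_def typed_def del: Kb_bimod_base_simps(9-))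
  then have "kclass M ((Z \<diamond>\<^sub>R SX) \<diamond>\<^sub>R SY) (SX \<diamond>\<^sub>L (SY \<diamond>\<^sub>L Z))
      (\<lambda>n. (hatL SX SY Z n \<cdot>\<^bsub>M\<^esub> ?mi n) \<cdot>\<^bsub>M\<^esub> (?t n \<cdot>\<^bsub>M\<^esub> (?m n \<cdot>\<^bsub>M\<^esub> hatR Z SX SY n)))
    = kclass M ((Z \<diamond>\<^sub>R SX) \<diamond>\<^sub>R SY) (SX \<diamond>\<^sub>L (SY \<diamond>\<^sub>L Z)) (\<lambda>n. ?l n \<cdot>\<^bsub>M\<^esub> (hatM SX Z SY n \<cdot>\<^bsub>M\<^esub> ?r n))"
    unfolding AA.stalk_mor_ident[OF X] AA.stalk_mor_ident[OF Y] Kb_bimod_base_simps Kb_bimod_simps Kb_assoc_eq stalk_mu_eq[OF X Y]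
      AM.Kb_ident AA.Kb_ident kclass_th[OF X, symmetric] kclass_th[OF Y, symmetric] kclass_th[OF XY, symmetric] SX_def[symmetric] SY_def[symmetric]
    using muc thX thY th_cocycle[OF XY] mi m l r hL hM hR c c'
    by (simp add: AM.Kb_comp)
  \<comment> \<open>The constraints of the action of \<open>A\<close> attach the monoidality
    isomorphisms to the associators; rebracketing moves them to the half-braiding.\<close>
  moreover have "(hatL SX SY Z n \<cdot>\<^bsub>M\<^esub> ?mi n) \<cdot>\<^bsub>M\<^esub> (?t n \<cdot>\<^bsub>M\<^esub> (?m n \<cdot>\<^bsub>M\<^esub> hatR Z SX SY n))
    = hatL SX SY Z n \<cdot>\<^bsub>M\<^esub> ((?mi n \<cdot>\<^bsub>M\<^esub> (?t n \<cdot>\<^bsub>M\<^esub> ?m n)) \<cdot>\<^bsub>M\<^esub> hatR Z SX SY n)" for n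
  proof -
    let ?L = "tmap ((SX \<diamond>\<^sub>A SY) \<diamond>\<^sub>L Z) (SX \<diamond>\<^sub>L (SY \<diamond>\<^sub>L Z)) 0 (hatL SX SY Z) n"
    let ?R = "tmap ((Z \<diamond>\<^sub>R SX) \<diamond>\<^sub>R SY) (Z \<diamond>\<^sub>R (SX \<diamond>\<^sub>A SY)) 0 (hatR Z SX SY) n"
    let ?I = "tmap (?S \<diamond>\<^sub>L Z) ((SX \<diamond>\<^sub>A SY) \<diamond>\<^sub>L Z) 0 ?mi n"
    let ?J = "tmap (Z \<diamond>\<^sub>R (SX \<diamond>\<^sub>A SY)) (Z \<diamond>\<^sub>R ?S) 0 ?m n"
    let ?T = "tmap (Z \<diamond>\<^sub>R ?S) (?S \<diamond>\<^sub>L Z) 0 ?t n"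
    have "(?L \<odot>\<^bsub>M\<^esub> ?I) \<odot>\<^bsub>M\<^esub> (?T \<odot>\<^bsub>M\<^esub> (?J \<odot>\<^bsub>M\<^esub> ?R)) = ?L \<odot>\<^bsub>M\<^esub> ((?I \<odot>\<^bsub>M\<^esub> (?T \<odot>\<^bsub>M\<^esub> ?J)) \<odot>\<^bsub>M\<^esub> ?R)"
      using hL hR mi m th_cocycle[OF XY] by (simp add: hom_cocyclesD)
    from arg_cong[where f = mor, OF this] show ?thesis by simp
  qed
  ultimately show ?thesis by (simp add: AM.kclass_eq_iff)
qed

end

context linear_category
begin

lemma homotopic_whisker:
  assumes X: "cplx C W" "cplx C X" "cplx C Y" "cplx C V"
    and fg: "homotopic C X Y f g" and f: "f \<in> hom_cocycles C X Y 0"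
    and j: "j \<in> hom_cocycles C W X 0" and q: "q \<in> hom_cocycles C Y V 0"
  shows "homotopic C W V (\<lambda>i. q i \<cdot>\<^bsub>C\<^esub> (f i \<cdot>\<^bsub>C\<^esub> j i)) (\<lambda>i. q i \<cdot>\<^bsub>C\<^esub> (g i \<cdot>\<^bsub>C\<^esub> j i))"
proof -
  have 1: "homotopic C W Y (\<lambda>i. f i \<cdot>\<^bsub>C\<^esub> j i) (\<lambda>i. g i \<cdot>\<^bsub>C\<^esub> j i)"
    by (rule homotopic_comp[OF X(1,2,3) j homotopic_refl[OF X(1,2)] f fg])
  show ?thesis
    by (rule homotopic_comp[OF X(1,3,4) cocycle_comp0[OF X(1,2,3) j f] 1 q homotopic_refl[OF X(3,4)]])
qed

text \<open>The inverse is exact in every degree, so the required homotopies are equalities.\<close>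

lemma isomorphism_cocycle:
  assumes X: "cplx C X" and Y: "cplx C Y" and j: "j \<in> hom_cocycles C X Y 0"
    and iso: "\<And>n. is_iso C (ob X n) (ob Y n) (j n)"
  obtains q where "q \<in> hom_cocycles C Y X 0"
    "homotopic C X X (\<lambda>i. q i \<cdot>\<^bsub>C\<^esub> j i) (\<lambda>i. Ident C (ob X i))"
    "homotopic C Y Y (\<lambda>i. j i \<cdot>\<^bsub>C\<^esub> q i) (\<lambda>i. Ident C (ob Y i))"
proof -
  have "\<forall>n. \<exists>g. g \<in> Hom C (ob Y n) (ob X n) \<and> g \<cdot>\<^bsub>C\<^esub> j n = Ident C (ob X n) \<and> j n \<cdot>\<^bsub>C\<^esub> g = Ident C (ob Y n)"
    using iso by (auto simp: is_iso_def)
  then obtain q where q: "\<And>n. q n \<in> Hom C (ob Y n) (ob X n)" "\<And>n. q n \<cdot>\<^bsub>C\<^esub> j n = Ident C (ob X n)"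
    "\<And>n. j n \<cdot>\<^bsub>C\<^esub> q n = Ident C (ob Y n)" by metis
  show thesis
    by (rule that[OF inverse_cocycle[OF X Y j q]]) (simp_all add: q X Y)
qed

end

section \<open>The half-braiding between columns\<close>

context centralizer_lift
begin

lemma colR_cplx [simp]: "X \<in> Obj A \<Longrightarrow> cplx M (colR X)" "X \<in> Obj A \<Longrightarrow> cplx M (colL X)"
  "X \<in> Obj A \<Longrightarrow> Y \<in> Obj A \<Longrightarrow> cplx M (colRR X Y)" "X \<in> Obj A \<Longrightarrow> Y \<in> Obj A \<Longrightarrow> cplx M (colLL X Y)"
  by simp_all

text \<open>\<open>th X\<close> transported along the isomorphisms between columns and total
  products with a stalk. These maps become the diagonal entries of the lifts.\<close>

definition t :: "'o \<Rightarrow> int \<Rightarrow> 'n" where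
  "t X n = prj (tot_sum M (LAct M) (stalk A X) Z n) 0 \<cdot>\<^bsub>M\<^esub> (th X n \<cdot>\<^bsub>M\<^esub> inj (tot_sum M (RAct M) Z (stalk A X) n) n)"

lemma t_cocycle:
  assumes [simp]: "X \<in> Obj A" shows "t X \<in> hom_cocycles M (colR X) (colL X) 0"
proof -
  have 1: "(\<lambda>n. th X n \<cdot>\<^bsub>M\<^esub> inj (tot_sum M (RAct M) Z (stalk A X) n) n) \<in> hom_cocycles M (colR X) (stalk A X \<diamond>\<^sub>L Z) 0"
    by (rule AM.cocycle_comp0[OF _ _ _ tR.tinj_stalk_right_cocycle th_cocycle]) simp_all
  show ?thesis
    unfolding t_def[abs_def]
    by (rule AM.cocycle_comp0[OF _ _ _ 1 tL.tprj_stalk_left_cocycle]) simp_all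
qed

text \<open>A homotopy inverse of \<open>th X\<close>, transported in the same way; in both
  composites the isomorphisms in the middle cancel.\<close>

lemma t_inverse:
  assumes X [simp]: "X \<in> Obj A"
  shows "\<exists>s \<in> hom_cocycles M (colL X) (colR X) 0.
    homotopic M (colR X) (colR X) (\<lambda>i. s i \<cdot>\<^bsub>M\<^esub> t X i) (\<lambda>i. Ident M (ob (colR X) i)) \<and>
    homotopic M (colL X) (colL X) (\<lambda>i. t X i \<cdot>\<^bsub>M\<^esub> s i) (\<lambda>i. Ident M (ob (colL X) i))"
proof -
  let ?P = "Z \<diamond>\<^sub>R stalk A X" and ?Q = "stalk A X \<diamond>\<^sub>L Z"
  let ?jR = "\<lambda>n. inj (tot_sum M (RAct M) Z (stalk A X) n) n" and ?qR = "\<lambda>n. prj (tot_sum M (RAct M) Z (stalk A X) n) n"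
  let ?jL = "\<lambda>n. inj (tot_sum M (LAct M) (stalk A X) Z n) 0" and ?qL = "\<lambda>n. prj (tot_sum M (LAct M) (stalk A X) Z n) 0"
  note R = tR.stalk_right[OF Z X] and L = tL.stalk_left[OF Z X]
  obtain g where g: "g \<in> hom_cocycles M ?Q ?P 0"
    "homotopic M ?P ?P (\<lambda>i. g i \<cdot>\<^bsub>M\<^esub> th X i) (\<lambda>i. Ident M (ob ?P i))"
    "homotopic M ?Q ?Q (\<lambda>i. th X i \<cdot>\<^bsub>M\<^esub> g i) (\<lambda>i. Ident M (ob ?Q i))"
    using th_inverse[OF X] by blast
  define s where "s n = ?qR n \<cdot>\<^bsub>M\<^esub> (g n \<cdot>\<^bsub>M\<^esub> ?jL n)" for n
  have gj: "(\<lambda>n. g n \<cdot>\<^bsub>M\<^esub> ?jL n) \<in> hom_cocycles M (colL X) ?P 0"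
    by (rule AM.cocycle_comp0[OF _ _ _ L(1) g(1)]) simp_all
  have s: "s \<in> hom_cocycles M (colL X) (colR X) 0"
    unfolding s_def[abs_def] by (rule AM.cocycle_comp0[OF _ _ _ gj R(2)]) simp_all
  have c: "th X \<in> hom_cx M ?P ?Q 0" "g \<in> hom_cx M ?Q ?P 0" "?jR \<in> hom_cx M (colR X) ?P 0" "?jL \<in> hom_cx M (colL X) ?Q 0"
     "?qR \<in> hom_cx M ?P (colR X) 0" "?qL \<in> hom_cx M ?Q (colL X) 0"
    using th_cocycle[OF X] g(1) R(1,2) L(1,2) by (auto dest: hom_cocyclesD)
  let ?ttR = "tmap (colR X) ?P 0 ?jR" and ?ttL = "tmap (colL X) ?Q 0 ?jL" and ?ppR = "tmap ?P (colR X) 0 ?qR" and ?ppL = "tmap ?Q (colL X) 0 ?qL"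
  let ?h = "tmap ?P ?Q 0 (th X)" and ?g = "tmap ?Q ?P 0 g"
  have jq: "?ttR n \<odot>\<^bsub>M\<^esub> ?ppR n = tid M (ob ?P n)" "?ttL n \<odot>\<^bsub>M\<^esub> ?ppL n = tid M (ob ?Q n)" for n
    using R(4) L(4) by (auto intro!: arr_eqI)
  have e1: "s n \<cdot>\<^bsub>M\<^esub> t X n = ?qR n \<cdot>\<^bsub>M\<^esub> ((g n \<cdot>\<^bsub>M\<^esub> th X n) \<cdot>\<^bsub>M\<^esub> ?jR n)" for n
  proof -
    have "(?ppR n \<odot>\<^bsub>M\<^esub> (?g n \<odot>\<^bsub>M\<^esub> ?ttL n)) \<odot>\<^bsub>M\<^esub> (?ppL n \<odot>\<^bsub>M\<^esub> (?h n \<odot>\<^bsub>M\<^esub> ?ttR n))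
      = ?ppR n \<odot>\<^bsub>M\<^esub> ?g n \<odot>\<^bsub>M\<^esub> (?ttL n \<odot>\<^bsub>M\<^esub> ?ppL n) \<odot>\<^bsub>M\<^esub> (?h n \<odot>\<^bsub>M\<^esub> ?ttR n)"
      using c by simp
    also have "\<dots> = ?ppR n \<odot>\<^bsub>M\<^esub> ((?g n \<odot>\<^bsub>M\<^esub> ?h n) \<odot>\<^bsub>M\<^esub> ?ttR n)" unfolding jq using c by simp
    finally show ?thesis by (auto dest: arg_cong[where f = mor] simp: s_def t_def)
  qed
  have e2: "t X n \<cdot>\<^bsub>M\<^esub> s n = ?qL n \<cdot>\<^bsub>M\<^esub> ((th X n \<cdot>\<^bsub>M\<^esub> g n) \<cdot>\<^bsub>M\<^esub> ?jL n)" for n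
  proof -
    have "(?ppL n \<odot>\<^bsub>M\<^esub> (?h n \<odot>\<^bsub>M\<^esub> ?ttR n)) \<odot>\<^bsub>M\<^esub> (?ppR n \<odot>\<^bsub>M\<^esub> (?g n \<odot>\<^bsub>M\<^esub> ?ttL n))
      = ?ppL n \<odot>\<^bsub>M\<^esub> ?h n \<odot>\<^bsub>M\<^esub> (?ttR n \<odot>\<^bsub>M\<^esub> ?ppR n) \<odot>\<^bsub>M\<^esub> (?g n \<odot>\<^bsub>M\<^esub> ?ttL n)"
      using c by simp
    also have "\<dots> = ?ppL n \<odot>\<^bsub>M\<^esub> ((?h n \<odot>\<^bsub>M\<^esub> ?g n) \<odot>\<^bsub>M\<^esub> ?ttL n)" unfolding jq using c by simp
    finally show ?thesis by (auto dest: arg_cong[where f = mor] simp: s_def t_def)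
  qed
  have iR: "?qR n \<cdot>\<^bsub>M\<^esub> (Ident M (ob ?P n) \<cdot>\<^bsub>M\<^esub> ?jR n) = Ident M (ob (colR X) n)" for n
    using fun_cong[OF AM.comp0_ident(2)[OF _ _ c(3)], of n] R(3) by simp
  have iL: "?qL n \<cdot>\<^bsub>M\<^esub> (Ident M (ob ?Q n) \<cdot>\<^bsub>M\<^esub> ?jL n) = Ident M (ob (colL X) n)" for n
    using fun_cong[OF AM.comp0_ident(2)[OF _ _ c(4)], of n] L(3) by simp
  have gh: "(\<lambda>i. g i \<cdot>\<^bsub>M\<^esub> th X i) \<in> hom_cocycles M ?P ?P 0" "(\<lambda>i. th X i \<cdot>\<^bsub>M\<^esub> g i) \<in> hom_cocycles M ?Q ?Q 0"
    by (rule AM.cocycle_comp0[OF _ _ _ th_cocycle g(1)] AM.cocycle_comp0[OF _ _ _ g(1) th_cocycle]; simp)+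
  have "homotopic M (colR X) (colR X) (\<lambda>i. s i \<cdot>\<^bsub>M\<^esub> t X i) (\<lambda>i. Ident M (ob (colR X) i))"
    using AM.homotopic_whisker[OF _ _ _ _ g(2) gh(1) R(1) R(2)] unfolding iR e1 by simp
  moreover have "homotopic M (colL X) (colL X) (\<lambda>i. t X i \<cdot>\<^bsub>M\<^esub> s i) (\<lambda>i. Ident M (ob (colL X) i))"
    using AM.homotopic_whisker[OF _ _ _ _ g(3) gh(2) L(1) L(2)] unfolding iL e2 by simp
  ultimately show ?thesis using s by blast
qed

text \<open>The hypothesis of the theorem, carried from stalks to columns along
  isomorphisms.\<close>

lemma acyclic_RL:
  assumes X [simp]: "X \<in> Obj A" and Y [simp]: "Y \<in> Obj A" shows "AM.acyclic_below (colR X) (colL Y)"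
proof -
  have "AM.acyclic_below (Z \<diamond>\<^sub>R stalk A X) (stalk A Y \<diamond>\<^sub>L Z)"
    using hom_cohomology_negative[OF X Y] by (intro AM.acyclic_belowI) simp_all
  then have "AM.acyclic_below (colR X) (stalk A Y \<diamond>\<^sub>L Z)"
    by (rule AM.acyclic_below_source[rotated -1, OF _ _ _ _ tR.tprj_stalk_right_cocycle tR.tinj_stalk_right_cocycle])
      (simp_all add: tR.tprj_tinj_stalk_right)
  then show ?thesis
    by (rule AM.acyclic_below_target[rotated -1, OF _ _ _ _ tL.tprj_stalk_left_cocycle tL.tinj_stalk_left_cocycle])
      (simp_all add: tL.tprj_tinj_stalk_left)
qed

text \<open>\<open>t\<close> makes \<open>colR Y\<close> and \<open>colL Y\<close> homotopy
  equivalent, so vanishing also holds between columns of the same side. Homotopy inverses of lifts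
  depend on this.\<close>

lemma acyclic_RR:
  assumes X [simp]: "X \<in> Obj A" and Y [simp]: "Y \<in> Obj A" shows "AM.acyclic_below (colR X) (colR Y)"
  using t_inverse[OF Y] AM.acyclic_below_target[OF _ _ _ _ t_cocycle[OF Y] _ acyclic_RL[OF X Y]] by auto

lemma acyclic_LL_of_R:
  assumes X [simp]: "X \<in> Obj A" and K [simp]: "cplx M K" and "AM.acyclic_below (colR X) K"
  shows "AM.acyclic_below (colL X) K"
  using t_inverse[OF X] AM.acyclic_below_source[OF _ _ _ t_cocycle[OF X] _ _ assms(3)] by auto

lemma RAssoc_cocycle:
  assumes X [simp]: "X \<in> Obj A" and Y [simp]: "Y \<in> Obj A"
  shows "(\<lambda>n. RAssoc M (ob Z n) X Y) \<in> hom_cocycles M (colRR X Y) (colR (X \<star>\<^bsub>Tensor A\<^esub> Y)) 0"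
proof -
  have "aR.tas (ob Z (n + 1)) X Y \<odot>\<^bsub>M\<^esub> ((tmap Z Z 1 (diff Z) n \<Otimes>\<^bsub>RAct M\<^esub> tid A X) \<Otimes>\<^bsub>RAct M\<^esub> tid A Y)
    = (tmap Z Z 1 (diff Z) n \<Otimes>\<^bsub>RAct M\<^esub> (tid A X \<Otimes>\<^bsub>Tensor A\<^esub> tid A Y)) \<odot>\<^bsub>M\<^esub> aR.tas (ob Z n) X Y" for n
    by (subst aR.tas_natural) simp_all
  from arg_cong[where f = mor, OF this] aR.valid_tas[of "ob Z n" X Y for n] show ?thesis
    by (auto simp: AM.cocycle0_iff valid_def A.preserves_ident)
qed

lemma LAssoc_cocycle:
  assumes X [simp]: "X \<in> Obj A" and Y [simp]: "Y \<in> Obj A"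
  shows "(\<lambda>n. LAssoc M X Y (ob Z n)) \<in> hom_cocycles M (colL (X \<star>\<^bsub>Tensor A\<^esub> Y)) (colLL X Y) 0"
proof -
  have "aL.tas X Y (ob Z (n + 1)) \<odot>\<^bsub>M\<^esub> ((tid A X \<Otimes>\<^bsub>Tensor A\<^esub> tid A Y) \<Otimes>\<^bsub>LAct M\<^esub> tmap Z Z 1 (diff Z) n)
    = (tid A X \<Otimes>\<^bsub>LAct M\<^esub> (tid A Y \<Otimes>\<^bsub>LAct M\<^esub> tmap Z Z 1 (diff Z) n)) \<odot>\<^bsub>M\<^esub> aL.tas X Y (ob Z n)" for n
    by (subst aL.tas_natural) simp_all
  from arg_cong[where f = mor, OF this] aL.valid_tas[of X Y "ob Z n" for n] show ?thesis
    by (auto simp: AM.cocycle0_iff valid_def A.preserves_ident)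
qed

text \<open>The associativity constraints identify \<open>colRR X Y\<close> and
  \<open>colLL X' Y'\<close> with columns of product objects, which reduces to
  \<open>acyclic_RL\<close>.\<close>

lemma acyclic_RR_LL:
  assumes X [simp]: "X \<in> Obj A" and Y [simp]: "Y \<in> Obj A" and X' [simp]: "X' \<in> Obj A" and Y' [simp]: "Y' \<in> Obj A"
  shows "AM.acyclic_below (colRR X Y) (colLL X' Y')"
proof -
  have i: "is_iso M (ob (colRR X Y) n) (ob (colR (X \<star>\<^bsub>Tensor A\<^esub> Y)) n) (RAssoc M (ob Z n) X Y)" for n
    using RA.assoc_iso[of "ob Z n" X Y] by simp
  have i': "is_iso M (ob (colL (X' \<star>\<^bsub>Tensor A\<^esub> Y')) n) (ob (colLL X' Y') n) (LAssoc M X' Y' (ob Z n))" for n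
    using LA.assoc_iso[of X' Y' "ob Z n"] by simp
  obtain q where q: "q \<in> hom_cocycles M (colR (X \<star>\<^bsub>Tensor A\<^esub> Y)) (colRR X Y) 0"
      "homotopic M (colRR X Y) (colRR X Y) (\<lambda>i. q i \<cdot>\<^bsub>M\<^esub> RAssoc M (ob Z i) X Y) (\<lambda>i. Ident M (ob (colRR X Y) i))"
    by (rule AM.isomorphism_cocycle[OF _ _ RAssoc_cocycle[OF X Y] i]) simp_all
  obtain q' where q': "q' \<in> hom_cocycles M (colLL X' Y') (colL (X' \<star>\<^bsub>Tensor A\<^esub> Y')) 0"
      "homotopic M (colLL X' Y') (colLL X' Y') (\<lambda>i. LAssoc M X' Y' (ob Z i) \<cdot>\<^bsub>M\<^esub> q' i) (\<lambda>i. Ident M (ob (colLL X' Y') i))"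
    by (rule AM.isomorphism_cocycle[OF _ _ LAssoc_cocycle[OF X' Y'] i']) simp_all
  have "AM.acyclic_below (colR (X \<star>\<^bsub>Tensor A\<^esub> Y)) (colL (X' \<star>\<^bsub>Tensor A\<^esub> Y'))" by (rule acyclic_RL) simp_all
  then have "AM.acyclic_below (colRR X Y) (colL (X' \<star>\<^bsub>Tensor A\<^esub> Y'))"
    by (rule AM.acyclic_below_source[rotated -1, OF _ _ _ _ q(1) RAssoc_cocycle[OF X Y] q(2)]) simp_all
  then show ?thesis
    by (rule AM.acyclic_below_target[rotated -1, OF _ _ _ _ LAssoc_cocycle[OF X' Y'] q'(1) q'(2)]) simp_all
qed

text \<open>\<open>th_natural\<close> restricted to the summand of the stalk in degree 0, where the
  maps induced by f on total products are the maps induced on columns.\<close>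

lemma t_natural:
  assumes X [simp]: "X \<in> Obj A" and Y [simp]: "Y \<in> Obj A" and f: "f \<in> Hom A X Y"
  shows "homotopic M (colR X) (colL Y) (\<lambda>n. t Y n \<cdot>\<^bsub>M\<^esub> (Ident M (ob Z n) \<otimes>\<^bsub>RAct M\<^esub> f))
    (\<lambda>n. (f \<otimes>\<^bsub>LAct M\<^esub> Ident M (ob Z n)) \<cdot>\<^bsub>M\<^esub> t X n)"
proof -
  define fh where "fh = (\<lambda>i::int. if i = 0 then f else 0)"
  let ?SX = "stalk A X" and ?SY = "stalk A Y"
  let ?u = "\<lparr>src = X, tgt = Y, mor = f\<rparr>"
  have fc: "fh \<in> hom_cocycles A ?SX ?SY 0" unfolding fh_def by (rule AA.stalk_mor_cocycle[OF X Y f])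
  have fx: "fh \<in> hom_cx A ?SX ?SY 0" using fc by (rule hom_cocyclesD)
  have vu: "valid A ?u" using f by (simp add: valid_def)
  have fu: "tmap ?SX ?SY 0 fh 0 = ?u" by (simp add: tmap_def fh_def)
  let ?m = "tot_mor M (RAct M) Z ?SX Z ?SY 0 0 (\<lambda>i. Ident M (ob Z i)) fh"
  let ?l = "tot_mor M (LAct M) ?SX Z ?SY Z 0 0 fh (\<lambda>i. Ident M (ob Z i))"
  have m: "?m \<in> hom_cocycles M (Z \<diamond>\<^sub>R ?SX) (Z \<diamond>\<^sub>R ?SY) 0" using fc by (intro tR.tot_mor_cocycle) simp_all
  have l: "?l \<in> hom_cocycles M (?SX \<diamond>\<^sub>L Z) (?SY \<diamond>\<^sub>L Z) 0" using fc by (intro tL.tot_mor_cocycle) simp_all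
  have tm: "(\<lambda>i. th Y i \<cdot>\<^bsub>M\<^esub> ?m i) \<in> hom_cocycles M (Z \<diamond>\<^sub>R ?SX) (?SY \<diamond>\<^sub>L Z) 0"
    by (rule AM.cocycle_comp0[OF _ _ _ m th_cocycle]) simp_all
  note thX = hom_cocyclesD[OF th_cocycle[OF X]] and thY = hom_cocyclesD[OF th_cocycle[OF Y]]
  have "homotopic M (colR X) (colL Y)
     (\<lambda>n. prj (tot_sum M (LAct M) ?SY Z n) 0 \<cdot>\<^bsub>M\<^esub> ((th Y n \<cdot>\<^bsub>M\<^esub> ?m n) \<cdot>\<^bsub>M\<^esub> inj (tot_sum M (RAct M) Z ?SX n) n))
     (\<lambda>n. prj (tot_sum M (LAct M) ?SY Z n) 0 \<cdot>\<^bsub>M\<^esub> ((?l n \<cdot>\<^bsub>M\<^esub> th X n) \<cdot>\<^bsub>M\<^esub> inj (tot_sum M (RAct M) Z ?SX n) n))"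
    by (rule AM.homotopic_whisker[OF _ _ _ _ th_natural[OF X Y f, folded fh_def] tm
          tR.tinj_stalk_right_cocycle tL.tprj_stalk_left_cocycle]) simp_all
  moreover have "prj (tot_sum M (LAct M) ?SY Z n) 0 \<cdot>\<^bsub>M\<^esub> ((th Y n \<cdot>\<^bsub>M\<^esub> ?m n) \<cdot>\<^bsub>M\<^esub> inj (tot_sum M (RAct M) Z ?SX n) n)
    = t Y n \<cdot>\<^bsub>M\<^esub> (Ident M (ob Z n) \<otimes>\<^bsub>RAct M\<^esub> f)" for n
  proof -
    let ?h = "tmap (Z \<diamond>\<^sub>R ?SY) (?SY \<diamond>\<^sub>L Z) 0 (th Y) n" and ?mm = "tmap (Z \<diamond>\<^sub>R ?SX) (Z \<diamond>\<^sub>R ?SY) 0 ?m n"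
    have "?mm \<odot>\<^bsub>M\<^esub> jR Z ?SX n n = jR Z ?SY n n \<odot>\<^bsub>M\<^esub> (tid M (ob Z n) \<Otimes>\<^bsub>RAct M\<^esub> ?u)"
      using fx by (simp add: fu)
    then have "qL ?SY Z n 0 \<odot>\<^bsub>M\<^esub> ((?h \<odot>\<^bsub>M\<^esub> ?mm) \<odot>\<^bsub>M\<^esub> jR Z ?SX n n)
      = (qL ?SY Z n 0 \<odot>\<^bsub>M\<^esub> (?h \<odot>\<^bsub>M\<^esub> jR Z ?SY n n)) \<odot>\<^bsub>M\<^esub> (tid M (ob Z n) \<Otimes>\<^bsub>RAct M\<^esub> ?u)"
      using thY hom_cocyclesD[OF m] vu by simp
    from arg_cong[where f = mor, OF this] show ?thesis by (simp add: t_def)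
  qed
  moreover have "prj (tot_sum M (LAct M) ?SY Z n) 0 \<cdot>\<^bsub>M\<^esub> ((?l n \<cdot>\<^bsub>M\<^esub> th X n) \<cdot>\<^bsub>M\<^esub> inj (tot_sum M (RAct M) Z ?SX n) n)
    = (f \<otimes>\<^bsub>LAct M\<^esub> Ident M (ob Z n)) \<cdot>\<^bsub>M\<^esub> t X n" for n
  proof -
    let ?h = "tmap (Z \<diamond>\<^sub>R ?SX) (?SX \<diamond>\<^sub>L Z) 0 (th X) n" and ?ll = "tmap (?SX \<diamond>\<^sub>L Z) (?SY \<diamond>\<^sub>L Z) 0 ?l n"
    have "qL ?SY Z n 0 \<odot>\<^bsub>M\<^esub> ?ll = (?u \<Otimes>\<^bsub>LAct M\<^esub> tid M (ob Z n)) \<odot>\<^bsub>M\<^esub> qL ?SX Z n 0"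
      using tL.tot_mor_tprj[OF _ Z _ Z fx AM.ident_hom_cx, of n 0] by (simp add: fu)
    then have "(qL ?SY Z n 0 \<odot>\<^bsub>M\<^esub> ?ll) \<odot>\<^bsub>M\<^esub> (?h \<odot>\<^bsub>M\<^esub> jR Z ?SX n n)
      = (?u \<Otimes>\<^bsub>LAct M\<^esub> tid M (ob Z n)) \<odot>\<^bsub>M\<^esub> (qL ?SX Z n 0 \<odot>\<^bsub>M\<^esub> (?h \<odot>\<^bsub>M\<^esub> jR Z ?SX n n))"
      using thX vu by simp
    moreover have "qL ?SY Z n 0 \<odot>\<^bsub>M\<^esub> ((?ll \<odot>\<^bsub>M\<^esub> ?h) \<odot>\<^bsub>M\<^esub> jR Z ?SX n n) = (qL ?SY Z n 0 \<odot>\<^bsub>M\<^esub> ?ll) \<odot>\<^bsub>M\<^esub> (?h \<odot>\<^bsub>M\<^esub> jR Z ?SX n n)"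
      using thX hom_cocyclesD[OF l] by simp
    ultimately have "qL ?SY Z n 0 \<odot>\<^bsub>M\<^esub> ((?ll \<odot>\<^bsub>M\<^esub> ?h) \<odot>\<^bsub>M\<^esub> jR Z ?SX n n)
      = (?u \<Otimes>\<^bsub>LAct M\<^esub> tid M (ob Z n)) \<odot>\<^bsub>M\<^esub> (qL ?SX Z n 0 \<odot>\<^bsub>M\<^esub> (?h \<odot>\<^bsub>M\<^esub> jR Z ?SX n n))" by (rule trans[rotated])
    from arg_cong[where f = mor, OF this] show ?thesis by (simp add: t_def)
  qed
  ultimately show ?thesis by simp
qed

end

section \<open>Homotopy inverses of filtered morphisms\<close>

context linear_category
begin

text \<open>Naturality passes to homotopy inverses: b s ~ s' t' b s ~ s' a t s ~ s' a.\<close>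

lemma homotopy_inverse_natural:
  assumes X: "cplx C X" "cplx C X'" "cplx C Y" "cplx C Y'"
    and t: "t \<in> hom_cocycles C X X' 0" and s: "s \<in> hom_cocycles C X' X 0"
    and ts: "homotopic C X' X' (\<lambda>i. t i \<cdot>\<^bsub>C\<^esub> s i) (\<lambda>i. Ident C (ob X' i))"
    and t': "t' \<in> hom_cocycles C Y Y' 0" and s': "s' \<in> hom_cocycles C Y' Y 0"
    and st': "homotopic C Y Y (\<lambda>i. s' i \<cdot>\<^bsub>C\<^esub> t' i) (\<lambda>i. Ident C (ob Y i))"
    and b: "b \<in> hom_cocycles C X Y 0" and a: "a \<in> hom_cocycles C X' Y' 0"
    and nat: "homotopic C X Y' (\<lambda>i. t' i \<cdot>\<^bsub>C\<^esub> b i) (\<lambda>i. a i \<cdot>\<^bsub>C\<^esub> t i)"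
  shows "homotopic C X' Y (\<lambda>i. b i \<cdot>\<^bsub>C\<^esub> s i) (\<lambda>i. s' i \<cdot>\<^bsub>C\<^esub> a i)"
proof -
  note cx = hom_cocyclesD[OF t] hom_cocyclesD[OF s] hom_cocyclesD[OF t'] hom_cocyclesD[OF s'] hom_cocyclesD[OF b] hom_cocyclesD[OF a]
  have bs: "(\<lambda>i. b i \<cdot>\<^bsub>C\<^esub> s i) \<in> hom_cocycles C X' Y 0" by (rule cocycle_comp0[OF X(2,1,3) s b])
  have sa: "(\<lambda>i. s' i \<cdot>\<^bsub>C\<^esub> a i) \<in> hom_cocycles C X' Y 0" by (rule cocycle_comp0[OF X(2,4,3) a s'])
  have st: "(\<lambda>i. s' i \<cdot>\<^bsub>C\<^esub> t' i) \<in> hom_cocycles C Y Y 0" by (rule cocycle_comp0[OF X(3,4,3) t' s'])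
  have tsc: "(\<lambda>i. t i \<cdot>\<^bsub>C\<^esub> s i) \<in> hom_cocycles C X' X' 0" by (rule cocycle_comp0[OF X(2,1,2) s t])
  have tb: "(\<lambda>i. t' i \<cdot>\<^bsub>C\<^esub> b i) \<in> hom_cocycles C X Y' 0" by (rule cocycle_comp0[OF X(1,3,4) b t'])
  have "homotopic C X' Y (\<lambda>i. (s' i \<cdot>\<^bsub>C\<^esub> t' i) \<cdot>\<^bsub>C\<^esub> (b i \<cdot>\<^bsub>C\<^esub> s i)) (\<lambda>i. Ident C (ob Y i) \<cdot>\<^bsub>C\<^esub> (b i \<cdot>\<^bsub>C\<^esub> s i))"
    by (rule homotopic_comp[OF X(2,3,3) bs homotopic_refl[OF X(2,3)] st st'])
  then have 1: "homotopic C X' Y (\<lambda>i. b i \<cdot>\<^bsub>C\<^esub> s i) (\<lambda>i. (s' i \<cdot>\<^bsub>C\<^esub> t' i) \<cdot>\<^bsub>C\<^esub> (b i \<cdot>\<^bsub>C\<^esub> s i))"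
    unfolding comp0_ident(2)[OF X(2,3) hom_cocyclesD[OF bs]] by (rule homotopic_sym[OF X(2,3)])
  have 2: "homotopic C X' Y (\<lambda>i. s' i \<cdot>\<^bsub>C\<^esub> ((t' i \<cdot>\<^bsub>C\<^esub> b i) \<cdot>\<^bsub>C\<^esub> s i)) (\<lambda>i. s' i \<cdot>\<^bsub>C\<^esub> ((a i \<cdot>\<^bsub>C\<^esub> t i) \<cdot>\<^bsub>C\<^esub> s i))"
    by (rule homotopic_whisker[OF X(2,1,4,3) nat tb s s'])
  have "homotopic C X' Y (\<lambda>i. (s' i \<cdot>\<^bsub>C\<^esub> a i) \<cdot>\<^bsub>C\<^esub> (t i \<cdot>\<^bsub>C\<^esub> s i)) (\<lambda>i. (s' i \<cdot>\<^bsub>C\<^esub> a i) \<cdot>\<^bsub>C\<^esub> Ident C (ob X' i))"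
    by (rule homotopic_comp[OF X(2,2,3) tsc ts sa homotopic_refl[OF X(2,3)]])
  then have 3: "homotopic C X' Y (\<lambda>i. (s' i \<cdot>\<^bsub>C\<^esub> a i) \<cdot>\<^bsub>C\<^esub> (t i \<cdot>\<^bsub>C\<^esub> s i)) (\<lambda>i. s' i \<cdot>\<^bsub>C\<^esub> a i)"
    unfolding comp0_ident(1)[OF X(2,3) hom_cocyclesD[OF sa]] .
  let ?t = "tmap X X' 0 t" and ?s = "tmap X' X 0 s" and ?t' = "tmap Y Y' 0 t'" and ?s' = "tmap Y' Y 0 s'"
    and ?a = "tmap X' Y' 0 a" and ?b = "tmap X Y 0 b"
  have "(?s' i \<odot>\<^bsub>C\<^esub> ?t' i) \<odot>\<^bsub>C\<^esub> (?b i \<odot>\<^bsub>C\<^esub> ?s i) = ?s' i \<odot>\<^bsub>C\<^esub> ((?t' i \<odot>\<^bsub>C\<^esub> ?b i) \<odot>\<^bsub>C\<^esub> ?s i)"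
    "?s' i \<odot>\<^bsub>C\<^esub> ((?a i \<odot>\<^bsub>C\<^esub> ?t i) \<odot>\<^bsub>C\<^esub> ?s i) = (?s' i \<odot>\<^bsub>C\<^esub> ?a i) \<odot>\<^bsub>C\<^esub> (?t i \<odot>\<^bsub>C\<^esub> ?s i)" for i
    using cx X by simp_all
  from this[THEN arg_cong[where f = mor]]
  have e: "(s' i \<cdot>\<^bsub>C\<^esub> t' i) \<cdot>\<^bsub>C\<^esub> (b i \<cdot>\<^bsub>C\<^esub> s i) = s' i \<cdot>\<^bsub>C\<^esub> ((t' i \<cdot>\<^bsub>C\<^esub> b i) \<cdot>\<^bsub>C\<^esub> s i)"
    "s' i \<cdot>\<^bsub>C\<^esub> ((a i \<cdot>\<^bsub>C\<^esub> t i) \<cdot>\<^bsub>C\<^esub> s i) = (s' i \<cdot>\<^bsub>C\<^esub> a i) \<cdot>\<^bsub>C\<^esub> (t i \<cdot>\<^bsub>C\<^esub> s i)" for i by simp_all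
  show ?thesis
    by (rule homotopic_trans[OF X(2,3) 1[unfolded e(1)] homotopic_trans[OF X(2,3) 2[unfolded e(2)] 3]])
qed

text \<open>S after T is triangular with diagonal entries s t, which are homotopic to identities;
  \<open>filtered_homotopicI\<close> then compares it with the identity of \<open>P\<close>.\<close>

lemma filtered_inverse:
  assumes FP: "filtered C P I (\<lambda>j. j) c \<iota> \<pi>" and FQ: "filtered C Q I (\<lambda>j. j) c' \<iota>' \<pi>'"
    and acyclic: "\<And>a b. a \<in> I \<Longrightarrow> b \<in> I \<Longrightarrow> acyclic_below (c a) (c b)"
    and T: "T \<in> hom_cocycles C P Q 0" and S: "S \<in> hom_cocycles C Q P 0"
    and Tlow: "\<And>a b n. \<lbrakk>a \<in> I; b \<in> I; b < a\<rbrakk> \<Longrightarrow> mor (\<pi>' b n \<odot>\<^bsub>C\<^esub> tmap P Q 0 T n \<odot>\<^bsub>C\<^esub> \<iota> a n) = 0"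
    and Tdiag: "\<And>a n. a \<in> I \<Longrightarrow> mor (\<pi>' a n \<odot>\<^bsub>C\<^esub> tmap P Q 0 T n \<odot>\<^bsub>C\<^esub> \<iota> a n) = t a (n - a)"
    and Slow: "\<And>a b n. \<lbrakk>a \<in> I; b \<in> I; b < a\<rbrakk> \<Longrightarrow> mor (\<pi> b n \<odot>\<^bsub>C\<^esub> tmap Q P 0 S n \<odot>\<^bsub>C\<^esub> \<iota>' a n) = 0"
    and Sdiag: "\<And>a n. a \<in> I \<Longrightarrow> mor (\<pi> a n \<odot>\<^bsub>C\<^esub> tmap Q P 0 S n \<odot>\<^bsub>C\<^esub> \<iota>' a n) = s a (n - a)"
    and st: "\<And>a. a \<in> I \<Longrightarrow> homotopic C (c a) (c a) (\<lambda>p. s a p \<cdot>\<^bsub>C\<^esub> t a p) (\<lambda>p. Ident C (ob (c a) p))"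
  shows "homotopic C P P (\<lambda>i. S i \<cdot>\<^bsub>C\<^esub> T i) (\<lambda>i. Ident C (ob P i))"
proof (rule filtered_homotopicI[OF FP FP acyclic])
  note f = filtered_cplx[OF FP] filtered_inj[OF FP] filtered_prj[OF FP] filtered_cplx[OF FQ] filtered_inj[OF FQ] filtered_prj[OF FQ]
  have cx: "T \<in> hom_cx C P Q 0" "S \<in> hom_cx C Q P 0" using S T by (auto dest: hom_cocyclesD)
  show ST: "(\<lambda>i. S i \<cdot>\<^bsub>C\<^esub> T i) \<in> hom_cocycles C P P 0" by (rule cocycle_comp0[OF f(1) _ f(1) T S]) (simp add: f)
  show "(\<lambda>i. Ident C (ob P i)) \<in> hom_cocycles C P P 0" by (rule ident_cocycle[OF f(1)])
  have id: "\<pi> b n \<odot>\<^bsub>C\<^esub> tmap P P 0 (\<lambda>i. Ident C (ob P i)) n \<odot>\<^bsub>C\<^esub> \<iota> a n = \<pi> b n \<odot>\<^bsub>C\<^esub> \<iota> a n" if "a \<in> I" for a b n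
    using that by (simp add: f)
  have comp: "\<pi> b n \<odot>\<^bsub>C\<^esub> tmap P P 0 (\<lambda>i. S i \<cdot>\<^bsub>C\<^esub> T i) n \<odot>\<^bsub>C\<^esub> \<iota> a n
    = (\<pi> b n \<odot>\<^bsub>C\<^esub> tmap Q P 0 S n) \<odot>\<^bsub>C\<^esub> (tmap P Q 0 T n \<odot>\<^bsub>C\<^esub> \<iota> a n)" if "a \<in> I" "b \<in> I" for a b n
  proof -
    have e: "tmap P P 0 (\<lambda>i. S i \<cdot>\<^bsub>C\<^esub> T i) n = tmap Q P 0 S n \<odot>\<^bsub>C\<^esub> tmap P Q 0 T n" by (rule arr_eqI) simp_all
    show ?thesis unfolding e using that cx by (simp add: f)
  qed
  have S': "mor ((\<pi> b n \<odot>\<^bsub>C\<^esub> tmap Q P 0 S n) \<odot>\<^bsub>C\<^esub> \<iota>' y n) = mor (\<pi> b n \<odot>\<^bsub>C\<^esub> tmap Q P 0 S n \<odot>\<^bsub>C\<^esub> \<iota>' y n)"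
    if "b \<in> I" "y \<in> I" for b y n
    by (rule arg_cong[where f = mor]) (use that cx in \<open>simp add: f\<close>)
  fix a b assume a: "a \<in> I" and b: "b \<in> I"
  have uv: "valid C (tmap P Q 0 T n \<odot>\<^bsub>C\<^esub> \<iota> a n)" "tgt (tmap P Q 0 T n \<odot>\<^bsub>C\<^esub> \<iota> a n) = ob Q n"
    "valid C (\<pi> b n \<odot>\<^bsub>C\<^esub> tmap Q P 0 S n)" "src (\<pi> b n \<odot>\<^bsub>C\<^esub> tmap Q P 0 S n) = ob Q n" for n
    using a b cx by (simp_all add: f)
  have tri: "\<And>y. y \<in> I \<Longrightarrow> y < a \<Longrightarrow> mor (\<pi>' y n \<odot>\<^bsub>C\<^esub> tmap P Q 0 T n \<odot>\<^bsub>C\<^esub> \<iota> a n) = 0"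
    "\<And>y. y \<in> I \<Longrightarrow> b < y \<Longrightarrow> mor ((\<pi> b n \<odot>\<^bsub>C\<^esub> tmap Q P 0 S n) \<odot>\<^bsub>C\<^esub> \<iota>' y n) = 0" for n
    using a b Tlow Slow S' by (auto simp del: arr_fields(3))
  show "mor (\<pi> b n \<odot>\<^bsub>C\<^esub> tmap P P 0 (\<lambda>i. S i \<cdot>\<^bsub>C\<^esub> T i) n \<odot>\<^bsub>C\<^esub> \<iota> a n) = 0" if "b < a" for n
    unfolding comp[OF a b] by (rule filtered_comp_int(1)[OF FQ uv tri that])
  show "mor (\<pi> b n \<odot>\<^bsub>C\<^esub> tmap P P 0 (\<lambda>i. Ident C (ob P i)) n \<odot>\<^bsub>C\<^esub> \<iota> a n) = 0" if "b < a" for n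
    unfolding id[OF a] using that a b by (simp add: filtered_prj_inj[OF FP] del: arr_fields(3))
  show "homotopic C (c a) (c b)
      (\<lambda>p. mor (\<pi> b (p + a) \<odot>\<^bsub>C\<^esub> tmap P P 0 (\<lambda>i. S i \<cdot>\<^bsub>C\<^esub> T i) (p + a) \<odot>\<^bsub>C\<^esub> \<iota> a (p + a)))
      (\<lambda>p. mor (\<pi> b (p + a) \<odot>\<^bsub>C\<^esub> tmap P P 0 (\<lambda>i. Ident C (ob P i)) (p + a) \<odot>\<^bsub>C\<^esub> \<iota> a (p + a)))" if ba: "b = a"
  proof -
    have "mor (\<pi> b n \<odot>\<^bsub>C\<^esub> tmap P P 0 (\<lambda>i. S i \<cdot>\<^bsub>C\<^esub> T i) n \<odot>\<^bsub>C\<^esub> \<iota> a n) = s a (n - a) \<cdot>\<^bsub>C\<^esub> t a (n - a)" for n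
    proof -
      have "mor ((\<pi> b n \<odot>\<^bsub>C\<^esub> tmap Q P 0 S n) \<odot>\<^bsub>C\<^esub> (tmap P Q 0 T n \<odot>\<^bsub>C\<^esub> \<iota> a n))
        = mor ((\<pi> b n \<odot>\<^bsub>C\<^esub> tmap Q P 0 S n) \<odot>\<^bsub>C\<^esub> \<iota>' a n) \<cdot>\<^bsub>C\<^esub> mor (\<pi>' a n \<odot>\<^bsub>C\<^esub> (tmap P Q 0 T n \<odot>\<^bsub>C\<^esub> \<iota> a n))"
        by (rule filtered_comp_int(2)[OF FQ uv tri ba a])
      also have "\<dots> = s a (n - a) \<cdot>\<^bsub>C\<^esub> t a (n - a)"
        unfolding S'[OF b a] Tdiag[OF a] unfolding ba Sdiag[OF a] ..
      finally show ?thesis unfolding comp[OF a b] .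
    qed
    moreover have "mor (\<pi> b n \<odot>\<^bsub>C\<^esub> tmap P P 0 (\<lambda>i. Ident C (ob P i)) n \<odot>\<^bsub>C\<^esub> \<iota> a n) = Ident C (ob (c a) (n - a))" for n
      unfolding id[OF a] ba filtered_prj_inj(1)[OF FP a] by simp
    ultimately show ?thesis using st[OF a] ba by (simp del: arr_fields(3))
  qed
qed

end

context centralizer_lift
begin

text \<open>\<open>th_multiplicative\<close> restricted to the column (0, 0), where
  \<open>mu\<close> and \<open>mu_inv\<close> cancel against the inclusion and projection of the
  only summand.\<close>

lemma t_multiplicative:
  assumes X [simp]: "X \<in> Obj A" and Y [simp]: "Y \<in> Obj A"
  shows "homotopic M (colRR X Y) (colLL X Y)
    (\<lambda>n. LAssoc M X Y (ob Z n) \<cdot>\<^bsub>M\<^esub> (t (X \<star>\<^bsub>Tensor A\<^esub> Y) n \<cdot>\<^bsub>M\<^esub> RAssoc M (ob Z n) X Y))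
    (\<lambda>n. (Ident A X \<otimes>\<^bsub>LAct M\<^esub> t Y n) \<cdot>\<^bsub>M\<^esub> (MAssoc M X (ob Z n) Y \<cdot>\<^bsub>M\<^esub> (t X n \<otimes>\<^bsub>RAct M\<^esub> Ident A Y)))"
proof -
  let ?SX = "stalk A X" and ?SY = "stalk A Y" and ?S = "stalk A (X \<star>\<^bsub>Tensor A\<^esub> Y)" and ?XY = "X \<star>\<^bsub>Tensor A\<^esub> Y"
  have B [simp]: "bounded_complex A ?SX" "bounded_complex A ?SY" "bounded_complex A ?S" by simp_all
  let ?mi = "tot_mor M (LAct M) ?S Z (?SX \<diamond>\<^sub>A ?SY) Z 0 0 (mu_inv X Y) (\<lambda>i. Ident M (ob Z i))"
  let ?m = "tot_mor M (RAct M) Z (?SX \<diamond>\<^sub>A ?SY) Z ?S 0 0 (\<lambda>i. Ident M (ob Z i)) (mu X Y)"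
  let ?T = "\<lambda>n. ?mi n \<cdot>\<^bsub>M\<^esub> (th ?XY n \<cdot>\<^bsub>M\<^esub> ?m n)"
  note muc = mu_cocycle[OF X Y] mu_inv_cocycle[OF X Y]
  have mux: "mu X Y \<in> hom_cx A (?SX \<diamond>\<^sub>A ?SY) ?S 0" "mu_inv X Y \<in> hom_cx A ?S (?SX \<diamond>\<^sub>A ?SY) 0"
    using muc by (auto dest: hom_cocyclesD)
  have XY: "?XY \<in> Obj A" by simp
  note thXY = hom_cocyclesD[OF th_cocycle[OF XY]]
  have mi: "?mi \<in> hom_cocycles M (?S \<diamond>\<^sub>L Z) ((?SX \<diamond>\<^sub>A ?SY) \<diamond>\<^sub>L Z) 0" using muc by (intro tL.tot_mor_cocycle) simp_all
  have m: "?m \<in> hom_cocycles M (Z \<diamond>\<^sub>R (?SX \<diamond>\<^sub>A ?SY)) (Z \<diamond>\<^sub>R ?S) 0" using muc by (intro tR.tot_mor_cocycle) simp_all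
  have tm: "(\<lambda>n. th ?XY n \<cdot>\<^bsub>M\<^esub> ?m n) \<in> hom_cocycles M (Z \<diamond>\<^sub>R (?SX \<diamond>\<^sub>A ?SY)) (?S \<diamond>\<^sub>L Z) 0"
    by (rule AM.cocycle_comp0[OF _ _ _ m th_cocycle]) simp_all
  have T: "?T \<in> hom_cocycles M (Z \<diamond>\<^sub>R (?SX \<diamond>\<^sub>A ?SY)) ((?SX \<diamond>\<^sub>A ?SY) \<diamond>\<^sub>L Z) 0"
    by (rule AM.cocycle_comp0[OF _ _ _ tm mi]) simp_all
  note Tx = hom_cocyclesD[OF T]
  let ?U = "\<lambda>n. hatL ?SX ?SY Z n \<cdot>\<^bsub>M\<^esub> (?T n \<cdot>\<^bsub>M\<^esub> hatR Z ?SX ?SY n)"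
  let ?V = "\<lambda>n. tot_mor M (LAct M) ?SX (Z \<diamond>\<^sub>R ?SY) ?SX (?SY \<diamond>\<^sub>L Z) 0 0 (\<lambda>i. Ident A (ob ?SX i)) (th Y) n
        \<cdot>\<^bsub>M\<^esub> (hatM ?SX Z ?SY n \<cdot>\<^bsub>M\<^esub> tot_mor M (RAct M) (Z \<diamond>\<^sub>R ?SX) ?SY (?SX \<diamond>\<^sub>L Z) ?SY 0 0 (th X) (\<lambda>i. Ident A (ob ?SY i)) n)"
  let ?P = "(Z \<diamond>\<^sub>R ?SX) \<diamond>\<^sub>R ?SY" and ?Q = "?SX \<diamond>\<^sub>L (?SY \<diamond>\<^sub>L Z)"
  have UV: "homotopic M ?P ?Q ?U ?V" by (rule th_multiplicative[OF X Y])
  have TR: "(\<lambda>n. ?T n \<cdot>\<^bsub>M\<^esub> hatR Z ?SX ?SY n) \<in> hom_cocycles M ?P ((?SX \<diamond>\<^sub>A ?SY) \<diamond>\<^sub>L Z) 0"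
    by (rule AM.cocycle_comp0[OF _ _ _ aR.tot_assoc_cocycle T]) simp_all
  have U: "?U \<in> hom_cocycles M ?P ?Q 0"
    by (rule AM.cocycle_comp0[OF _ _ _ TR aL.tot_assoc_cocycle]) simp_all
  let ?j = "\<lambda>n. mor (jRR Z ?SX ?SY n 0 0)" and ?q = "\<lambda>n. mor (qLL Z ?SX ?SY n 0 0)"
  have "(\<lambda>n. inj (tot_sum M (RAct M) (Z \<diamond>\<^sub>R ?SX) ?SY n) n \<cdot>\<^bsub>M\<^esub> (inj (tot_sum M (RAct M) Z ?SX n) n \<otimes>\<^bsub>RAct M\<^esub> Ident A Y))
      \<in> hom_cocycles M (colRR X Y) ?P 0"
    by (rule AM.cocycle_comp0[OF _ _ _ tR.rcol_cocycle[OF _ _ _ tR.tinj_stalk_right_cocycle] tR.tinj_stalk_right_cocycle]) simp_all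
  then have j: "?j \<in> hom_cocycles M (colRR X Y) ?P 0" by (simp add: jRR_def)
  have "(\<lambda>n. (Ident A X \<otimes>\<^bsub>LAct M\<^esub> prj (tot_sum M (LAct M) ?SY Z n) 0) \<cdot>\<^bsub>M\<^esub> prj (tot_sum M (LAct M) ?SX (?SY \<diamond>\<^sub>L Z) n) 0)
      \<in> hom_cocycles M ?Q (colLL X Y) 0"
    by (rule AM.cocycle_comp0[OF _ _ _ tL.tprj_stalk_left_cocycle tL.lcol_cocycle[OF _ _ _ tL.tprj_stalk_left_cocycle]]) simp_all
  then have q: "?q \<in> hom_cocycles M ?Q (colLL X Y) 0" by (simp add: qLL_def)
  have "homotopic M (colRR X Y) (colLL X Y) (\<lambda>n. ?q n \<cdot>\<^bsub>M\<^esub> (?U n \<cdot>\<^bsub>M\<^esub> ?j n)) (\<lambda>n. ?q n \<cdot>\<^bsub>M\<^esub> (?V n \<cdot>\<^bsub>M\<^esub> ?j n))"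
    by (rule AM.homotopic_whisker[OF _ _ _ _ UV U j q]) simp_all
  moreover have "?q n \<cdot>\<^bsub>M\<^esub> (?U n \<cdot>\<^bsub>M\<^esub> ?j n) = LAssoc M X Y (ob Z n) \<cdot>\<^bsub>M\<^esub> (t ?XY n \<cdot>\<^bsub>M\<^esub> RAssoc M (ob Z n) X Y)" for n
  proof -
    let ?hh = "tmap (Z \<diamond>\<^sub>R ?S) (?S \<diamond>\<^sub>L Z) 0 (th ?XY) n"
    let ?tT = "tmap (Z \<diamond>\<^sub>R (?SX \<diamond>\<^sub>A ?SY)) ((?SX \<diamond>\<^sub>A ?SY) \<diamond>\<^sub>L Z) 0 ?T n"
    let ?I = "tmap (?S \<diamond>\<^sub>L Z) ((?SX \<diamond>\<^sub>A ?SY) \<diamond>\<^sub>L Z) 0 ?mi n" and ?J = "tmap (Z \<diamond>\<^sub>R (?SX \<diamond>\<^sub>A ?SY)) (Z \<diamond>\<^sub>R ?S) 0 ?m n"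
    have e: "?tT = ?I \<odot>\<^bsub>M\<^esub> ?hh \<odot>\<^bsub>M\<^esub> ?J" by (rule arr_eqI) simp_all
    have qi: "qA ?SX ?SY 0 0 \<odot>\<^bsub>A\<^esub> tmap ?S (?SX \<diamond>\<^sub>A ?SY) 0 (mu_inv X Y) 0 = tid A ?XY"
    proof -
      have "tmap ?S (?SX \<diamond>\<^sub>A ?SY) 0 (mu_inv X Y) 0 = jA ?SX ?SY 0 0"
        by (rule arr_eqI) (simp_all add: mu_inv_def[OF X Y])
      then show ?thesis by simp
    qed
    have ij: "tmap (?SX \<diamond>\<^sub>A ?SY) ?S 0 (mu X Y) 0 \<odot>\<^bsub>A\<^esub> jA ?SX ?SY 0 0 = tid A ?XY"
    proof -
      have "tmap (?SX \<diamond>\<^sub>A ?SY) ?S 0 (mu X Y) 0 = qA ?SX ?SY 0 0"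
        by (rule arr_eqI) (simp_all add: mu_def[OF X Y])
      then show ?thesis by simp
    qed
    have l: "(qA ?SX ?SY 0 0 \<Otimes>\<^bsub>LAct M\<^esub> tid M (ob Z n)) \<odot>\<^bsub>M\<^esub> (qL (?SX \<diamond>\<^sub>A ?SY) Z n 0 \<odot>\<^bsub>M\<^esub> ?I) = qL ?S Z n 0"
    proof -
      have 1: "qL (?SX \<diamond>\<^sub>A ?SY) Z n 0 \<odot>\<^bsub>M\<^esub> ?I = (tmap ?S (?SX \<diamond>\<^sub>A ?SY) 0 (mu_inv X Y) 0 \<Otimes>\<^bsub>LAct M\<^esub> tid M (ob Z n)) \<odot>\<^bsub>M\<^esub> qL ?S Z n 0"
        using tL.tot_mor_tprj[OF _ Z _ Z mux(2) AM.ident_hom_cx, of n 0] by simp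
      show ?thesis unfolding 1 using mux qi by simp
    qed
    have r: "(?J \<odot>\<^bsub>M\<^esub> jR Z (?SX \<diamond>\<^sub>A ?SY) n n) \<odot>\<^bsub>M\<^esub> (tid M (ob Z n) \<Otimes>\<^bsub>RAct M\<^esub> jA ?SX ?SY 0 0) = jR Z ?S n n"
      using mux ij by simp
    have mx: "?mi \<in> hom_cx M (?S \<diamond>\<^sub>L Z) ((?SX \<diamond>\<^sub>A ?SY) \<diamond>\<^sub>L Z) 0" "?m \<in> hom_cx M (Z \<diamond>\<^sub>R (?SX \<diamond>\<^sub>A ?SY)) (Z \<diamond>\<^sub>R ?S) 0"
      using mi m by (auto dest: hom_cocyclesD)
    have "qLL Z ?SX ?SY n 0 0 \<odot>\<^bsub>M\<^esub> tmap ?P ?Q 0 ?U n \<odot>\<^bsub>M\<^esub> jRR Z ?SX ?SY n 0 0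
      = aL.tas X Y (ob Z n) \<odot>\<^bsub>M\<^esub> (qA ?SX ?SY 0 0 \<Otimes>\<^bsub>LAct M\<^esub> tid M (ob Z n))
        \<odot>\<^bsub>M\<^esub> (qL (?SX \<diamond>\<^sub>A ?SY) Z n 0 \<odot>\<^bsub>M\<^esub> (?I \<odot>\<^bsub>M\<^esub> ?hh \<odot>\<^bsub>M\<^esub> ?J) \<odot>\<^bsub>M\<^esub> jR Z (?SX \<diamond>\<^sub>A ?SY) n n)
        \<odot>\<^bsub>M\<^esub> (tid M (ob Z n) \<Otimes>\<^bsub>RAct M\<^esub> jA ?SX ?SY 0 0) \<odot>\<^bsub>M\<^esub> aR.tas (ob Z n) X Y"
      using components_assoc_left[OF Z B(1,2) Tx, of n 0 0 0 0] unfolding e by simp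
    \<comment> \<open>Rebracketed so that the factors treated in \<open>l\<close> and
      \<open>r\<close> stand together; the rules that would push the inclusion through
      \<open>?m\<close> are switched off meanwhile.\<close>
    also have "\<dots> = aL.tas X Y (ob Z n) \<odot>\<^bsub>M\<^esub> ((qA ?SX ?SY 0 0 \<Otimes>\<^bsub>LAct M\<^esub> tid M (ob Z n)) \<odot>\<^bsub>M\<^esub> (qL (?SX \<diamond>\<^sub>A ?SY) Z n 0 \<odot>\<^bsub>M\<^esub> ?I))
        \<odot>\<^bsub>M\<^esub> ?hh \<odot>\<^bsub>M\<^esub> ((?J \<odot>\<^bsub>M\<^esub> jR Z (?SX \<diamond>\<^sub>A ?SY) n n) \<odot>\<^bsub>M\<^esub> (tid M (ob Z n) \<Otimes>\<^bsub>RAct M\<^esub> jA ?SX ?SY 0 0)) \<odot>\<^bsub>M\<^esub> aR.tas (ob Z n) X Y"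
      using mx thXY by (simp del: tR.tot_mor_tinj' tR.tot_mor_tinj_tail)
    also have "\<dots> = aL.tas X Y (ob Z n) \<odot>\<^bsub>M\<^esub> (qL ?S Z n 0 \<odot>\<^bsub>M\<^esub> (?hh \<odot>\<^bsub>M\<^esub> jR Z ?S n n)) \<odot>\<^bsub>M\<^esub> aR.tas (ob Z n) X Y"
      unfolding l r using thXY by simp
    finally show ?thesis by (auto dest: arg_cong[where f = mor] simp: t_def)
  qed
  moreover have "?q n \<cdot>\<^bsub>M\<^esub> (?V n \<cdot>\<^bsub>M\<^esub> ?j n)
    = (Ident A X \<otimes>\<^bsub>LAct M\<^esub> t Y n) \<cdot>\<^bsub>M\<^esub> (MAssoc M X (ob Z n) Y \<cdot>\<^bsub>M\<^esub> (t X n \<otimes>\<^bsub>RAct M\<^esub> Ident A Y))" for n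
    using arg_cong[where f = mor, OF components_assoc_right[OF Z B(1,2) hom_cocyclesD[OF th_cocycle[OF X]] hom_cocyclesD[OF th_cocycle[OF Y]], of n 0 0 0 0]]
    by (simp add: t_def)
  ultimately show ?thesis by simp
qed

end

section \<open>Lifting the half-braiding\<close>

context centralizer_lift
begin

text \<open>Lifts of the half-braiding as cocycles: triangular for the filtrations by the degree in
  \<open>X\<close>, with \<open>t\<close> on the diagonal. The diagonal is fixed exactly and not up
  to homotopy, and the conditions range over all integers, which avoids case distinctions on
  \<open>supp\<close> in later use.\<close>

definition lift_mor :: "('o, 'm) cochain \<Rightarrow> (int \<Rightarrow> 'n) \<Rightarrow> bool" where
  "lift_mor X T \<longleftrightarrow> T \<in> hom_cocycles M (Z \<diamond>\<^sub>R X) (X \<diamond>\<^sub>L Z) 0 \<and>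
    (\<forall>n i k. k < i \<longrightarrow> mor (qL X Z n k \<odot>\<^bsub>M\<^esub> tmap (Z \<diamond>\<^sub>R X) (X \<diamond>\<^sub>L Z) 0 T n \<odot>\<^bsub>M\<^esub> tsgn (i * (n - i)) (jR Z X n (n - i))) = 0) \<and>
    (\<forall>n i. mor (qL X Z n i \<odot>\<^bsub>M\<^esub> tmap (Z \<diamond>\<^sub>R X) (X \<diamond>\<^sub>L Z) 0 T n \<odot>\<^bsub>M\<^esub> tsgn (i * (n - i)) (jR Z X n (n - i))) = t (ob X i) (n - i))"

lemma lift_morD:
  assumes "lift_mor X T"
  shows "T \<in> hom_cocycles M (Z \<diamond>\<^sub>R X) (X \<diamond>\<^sub>L Z) 0"
    and "k < i \<Longrightarrow> mor (qL X Z n k \<odot>\<^bsub>M\<^esub> tmap (Z \<diamond>\<^sub>R X) (X \<diamond>\<^sub>L Z) 0 T n \<odot>\<^bsub>M\<^esub> tsgn (i * (n - i)) (jR Z X n (n - i))) = 0"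
    and "mor (qL X Z n i \<odot>\<^bsub>M\<^esub> tmap (Z \<diamond>\<^sub>R X) (X \<diamond>\<^sub>L Z) 0 T n \<odot>\<^bsub>M\<^esub> tsgn (i * (n - i)) (jR Z X n (n - i))) = t (ob X i) (n - i)"
  using assms unfolding lift_mor_def by blast+

text \<open>Outside \<open>supp\<close> the entries start or end at zero objects, and
  \<open>t\<close> at a zero object is 0 as well.\<close>

lemma lift_morI:
  assumes X [simp]: "bounded_complex A X" and T: "T \<in> hom_cocycles M (Z \<diamond>\<^sub>R X) (X \<diamond>\<^sub>L Z) 0"
    and low: "\<And>n i k. i \<in> supp A X \<Longrightarrow> k \<in> supp A X \<Longrightarrow> k < i \<Longrightarrow>
      mor (qL X Z n k \<odot>\<^bsub>M\<^esub> tmap (Z \<diamond>\<^sub>R X) (X \<diamond>\<^sub>L Z) 0 T n \<odot>\<^bsub>M\<^esub> tsgn (i * (n - i)) (jR Z X n (n - i))) = 0"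
    and diag: "\<And>n i. i \<in> supp A X \<Longrightarrow>
      mor (qL X Z n i \<odot>\<^bsub>M\<^esub> tmap (Z \<diamond>\<^sub>R X) (X \<diamond>\<^sub>L Z) 0 T n \<odot>\<^bsub>M\<^esub> tsgn (i * (n - i)) (jR Z X n (n - i))) = t (ob X i) (n - i)"
  shows "lift_mor X T"
proof -
  let ?u = "\<lambda>n k i. qL X Z n k \<odot>\<^bsub>M\<^esub> tmap (Z \<diamond>\<^sub>R X) (X \<diamond>\<^sub>L Z) 0 T n \<odot>\<^bsub>M\<^esub> tsgn (i * (n - i)) (jR Z X n (n - i))"
  have v: "valid M (?u n k i)" for n k i using hom_cocyclesD[OF T] by simp
  have src: "mor (?u n k i) = 0" if "i \<notin> supp A X" for n k i
  proof (rule AM.is_zero_src[OF _ v])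
    show "is_zero M (src (?u n k i))" using that tR.is_zero_tensor_right by (simp add: supp_def)
  qed
  have tgt: "mor (?u n k i) = 0" if "k \<notin> supp A X" for n k i
  proof (rule AM.is_zero_tgt[OF _ v])
    show "is_zero M (tgt (?u n k i))" using that tL.is_zero_tensor_left by (simp add: supp_def)
  qed
  have "t (ob X i) p = 0" if "i \<notin> supp A X" for i p
  proof -
    have "is_zero M (ob (colR (ob X i)) p)" using that tR.is_zero_tensor_right by (simp add: supp_def)
    moreover have "t (ob X i) p \<in> Hom M (ob (colR (ob X i)) p) (ob (colL (ob X i)) p)"
      by (rule AM.hom_cx_0D[OF hom_cocyclesD[OF t_cocycle]]) simp
    ultimately show ?thesis by (auto simp: is_zero_def)
  qed
  then have "mor (?u n i i) = t (ob X i) (n - i)" for n i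
    using diag src by (cases "i \<in> supp A X") (simp_all del: arr_fields(3))
  moreover have "mor (?u n k i) = 0" if "k < i" for n k i
    using low[OF _ _ that] src tgt by blast
  ultimately show ?thesis unfolding lift_mor_def using T by (simp del: arr_fields(3))
qed

lemma lift_mor_exists:
  assumes X [simp]: "bounded_complex A X" shows "\<exists>T. lift_mor X T"
proof -
  have nat: "(\<lambda>p. mor (qL X Z (p + a + 1) b \<odot>\<^bsub>M\<^esub> tmap (X \<diamond>\<^sub>L Z) (X \<diamond>\<^sub>L Z) 1 (diff (X \<diamond>\<^sub>L Z)) (p + a) \<odot>\<^bsub>M\<^esub> jL X Z (p + a) a) \<cdot>\<^bsub>M\<^esub> t (ob X a) p
      - t (ob X b) p \<cdot>\<^bsub>M\<^esub> mor (tsgn (b * (p + a + 1 - b)) (qR Z X (p + a + 1) (p + a + 1 - b)) \<odot>\<^bsub>M\<^esub>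
          tmap (Z \<diamond>\<^sub>R X) (Z \<diamond>\<^sub>R X) 1 (diff (Z \<diamond>\<^sub>R X)) (p + a) \<odot>\<^bsub>M\<^esub> tsgn (a * (p + a - a)) (jR Z X (p + a) (p + a - a))))
      \<in> hom_coboundaries M (colR (ob X a)) (colL (ob X b)) 0" if b: "b = a + 1" for a b
  proof -
    have d: "diff X a \<in> Hom A (ob X a) (ob X (a + 1))" by (rule cplx_diff) simp
    \<comment> \<open>The connecting maps of both filtrations are induced by the differential of
      \<open>X\<close>, so the first obstruction is the naturality square of \<open>t\<close> for
      that differential.\<close>
    have "homotopic M (colR (ob X a)) (colL (ob X (a + 1)))
      (\<lambda>p. (diff X a \<otimes>\<^bsub>LAct M\<^esub> Ident M (ob Z p)) \<cdot>\<^bsub>M\<^esub> t (ob X a) p) (\<lambda>p. t (ob X (a + 1)) p \<cdot>\<^bsub>M\<^esub> (Ident M (ob Z p) \<otimes>\<^bsub>RAct M\<^esub> diff X a))"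
      by (rule AM.homotopic_sym[OF _ _ t_natural[OF _ _ d]]) simp_all
    then show ?thesis
      unfolding b filtered_L(2)[OF Z X] filtered_R(2)[OF Z X] by (simp add: homotopic_def)
  qed
  have "\<exists>T \<in> hom_cocycles M (Z \<diamond>\<^sub>R X) (X \<diamond>\<^sub>L Z) 0.
    (\<forall>a\<in>supp A X. \<forall>b\<in>supp A X. \<forall>n. b < a \<or> b = a \<and> a \<noteq> b \<longrightarrow>
      mor (qL X Z n b \<odot>\<^bsub>M\<^esub> tmap (Z \<diamond>\<^sub>R X) (X \<diamond>\<^sub>L Z) 0 T n \<odot>\<^bsub>M\<^esub> tsgn (a * (n - a)) (jR Z X n (n - a))) = 0) \<and>
    (\<forall>a\<in>supp A X. \<forall>n. mor (qL X Z n a \<odot>\<^bsub>M\<^esub> tmap (Z \<diamond>\<^sub>R X) (X \<diamond>\<^sub>L Z) 0 T n \<odot>\<^bsub>M\<^esub> tsgn (a * (n - a)) (jR Z X n (n - a))) = t (ob X a) (n - a))"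
  proof (rule AM.filtered_cocycle_exists[OF filtered_R(1)[OF Z X] filtered_L(1)[OF Z X], where t = "\<lambda>a. t (ob X a)"])
    fix a b
    show "AM.acyclic_below (colR (ob X a)) (colL (ob X b))" by (rule acyclic_RL) simp_all
    show "t (ob X a) \<in> hom_cocycles M (colR (ob X a)) (colL (ob X a)) 0" by (rule t_cocycle) simp
  qed (rule nat)
  then obtain T where "T \<in> hom_cocycles M (Z \<diamond>\<^sub>R X) (X \<diamond>\<^sub>L Z) 0"
    "\<forall>a\<in>supp A X. \<forall>b\<in>supp A X. \<forall>n. b < a \<or> b = a \<and> a \<noteq> b \<longrightarrow>
      mor (qL X Z n b \<odot>\<^bsub>M\<^esub> tmap (Z \<diamond>\<^sub>R X) (X \<diamond>\<^sub>L Z) 0 T n \<odot>\<^bsub>M\<^esub> tsgn (a * (n - a)) (jR Z X n (n - a))) = 0"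
    "\<forall>a\<in>supp A X. \<forall>n. mor (qL X Z n a \<odot>\<^bsub>M\<^esub> tmap (Z \<diamond>\<^sub>R X) (X \<diamond>\<^sub>L Z) 0 T n \<odot>\<^bsub>M\<^esub> tsgn (a * (n - a)) (jR Z X n (n - a))) = t (ob X a) (n - a)"
    by (elim bexE conjE) (rule that)
  then have "lift_mor X T"
    by (intro lift_morI[OF X]) (simp_all del: arr_fields(3))
  then show ?thesis by (rule exI[of "\<lambda>T. lift_mor X T" T])
qed

text \<open>The extension principle is applied in the opposite direction, with homotopy inverses of
  the diagonal entries as the new diagonal; both composites are then triangular with diagonals
  homotopic to identities.\<close>

lemma lift_mor_iso:
  assumes X [simp]: "bounded_complex A X" and T: "lift_mor X T"
  shows "is_iso (Kb M) (Z \<diamond>\<^sub>R X) (X \<diamond>\<^sub>L Z) (kclass M (Z \<diamond>\<^sub>R X) (X \<diamond>\<^sub>L Z) T)"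
proof -
  \<comment> \<open>One homotopy inverse of \<open>t W\<close> for each object \<open>W\<close>.
    Naturality up to homotopy, needed for the first obstruction, is inherited from \<open>t\<close>
    by \<open>homotopy_inverse_natural\<close>.\<close>
  define s where "s W = (SOME s. s \<in> hom_cocycles M (colL W) (colR W) 0 \<and>
    homotopic M (colR W) (colR W) (\<lambda>i. s i \<cdot>\<^bsub>M\<^esub> t W i) (\<lambda>i. Ident M (ob (colR W) i)) \<and>
    homotopic M (colL W) (colL W) (\<lambda>i. t W i \<cdot>\<^bsub>M\<^esub> s i) (\<lambda>i. Ident M (ob (colL W) i)))" for W
  note s_spec = someI_ex[OF t_inverse[unfolded Bex_def], folded s_def]
  note s = s_spec[THEN conjunct1] s_spec[THEN conjunct2, THEN conjunct1] s_spec[THEN conjunct2, THEN conjunct2]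
  have nat: "(\<lambda>p. mor (tsgn (b * (p + a + 1 - b)) (qR Z X (p + a + 1) (p + a + 1 - b)) \<odot>\<^bsub>M\<^esub>
          tmap (Z \<diamond>\<^sub>R X) (Z \<diamond>\<^sub>R X) 1 (diff (Z \<diamond>\<^sub>R X)) (p + a) \<odot>\<^bsub>M\<^esub> tsgn (a * (p + a - a)) (jR Z X (p + a) (p + a - a))) \<cdot>\<^bsub>M\<^esub> s (ob X a) p
      - s (ob X b) p \<cdot>\<^bsub>M\<^esub> mor (qL X Z (p + a + 1) b \<odot>\<^bsub>M\<^esub> tmap (X \<diamond>\<^sub>L Z) (X \<diamond>\<^sub>L Z) 1 (diff (X \<diamond>\<^sub>L Z)) (p + a) \<odot>\<^bsub>M\<^esub> jL X Z (p + a) a))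
      \<in> hom_coboundaries M (colL (ob X a)) (colR (ob X b)) 0" if b: "b = a + 1" for a b
  proof -
    have d: "diff X a \<in> Hom A (ob X a) (ob X (a + 1))" by (rule cplx_diff) simp
    have O: "ob X a \<in> Obj A" "ob X (a + 1) \<in> Obj A" by simp_all
    have "homotopic M (colL (ob X a)) (colR (ob X (a + 1)))
      (\<lambda>p. (Ident M (ob Z p) \<otimes>\<^bsub>RAct M\<^esub> diff X a) \<cdot>\<^bsub>M\<^esub> s (ob X a) p) (\<lambda>p. s (ob X (a + 1)) p \<cdot>\<^bsub>M\<^esub> (diff X a \<otimes>\<^bsub>LAct M\<^esub> Ident M (ob Z p)))"
      by (rule AM.homotopy_inverse_natural[OF _ _ _ _ t_cocycle[OF O(1)] s(1)[OF O(1)] s(3)[OF O(1)] t_cocycle[OF O(2)] s(1)[OF O(2)] s(2)[OF O(2)]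
          tR.rcol_mor_cocycle[OF _ O d] tL.lcol_mor_cocycle[OF _ O d] t_natural[OF O d]]) simp_all
    then show ?thesis
      unfolding b filtered_L(2)[OF Z X] filtered_R(2)[OF Z X] by (simp add: homotopic_def)
  qed
  have "\<exists>S \<in> hom_cocycles M (X \<diamond>\<^sub>L Z) (Z \<diamond>\<^sub>R X) 0.
    (\<forall>a\<in>supp A X. \<forall>b\<in>supp A X. \<forall>n. b < a \<or> b = a \<and> a \<noteq> b \<longrightarrow>
      mor (tsgn (b * (n - b)) (qR Z X n (n - b)) \<odot>\<^bsub>M\<^esub> tmap (X \<diamond>\<^sub>L Z) (Z \<diamond>\<^sub>R X) 0 S n \<odot>\<^bsub>M\<^esub> jL X Z n a) = 0) \<and>
    (\<forall>a\<in>supp A X. \<forall>n. mor (tsgn (a * (n - a)) (qR Z X n (n - a)) \<odot>\<^bsub>M\<^esub> tmap (X \<diamond>\<^sub>L Z) (Z \<diamond>\<^sub>R X) 0 S n \<odot>\<^bsub>M\<^esub> jL X Z n a) = s (ob X a) (n - a))"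
  proof (rule AM.filtered_cocycle_exists[OF filtered_L(1)[OF Z X] filtered_R(1)[OF Z X], where t = "\<lambda>a. s (ob X a)"])
    fix a b
    show "AM.acyclic_below (colL (ob X a)) (colR (ob X b))" by (rule acyclic_LL_of_R[OF _ _ acyclic_RR]) simp_all
    show "s (ob X a) \<in> hom_cocycles M (colL (ob X a)) (colR (ob X a)) 0" by (rule s(1)) simp
  qed (rule nat)
  then obtain S where S': "S \<in> hom_cocycles M (X \<diamond>\<^sub>L Z) (Z \<diamond>\<^sub>R X) 0"
    "\<forall>a\<in>supp A X. \<forall>b\<in>supp A X. \<forall>n. b < a \<or> b = a \<and> a \<noteq> b \<longrightarrow>
      mor (tsgn (b * (n - b)) (qR Z X n (n - b)) \<odot>\<^bsub>M\<^esub> tmap (X \<diamond>\<^sub>L Z) (Z \<diamond>\<^sub>R X) 0 S n \<odot>\<^bsub>M\<^esub> jL X Z n a) = 0"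
    "\<forall>a\<in>supp A X. \<forall>n. mor (tsgn (a * (n - a)) (qR Z X n (n - a)) \<odot>\<^bsub>M\<^esub> tmap (X \<diamond>\<^sub>L Z) (Z \<diamond>\<^sub>R X) 0 S n \<odot>\<^bsub>M\<^esub> jL X Z n a) = s (ob X a) (n - a)"
    by (elim bexE conjE) (rule that)
  have S: "S \<in> hom_cocycles M (X \<diamond>\<^sub>L Z) (Z \<diamond>\<^sub>R X) 0"
    "\<And>a b n. \<lbrakk>a \<in> supp A X; b \<in> supp A X; b < a\<rbrakk> \<Longrightarrow>
      mor (tsgn (b * (n - b)) (qR Z X n (n - b)) \<odot>\<^bsub>M\<^esub> tmap (X \<diamond>\<^sub>L Z) (Z \<diamond>\<^sub>R X) 0 S n \<odot>\<^bsub>M\<^esub> jL X Z n a) = 0"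
    "\<And>a n. a \<in> supp A X \<Longrightarrow>
      mor (tsgn (a * (n - a)) (qR Z X n (n - a)) \<odot>\<^bsub>M\<^esub> tmap (X \<diamond>\<^sub>L Z) (Z \<diamond>\<^sub>R X) 0 S n \<odot>\<^bsub>M\<^esub> jL X Z n a) = s (ob X a) (n - a)"
    using S' by (simp_all del: arr_fields(3))
  note TD = lift_morD[OF T]
  have "homotopic M (Z \<diamond>\<^sub>R X) (Z \<diamond>\<^sub>R X) (\<lambda>i. S i \<cdot>\<^bsub>M\<^esub> T i) (\<lambda>i. Ident M (ob (Z \<diamond>\<^sub>R X) i))"
    by (rule AM.filtered_inverse[OF filtered_R(1)[OF Z X] filtered_L(1)[OF Z X] _ TD(1) S(1) TD(2) TD(3) S(2,3)])
      (simp_all add: acyclic_RR s(2)[simplified])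
  \<comment> \<open>The same comparison with the two sides exchanged; it relies on vanishing between
    left columns.\<close>
  moreover have "homotopic M (X \<diamond>\<^sub>L Z) (X \<diamond>\<^sub>L Z) (\<lambda>i. T i \<cdot>\<^bsub>M\<^esub> S i) (\<lambda>i. Ident M (ob (X \<diamond>\<^sub>L Z) i))"
    by (rule AM.filtered_inverse[OF filtered_L(1)[OF Z X] filtered_R(1)[OF Z X] _ S(1) TD(1) S(2,3) TD(2) TD(3)])
      (simp_all add: acyclic_LL_of_R acyclic_RL s(3)[simplified])
  ultimately show ?thesis
    using TD(1) S(1) by (intro AM.Kb_is_isoI) simp_all
qed

text \<open>Both composites are triangular, with diagonals t_Y (1 \<star> f) and (f \<star> 1) t_X,
  which are homotopic by \<open>t_natural\<close>. As f preserves degrees, each entry is a single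
  product.\<close>

lemma lift_mor_natural:
  assumes X [simp]: "bounded_complex A X" and Y [simp]: "bounded_complex A Y" and f: "f \<in> hom_cocycles A X Y 0"
    and T: "lift_mor X T" and T': "lift_mor Y T'"
  shows "homotopic M (Z \<diamond>\<^sub>R X) (Y \<diamond>\<^sub>L Z)
    (\<lambda>i. T' i \<cdot>\<^bsub>M\<^esub> tot_mor M (RAct M) Z X Z Y 0 0 (\<lambda>i. Ident M (ob Z i)) f i)
    (\<lambda>i. tot_mor M (LAct M) X Z Y Z 0 0 f (\<lambda>i. Ident M (ob Z i)) i \<cdot>\<^bsub>M\<^esub> T i)"
proof (rule AM.filtered_homotopicI[OF filtered_R(1)[OF Z X] filtered_L(1)[OF Z Y]])
  let ?m = "tot_mor M (RAct M) Z X Z Y 0 0 (\<lambda>i. Ident M (ob Z i)) f"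
  let ?l = "tot_mor M (LAct M) X Z Y Z 0 0 f (\<lambda>i. Ident M (ob Z i))"
  note TD = lift_morD[OF T] and TD' = lift_morD[OF T']
  note cx = hom_cocyclesD[OF TD(1)] hom_cocyclesD[OF TD'(1)] hom_cocyclesD[OF f]
  have m: "?m \<in> hom_cocycles M (Z \<diamond>\<^sub>R X) (Z \<diamond>\<^sub>R Y) 0" using f by (intro tR.tot_mor_cocycle) simp_all
  have l: "?l \<in> hom_cocycles M (X \<diamond>\<^sub>L Z) (Y \<diamond>\<^sub>L Z) 0" using f by (intro tL.tot_mor_cocycle) simp_all
  show "AM.acyclic_below (colR (ob X a)) (colL (ob Y b))" for a b by (rule acyclic_RL) simp_all
  show "(\<lambda>i. T' i \<cdot>\<^bsub>M\<^esub> ?m i) \<in> hom_cocycles M (Z \<diamond>\<^sub>R X) (Y \<diamond>\<^sub>L Z) 0"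
    by (rule AM.cocycle_comp0[OF _ _ _ m TD'(1)]) simp_all
  show "(\<lambda>i. ?l i \<cdot>\<^bsub>M\<^esub> T i) \<in> hom_cocycles M (Z \<diamond>\<^sub>R X) (Y \<diamond>\<^sub>L Z) 0"
    by (rule AM.cocycle_comp0[OF _ _ _ TD(1) l]) simp_all
  let ?U = "\<lambda>n b a. qL Y Z n b \<odot>\<^bsub>M\<^esub> tmap (Z \<diamond>\<^sub>R X) (Y \<diamond>\<^sub>L Z) 0 (\<lambda>i. T' i \<cdot>\<^bsub>M\<^esub> ?m i) n \<odot>\<^bsub>M\<^esub> tsgn (a * (n - a)) (jR Z X n (n - a))"
  let ?V = "\<lambda>n b a. qL Y Z n b \<odot>\<^bsub>M\<^esub> tmap (Z \<diamond>\<^sub>R X) (Y \<diamond>\<^sub>L Z) 0 (\<lambda>i. ?l i \<cdot>\<^bsub>M\<^esub> T i) n \<odot>\<^bsub>M\<^esub> tsgn (a * (n - a)) (jR Z X n (n - a))"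
  let ?c' = "\<lambda>n b a. qL Y Z n b \<odot>\<^bsub>M\<^esub> tmap (Z \<diamond>\<^sub>R Y) (Y \<diamond>\<^sub>L Z) 0 T' n \<odot>\<^bsub>M\<^esub> tsgn (a * (n - a)) (jR Z Y n (n - a))"
  let ?c = "\<lambda>n b a. qL X Z n b \<odot>\<^bsub>M\<^esub> tmap (Z \<diamond>\<^sub>R X) (X \<diamond>\<^sub>L Z) 0 T n \<odot>\<^bsub>M\<^esub> tsgn (a * (n - a)) (jR Z X n (n - a))"
  have U: "?U n b a = ?c' n b a \<odot>\<^bsub>M\<^esub> (tid M (ob Z (n - a)) \<Otimes>\<^bsub>RAct M\<^esub> tmap X Y 0 f a)" for n a b
  proof -
    have e: "tmap (Z \<diamond>\<^sub>R X) (Y \<diamond>\<^sub>L Z) 0 (\<lambda>i. T' i \<cdot>\<^bsub>M\<^esub> ?m i) n = tmap (Z \<diamond>\<^sub>R Y) (Y \<diamond>\<^sub>L Z) 0 T' n \<odot>\<^bsub>M\<^esub> tmap (Z \<diamond>\<^sub>R X) (Z \<diamond>\<^sub>R Y) 0 ?m n"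
      by (rule arr_eqI) simp_all
    show ?thesis unfolding e using cx by simp
  qed
  have V: "?V n b a = (tmap X Y 0 f b \<Otimes>\<^bsub>LAct M\<^esub> tid M (ob Z (n - b))) \<odot>\<^bsub>M\<^esub> ?c n b a" for n a b
  proof -
    have e: "tmap (Z \<diamond>\<^sub>R X) (Y \<diamond>\<^sub>L Z) 0 (\<lambda>i. ?l i \<cdot>\<^bsub>M\<^esub> T i) n = tmap (X \<diamond>\<^sub>L Z) (Y \<diamond>\<^sub>L Z) 0 ?l n \<odot>\<^bsub>M\<^esub> tmap (Z \<diamond>\<^sub>R X) (X \<diamond>\<^sub>L Z) 0 T n"
      by (rule arr_eqI) simp_all
    have q: "qL Y Z n b \<odot>\<^bsub>M\<^esub> tmap (X \<diamond>\<^sub>L Z) (Y \<diamond>\<^sub>L Z) 0 ?l n = (tmap X Y 0 f b \<Otimes>\<^bsub>LAct M\<^esub> tid M (ob Z (n - b))) \<odot>\<^bsub>M\<^esub> qL X Z n b"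
      using tL.tot_mor_tprj[OF X Z Y Z cx(3) AM.ident_hom_cx, of n b] by simp
    have "?V n b a = (qL Y Z n b \<odot>\<^bsub>M\<^esub> tmap (X \<diamond>\<^sub>L Z) (Y \<diamond>\<^sub>L Z) 0 ?l n) \<odot>\<^bsub>M\<^esub> tmap (Z \<diamond>\<^sub>R X) (X \<diamond>\<^sub>L Z) 0 T n \<odot>\<^bsub>M\<^esub> tsgn (a * (n - a)) (jR Z X n (n - a))"
      unfolding e using cx hom_cocyclesD[OF l] by simp
    then show ?thesis unfolding q using cx by simp
  qed
  have v: "valid M (tid M (ob Z (n - a)) \<Otimes>\<^bsub>RAct M\<^esub> tmap X Y 0 f a)" "valid M (tmap X Y 0 f b \<Otimes>\<^bsub>LAct M\<^esub> tid M (ob Z (n - b)))" for n a b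
    using cx by simp_all
  show "mor (?U n b a) = 0" if "b < a" for n a b
    unfolding U arr_fields(3)[of _ "?c' n b a"] TD'(2)[OF that] using AM.valid_comp_zero(2)[OF v(1)] .
  show "mor (?V n b a) = 0" if "b < a" for n a b
    unfolding V arr_fields(3)[of _ _ "?c n b a"] TD(2)[OF that] using AM.valid_comp_zero(1)[OF v(2)] .
  show "homotopic M (colR (ob X a)) (colL (ob Y b)) (\<lambda>p. mor (?U (p + a) b a)) (\<lambda>p. mor (?V (p + a) b a))" if "b = a" for a b
  proof -
    have fa: "f a \<in> Hom A (ob X a) (ob Y a)" by (rule AA.hom_cx_0D[OF cx(3)])
    have 1: "mor (?U (p + a) a a) = t (ob Y a) p \<cdot>\<^bsub>M\<^esub> (Ident M (ob Z p) \<otimes>\<^bsub>RAct M\<^esub> f a)" for p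
      unfolding U arr_fields(3)[of _ "?c' (p + a) a a"] TD'(3) by simp
    have 2: "mor (?V (p + a) a a) = (f a \<otimes>\<^bsub>LAct M\<^esub> Ident M (ob Z p)) \<cdot>\<^bsub>M\<^esub> t (ob X a) p" for p
      unfolding V arr_fields(3)[of _ _ "?c (p + a) a a"] TD(3) by simp
    show ?thesis unfolding that 1 2 by (rule t_natural[OF _ _ fa]) simp_all
  qed
qed

end

section \<open>Uniqueness and multiplicativity of lifts\<close>

context centralizer_lift
begin

text \<open>The entries with the sign of the filtration taken out. The degree m in \<open>Z\<close>
  is a separate variable because triple products present it in several arithmetic forms.\<close>

lemma lift_mor_unsigned:
  assumes X [simp]: "bounded_complex A X" and T: "lift_mor X T" and m: "m = n - i"
  shows "k < i \<Longrightarrow> qL X Z n k \<odot>\<^bsub>M\<^esub> tmap (Z \<diamond>\<^sub>R X) (X \<diamond>\<^sub>L Z) 0 T n \<odot>\<^bsub>M\<^esub> jR Z X n m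
      = tzero (ob Z m \<star>\<^bsub>RAct M\<^esub> ob X i) (ob X k \<star>\<^bsub>LAct M\<^esub> ob Z (n - k))"
    and "qL X Z n i \<odot>\<^bsub>M\<^esub> tmap (Z \<diamond>\<^sub>R X) (X \<diamond>\<^sub>L Z) 0 T n \<odot>\<^bsub>M\<^esub> jR Z X n m
      = tsgn (i * m) (tmap (colR (ob X i)) (colL (ob X i)) 0 (t (ob X i)) m)"
proof -
  note TD = lift_morD[OF T]
  have c: "T \<in> hom_cx M (Z \<diamond>\<^sub>R X) (X \<diamond>\<^sub>L Z) 0" using TD(1) by (rule hom_cocyclesD)
  have e: "qL X Z n k \<odot>\<^bsub>M\<^esub> tmap (Z \<diamond>\<^sub>R X) (X \<diamond>\<^sub>L Z) 0 T n \<odot>\<^bsub>M\<^esub> tsgn (i * (n - i)) (jR Z X n (n - i))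
    = tsgn (i * m) (qL X Z n k \<odot>\<^bsub>M\<^esub> tmap (Z \<diamond>\<^sub>R X) (X \<diamond>\<^sub>L Z) 0 T n \<odot>\<^bsub>M\<^esub> jR Z X n m)" for k
    unfolding m using c by simp
  have d: "ksign (i * m) (mor (qL X Z n k \<odot>\<^bsub>M\<^esub> tmap (Z \<diamond>\<^sub>R X) (X \<diamond>\<^sub>L Z) 0 T n \<odot>\<^bsub>M\<^esub> jR Z X n m))
     = mor (qL X Z n k \<odot>\<^bsub>M\<^esub> tmap (Z \<diamond>\<^sub>R X) (X \<diamond>\<^sub>L Z) 0 T n \<odot>\<^bsub>M\<^esub> tsgn (i * (n - i)) (jR Z X n (n - i)))" for k
    unfolding e by (simp only: arr_fields(12))
  show "qL X Z n k \<odot>\<^bsub>M\<^esub> tmap (Z \<diamond>\<^sub>R X) (X \<diamond>\<^sub>L Z) 0 T n \<odot>\<^bsub>M\<^esub> jR Z X n m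
      = tzero (ob Z m \<star>\<^bsub>RAct M\<^esub> ob X i) (ob X k \<star>\<^bsub>LAct M\<^esub> ob Z (n - k))" if "k < i"
    using d[of k] TD(2)[OF that] by (intro arr_eqI) (simp_all add: m del: arr_fields(3))
  show "qL X Z n i \<odot>\<^bsub>M\<^esub> tmap (Z \<diamond>\<^sub>R X) (X \<diamond>\<^sub>L Z) 0 T n \<odot>\<^bsub>M\<^esub> jR Z X n m
      = tsgn (i * m) (tmap (colR (ob X i)) (colL (ob X i)) 0 (t (ob X i)) m)"
  proof (rule arr_eqI)
    have "mor (qL X Z n i \<odot>\<^bsub>M\<^esub> tmap (Z \<diamond>\<^sub>R X) (X \<diamond>\<^sub>L Z) 0 T n \<odot>\<^bsub>M\<^esub> jR Z X n m) = ksign (i * m) (t (ob X i) m)"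
      using arg_cong[where f = "ksign (i * m)", OF d[of i]] unfolding TD(3) by (simp add: m)
    then show "mor (qL X Z n i \<odot>\<^bsub>M\<^esub> tmap (Z \<diamond>\<^sub>R X) (X \<diamond>\<^sub>L Z) 0 T n \<odot>\<^bsub>M\<^esub> jR Z X n m)
      = mor (tsgn (i * m) (tmap (colR (ob X i)) (colL (ob X i)) 0 (t (ob X i)) m))" by (simp del: arr_fields(3))
  qed (simp_all add: m)
qed

text \<open>The diagonals of two lifts coincide. Hence the class of a lift does not depend on the
  choices made in its construction.\<close>

lemma lift_mor_unique:
  assumes X [simp]: "bounded_complex A X" and T: "lift_mor X T" and T': "lift_mor X T'"
  shows "homotopic M (Z \<diamond>\<^sub>R X) (X \<diamond>\<^sub>L Z) T T'"
proof (rule AM.filtered_homotopicI[OF filtered_R(1)[OF Z X] filtered_L(1)[OF Z X] _ lift_morD(1)[OF T] lift_morD(1)[OF T']])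
  fix a b
  show "AM.acyclic_below (colR (ob X a)) (colL (ob X b))" by (rule acyclic_RL) simp_all
  show "mor (qL X Z n b \<odot>\<^bsub>M\<^esub> tmap (Z \<diamond>\<^sub>R X) (X \<diamond>\<^sub>L Z) 0 T n \<odot>\<^bsub>M\<^esub> tsgn (a * (n - a)) (jR Z X n (n - a))) = 0"
    "mor (qL X Z n b \<odot>\<^bsub>M\<^esub> tmap (Z \<diamond>\<^sub>R X) (X \<diamond>\<^sub>L Z) 0 T' n \<odot>\<^bsub>M\<^esub> tsgn (a * (n - a)) (jR Z X n (n - a))) = 0" if "b < a" for n
    by (rule lift_morD(2)[OF T that], rule lift_morD(2)[OF T' that])
  show "homotopic M (colR (ob X a)) (colL (ob X b))
    (\<lambda>p. mor (qL X Z (p + a) b \<odot>\<^bsub>M\<^esub> tmap (Z \<diamond>\<^sub>R X) (X \<diamond>\<^sub>L Z) 0 T (p + a) \<odot>\<^bsub>M\<^esub> tsgn (a * (p + a - a)) (jR Z X (p + a) (p + a - a))))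
    (\<lambda>p. mor (qL X Z (p + a) b \<odot>\<^bsub>M\<^esub> tmap (Z \<diamond>\<^sub>R X) (X \<diamond>\<^sub>L Z) 0 T' (p + a) \<odot>\<^bsub>M\<^esub> tsgn (a * (p + a - a)) (jR Z X (p + a) (p + a - a))))"
    if "b = a"
    unfolding that lift_morD(3)[OF T] lift_morD(3)[OF T'] by (rule AM.homotopic_refl) simp_all
qed

text \<open>Only the column in degree 0 is nonzero, and there the entry is \<open>t X\<close> by
  definition.\<close>

lemma lift_mor_stalk:
  assumes X [simp]: "X \<in> Obj A" shows "lift_mor (stalk A X) (th X)"
proof (rule lift_morI[OF AA.stalk_bounded[OF X] th_cocycle[OF X]])
  have 0: "i = 0" if "i \<in> supp A (stalk A X)" for i
    using that AA.stalk_ob_zero[of i X] by (auto simp: supp_def)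
  show "mor (qL (stalk A X) Z n k \<odot>\<^bsub>M\<^esub> tmap (Z \<diamond>\<^sub>R stalk A X) (stalk A X \<diamond>\<^sub>L Z) 0 (th X) n \<odot>\<^bsub>M\<^esub>
      tsgn (i * (n - i)) (jR Z (stalk A X) n (n - i))) = 0"
    if "i \<in> supp A (stalk A X)" "k \<in> supp A (stalk A X)" "k < i" for n i k
    using 0[OF that(1)] 0[OF that(2)] that(3) by simp
  show "mor (qL (stalk A X) Z n i \<odot>\<^bsub>M\<^esub> tmap (Z \<diamond>\<^sub>R stalk A X) (stalk A X \<diamond>\<^sub>L Z) 0 (th X) n \<odot>\<^bsub>M\<^esub>
      tsgn (i * (n - i)) (jR Z (stalk A X) n (n - i))) = t (ob (stalk A X) i) (n - i)"
    if "i \<in> supp A (stalk A X)" for n i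
    using 0[OF that] by (simp add: t_def)
qed

text \<open>Both sides are compared for the filtration by i + j. The right side is triangular in
  each index separately. The left side passes through the lift for the total product and is
  triangular in the sum only, so its entries with k + l = i + j need an argument of their
  own.\<close>

lemma lift_mor_multiplicative:
  assumes X [simp]: "bounded_complex A X" and Y [simp]: "bounded_complex A Y"
    and TX: "lift_mor X TX" and TY: "lift_mor Y TY" and T: "lift_mor (X \<diamond>\<^sub>A Y) T"
  shows "homotopic M ((Z \<diamond>\<^sub>R X) \<diamond>\<^sub>R Y) (X \<diamond>\<^sub>L (Y \<diamond>\<^sub>L Z))
    (\<lambda>n. hatL X Y Z n \<cdot>\<^bsub>M\<^esub> (T n \<cdot>\<^bsub>M\<^esub> hatR Z X Y n))
    (\<lambda>n. tot_mor M (LAct M) X (Z \<diamond>\<^sub>R Y) X (Y \<diamond>\<^sub>L Z) 0 0 (\<lambda>i. Ident A (ob X i)) TY n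
        \<cdot>\<^bsub>M\<^esub> (hatM X Z Y n \<cdot>\<^bsub>M\<^esub> tot_mor M (RAct M) (Z \<diamond>\<^sub>R X) Y (X \<diamond>\<^sub>L Z) Y 0 0 TX (\<lambda>i. Ident A (ob Y i)) n))"
    (is "homotopic M ?P ?Q ?U ?V")
proof -
  let ?XY = "X \<diamond>\<^sub>A Y"
  have XY [simp]: "bounded_complex A ?XY" by simp
  note Tc = lift_morD(1)[OF T] and TXc = lift_morD(1)[OF TX] and TYc = lift_morD(1)[OF TY]
  note cx = hom_cocyclesD[OF Tc] hom_cocyclesD[OF TXc] hom_cocyclesD[OF TYc]
  let ?u = "\<lambda>n k l i j. qLL Z X Y n k l \<odot>\<^bsub>M\<^esub> tmap ?P ?Q 0 ?U n \<odot>\<^bsub>M\<^esub> tsgn ((i + j) * (n - (i + j))) (jRR Z X Y n i j)"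
  let ?v = "\<lambda>n k l i j. qLL Z X Y n k l \<odot>\<^bsub>M\<^esub> tmap ?P ?Q 0 ?V n \<odot>\<^bsub>M\<^esub> tsgn ((i + j) * (n - (i + j))) (jRR Z X Y n i j)"
  have l: "tot_mor M (LAct M) X (Z \<diamond>\<^sub>R Y) X (Y \<diamond>\<^sub>L Z) 0 0 (\<lambda>i. Ident A (ob X i)) TY \<in> hom_cocycles M (X \<diamond>\<^sub>L (Z \<diamond>\<^sub>R Y)) ?Q 0"
    using TYc by (intro tL.tot_mor_cocycle) simp_all
  have r: "tot_mor M (RAct M) (Z \<diamond>\<^sub>R X) Y (X \<diamond>\<^sub>L Z) Y 0 0 TX (\<lambda>i. Ident A (ob Y i)) \<in> hom_cocycles M ?P ((X \<diamond>\<^sub>L Z) \<diamond>\<^sub>R Y) 0"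
    using TXc by (intro tR.tot_mor_cocycle) simp_all
  have TR: "(\<lambda>n. T n \<cdot>\<^bsub>M\<^esub> hatR Z X Y n) \<in> hom_cocycles M ?P (?XY \<diamond>\<^sub>L Z) 0"
    by (rule AM.cocycle_comp0[OF _ _ _ aR.tot_assoc_cocycle[OF Z X Y] Tc]) simp_all
  have U: "?U \<in> hom_cocycles M ?P ?Q 0"
    by (rule AM.cocycle_comp0[OF _ _ _ TR aL.tot_assoc_cocycle[OF X Y Z]]) simp_all
  have Mr: "(\<lambda>n. hatM X Z Y n \<cdot>\<^bsub>M\<^esub> tot_mor M (RAct M) (Z \<diamond>\<^sub>R X) Y (X \<diamond>\<^sub>L Z) Y 0 0 TX (\<lambda>i. Ident A (ob Y i)) n)
      \<in> hom_cocycles M ?P (X \<diamond>\<^sub>L (Z \<diamond>\<^sub>R Y)) 0"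
    by (rule AM.cocycle_comp0[OF _ _ _ r aM.tot_assoc_cocycle[OF X Z Y]]) simp_all
  have V: "?V \<in> hom_cocycles M ?P ?Q 0"
    by (rule AM.cocycle_comp0[OF _ _ _ Mr l]) simp_all
  have u: "?u n k l i j = aL.tas (ob X k) (ob Y l) (ob Z (n - (k + l))) \<odot>\<^bsub>M\<^esub> (qA X Y (k + l) k \<Otimes>\<^bsub>LAct M\<^esub> tid M (ob Z (n - (k + l))))
      \<odot>\<^bsub>M\<^esub> tsgn ((i + j) * (n - (i + j))) (qL ?XY Z n (k + l) \<odot>\<^bsub>M\<^esub> tmap (Z \<diamond>\<^sub>R ?XY) (?XY \<diamond>\<^sub>L Z) 0 T n \<odot>\<^bsub>M\<^esub> jR Z ?XY n (n - (i + j)))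
      \<odot>\<^bsub>M\<^esub> (tid M (ob Z (n - (i + j))) \<Otimes>\<^bsub>RAct M\<^esub> jA X Y (i + j) i) \<odot>\<^bsub>M\<^esub> aR.tas (ob Z (n - (i + j))) (ob X i) (ob Y j)" for n k l i j
  proof -
    have "?u n k l i j = tsgn ((i + j) * (n - (i + j))) (qLL Z X Y n k l \<odot>\<^bsub>M\<^esub> tmap ?P ?Q 0 ?U n \<odot>\<^bsub>M\<^esub> jRR Z X Y n i j)"
      using hom_cocyclesD[OF U] by simp
    then show ?thesis unfolding components_assoc_left[OF Z X Y cx(1)] using cx by (simp add: algebra_simps)
  qed
  have v: "?v n k l i j = tsgn ((i + j) * (n - (i + j)))
      ((tid A (ob X k) \<Otimes>\<^bsub>LAct M\<^esub> (qL Y Z (n - k) l \<odot>\<^bsub>M\<^esub> tmap (Z \<diamond>\<^sub>R Y) (Y \<diamond>\<^sub>L Z) 0 TY (n - k) \<odot>\<^bsub>M\<^esub> jR Z Y (n - k) (n - (k + j))))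
      \<odot>\<^bsub>M\<^esub> aM.tas (ob X k) (ob Z (n - (k + j))) (ob Y j)
      \<odot>\<^bsub>M\<^esub> ((qL X Z (n - j) k \<odot>\<^bsub>M\<^esub> tmap (Z \<diamond>\<^sub>R X) (X \<diamond>\<^sub>L Z) 0 TX (n - j) \<odot>\<^bsub>M\<^esub> jR Z X (n - j) (n - (i + j))) \<Otimes>\<^bsub>RAct M\<^esub> tid A (ob Y j)))" for n k l i j
    unfolding components_assoc_right[OF Z X Y cx(2,3), symmetric] using hom_cocyclesD[OF V] by simp
  have u0: "mor (?u n k l i j) = 0" if "k + l < i + j" for n k l i j
  proof -
    have "?u n k l i j = tzero (src (?u n k l i j)) (tgt (?u n k l i j))"
      unfolding u lift_mor_unsigned(1)[OF XY T refl that] by (simp add: algebra_simps)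
    from arg_cong[where f = mor, OF this] show ?thesis by (simp only: arr_fields(15))
  qed
  \<comment> \<open>The entry is a product with factors the entries of \<open>TX\<close> from i to k
    and of \<open>TY\<close> from j to l, one of which vanishes.\<close>
  have v0: "mor (?v n k l i j) = 0" if "k < i \<or> l < j" for n k l i j
  proof -
    have "n - (i + j) = n - j - i" "n - (k + j) = n - k - j" by simp_all
    note z = lift_mor_unsigned(1)[OF X TX this(1)] lift_mor_unsigned(1)[OF Y TY this(2)]
    have "?v n k l i j = tzero (src (?v n k l i j)) (tgt (?v n k l i j))"
    proof (cases "k < i")
      case True
      show ?thesis unfolding v z(1)[OF True] using cx by (simp add: algebra_simps)
    next
      case False
      then have "l < j" using that by simp
      show ?thesis unfolding v z(2)[OF \<open>l < j\<close>] using cx by (simp add: algebra_simps)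
    qed
    from arg_cong[where f = mor, OF this] show ?thesis by (simp only: arr_fields(15))
  qed
  have v1: "mor (?v (p + (i + j)) i j i j) = (Ident A (ob X i) \<otimes>\<^bsub>LAct M\<^esub> t (ob Y j) p) \<cdot>\<^bsub>M\<^esub> (MAssoc M (ob X i) (ob Z p) (ob Y j) \<cdot>\<^bsub>M\<^esub> (t (ob X i) p \<otimes>\<^bsub>RAct M\<^esub> Ident A (ob Y j)))" for p i j
  proof -
    have "p + (i + j) - (i + j) = p + (i + j) - j - i" "p + (i + j) - (i + j) = p + (i + j) - i - j" by simp_all
    note z = lift_mor_unsigned(2)[OF X TX this(1)] lift_mor_unsigned(2)[OF Y TY this(2)]
    have tc: "t (ob X i) \<in> hom_cx M (colR (ob X i)) (colL (ob X i)) 0" "t (ob Y j) \<in> hom_cx M (colR (ob Y j)) (colL (ob Y j)) 0"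
      by (rule hom_cocyclesD[OF t_cocycle]; simp)+
    \<comment> \<open>The exponent (i + j) p of the filtration cancels against i p from
      \<open>TX\<close> and j p from \<open>TY\<close>.\<close>
    have "?v (p + (i + j)) i j i j = (tid A (ob X i) \<Otimes>\<^bsub>LAct M\<^esub> tmap (colR (ob Y j)) (colL (ob Y j)) 0 (t (ob Y j)) p)
       \<odot>\<^bsub>M\<^esub> aM.tas (ob X i) (ob Z p) (ob Y j) \<odot>\<^bsub>M\<^esub> (tmap (colR (ob X i)) (colL (ob X i)) 0 (t (ob X i)) p \<Otimes>\<^bsub>RAct M\<^esub> tid A (ob Y j))"
      unfolding v z using tc by (simp add: algebra_simps tsgn_even)
    from arg_cong[where f = mor, OF this] show ?thesis by (simp del: arr_fields(3)) simp
  qed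
  \<comment> \<open>On the left side the entry is the map \<open>t\<close> of the whole object W =
    (X \<star> Y)^(i+j), preceded by the inclusion of the summand i and followed by the projection
    to the summand k.\<close>
  have lead: "homotopic M (colRR (ob X i) (ob Y j)) (colLL (ob X k) (ob Y l))
      (\<lambda>p. mor (?u (p + (i + j)) k l i j)) (\<lambda>p. mor (?v (p + (i + j)) k l i j))" if kl: "k + l = i + j" for i j k l
  proof -
    define W where "W = sum_ob (tot_sum A (Tensor A) X Y (i + j))"
    define jj where "jj = inj (tot_sum A (Tensor A) X Y (i + j)) i"
    define qq where "qq = prj (tot_sum A (Tensor A) X Y (i + j)) k"
    let ?jj = "jA X Y (i + j) i" and ?qq = "qA X Y (i + j) k"
    let ?V = "ob X i \<star>\<^bsub>Tensor A\<^esub> ob Y j" and ?V' = "ob X k \<star>\<^bsub>Tensor A\<^esub> ob Y l"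
    have ij: "i + j - i = j" "i + j - k = l" using kl by simp_all
    have W [simp]: "W \<in> Obj A" by (simp add: W_def)
    have jj: "jj \<in> Hom A ?V W" and qq: "qq \<in> Hom A W ?V'"
      using tA.valid_tinj[OF X Y, of "i + j" i] tA.valid_tprj[OF X Y, of "i + j" k] ij
      by (simp_all add: valid_def jj_def qq_def W_def)
    have Vo: "?V \<in> Obj A" "?V' \<in> Obj A" by simp_all
    let ?aR = "\<lambda>p. RAssoc M (ob Z p) (ob X i) (ob Y j)" and ?aL = "\<lambda>p. LAssoc M (ob X k) (ob Y l) (ob Z p)"
    let ?q = "\<lambda>p. ?aL p \<cdot>\<^bsub>M\<^esub> (qq \<otimes>\<^bsub>LAct M\<^esub> Ident M (ob Z p))"
    have aR: "?aR \<in> hom_cocycles M (colRR (ob X i) (ob Y j)) (colR ?V) 0" by (rule RAssoc_cocycle) simp_all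
    have q: "?q \<in> hom_cocycles M (colL W) (colLL (ob X k) (ob Y l)) 0"
      by (rule AM.cocycle_comp0[OF _ _ _ tL.lcol_mor_cocycle[OF _ W Vo(2) qq] LAssoc_cocycle]) simp_all
    have tj: "(\<lambda>p. t W p \<cdot>\<^bsub>M\<^esub> (Ident M (ob Z p) \<otimes>\<^bsub>RAct M\<^esub> jj)) \<in> hom_cocycles M (colR ?V) (colL W) 0"
      by (rule AM.cocycle_comp0[OF _ _ _ tR.rcol_mor_cocycle[OF _ Vo(1) W jj] t_cocycle]) simp_all
    \<comment> \<open>Naturality of \<open>t\<close> for the inclusion moves it past
      \<open>t\<close> and next to the projection; their composite is the identity for k = i and 0
      otherwise.\<close>
    have h: "homotopic M (colRR (ob X i) (ob Y j)) (colLL (ob X k) (ob Y l))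
      (\<lambda>p. ?q p \<cdot>\<^bsub>M\<^esub> ((t W p \<cdot>\<^bsub>M\<^esub> (Ident M (ob Z p) \<otimes>\<^bsub>RAct M\<^esub> jj)) \<cdot>\<^bsub>M\<^esub> ?aR p))
      (\<lambda>p. ?q p \<cdot>\<^bsub>M\<^esub> (((jj \<otimes>\<^bsub>LAct M\<^esub> Ident M (ob Z p)) \<cdot>\<^bsub>M\<^esub> t ?V p) \<cdot>\<^bsub>M\<^esub> ?aR p))"
      by (rule AM.homotopic_whisker[OF _ _ _ _ t_natural[OF Vo(1) W jj] tj aR q]) simp_all
    have tW: "t W \<in> hom_cx M (colR W) (colL W) 0" "t ?V \<in> hom_cx M (colR ?V) (colL ?V) 0"
      by (rule hom_cocyclesD[OF t_cocycle]; simp)+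
    let ?tW = "\<lambda>p. tmap (colR W) (colL W) 0 (t W) p" and ?tV = "\<lambda>p. tmap (colR ?V) (colL ?V) 0 (t ?V) p"
    let ?tL = "\<lambda>p. aL.tas (ob X k) (ob Y l) (ob Z p)" and ?tR = "\<lambda>p. aR.tas (ob Z p) (ob X i) (ob Y j)"
    have e1: "mor (?u (p + (i + j)) k l i j) = ?q p \<cdot>\<^bsub>M\<^esub> ((t W p \<cdot>\<^bsub>M\<^esub> (Ident M (ob Z p) \<otimes>\<^bsub>RAct M\<^esub> jj)) \<cdot>\<^bsub>M\<^esub> ?aR p)" for p
    proof -
      have "?u (p + (i + j)) k l i j = ?tL p \<odot>\<^bsub>M\<^esub> (?qq \<Otimes>\<^bsub>LAct M\<^esub> tid M (ob Z p)) \<odot>\<^bsub>M\<^esub> ?tW p \<odot>\<^bsub>M\<^esub> (tid M (ob Z p) \<Otimes>\<^bsub>RAct M\<^esub> ?jj) \<odot>\<^bsub>M\<^esub> ?tR p"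
        unfolding u kl lift_mor_unsigned(2)[OF XY T refl] W_def using ij by (simp add: tsgn_even)
      also have "\<dots> = (?tL p \<odot>\<^bsub>M\<^esub> (?qq \<Otimes>\<^bsub>LAct M\<^esub> tid M (ob Z p))) \<odot>\<^bsub>M\<^esub> ((?tW p \<odot>\<^bsub>M\<^esub> (tid M (ob Z p) \<Otimes>\<^bsub>RAct M\<^esub> ?jj)) \<odot>\<^bsub>M\<^esub> ?tR p)"
        using tW(1) ij by (simp add: W_def)
      finally show ?thesis by (auto dest: arg_cong[where f = mor] simp: jj_def qq_def)
    qed
    have e2: "?q p \<cdot>\<^bsub>M\<^esub> (((jj \<otimes>\<^bsub>LAct M\<^esub> Ident M (ob Z p)) \<cdot>\<^bsub>M\<^esub> t ?V p) \<cdot>\<^bsub>M\<^esub> ?aR p)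
      = (if k = i then ?aL p \<cdot>\<^bsub>M\<^esub> (t ?V p \<cdot>\<^bsub>M\<^esub> ?aR p) else 0)" for p
    proof -
      have "(?tL p \<odot>\<^bsub>M\<^esub> (?qq \<Otimes>\<^bsub>LAct M\<^esub> tid M (ob Z p))) \<odot>\<^bsub>M\<^esub> (((?jj \<Otimes>\<^bsub>LAct M\<^esub> tid M (ob Z p)) \<odot>\<^bsub>M\<^esub> ?tV p) \<odot>\<^bsub>M\<^esub> ?tR p)
        = ?tL p \<odot>\<^bsub>M\<^esub> ((?qq \<odot>\<^bsub>A\<^esub> ?jj) \<Otimes>\<^bsub>LAct M\<^esub> tid M (ob Z p)) \<odot>\<^bsub>M\<^esub> (?tV p \<odot>\<^bsub>M\<^esub> ?tR p)"
        using tW(2) ij by (simp del: tA.tprj_tinj tA.tprj_tinj_neq)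
      also have "\<dots> = (if k = i then ?tL p \<odot>\<^bsub>M\<^esub> (?tV p \<odot>\<^bsub>M\<^esub> ?tR p)
          else tzero ((ob Z p \<star>\<^bsub>RAct M\<^esub> ob X i) \<star>\<^bsub>RAct M\<^esub> ob Y j) (ob X k \<star>\<^bsub>LAct M\<^esub> (ob Y l \<star>\<^bsub>LAct M\<^esub> ob Z p)))"
        using tW(2) ij by (cases "k = i") simp_all
      finally show ?thesis by (cases "k = i") (auto dest: arg_cong[where f = mor] simp: jj_def qq_def)
    qed
    show ?thesis
    proof (cases "k = i")
      case True
      then have l: "l = j" using kl by simp
      have 1: "homotopic M (colRR (ob X i) (ob Y j)) (colLL (ob X k) (ob Y l))
        (\<lambda>p. mor (?u (p + (i + j)) k l i j)) (\<lambda>p. ?aL p \<cdot>\<^bsub>M\<^esub> (t ?V p \<cdot>\<^bsub>M\<^esub> ?aR p))"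
        unfolding e1 using h[unfolded e2 if_P[OF True]] .
      have 2: "homotopic M (colRR (ob X i) (ob Y j)) (colLL (ob X k) (ob Y l))
        (\<lambda>p. ?aL p \<cdot>\<^bsub>M\<^esub> (t ?V p \<cdot>\<^bsub>M\<^esub> ?aR p)) (\<lambda>p. mor (?v (p + (i + j)) k l i j))"
        unfolding True l v1 by (rule t_multiplicative) simp_all
      show ?thesis by (rule AM.homotopic_trans[OF _ _ 1 2]) simp_all
    next
      case False
      \<comment> \<open>Equal sums with k \<noteq> i force one of the indices to drop, so the right
        side is 0 as well.\<close>
      then have "k < i \<or> l < j" using kl by linarith
      then show ?thesis using h unfolding e1 e2 v0[OF \<open>k < i \<or> l < j\<close>] using False by simp
    qed
  qed
  show ?thesis
  proof (rule AM.filtered_homotopicI[OF filtered_RR[OF Z X Y] filtered_LL[OF Z X Y] _ U V])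
    fix a b :: "int \<times> int"
    obtain i j k l where ab: "a = (i, j)" "b = (k, l)" by (cases a, cases b)
    show "AM.acyclic_below (case a of (i, j) \<Rightarrow> colRR (ob X i) (ob Y j)) (case b of (i, j) \<Rightarrow> colLL (ob X i) (ob Y j))"
      unfolding ab prod.case by (rule acyclic_RR_LL) simp_all
    show "mor ((case b of (i, j) \<Rightarrow> \<lambda>n. qLL Z X Y n i j) n \<odot>\<^bsub>M\<^esub> tmap ?P ?Q 0 ?U n \<odot>\<^bsub>M\<^esub>
        (case a of (i, j) \<Rightarrow> \<lambda>n. tsgn ((i + j) * (n - (i + j))) (jRR Z X Y n i j)) n) = 0"
      if "(case b of (i, j) \<Rightarrow> i + j) < (case a of (i, j) \<Rightarrow> i + j)" for n
      using that unfolding ab prod.case by (rule u0)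
    show "mor ((case b of (i, j) \<Rightarrow> \<lambda>n. qLL Z X Y n i j) n \<odot>\<^bsub>M\<^esub> tmap ?P ?Q 0 ?V n \<odot>\<^bsub>M\<^esub>
        (case a of (i, j) \<Rightarrow> \<lambda>n. tsgn ((i + j) * (n - (i + j))) (jRR Z X Y n i j)) n) = 0"
      if "(case b of (i, j) \<Rightarrow> i + j) < (case a of (i, j) \<Rightarrow> i + j)" for n
    proof -
      have "k < i \<or> l < j" using that unfolding ab prod.case by linarith
      then show ?thesis unfolding ab prod.case by (rule v0)
    qed
    show "homotopic M (case a of (i, j) \<Rightarrow> colRR (ob X i) (ob Y j)) (case b of (i, j) \<Rightarrow> colLL (ob X i) (ob Y j))
      (\<lambda>p. mor ((case b of (i, j) \<Rightarrow> \<lambda>n. qLL Z X Y n i j) (p + (case a of (i, j) \<Rightarrow> i + j)) \<odot>\<^bsub>M\<^esub>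
        tmap ?P ?Q 0 ?U (p + (case a of (i, j) \<Rightarrow> i + j)) \<odot>\<^bsub>M\<^esub>
        (case a of (i, j) \<Rightarrow> \<lambda>n. tsgn ((i + j) * (n - (i + j))) (jRR Z X Y n i j)) (p + (case a of (i, j) \<Rightarrow> i + j))))
      (\<lambda>p. mor ((case b of (i, j) \<Rightarrow> \<lambda>n. qLL Z X Y n i j) (p + (case a of (i, j) \<Rightarrow> i + j)) \<odot>\<^bsub>M\<^esub>
        tmap ?P ?Q 0 ?V (p + (case a of (i, j) \<Rightarrow> i + j)) \<odot>\<^bsub>M\<^esub>
        (case a of (i, j) \<Rightarrow> \<lambda>n. tsgn ((i + j) * (n - (i + j))) (jRR Z X Y n i j)) (p + (case a of (i, j) \<Rightarrow> i + j))))"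
      if "(case b of (i, j) \<Rightarrow> i + j) = (case a of (i, j) \<Rightarrow> i + j)"
      using that unfolding ab prod.case by (rule lead)
  qed
qed

end

lemma Kb_mon_simps [simp]:
  "Obj (Kb_mon A) = Obj (Kb A)" "Hom (Kb_mon A) = Hom (Kb A)" "Ident (Kb_mon A) = Ident (Kb A)"
  "Tensor (Kb_mon A) = Kb_bifun A A A (Tensor A)"
  by (simp_all add: Kb_mon_def)

section \<open>The lifted object of the centralizer\<close>

context centralizer_lift
begin

theorem half_braiding_lifts:
  "\<exists>T. (Z, T) \<in> centralizer (Kb_mon A) (Kb_bimod A M) \<and> lifts A T \<tau>"
proof -
  \<comment> \<open>One lift for each bounded complex, with no compatibility between the choices:
    naturality and multiplicativity hold for arbitrary lifts.\<close>
  define h where "h X = (SOME T. lift_mor X T)" for X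
  have h: "lift_mor X (h X)" if "bounded_complex A X" for X
    unfolding h_def using someI_ex[OF lift_mor_exists[OF that]] .
  define T where "T X = kclass M (Z \<diamond>\<^sub>R X) (X \<diamond>\<^sub>L Z) (h X)" for X
  have nat: "T Y \<cdot>\<^bsub>Kb M\<^esub> MorT (Kb_bifun M A M (RAct M)) (Ident (Kb M) Z) f = MorT (Kb_bifun A M M (LAct M)) f (Ident (Kb M) Z) \<cdot>\<^bsub>Kb M\<^esub> T X"
    if X [simp]: "bounded_complex A X" and Y [simp]: "bounded_complex A Y" and f: "f \<in> Hom (Kb A) X Y" for X Y f
  proof -
    obtain g where g: "g \<in> hom_cocycles A X Y 0" "f = kclass A X Y g" using f by (rule AA.Kb_HomE)
    have m: "tot_mor M (RAct M) Z X Z Y 0 0 (\<lambda>i. Ident M (ob Z i)) g \<in> hom_cocycles M (Z \<diamond>\<^sub>R X) (Z \<diamond>\<^sub>R Y) 0"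
      using g by (intro tR.tot_mor_cocycle) simp_all
    have l: "tot_mor M (LAct M) X Z Y Z 0 0 g (\<lambda>i. Ident M (ob Z i)) \<in> hom_cocycles M (X \<diamond>\<^sub>L Z) (Y \<diamond>\<^sub>L Z) 0"
      using g by (intro tL.tot_mor_cocycle) simp_all
    show ?thesis
      unfolding T_def g(2) AM.Kb_ident
      using lift_morD(1)[OF h[OF X]] lift_morD(1)[OF h[OF Y]] g(1) m l lift_mor_natural[OF X Y g(1) h[OF X] h[OF Y]]
      by (simp add: AM.Kb_comp AM.kclass_eq_iff)
  qed
  have mult: "Kb_assoc A A M A M M (Tensor A) (LAct M) (LAct M) (LAct M) (LAssoc M) X Y Z \<cdot>\<^bsub>Kb M\<^esub> T (X \<diamond>\<^sub>A Y)
      \<cdot>\<^bsub>Kb M\<^esub> Kb_assoc M A A M A M (RAct M) (RAct M) (Tensor A) (RAct M) (RAssoc M) Z X Y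
    = MorT (Kb_bifun A M M (LAct M)) (Ident (Kb A) X) (T Y)
      \<cdot>\<^bsub>Kb M\<^esub> Kb_assoc A M A M M M (LAct M) (RAct M) (RAct M) (LAct M) (MAssoc M) X Z Y
      \<cdot>\<^bsub>Kb M\<^esub> MorT (Kb_bifun M A M (RAct M)) (T X) (Ident (Kb A) Y)"
    if X [simp]: "bounded_complex A X" and Y [simp]: "bounded_complex A Y" for X Y
  proof -
    let ?l = "tot_mor M (LAct M) X (Z \<diamond>\<^sub>R Y) X (Y \<diamond>\<^sub>L Z) 0 0 (\<lambda>i. Ident A (ob X i)) (h Y)"
    let ?r = "tot_mor M (RAct M) (Z \<diamond>\<^sub>R X) Y (X \<diamond>\<^sub>L Z) Y 0 0 (h X) (\<lambda>i. Ident A (ob Y i))"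
    have XY: "bounded_complex A (X \<diamond>\<^sub>A Y)" by simp
    note hX = lift_morD(1)[OF h[OF X]] and hY = lift_morD(1)[OF h[OF Y]] and hXY = lift_morD(1)[OF h[OF XY]]
    have l: "?l \<in> hom_cocycles M (X \<diamond>\<^sub>L (Z \<diamond>\<^sub>R Y)) (X \<diamond>\<^sub>L (Y \<diamond>\<^sub>L Z)) 0" using hY by (intro tL.tot_mor_cocycle) simp_all
    have r: "?r \<in> hom_cocycles M ((Z \<diamond>\<^sub>R X) \<diamond>\<^sub>R Y) ((X \<diamond>\<^sub>L Z) \<diamond>\<^sub>R Y) 0" using hX by (intro tR.tot_mor_cocycle) simp_all
    note a = aL.tot_assoc_cocycle[OF X Y Z] aM.tot_assoc_cocycle[OF X Z Y] aR.tot_assoc_cocycle[OF Z X Y]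
    have c: "(\<lambda>n. h (X \<diamond>\<^sub>A Y) n \<cdot>\<^bsub>M\<^esub> hatR Z X Y n) \<in> hom_cocycles M ((Z \<diamond>\<^sub>R X) \<diamond>\<^sub>R Y) ((X \<diamond>\<^sub>A Y) \<diamond>\<^sub>L Z) 0"
      "(\<lambda>n. hatM X Z Y n \<cdot>\<^bsub>M\<^esub> ?r n) \<in> hom_cocycles M ((Z \<diamond>\<^sub>R X) \<diamond>\<^sub>R Y) (X \<diamond>\<^sub>L (Z \<diamond>\<^sub>R Y)) 0"
      by (rule AM.cocycle_comp0[OF _ _ _ a(3) hXY] AM.cocycle_comp0[OF _ _ _ r a(2)]; simp)+
    show ?thesis
      unfolding T_def Kb_assoc_eq AA.Kb_ident
      using hX hY hXY l r a c lift_mor_multiplicative[OF X Y h[OF X] h[OF Y] h[OF XY]]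
      by (simp add: AM.Kb_comp AM.kclass_eq_iff)
  qed
  have iso: "is_iso (Kb_bimod A M) (Z \<diamond>\<^sub>R X) (X \<diamond>\<^sub>L Z) (T X)" if "bounded_complex A X" for X
    using lift_mor_iso[OF that h[OF that]] by (simp add: is_iso_def T_def)
  have "(Z, T) \<in> centralizer (Kb_mon A) (Kb_bimod A M)"
    unfolding centralizer_def using iso nat mult by simp
  \<comment> \<open>The representative \<open>th X\<close> of \<open>\<tau> X\<close> is a lift as
    well, hence homotopic to the chosen one.\<close>
  moreover have "T (stalk A X) = \<tau> X" if X [simp]: "X \<in> Obj A" for X
    unfolding T_def kclass_th[OF X, symmetric]
    using lift_mor_unique[OF _ h lift_mor_stalk[OF X]] by (simp add: AM.kclass_eq_iff)
  ultimately show ?thesis unfolding lifts_def by blast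
qed

end

theorem theorem1p5:
  fixes A :: "('o, 'm::ab_group_add) moncat"
    and sA :: "'k::comm_ring_1 \<Rightarrow> 'm \<Rightarrow> 'm"
    and M :: "('p, 'n::ab_group_add, 'o, 'm) bimod"
    and sM :: "'k \<Rightarrow> 'n \<Rightarrow> 'n"
    and Z :: "('p, 'n) cochain"
    and \<tau> :: "'o \<Rightarrow> ('p, 'n) kmor"
  assumes "additive_monoidal_category A sA"
    and "additive_bimodule_category A sA M sM"
    and "Z \<in> Obj (Kb M)"
    and "\<And>X Y k. \<lbrakk>X \<in> Obj A; Y \<in> Obj A; k < 0\<rbrakk> \<Longrightarrow>
      hom_cohomology M (Z \<star>\<^bsub>RAct (Kb_bimod_base A M)\<^esub> X) (Y \<star>\<^bsub>LAct (Kb_bimod_base A M)\<^esub> Z) k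
      = {hom_class M (Z \<star>\<^bsub>RAct (Kb_bimod_base A M)\<^esub> X) (Y \<star>\<^bsub>LAct (Kb_bimod_base A M)\<^esub> Z) k (\<lambda>_. 0)}"
    and "(Z, \<tau>) \<in> centralizer (typed A) (Kb_bimod_base A M)"
  shows "\<exists>T. (Z, T) \<in> centralizer (Kb_mon A) (Kb_bimod A M) \<and> lifts A T \<tau>"
proof -
  have "centralizer_lift A sA M sM Z \<tau>"
    unfolding centralizer_lift_def centralizer_lift_axioms_def
    using assms(2-5) by (simp add: Kb_def)
  then show ?thesis by (rule centralizer_lift.half_braiding_lifts)
qed

end
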